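(* Let $\gamma:S\to\mathbb R$ be lower semicontinuous and bounded from below. Then the optimal Skorokhod embedding problem $$P_\gamma=\inf\Big\{\mathbb E\big[\gamma\big((B_t)_{t\le\tau},\tau\big)\big]:\ \tau \text{ is a stopping time on }\Omega,\ B_\tau\sim\mu,\ \mathbb E[\tau]<\infty\Big\}$$ admits a minimizing stopping time $\tau$.
   Context: $\mu$ is a fixed probability measure on $\mathbb R$ which is centered and has finite second moment. $\Omega=(\Omega,\mathcal G,(\mathcal G_t)_{t\ge0},\mathbb P)$ is a fixed stochastic basis rich enough to support a one-dimensional Brownian motion $B$ (with respect to $(\mathcal G_t)$) with $B_0=0$ and a uniformly distributed $\mathcal G_0$-measurable random variable independent of $B$. Stopping times are $(\mathcal G_t)$-stopping times. $S=\{(f,s): s\ge 0,\ f:[0,s]\to\mathbb R \text{ continuous},\ f(0)=0\}$ is the set of stopped paths, equipped with the Polish topology induced by the metric $$d_S((f,s),(g,t))=\max\Big(t-s,\ \sup_{0\le u\le s}|f(u)-g(u)|,\ \sup_{s\le u\le t}|g(u)-f(s)|\Big),\qquad s\le t.$$ *)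

theory Defs
  imports "HOL-Probability.Probability"
begin

section \<open>The space of stopped paths\<close>

text \<open>A continuous function on \<open>[0,s]\<close> is represented by the total function that is
  \<open>undefined\<close> outside \<open>[0,s]\<close>, so that equality of pairs is equality of stopped paths.\<close>

definition stopped_paths :: "((real \<Rightarrow> real) \<times> real) set" where
  "stopped_paths =
     {(f, s). 0 \<le> s \<and> f \<in> extensional {0..s} \<and> continuous_on {0..s} f \<and> f 0 = 0}"

definition ordered_path_dist ::
    "(real \<Rightarrow> real) \<Rightarrow> real \<Rightarrow> (real \<Rightarrow> real) \<Rightarrow> real \<Rightarrow> real" where
  "ordered_path_dist f s g t =
     max (t - s) (max (SUP u\<in>{0..s}. \<bar>f u - g u\<bar>) (SUP u\<in>{s..t}. \<bar>g u - f s\<bar>))"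

definition path_dist :: "(real \<Rightarrow> real) \<times> real \<Rightarrow> (real \<Rightarrow> real) \<times> real \<Rightarrow> real" where
  "path_dist x y =
     (if snd x \<le> snd y then ordered_path_dist (fst x) (snd x) (fst y) (snd y)
      else ordered_path_dist (fst y) (snd y) (fst x) (snd x))"

lemma path_dist_nonneg: "0 \<le> path_dist x y"
  by (auto simp: path_dist_def ordered_path_dist_def le_max_iff_disj)

lemma path_dist_commute: "path_dist x y = path_dist y x"
  by (auto simp: path_dist_def ordered_path_dist_def abs_minus_commute)

lemma ordered_path_dist_le_iff:
  assumes "(f, s) \<in> stopped_paths" "(g, t) \<in> stopped_paths" "s \<le> t"
  shows "ordered_path_dist f s g t \<le> r \<longleftrightarrow>
    \<bar>s - t\<bar> \<le> r \<and> (\<forall>u\<ge>0. \<bar>f (min u s) - g (min u t)\<bar> \<le> r)"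
proof -
  have s: "0 \<le> s" "continuous_on {0..s} f" and t: "continuous_on {0..t} g"
    using assms by (auto simp: stopped_paths_def)
  have "continuous_on {0..s} (\<lambda>u. \<bar>f u - g u\<bar>)"
    using assms(3) by (intro continuous_intros s continuous_on_subset[OF t]) auto
  then have b1: "bdd_above ((\<lambda>u. \<bar>f u - g u\<bar>) ` {0..s})"
    by (intro bounded_imp_bdd_above compact_imp_bounded compact_continuous_image) auto
  have "continuous_on {s..t} (\<lambda>u. \<bar>g u - f s\<bar>)"
    using s(1) by (intro continuous_intros continuous_on_subset[OF t]) auto
  then have b2: "bdd_above ((\<lambda>u. \<bar>g u - f s\<bar>) ` {s..t})"
    by (intro bounded_imp_bdd_above compact_imp_bounded compact_continuous_image) auto
  have "ordered_path_dist f s g t \<le> r \<longleftrightarrow>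
      t - s \<le> r \<and> (\<forall>u\<in>{0..s}. \<bar>f u - g u\<bar> \<le> r) \<and> (\<forall>u\<in>{s..t}. \<bar>g u - f s\<bar> \<le> r)"
    using assms(3) s(1) cSUP_le_iff[OF _ b1, of r] cSUP_le_iff[OF _ b2, of r]
    by (auto simp: ordered_path_dist_def)
  also have "\<dots> \<longleftrightarrow> \<bar>s - t\<bar> \<le> r \<and> (\<forall>u\<ge>0. \<bar>f (min u s) - g (min u t)\<bar> \<le> r)"
  proof (intro iffI conjI ballI allI impI)
    fix u :: real
    assume *: "t - s \<le> r \<and> (\<forall>u\<in>{0..s}. \<bar>f u - g u\<bar> \<le> r) \<and> (\<forall>u\<in>{s..t}. \<bar>g u - f s\<bar> \<le> r)"
      and u: "0 \<le> u"
    consider "u \<le> s" | "s \<le> u" "u \<le> t" | "t \<le> u" by linarith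
    then show "\<bar>f (min u s) - g (min u t)\<bar> \<le> r"
      using * u assms(3) by cases (auto simp: min_def abs_minus_commute)
  next
    fix u
    assume *: "\<bar>s - t\<bar> \<le> r \<and> (\<forall>u\<ge>0. \<bar>f (min u s) - g (min u t)\<bar> \<le> r)"
    { assume "u \<in> {0..s}"
      then show "\<bar>f u - g u\<bar> \<le> r" using *[THEN conjunct2, rule_format, of u] assms(3) by auto }
    { assume "u \<in> {s..t}"
      then show "\<bar>g u - f s\<bar> \<le> r"
        using *[THEN conjunct2, rule_format, of u] s(1) by (auto simp: abs_minus_commute) }
  qed (use assms(3) in auto)
  finally show ?thesis .
qed

lemma path_dist_le_iff:
  assumes "x \<in> stopped_paths" "y \<in> stopped_paths"
  shows "path_dist x y \<le> r \<longleftrightarrow> \<bar>snd x - snd y\<bar> \<le> r \<and>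
    (\<forall>u\<ge>0. \<bar>fst x (min u (snd x)) - fst y (min u (snd y))\<bar> \<le> r)"
  using assms ordered_path_dist_le_iff[of "fst x" "snd x" "fst y" "snd y" r]
    ordered_path_dist_le_iff[of "fst y" "snd y" "fst x" "snd x" r]
  by (auto simp: path_dist_def abs_minus_commute)

interpretation stopped_paths: Metric_space stopped_paths path_dist
proof
  fix x y z
  show "0 \<le> path_dist x y" by (rule path_dist_nonneg)
  show "path_dist x y = path_dist y x" by (rule path_dist_commute)
  assume x: "x \<in> stopped_paths" and y: "y \<in> stopped_paths"
  show "path_dist x y = 0 \<longleftrightarrow> x = y"
  proof
    assume "path_dist x y = 0"
    then have "snd x = snd y" and
      *: "\<And>u. 0 \<le> u \<Longrightarrow> fst x (min u (snd x)) = fst y (min u (snd y))"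
      using path_dist_le_iff[OF x y, of 0] by auto
    moreover have "fst x u = fst y u" if "0 \<le> u" "u \<le> snd x" for u
      using *[of u] that \<open>snd x = snd y\<close> by auto
    moreover have "fst x u = fst y u" if "\<not> (0 \<le> u \<and> u \<le> snd x)" for u
      using x y that \<open>snd x = snd y\<close> by (auto simp: stopped_paths_def extensional_def)
    ultimately show "x = y" by (intro prod_eqI ext) blast+
  next
    assume "x = y"
    then have "path_dist x y \<le> 0" using path_dist_le_iff[OF x y, of 0] by auto
    then show "path_dist x y = 0" using path_dist_nonneg[of x y] by linarith
  qed
  assume z: "z \<in> stopped_paths"
  have xy: "\<bar>snd x - snd y\<bar> \<le> path_dist x y"
      "\<And>u. 0 \<le> u \<Longrightarrow> \<bar>fst x (min u (snd x)) - fst y (min u (snd y))\<bar> \<le> path_dist x y"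
    using path_dist_le_iff[OF x y, of "path_dist x y"] by auto
  have yz: "\<bar>snd y - snd z\<bar> \<le> path_dist y z"
      "\<And>u. 0 \<le> u \<Longrightarrow> \<bar>fst y (min u (snd y)) - fst z (min u (snd z))\<bar> \<le> path_dist y z"
    using path_dist_le_iff[OF y z, of "path_dist y z"] by auto
  show "path_dist x z \<le> path_dist x y + path_dist y z"
    unfolding path_dist_le_iff[OF x z]
  proof (intro conjI allI impI)
    show "\<bar>snd x - snd z\<bar> \<le> path_dist x y + path_dist y z" using xy(1) yz(1) by linarith
    fix u :: real assume "0 \<le> u"
    then show "\<bar>fst x (min u (snd x)) - fst z (min u (snd z))\<bar> \<le> path_dist x y + path_dist y z"
      using xy(2)[of u] yz(2)[of u] by linarith
  qed
qed

definition lower_semicontinuous_map :: "'a topology \<Rightarrow> ('a \<Rightarrow> real) \<Rightarrow> bool" where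
  "lower_semicontinuous_map X f \<longleftrightarrow> (\<forall>c. openin X {x \<in> topspace X. c < f x})"

section \<open>The stochastic basis\<close>

text \<open>Filtrations are indexed by \<open>[0,\<infinity>]\<close>, so that the library's \<^const>\<open>stopping_time\<close> applies to
  times \<open>\<tau> :: 'a \<Rightarrow> ennreal\<close> that may take the value \<open>\<infinity>\<close>. The sigma-algebra at index \<open>\<infinity>\<close> is an
  arbitrary one between \<open>\<Union>t<\<infinity>. G t\<close> and \<open>M\<close>; it has no influence on which \<open>\<tau>\<close> are stopping
  times, because \<open>\<tau> \<omega> \<le> \<infinity>\<close> always holds. No completeness or right-continuity is imposed.\<close>

locale stochastic_basis = prob_space M + filtration "space M" G
  for M :: "'a measure" and G :: "ennreal \<Rightarrow> 'a measure" +
  assumes subalgebra_basis: "\<And>t. subalgebra M (G t)"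

definition brownian_motion ::
    "'a measure \<Rightarrow> (ennreal \<Rightarrow> 'a measure) \<Rightarrow> (real \<Rightarrow> 'a \<Rightarrow> real) \<Rightarrow> bool" where
  "brownian_motion M G B \<longleftrightarrow>
     (\<forall>\<omega>\<in>space M. B 0 \<omega> = 0) \<and>
     (\<forall>\<omega>\<in>space M. continuous_on {0..} (\<lambda>t. B t \<omega>)) \<and>
     (\<forall>t\<ge>0. B t \<in> borel_measurable (G (ennreal t))) \<and>
     (\<forall>s t. 0 \<le> s \<and> s < t \<longrightarrow>
        distributed M lborel (\<lambda>\<omega>. B t \<omega> - B s \<omega>) (normal_density 0 (sqrt (t - s))) \<and>
        prob_space.indep_set M (sets (G (ennreal s)))
          (sets (vimage_algebra (space M) (\<lambda>\<omega>. B t \<omega> - B s \<omega>) borel)))"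

definition independent_uniform ::
    "'a measure \<Rightarrow> (ennreal \<Rightarrow> 'a measure) \<Rightarrow> (real \<Rightarrow> 'a \<Rightarrow> real) \<Rightarrow> ('a \<Rightarrow> real) \<Rightarrow> bool" where
  "independent_uniform M G B U \<longleftrightarrow>
     U \<in> borel_measurable (G 0) \<and>
     distr M borel U = uniform_measure lborel {0..1} \<and>
     prob_space.indep_set M
       (sets (vimage_algebra (space M) U borel))
       (sets (vimage_algebra (space M) (\<lambda>\<omega>. \<lambda>t\<in>{0..}. B t \<omega>) (PiM {0..} (\<lambda>_. borel))))"

section \<open>The optimal Skorokhod embedding problem\<close>

text \<open>An embedding time has finite expectation, so \<open>\<tau> = \<infinity>\<close> only on a null set; there
  \<^const>\<open>enn2real\<close> replaces \<open>\<tau>\<close> by \<open>0\<close>.\<close>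

definition skorokhod_embeddings ::
    "'a measure \<Rightarrow> (ennreal \<Rightarrow> 'a measure) \<Rightarrow> (real \<Rightarrow> 'a \<Rightarrow> real) \<Rightarrow> real measure
      \<Rightarrow> ('a \<Rightarrow> ennreal) set" where
  "skorokhod_embeddings M G B \<mu> =
     {\<tau>. stopping_time G \<tau> \<and>
         distr M borel (\<lambda>\<omega>. B (enn2real (\<tau> \<omega>)) \<omega>) = \<mu> \<and>
         (\<integral>\<^sup>+ \<omega>. \<tau> \<omega> \<partial>M) < \<infinity>}"

definition stopped_path ::
    "(real \<Rightarrow> 'a \<Rightarrow> real) \<Rightarrow> ('a \<Rightarrow> ennreal) \<Rightarrow> 'a \<Rightarrow> (real \<Rightarrow> real) \<times> real" where
  "stopped_path B \<tau> \<omega> =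
     (restrict (\<lambda>t. B t \<omega>) {0..enn2real (\<tau> \<omega>)}, enn2real (\<tau> \<omega>))"

text \<open>The expectation is the difference of the integrals of the positive and the negative part
  (\<^const>\<open>ennreal\<close> truncates negative reals to \<open>0\<close>): for functions bounded from below it is
  well defined with values in \<open>(-\<infinity>,\<infinity>]\<close>, whereas the Bochner integral of a non-integrable
  function would be \<open>0\<close>.\<close>

definition extended_expectation :: "'a measure \<Rightarrow> ('a \<Rightarrow> real) \<Rightarrow> ereal" where
  "extended_expectation M f =
     enn2ereal (\<integral>\<^sup>+ \<omega>. ennreal (f \<omega>) \<partial>M) - enn2ereal (\<integral>\<^sup>+ \<omega>. ennreal (- f \<omega>) \<partial>M)"

definition embedding_cost ::
    "'a measure \<Rightarrow> (real \<Rightarrow> 'a \<Rightarrow> real) \<Rightarrow> ((real \<Rightarrow> real) \<times> real \<Rightarrow> real)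
      \<Rightarrow> ('a \<Rightarrow> ennreal) \<Rightarrow> ereal" where
  "embedding_cost M B \<gamma> \<tau> = extended_expectation M (\<lambda>\<omega>. \<gamma> (stopped_path B \<tau> \<omega>))"

definition optimal_embedding_value ::
    "'a measure \<Rightarrow> (ennreal \<Rightarrow> 'a measure) \<Rightarrow> (real \<Rightarrow> 'a \<Rightarrow> real) \<Rightarrow> real measure
      \<Rightarrow> ((real \<Rightarrow> real) \<times> real \<Rightarrow> real) \<Rightarrow> ereal" where
  "optimal_embedding_value M G B \<mu> \<gamma> =
     (INF \<tau>\<in>skorokhod_embeddings M G B \<mu>. embedding_cost M B \<gamma> \<tau>)"

end

theory Submission
  imports Defs
begin

text \<open>
The proof is the direct method: embeddings are compact and the cost is lower semicontinuous
  for a suitable convergence of stopping times. The convergence is that of randomised stopping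
  times, \<open>\<tau>\<close> being identified with its conditional distribution given the Brownian path:
  \<open>converges_stably\<close> asks that \<open>E[f; \<tau>\<^sub>n \<le> t]\<close> tends to \<open>E[f; T \<le> t]\<close> for all bounded functionals \<open>f\<close>
  of the path and all \<open>t\<close> that are not atoms of \<open>T\<close>.

  Compactness (\<open>stopping_time_compactness\<close>). The probabilities of \<open>E \<inter> {\<tau>\<^sub>n \<le> t}\<close> lie in \<open>[0,1]\<close>, so by
  Tychonoff there is a filter finer than the sequential one along which they converge for
  all events \<open>E\<close> and times \<open>t\<close> at once. For fixed \<open>t\<close> the limit is additive in \<open>E\<close> and dominated by
  the probability, so it has a density \<open>A\<^sub>t\<close> by Radon-Nikodym; increments after \<open>t\<close> are
  independent of \<open>{\<tau>\<^sub>n \<le> t}\<close>, whence \<open>A\<^sub>t\<close> depends on the path up to \<open>t\<close> only. The uniform variable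
  \<open>U\<close> is independent of the path, hence the infimum \<open>T\<close> of the dyadic times \<open>t\<close> with \<open>U \<le> A\<^sub>t\<close> has the
  limiting conditional distribution. For it, only \<open>{T < t} \<in> \<G>\<^sub>t\<close> is clear, which suffices for
  right-continuous filtrations. In general it is modified on a null set
  (\<open>predictable_version\<close>): products of continuous functions of \<open>U\<close> and of finitely many values of
  \<open>B\<close> close continuous martingales, by the heat semigroup, and they are dense in mean, so Doob's
  inequality makes the martingale closed by \<open>exp (- T)\<close> continuous. It stays below
  \<open>exp (- t)\<close> before \<open>T\<close>, so \<open>T\<close> is almost surely the first time at which a continuous adapted
  process reaches a continuous curve, and such a time is a stopping time without right-continuity.

  Limits of embeddings are embeddings (\<open>limit_of_embeddings\<close>). Approximation by discrete times
  gives \<open>E \<tau> \<le> 2 E B\<^sub>\<tau>\<^sup>2\<close> (\<open>wald\<close>), which for embeddings of \<open>\<mu>\<close> is a bound by twice the second moment of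
  \<open>\<mu>\<close>. No mass escapes to infinity, and the bound passes to the limit. The law of \<open>B\<close> at the limit
  is \<open>\<mu>\<close>, since bounded continuous functions of \<open>B\<^sub>t\<close> are continuous in \<open>t\<close>.

  Lower semicontinuity (\<open>lower_semicontinuity_cost\<close>). A nonnegative lower semicontinuous cost is
  the increasing limit of bounded Lipschitz functions on the space of stopped paths. These are
  continuous in time along each path, and expectations of continuous integrands are handled
  through step functions in time whose jumps avoid the atoms of the limit.

  Finally an embedding exists at all (\<open>embedding_exists\<close>): a centred law is a mixture of centred
  two-point laws, \<open>B\<close> realises each of these when it leaves the interval between the two points,
  and \<open>U\<close> selects the pair. The minimiser is then a limit of a minimising sequence.
\<close>

section \<open>Processes that are continuous in time\<close>

definition dyadic_above :: "nat \<Rightarrow> real \<Rightarrow> real" where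
  "dyadic_above j t = real_of_int (\<lfloor>t * 2 ^ j\<rfloor> + 1) / 2 ^ j"

lemma dyadic_above_bounds: "t < dyadic_above j t" "dyadic_above j t \<le> t + 1 / 2 ^ j"
proof -
  have "t * 2 ^ j < real_of_int (\<lfloor>t * 2 ^ j\<rfloor> + 1)" "real_of_int (\<lfloor>t * 2 ^ j\<rfloor> + 1) \<le> t * 2 ^ j + 1"
    by linarith+
  then show "t < dyadic_above j t" "dyadic_above j t \<le> t + 1 / 2 ^ j"
    by (simp_all add: dyadic_above_def field_simps)
qed

lemma dyadic_above_tendsto: "(\<lambda>j. dyadic_above j t) \<longlonglongrightarrow> t"
proof (rule tendsto_sandwich)
  show "\<forall>\<^sub>F j in sequentially. t \<le> dyadic_above j t"
    by (intro always_eventually allI less_imp_le dyadic_above_bounds)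
  show "\<forall>\<^sub>F j in sequentially. dyadic_above j t \<le> t + 1 / 2 ^ j"
    by (intro always_eventually allI dyadic_above_bounds)
  have "(\<lambda>j. t + (1 / 2) ^ j) \<longlonglongrightarrow> t + 0"
    by (intro tendsto_intros LIMSEQ_realpow_zero) auto
  then show "(\<lambda>j. t + 1 / 2 ^ j) \<longlonglongrightarrow> t" by (simp add: power_one_over)
qed simp

lemma continuous_on_tendsto_right:
  fixes f :: "real \<Rightarrow> 'b::topological_space"
  assumes "continuous_on {0..} f" "0 \<le> t" "X \<longlonglongrightarrow> t" "\<And>n. 0 \<le> X n"
  shows "(\<lambda>n. f (X n)) \<longlonglongrightarrow> f t"
  using assms by (intro continuous_on_tendsto_compose[OF assms(1,3)]) auto

text \<open>Dyadic approximations of the random time from above take countably many values, and the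
  paths are continuous.\<close>

lemma borel_measurable_at_random_time:
  fixes f :: "real \<Rightarrow> 'a \<Rightarrow> real"
  assumes f: "\<And>t. 0 \<le> t \<Longrightarrow> f t \<in> borel_measurable N"
    and cont: "\<And>\<omega>. \<omega> \<in> space N \<Longrightarrow> continuous_on {0..} (\<lambda>t. f t \<omega>)"
    and T[measurable]: "T \<in> borel_measurable N" and T0: "\<And>\<omega>. \<omega> \<in> space N \<Longrightarrow> 0 \<le> T \<omega>"
  shows "(\<lambda>\<omega>. f (T \<omega>) \<omega>) \<in> borel_measurable N"
proof (rule borel_measurable_LIMSEQ_real)
  fix \<omega> assume \<omega>: "\<omega> \<in> space N"
  have "0 \<le> dyadic_above j (T \<omega>)" for j
    using dyadic_above_bounds(1)[of "T \<omega>" j] T0[OF \<omega>] by simp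
  then show "(\<lambda>j. f (max 0 (dyadic_above j (T \<omega>))) \<omega>) \<longlonglongrightarrow> f (T \<omega>) \<omega>"
    using dyadic_above_tendsto[of "T \<omega>"] T0[OF \<omega>] cont[OF \<omega>]
    by (intro continuous_on_tendsto_right[of "\<lambda>t. f t \<omega>"]) auto
next
  fix j
  have m: "(\<lambda>\<omega>. f (max 0 (real_of_int (i + 1) / 2 ^ j)) \<omega>) \<in> borel_measurable N" for i :: int
    by (intro f) simp
  have "(\<lambda>\<omega>. \<lfloor>T \<omega> * 2 ^ j\<rfloor>) \<in> measurable N (count_space UNIV)" by measurable
  from measurable_compose_countable[OF m this]
  show "(\<lambda>\<omega>. f (max 0 (dyadic_above j (T \<omega>))) \<omega>) \<in> borel_measurable N"
    unfolding dyadic_above_def .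
qed

lemma (in prob_space) distr_pair_of_independent:
  assumes id: "(\<lambda>\<omega>. \<omega>) \<in> measurable M F" and sub: "space F = space M" and X: "X \<in> measurable M N"
    and indep: "\<And>A b. A \<in> sets F \<Longrightarrow> b \<in> sets N \<Longrightarrow>
      prob (A \<inter> (X -` b \<inter> space M)) = prob A * prob (X -` b \<inter> space M)"
  shows "distr M F (\<lambda>\<omega>. \<omega>) \<Otimes>\<^sub>M distr M N X = distr M (F \<Otimes>\<^sub>M N) (\<lambda>\<omega>. (\<omega>, X \<omega>))"
proof -
  interpret P: prob_space "distr M F (\<lambda>\<omega>. \<omega>)" by (rule prob_space_distr[OF id])
  interpret N: prob_space "distr M N X" by (rule prob_space_distr[OF X])
  show ?thesis
  proof (rule pair_measure_eqI)
    fix A b assume "A \<in> sets (distr M F (\<lambda>\<omega>. \<omega>))" "b \<in> sets (distr M N X)"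
    then have A: "A \<in> sets F" and b: "b \<in> sets N" by auto
    have sp: "A \<inter> space M \<in> sets M" using measurable_sets[OF id A] by (simp add: vimage_def Int_def)
    have AM: "(\<lambda>\<omega>. \<omega>) -` A \<inter> space M = A \<inter> space M" by auto
    have "A \<inter> space M = A" using sets.sets_into_space[OF A] sub by auto
    then have p: "prob (A \<inter> space M \<inter> (X -` b \<inter> space M)) = prob (A \<inter> space M) * prob (X -` b \<inter> space M)"
      using indep[OF A b] by simp
    have "(\<lambda>\<omega>. (\<omega>, X \<omega>)) -` (A \<times> b) \<inter> space M = A \<inter> space M \<inter> (X -` b \<inter> space M)" by auto
    then show "emeasure (distr M F (\<lambda>\<omega>. \<omega>)) A * emeasure (distr M N X) b
        = emeasure (distr M (F \<Otimes>\<^sub>M N) (\<lambda>\<omega>. (\<omega>, X \<omega>))) (A \<times> b)"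
      using A b id X sp p
      by (simp add: emeasure_distr AM emeasure_eq_measure measurable_sets flip: ennreal_mult)
  qed (auto intro: P.sigma_finite_measure_axioms N.sigma_finite_measure_axioms)
qed

section \<open>Brownian motion on the basis\<close>

locale brownian_basis = stochastic_basis M G
  for M :: "'a measure" and G :: "ennreal \<Rightarrow> 'a measure" +
  fixes B :: "real \<Rightarrow> 'a \<Rightarrow> real" and U :: "'a \<Rightarrow> real"
  assumes brownian: "brownian_motion M G B"
    and uniform: "independent_uniform M G B U"
begin

abbreviation Gt :: "real \<Rightarrow> 'a measure" where "Gt t \<equiv> G (ennreal t)"

lemma sets_G_subset: "sets (G t) \<subseteq> sets M"
  using subalgebra_basis[of t] by (auto simp: subalgebra_def)

lemma measurable_G_M: "f \<in> measurable (G t) N \<Longrightarrow> f \<in> measurable M N"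
  using measurable_from_subalg[OF subalgebra_basis] .

lemma measurable_G_mono: "f \<in> measurable (G s) N \<Longrightarrow> s \<le> t \<Longrightarrow> f \<in> measurable (G t) N"
  by (rule measurable_from_subalg[of "G t" "G s"]) (auto simp: subalgebra_def space_F dest: sets_F_mono)

lemma B_0: "\<omega> \<in> space M \<Longrightarrow> B 0 \<omega> = 0"
  using brownian by (auto simp: brownian_motion_def)

lemma B_continuous: "\<omega> \<in> space M \<Longrightarrow> continuous_on {0..} (\<lambda>t. B t \<omega>)"
  using brownian by (auto simp: brownian_motion_def)

lemma B_adapted: "0 \<le> s \<Longrightarrow> s \<le> t \<Longrightarrow> B s \<in> borel_measurable (Gt t)"
  using brownian measurable_G_mono[of "B s" "ennreal s" borel "ennreal t"]
  by (auto simp: brownian_motion_def ennreal_leI)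

lemma B_measurable: "0 \<le> s \<Longrightarrow> B s \<in> borel_measurable M"
  using B_adapted[of s s] measurable_G_M by blast

abbreviation gaussian :: "real measure" where "gaussian \<equiv> density lborel std_normal_density"

lemma prob_space_gaussian: "prob_space gaussian"
  by (rule prob_space_normal_density) simp

lemma distr_scaled_increment:
  assumes "0 \<le> s" "s < t"
  shows "distr M borel (\<lambda>\<omega>. (B t \<omega> - B s \<omega>) / sqrt (t - s)) = gaussian"
proof -
  have "distributed M lborel (\<lambda>\<omega>. B t \<omega> - B s \<omega>) (normal_density 0 (sqrt (t - s)))"
    using brownian assms by (auto simp: brownian_motion_def)
  then have "distributed M lborel (\<lambda>\<omega>. ((B t \<omega> - B s \<omega>) - 0) / sqrt (t - s)) std_normal_density"
    using assms by (subst (asm) normal_standard_normal_convert) auto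
  then have "distr M lborel (\<lambda>\<omega>. (B t \<omega> - B s \<omega>) / sqrt (t - s)) = gaussian"
    by (simp add: distributed_distr_eq_density)
  moreover have "distr M borel (\<lambda>\<omega>. (B t \<omega> - B s \<omega>) / sqrt (t - s)) = distr M lborel (\<lambda>\<omega>. (B t \<omega> - B s \<omega>) / sqrt (t - s))"
    by (rule distr_cong) auto
  ultimately show ?thesis by simp
qed

lemma prob_past_increment:
  assumes "0 \<le> s" "s < t" "A \<in> sets (Gt s)" "b \<in> sets borel"
  shows "prob (A \<inter> ((\<lambda>\<omega>. B t \<omega> - B s \<omega>) -` b \<inter> space M)) = prob A * prob ((\<lambda>\<omega>. B t \<omega> - B s \<omega>) -` b \<inter> space M)"
proof -
  have i: "indep_set (sets (Gt s)) (sets (vimage_algebra (space M) (\<lambda>\<omega>. B t \<omega> - B s \<omega>) borel))"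
    using brownian assms by (auto simp: brownian_motion_def)
  have "(\<lambda>\<omega>. B t \<omega> - B s \<omega>) -` b \<inter> space M \<in> sets (vimage_algebra (space M) (\<lambda>\<omega>. B t \<omega> - B s \<omega>) borel)"
    using assms by (intro in_vimage_algebra)
  then show ?thesis using i assms by (auto simp: indep_sets2_eq)
qed

text \<open>Independence of sigma-algebras in the form used by the library's product formula for
  expectations.\<close>

lemma indep_var_past_increment:
  assumes st: "0 \<le> s" "s < t" and Z: "Z \<in> borel_measurable (Gt s)" and f: "f \<in> borel_measurable borel"
  shows "indep_var borel Z borel (\<lambda>\<omega>. f (B t \<omega> - B s \<omega>) :: real)"
proof -
  let ?D = "\<lambda>\<omega>. B t \<omega> - B s \<omega>"
  have D[measurable]: "?D \<in> borel_measurable M" using st by (intro borel_measurable_diff B_measurable) auto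
  have "indep_set (sets (Gt s)) (sets (vimage_algebra (space M) ?D borel))"
    using brownian st by (auto simp: brownian_motion_def)
  moreover have "sigma_sets (space M) {Z -` A \<inter> space M |A. A \<in> sets borel} \<subseteq> sets (Gt s)"
    using sets.sigma_sets_subset[of "{Z -` A \<inter> space M |A. A \<in> sets borel}" "Gt s"] measurable_sets[OF Z]
    by (auto simp: space_F)
  moreover have "sigma_sets (space M) {(\<lambda>\<omega>. f (?D \<omega>)) -` A \<inter> space M |A. A \<in> sets borel} \<subseteq> sets (vimage_algebra (space M) ?D borel)"
  proof -
    have "(\<lambda>\<omega>. f (?D \<omega>)) \<in> borel_measurable (vimage_algebra (space M) ?D borel)"
      using f by (intro measurable_compose[OF measurable_vimage_algebra1 f]) auto
    from measurable_sets[OF this] show ?thesis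
      using sets.sigma_sets_subset[of "{(\<lambda>\<omega>. f (?D \<omega>)) -` A \<inter> space M |A. A \<in> sets borel}" "vimage_algebra (space M) ?D borel"]
      by (auto simp: space_vimage_algebra)
  qed
  ultimately have "indep_set (sigma_sets (space M) {Z -` A \<inter> space M |A. A \<in> sets borel})
      (sigma_sets (space M) {(\<lambda>\<omega>. f (?D \<omega>)) -` A \<inter> space M |A. A \<in> sets borel})"
    unfolding indep_sets2_eq by blast
  then show ?thesis unfolding indep_var_eq using measurable_G_M[OF Z] f by auto
qed

text \<open>Conditionally on the past, the increment is an independent Gaussian: the past and the increment
  have a product law, and Fubini integrates out the increment.\<close>

lemma expectation_past_increment:
  fixes \<Psi> :: "'a \<times> real \<Rightarrow> real"
  assumes st: "0 \<le> s" "s < t" and \<Psi>[measurable]: "\<Psi> \<in> borel_measurable (Gt s \<Otimes>\<^sub>M borel)"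
    and bd: "\<And>\<omega> z. \<omega> \<in> space M \<Longrightarrow> \<bar>\<Psi> (\<omega>, z)\<bar> \<le> C"
  shows "expectation (\<lambda>\<omega>. \<Psi> (\<omega>, (B t \<omega> - B s \<omega>) / sqrt (t - s))) = expectation (\<lambda>\<omega>. \<integral>z. \<Psi> (\<omega>, z) \<partial>gaussian)"
proof -
  let ?\<xi> = "\<lambda>\<omega>. (B t \<omega> - B s \<omega>) / sqrt (t - s)"
  let ?P = "distr M (Gt s) (\<lambda>\<omega>. \<omega>)"
  have id: "(\<lambda>\<omega>. \<omega>) \<in> measurable M (Gt s)" using measurable_G_M[of "\<lambda>\<omega>. \<omega>" "ennreal s" "Gt s"] by simp
  have xi[measurable]: "?\<xi> \<in> borel_measurable M"
    using st by (intro borel_measurable_divide borel_measurable_diff B_measurable) auto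
  have "?P \<Otimes>\<^sub>M distr M borel ?\<xi> = distr M (Gt s \<Otimes>\<^sub>M borel) (\<lambda>\<omega>. (\<omega>, ?\<xi> \<omega>))"
  proof (rule distr_pair_of_independent[OF id space_F xi])
    fix A and b :: "real set" assume A: "A \<in> sets (Gt s)" and b: "b \<in> sets borel"
    have m: "(\<lambda>z. z / sqrt (t - s)) \<in> borel_measurable borel" by simp
    have "(\<lambda>z. z / sqrt (t - s)) -` b \<in> sets borel" using measurable_sets[OF m b] by simp
    from prob_past_increment[OF st A this]
    show "prob (A \<inter> (?\<xi> -` b \<inter> space M)) = prob A * prob (?\<xi> -` b \<inter> space M)" by (simp add: vimage_def)
  qed
  then have eq: "?P \<Otimes>\<^sub>M gaussian = distr M (Gt s \<Otimes>\<^sub>M borel) (\<lambda>\<omega>. (\<omega>, ?\<xi> \<omega>))"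
    unfolding distr_scaled_increment[OF st] by simp
  interpret P: prob_space ?P by (rule prob_space_distr[OF id])
  interpret N: prob_space gaussian by (rule prob_space_gaussian)
  interpret PN: pair_prob_space ?P gaussian ..
  have m2: "\<Psi> \<in> borel_measurable (?P \<Otimes>\<^sub>M gaussian)" using \<Psi> by (simp cong: measurable_cong_sets)
  have int: "integrable (?P \<Otimes>\<^sub>M gaussian) \<Psi>"
    using m2 bd by (intro PN.integrable_const_bound[of _ C]) (auto simp: space_pair_measure space_F intro!: AE_I2)
  have "expectation (\<lambda>\<omega>. \<Psi> (\<omega>, ?\<xi> \<omega>)) = integral\<^sup>L (?P \<Otimes>\<^sub>M gaussian) \<Psi>"
    unfolding eq using id by (subst integral_distr) auto
  also have "\<dots> = (\<integral>\<omega>. (\<integral>z. \<Psi> (\<omega>, z) \<partial>gaussian) \<partial>?P)"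
    using int by (rule PN.integral_fst'[symmetric])
  also have "\<dots> = expectation (\<lambda>\<omega>. \<integral>z. \<Psi> (\<omega>, z) \<partial>gaussian)"
  proof (rule integral_distr[OF id])
    have "(\<lambda>\<omega>. \<integral>z. \<Psi> (\<omega>, z) \<partial>gaussian) \<in> borel_measurable ?P"
      using m2 by (intro N.borel_measurable_lebesgue_integral) simp
    then show "(\<lambda>\<omega>. \<integral>z. \<Psi> (\<omega>, z) \<partial>gaussian) \<in> borel_measurable (Gt s)" by simp
  qed
  finally show ?thesis .
qed

text \<open>The heat semigroup, with the variance \<open>r\<close> of the Gaussian kernel as time. Writing it as an integral over
  a fixed Gaussian gives a jointly continuous expression that includes \<open>r = 0\<close>.\<close>

definition heat :: "(real \<Rightarrow> real) \<Rightarrow> real \<Rightarrow> real \<Rightarrow> real" where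
  "heat g r x = (\<integral>z. g (x + sqrt r * z) \<partial>gaussian)"

lemma heat_0: "heat g 0 x = g x"
proof -
  interpret N: prob_space gaussian by (rule prob_space_gaussian)
  show ?thesis using N.prob_space by (simp add: heat_def)
qed

lemma abs_heat_le:
  assumes "\<And>x. \<bar>g x\<bar> \<le> D" "g \<in> borel_measurable borel"
  shows "\<bar>heat g r x\<bar> \<le> D"
proof -
  interpret N: prob_space gaussian by (rule prob_space_gaussian)
  have m: "(\<lambda>z. g (x + sqrt r * z)) \<in> borel_measurable gaussian" using assms(2) by simp
  have "\<bar>heat g r x\<bar> \<le> (\<integral>z. \<bar>g (x + sqrt r * z)\<bar> \<partial>gaussian)" unfolding heat_def by (rule integral_abs_bound)
  also have "\<dots> \<le> (\<integral>z. D \<partial>gaussian)"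
    using assms m order_trans[OF abs_ge_zero assms(1)]
    by (intro integral_mono N.integrable_const_bound[of _ D]) auto
  also have "\<dots> = D" using N.prob_space by simp
  finally show ?thesis .
qed

lemma heat_tendsto:
  assumes g: "continuous_on UNIV g" "\<And>x. \<bar>g x\<bar> \<le> D" and "R \<longlonglongrightarrow> r" "X \<longlonglongrightarrow> x"
  shows "(\<lambda>n. heat g (R n) (X n)) \<longlonglongrightarrow> heat g r x"
proof -
  interpret N: prob_space gaussian by (rule prob_space_gaussian)
  have gm[measurable]: "g \<in> borel_measurable borel" using g(1) by (rule borel_measurable_continuous_onI)
  have "(\<lambda>n. g (X n + sqrt (R n) * z)) \<longlonglongrightarrow> g (x + sqrt r * z)" for z
    by (intro continuous_on_tendsto_compose[OF g(1)] tendsto_intros assms) auto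
  then show ?thesis
    unfolding heat_def using g(2)
    by (intro integral_dominated_convergence[where w="\<lambda>_. D"]) auto
qed

lemma markov_property:
  assumes st: "0 \<le> s" "s \<le> t" and Z[measurable]: "Z \<in> borel_measurable (Gt s)"
    and Zb: "\<And>\<omega>. \<omega> \<in> space M \<Longrightarrow> \<bar>Z \<omega>\<bar> \<le> C" and g: "continuous_on UNIV g" "\<And>x. \<bar>g x\<bar> \<le> D"
  shows "expectation (\<lambda>\<omega>. Z \<omega> * g (B t \<omega>)) = expectation (\<lambda>\<omega>. Z \<omega> * heat g (t - s) (B s \<omega>))"
proof (cases "s = t")
  case True
  then show ?thesis by (simp add: heat_0)
next
  case False
  with st have lt: "s < t" by simp
  have gm[measurable]: "g \<in> borel_measurable borel" using g(1) by (rule borel_measurable_continuous_onI)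
  have Bm[measurable]: "B s \<in> borel_measurable (Gt s)" using st by (intro B_adapted) auto
  define \<Psi> where "\<Psi> = (\<lambda>(\<omega>, z). Z \<omega> * g (B s \<omega> + sqrt (t - s) * z))"
  have D0: "0 \<le> D" using g(2)[of 0] by linarith
  have "expectation (\<lambda>\<omega>. \<Psi> (\<omega>, (B t \<omega> - B s \<omega>) / sqrt (t - s))) = expectation (\<lambda>\<omega>. \<integral>z. \<Psi> (\<omega>, z) \<partial>gaussian)"
  proof (rule expectation_past_increment[OF st(1) lt, where C="C * D"])
    show "\<Psi> \<in> borel_measurable (Gt s \<Otimes>\<^sub>M borel)" unfolding \<Psi>_def by measurable
    show "\<bar>\<Psi> (\<omega>, z)\<bar> \<le> C * D" if "\<omega> \<in> space M" for \<omega> z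
      using Zb[OF that] g(2)[of "B s \<omega> + sqrt (t - s) * z"] D0 by (auto simp: \<Psi>_def abs_mult intro!: mult_mono)
  qed
  then show ?thesis using lt by (simp add: \<Psi>_def heat_def)
qed

section \<open>Second moments at stopping times\<close>

lemma increment_moments:
  assumes st: "0 \<le> s" "s < t" and Z: "Z \<in> borel_measurable (Gt s)" "integrable M Z"
  shows "integrable M (\<lambda>\<omega>. Z \<omega> * (B t \<omega> - B s \<omega>))" "expectation (\<lambda>\<omega>. Z \<omega> * (B t \<omega> - B s \<omega>)) = 0"
    "integrable M (\<lambda>\<omega>. Z \<omega> * (B t \<omega> - B s \<omega>)\<^sup>2)"
    "expectation (\<lambda>\<omega>. Z \<omega> * (B t \<omega> - B s \<omega>)\<^sup>2) = (t - s) * expectation Z"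
proof -
  have dist: "distributed M lborel (\<lambda>\<omega>. B t \<omega> - B s \<omega>) (normal_density 0 (sqrt (t - s)))"
    using brownian st by (auto simp: brownian_motion_def)
  note i1 = indep_var_past_increment[OF st Z(1), of "\<lambda>x. x", simplified]
  have i2: "indep_var borel Z borel (\<lambda>\<omega>. (B t \<omega> - B s \<omega>)\<^sup>2)"
    by (rule indep_var_past_increment[OF st Z(1), of "\<lambda>x. x\<^sup>2"]) simp
  have pos: "0 < sqrt (t - s)" using st by simp
  have e1: "expectation (\<lambda>\<omega>. B t \<omega> - B s \<omega>) = 0"
    using normal_distributed_expectation[OF pos dist] .
  have n1: "integrable M (\<lambda>\<omega>. B t \<omega> - B s \<omega>)"
    using integrable_normal_moment_nz_1[of "sqrt (t - s)" 0] pos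
    by (subst distributed_integrable[OF dist, of "\<lambda>x. x", symmetric]) auto
  have e2: "expectation (\<lambda>\<omega>. (B t \<omega> - B s \<omega>)\<^sup>2) = t - s"
    using normal_distributed_variance[OF pos dist] e1 st by simp
  have n2: "integrable M (\<lambda>\<omega>. (B t \<omega> - B s \<omega>)\<^sup>2)"
    using integrable_normal_moment[of "sqrt (t - s)" 0 2] pos
    by (subst distributed_integrable[OF dist, of "\<lambda>x. x\<^sup>2", symmetric]) auto
  show "integrable M (\<lambda>\<omega>. Z \<omega> * (B t \<omega> - B s \<omega>))" "expectation (\<lambda>\<omega>. Z \<omega> * (B t \<omega> - B s \<omega>)) = 0"
    "integrable M (\<lambda>\<omega>. Z \<omega> * (B t \<omega> - B s \<omega>)\<^sup>2)"
    "expectation (\<lambda>\<omega>. Z \<omega> * (B t \<omega> - B s \<omega>)\<^sup>2) = (t - s) * expectation Z"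
    using indep_var_lebesgue_integral[OF i1 Z(2) n1] indep_var_integrable[OF i1 Z(2) n1]
      indep_var_lebesgue_integral[OF i2 Z(2) n2] indep_var_integrable[OF i2 Z(2) n2] e1 e2
    by simp_all
qed

text \<open>Ito's isometry for integrands that are constant on grid cells: the products of different
  increments have expectation zero because the later one is centred given the past.\<close>

lemma simple_integral_isometry:
  assumes h: "0 < h" and H: "\<And>i. i < n \<Longrightarrow> H i \<in> borel_measurable (Gt (real i * h))"
    and Hb: "\<And>i \<omega>. i < n \<Longrightarrow> \<omega> \<in> space M \<Longrightarrow> \<bar>H i \<omega>\<bar> \<le> 1"
  defines "S \<equiv> \<lambda>\<omega>. \<Sum>i<n. H i \<omega> * (B (real (Suc i) * h) \<omega> - B (real i * h) \<omega>)"
  shows "S \<in> borel_measurable (Gt (real n * h)) \<and> integrable M (\<lambda>\<omega>. (S \<omega>)\<^sup>2) \<and> expectation S = 0 \<and>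
    expectation (\<lambda>\<omega>. (S \<omega>)\<^sup>2) = (\<Sum>i<n. h * expectation (\<lambda>\<omega>. (H i \<omega>)\<^sup>2))"
  using H Hb unfolding S_def
proof (induction n)
  case 0
  then show ?case by simp
next
  case (Suc n)
  let ?S = "\<lambda>\<omega>. \<Sum>i<n. H i \<omega> * (B (real (Suc i) * h) \<omega> - B (real i * h) \<omega>)"
  let ?D = "\<lambda>\<omega>. B (real (Suc n) * h) \<omega> - B (real n * h) \<omega>"
  have IH: "?S \<in> borel_measurable (Gt (real n * h))" "integrable M (\<lambda>\<omega>. (?S \<omega>)\<^sup>2)" "expectation ?S = 0"
    "expectation (\<lambda>\<omega>. (?S \<omega>)\<^sup>2) = (\<Sum>i<n. h * expectation (\<lambda>\<omega>. (H i \<omega>)\<^sup>2))"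
    using Suc by auto
  have st: "0 \<le> real n * h" "real n * h < real (Suc n) * h" and le: "real n * h \<le> real (Suc n) * h"
    using h by (auto intro: mult_strict_right_mono mult_right_mono)
  have Hm: "H n \<in> borel_measurable (Gt (real n * h))" and Hb: "\<And>\<omega>. \<omega> \<in> space M \<Longrightarrow> \<bar>H n \<omega>\<bar> \<le> 1"
    using Suc.prems by auto
  have SM: "?S \<in> borel_measurable M" using IH(1) by (rule measurable_G_M)
  have HM: "H n \<in> borel_measurable M" using Hm by (rule measurable_G_M)
  have Si: "integrable M ?S" using SM IH(2) by (rule square_integrable_imp_integrable)
  have Hi: "integrable M (H n)" using HM Hb by (intro integrable_const_bound[of _ 1]) auto
  have Hi2: "integrable M (\<lambda>\<omega>. (H n \<omega>)\<^sup>2)"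
    using HM Hb by (intro integrable_const_bound[of _ 1]) (auto simp: abs_square_le_1)
  have SHi: "integrable M (\<lambda>\<omega>. 2 * ?S \<omega> * H n \<omega>)"
  proof (rule Bochner_Integration.integrable_bound)
    show "integrable M (\<lambda>\<omega>. 2 * ?S \<omega>)" using Si by simp
    show "AE \<omega> in M. norm (2 * ?S \<omega> * H n \<omega>) \<le> norm (2 * ?S \<omega>)"
      using Hb by (intro AE_I2) (simp add: abs_mult mult_left_le)
  qed (use SM HM in simp)
  have a: "(?S \<omega> + H n \<omega> * ?D \<omega>)\<^sup>2 = (?S \<omega>)\<^sup>2 + 2 * ?S \<omega> * H n \<omega> * ?D \<omega> + (H n \<omega>)\<^sup>2 * (?D \<omega>)\<^sup>2" for \<omega>
    by (simp add: power2_sum power_mult_distrib)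
  note m1 = increment_moments[OF st Hm Hi]
  have "(\<lambda>\<omega>. 2 * ?S \<omega> * H n \<omega>) \<in> borel_measurable (Gt (real n * h))" using IH(1) Hm by simp
  note m2 = increment_moments[OF st this SHi]
  have "(\<lambda>\<omega>. (H n \<omega>)\<^sup>2) \<in> borel_measurable (Gt (real n * h))" using Hm by simp
  note m3 = increment_moments[OF st this Hi2]
  have D: "?D \<in> borel_measurable (Gt (real (Suc n) * h))"
    using st by (intro borel_measurable_diff B_adapted) auto
  have S': "?S \<in> borel_measurable (Gt (real (Suc n) * h))" "H n \<in> borel_measurable (Gt (real (Suc n) * h))"
    using measurable_G_mono[OF IH(1) ennreal_leI[OF le]] measurable_G_mono[OF Hm ennreal_leI[OF le]] by auto
  have "real (Suc n) * h - real n * h = h" by (simp add: algebra_simps)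
  then show ?case
    unfolding sum.lessThan_Suc a using IH m1 m2 m3 Si S' D by simp
qed

lemma B_on_grid: "\<omega> \<in> space M \<Longrightarrow> m \<le> n \<Longrightarrow>
  (\<Sum>i<n. of_bool (i < m) * (B (real (Suc i) * h) \<omega> - B (real i * h) \<omega>)) = B (real m * h) \<omega>"
proof -
  assume \<omega>: "\<omega> \<in> space M" and "m \<le> n"
  then have "(\<Sum>i<n. of_bool (i < m) * (B (real (Suc i) * h) \<omega> - B (real i * h) \<omega>))
      = (\<Sum>i<m. B (real (Suc i) * h) \<omega> - B (real i * h) \<omega>)"
    by (intro sum.mono_neutral_cong_right) auto
  also have "\<dots> = B (real m * h) \<omega>" using \<omega> by (subst sum_lessThan_telescope) (simp add: B_0)
  finally show ?thesis .
qed

text \<open>The difference of \<open>B\<close> at two grid-valued stopping times is the integral of the difference of the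
  two indicators \<open>i < N\<close> and \<open>i < L\<close>, so that the isometry applies.\<close>

lemma grid_times_isometry:
  assumes h: "0 < h" and N: "\<And>i. {\<omega>\<in>space M. i < N \<omega>} \<in> sets (Gt (real i * h))" "\<And>\<omega>. \<omega> \<in> space M \<Longrightarrow> N \<omega> \<le> n"
    and L: "\<And>i. {\<omega>\<in>space M. i < L \<omega>} \<in> sets (Gt (real i * h))" "\<And>\<omega>. \<omega> \<in> space M \<Longrightarrow> L \<omega> \<le> n"
  defines "X \<equiv> \<lambda>\<omega>. B (real (N \<omega>) * h) \<omega> - B (real (L \<omega>) * h) \<omega>"
  shows "integrable M (\<lambda>\<omega>. (X \<omega>)\<^sup>2)" "expectation X = 0"
    "expectation (\<lambda>\<omega>. (X \<omega>)\<^sup>2) = expectation (\<lambda>\<omega>. \<bar>real (N \<omega>) * h - real (L \<omega>) * h\<bar>)" "X \<in> borel_measurable M"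
proof -
  define H :: "nat \<Rightarrow> 'a \<Rightarrow> real" where "H = (\<lambda>i \<omega>. of_bool (i < N \<omega>) - of_bool (i < L \<omega>))"
  have Hm: "H i \<in> borel_measurable (Gt (real i * h))" for i
  proof -
    have "{\<omega>\<in>space (Gt (real i * h)). i < N \<omega>} \<in> sets (Gt (real i * h))"
      "{\<omega>\<in>space (Gt (real i * h)). i < L \<omega>} \<in> sets (Gt (real i * h))" using N(1) L(1) by (auto simp: space_F)
    then have [measurable]: "Measurable.pred (Gt (real i * h)) (\<lambda>\<omega>. i < N \<omega>)" "Measurable.pred (Gt (real i * h)) (\<lambda>\<omega>. i < L \<omega>)"
      by (simp_all add: pred_def)
    show ?thesis unfolding H_def of_bool_def by measurable
  qed
  have Hb: "\<bar>H i \<omega>\<bar> \<le> 1" for i \<omega> by (auto simp: H_def)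
  let ?S = "\<lambda>\<omega>. \<Sum>i<n. H i \<omega> * (B (real (Suc i) * h) \<omega> - B (real i * h) \<omega>)"
  have S: "?S \<omega> = X \<omega>" if "\<omega> \<in> space M" for \<omega>
    using that N(2)[OF that] L(2)[OF that] B_on_grid[of \<omega> "N \<omega>" n h] B_on_grid[of \<omega> "L \<omega>" n h]
    by (simp add: H_def X_def left_diff_distrib sum_subtractf)
  note I = simple_integral_isometry[OF h, of n H, OF Hm Hb]
  have c2: "expectation (\<lambda>\<omega>. (?S \<omega>)\<^sup>2) = expectation (\<lambda>\<omega>. (X \<omega>)\<^sup>2)" "expectation ?S = expectation X"
    "integrable M (\<lambda>\<omega>. (?S \<omega>)\<^sup>2) = integrable M (\<lambda>\<omega>. (X \<omega>)\<^sup>2)" "?S \<in> borel_measurable M \<longleftrightarrow> X \<in> borel_measurable M"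
    by (auto simp: S simp del: of_nat_Suc intro!: Bochner_Integration.integral_cong Bochner_Integration.integrable_cong measurable_cong)
  show "integrable M (\<lambda>\<omega>. (X \<omega>)\<^sup>2)" "expectation X = 0" using I c2 by auto
  show "X \<in> borel_measurable M" using I c2 measurable_G_M by blast
  have HM: "H i \<in> borel_measurable M" for i using Hm by (rule measurable_G_M)
  have i2: "integrable M (\<lambda>\<omega>. (H i \<omega>)\<^sup>2)" for i
    using HM Hb by (intro integrable_const_bound[of _ 1]) (auto simp: abs_square_le_1)
  have "expectation (\<lambda>\<omega>. (X \<omega>)\<^sup>2) = (\<Sum>i<n. h * expectation (\<lambda>\<omega>. (H i \<omega>)\<^sup>2))" using I c2 by auto
  also have "\<dots> = expectation (\<lambda>\<omega>. \<Sum>i<n. h * (H i \<omega>)\<^sup>2)" using i2 by simp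
  also have "\<dots> = expectation (\<lambda>\<omega>. \<bar>real (N \<omega>) * h - real (L \<omega>) * h\<bar>)"
  proof (intro Bochner_Integration.integral_cong refl)
    fix \<omega> assume \<omega>: "\<omega> \<in> space M"
    have "(\<Sum>i<n. (H i \<omega>)\<^sup>2) = (\<Sum>i<n. of_bool (i < max (N \<omega>) (L \<omega>)) - of_bool (i < min (N \<omega>) (L \<omega>)))"
      by (intro sum.cong) (auto simp: H_def)
    also have "\<dots> = real (max (N \<omega>) (L \<omega>)) - real (min (N \<omega>) (L \<omega>))"
    proof -
      have c: "(\<Sum>i<n. of_bool (i < m)) = real m" if "m \<le> n" for m
      proof -
        have "(\<Sum>i<n. of_bool (i < m)) = (\<Sum>i<m. (1::real))"
          using that by (intro sum.mono_neutral_cong_right) auto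
        then show ?thesis by simp
      qed
      have "max (N \<omega>) (L \<omega>) \<le> n" "min (N \<omega>) (L \<omega>) \<le> n" using N(2)[OF \<omega>] L(2)[OF \<omega>] by auto
      then show ?thesis by (simp only: sum_subtractf c)
    qed
    also have "\<dots> = \<bar>real (N \<omega>) - real (L \<omega>)\<bar>" by (simp add: max_def min_def)
    finally have e: "(\<Sum>i<n. (H i \<omega>)\<^sup>2) = \<bar>real (N \<omega>) - real (L \<omega>)\<bar>" .
    have "\<bar>real (N \<omega>) * h - real (L \<omega>) * h\<bar> = h * \<bar>real (N \<omega>) - real (L \<omega>)\<bar>"
      using h by (simp add: abs_mult mult.commute flip: right_diff_distrib)
    then show "(\<Sum>i<n. h * (H i \<omega>)\<^sup>2) = \<bar>real (N \<omega>) * h - real (L \<omega>) * h\<bar>"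
      by (simp add: e flip: sum_distrib_left)
  qed
  finally show "expectation (\<lambda>\<omega>. (X \<omega>)\<^sup>2) = expectation (\<lambda>\<omega>. \<bar>real (N \<omega>) * h - real (L \<omega>) * h\<bar>)" .
qed

lemma stopping_time_measurable: "stopping_time G \<tau> \<Longrightarrow> \<tau> \<in> borel_measurable M"
  using measurable_stopping_time[OF _ sets_G_subset space_F] .

lemma borel_measurable_B_at:
  "T \<in> borel_measurable M \<Longrightarrow> (\<And>\<omega>. \<omega> \<in> space M \<Longrightarrow> 0 \<le> T \<omega>) \<Longrightarrow> (\<lambda>\<omega>. B (T \<omega>) \<omega>) \<in> borel_measurable M"
  by (rule borel_measurable_at_random_time[of B]) (auto simp: B_measurable B_continuous)

text \<open>The index of the smallest grid time \<open>m / 2 ^ k\<close> not before \<open>\<tau>\<close>, capped at time \<open>k\<close>. Rounding up and capping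
  make the grid time a bounded stopping time, and the grids are nested in \<open>k\<close>.\<close>

definition grid_index :: "('a \<Rightarrow> ennreal) \<Rightarrow> nat \<Rightarrow> 'a \<Rightarrow> nat" where
  "grid_index \<tau> k \<omega> = (LEAST m. \<not> (m < k * 2 ^ k \<and> ennreal (real m / 2 ^ k) < \<tau> \<omega>))"

lemma less_grid_index: "i < grid_index \<tau> k \<omega> \<longleftrightarrow> i < k * 2 ^ k \<and> ennreal (real i / 2 ^ k) < \<tau> \<omega>"
proof
  let ?P = "\<lambda>m. m < k * 2 ^ k \<and> ennreal (real m / 2 ^ k) < \<tau> \<omega>"
  assume "i < grid_index \<tau> k \<omega>"
  then show "?P i" unfolding grid_index_def by (auto dest: not_less_Least)
next
  let ?P = "\<lambda>m. m < k * 2 ^ k \<and> ennreal (real m / 2 ^ k) < \<tau> \<omega>"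
  assume i: "?P i"
  have "\<not> ?P (k * 2 ^ k)" by simp
  then have L: "\<not> ?P (grid_index \<tau> k \<omega>)" unfolding grid_index_def by (rule LeastI)
  show "i < grid_index \<tau> k \<omega>"
  proof (rule ccontr)
    assume "\<not> i < grid_index \<tau> k \<omega>"
    then have le: "grid_index \<tau> k \<omega> \<le> i" by simp
    then have "ennreal (real (grid_index \<tau> k \<omega>) / 2 ^ k) \<le> ennreal (real i / 2 ^ k)"
      by (intro ennreal_leI divide_right_mono) auto
    then have "ennreal (real (grid_index \<tau> k \<omega>) / 2 ^ k) < \<tau> \<omega>" by (rule le_less_trans) (use i in blast)
    moreover have "grid_index \<tau> k \<omega> < k * 2 ^ k" by (rule le_less_trans[OF le]) (use i in blast)
    ultimately have "?P (grid_index \<tau> k \<omega>)" by blast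
    with L show False by blast
  qed
qed

lemma grid_index_le: "grid_index \<tau> k \<omega> \<le> k * 2 ^ k"
  using less_grid_index[of "k * 2 ^ k" \<tau> k \<omega>] by auto

lemma grid_time_bounds:
  assumes "\<tau> \<omega> < \<infinity>"
  shows "real (grid_index \<tau> k \<omega>) / 2 ^ k \<le> enn2real (\<tau> \<omega>) + 1 / 2 ^ k"
    "enn2real (\<tau> \<omega>) \<le> real k \<Longrightarrow> enn2real (\<tau> \<omega>) \<le> real (grid_index \<tau> k \<omega>) / 2 ^ k"
proof -
  let ?T = "enn2real (\<tau> \<omega>)" and ?m = "grid_index \<tau> k \<omega>"
  have T: "\<tau> \<omega> = ennreal ?T" "0 \<le> ?T" using assms by (auto simp: less_top)
  show "real ?m / 2 ^ k \<le> ?T + 1 / 2 ^ k"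
  proof (cases "?m")
    case 0
    then show ?thesis using T by simp
  next
    case (Suc m)
    then have "ennreal (real m / 2 ^ k) < ennreal ?T" using less_grid_index[of m \<tau> k \<omega>] T by simp
    then have "real m / 2 ^ k < ?T" by (subst (asm) ennreal_less_iff) auto
    then show ?thesis using Suc by (simp add: field_simps)
  qed
  assume k: "?T \<le> real k"
  have "\<not> ?m < ?m" by simp
  then consider "k * 2 ^ k \<le> ?m" | "\<tau> \<omega> \<le> ennreal (real ?m / 2 ^ k)" using less_grid_index[of ?m \<tau> k \<omega>] by auto
  then show "?T \<le> real ?m / 2 ^ k"
  proof cases
    case 1
    from of_nat_mono[OF this, where 'a=real] have "real k \<le> real ?m / 2 ^ k" by (simp add: field_simps)
    then show ?thesis using k by linarith
  next
    case 2
    then show ?thesis using T by (metis divide_nonneg_nonneg ennreal_le_iff of_nat_0_le_iff zero_le_numeral zero_le_power)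
  qed
qed

lemma grid_time_tendsto:
  assumes "\<tau> \<omega> < \<infinity>"
  shows "(\<lambda>k. real (grid_index \<tau> k \<omega>) / 2 ^ k) \<longlonglongrightarrow> enn2real (\<tau> \<omega>)"
proof (rule tendsto_sandwich)
  obtain K :: nat where K: "enn2real (\<tau> \<omega>) \<le> real K" using real_arch_simple by blast
  show "\<forall>\<^sub>F k in sequentially. enn2real (\<tau> \<omega>) \<le> real (grid_index \<tau> k \<omega>) / 2 ^ k"
    using eventually_ge_at_top[of K]
    by eventually_elim (use K in \<open>auto intro!: grid_time_bounds(2) assms\<close>)
  show "\<forall>\<^sub>F k in sequentially. real (grid_index \<tau> k \<omega>) / 2 ^ k \<le> enn2real (\<tau> \<omega>) + 1 / 2 ^ k"
    by (intro always_eventually allI grid_time_bounds assms)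
  have "(\<lambda>j. enn2real (\<tau> \<omega>) + (1 / 2) ^ j) \<longlonglongrightarrow> enn2real (\<tau> \<omega>) + 0"
    by (intro tendsto_intros LIMSEQ_realpow_zero) auto
  then show "(\<lambda>k. enn2real (\<tau> \<omega>) + 1 / 2 ^ k) \<longlonglongrightarrow> enn2real (\<tau> \<omega>)" by (simp add: power_one_over)
qed simp

text \<open>The time of grid \<open>j\<close> is expressed on the finer grid \<open>k\<close>, where both can be compared by the
  isometry.\<close>

lemma less_grid_index_G:
  assumes \<tau>: "stopping_time G \<tau>" and "j \<le> k"
  shows "{\<omega>\<in>space M. i < grid_index \<tau> j \<omega> * 2 ^ (k - j)} \<in> sets (Gt (real i * (1 / 2 ^ k)))"
proof -
  let ?i = "i div 2 ^ (k - j)"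
  have "i < grid_index \<tau> j \<omega> * 2 ^ (k - j) \<longleftrightarrow> ?i < j * 2 ^ j \<and> ennreal (real ?i / 2 ^ j) < \<tau> \<omega>" for \<omega>
    by (subst less_grid_index[symmetric]) (simp add: div_less_iff_less_mult)
  moreover have "real ?i / 2 ^ j \<le> real i * (1 / 2 ^ k)"
  proof -
    have "?i * 2 ^ (k - j) \<le> i" by (rule div_times_less_eq_dividend)
    from of_nat_mono[OF this, where 'a=real] have "real ?i * 2 ^ (k - j) \<le> real i" by simp
    moreover have "(2::real) ^ k = 2 ^ (k - j) * 2 ^ j" using assms(2) by (simp flip: power_add)
    ultimately show ?thesis by (simp add: field_simps)
  qed
  then have "ennreal (real ?i / 2 ^ j) \<le> ennreal (real i * (1 / 2 ^ k))" by (rule ennreal_leI)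
  have "Measurable.pred (Gt (real ?i / 2 ^ j)) (\<lambda>\<omega>. ennreal (real ?i / 2 ^ j) < \<tau> \<omega>)"
    using \<tau> by (rule stopping_timeD2)
  then have "{\<omega>\<in>space M. ennreal (real ?i / 2 ^ j) < \<tau> \<omega>} \<in> sets (Gt (real ?i / 2 ^ j))"
    by (simp add: pred_def space_F)
  then have m: "{\<omega>\<in>space M. ennreal (real ?i / 2 ^ j) < \<tau> \<omega>} \<in> sets (Gt (real i * (1 / 2 ^ k)))"
    using sets_F_mono[OF \<open>ennreal (real ?i / 2 ^ j) \<le> ennreal (real i * (1 / 2 ^ k))\<close>] by auto
  have "{\<omega>\<in>space M. ?i < j * 2 ^ j \<and> ennreal (real ?i / 2 ^ j) < \<tau> \<omega>} =
    (if ?i < j * 2 ^ j then {\<omega>\<in>space M. ennreal (real ?i / 2 ^ j) < \<tau> \<omega>} else {})" by auto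
  then show ?thesis using m calculation by simp
qed

lemma grid_times_L2:
  assumes \<tau>: "stopping_time G \<tau>"
  defines "X \<equiv> \<lambda>k \<omega>. B (real (grid_index \<tau> k \<omega>) / 2 ^ k) \<omega>"
    and "\<sigma> \<equiv> \<lambda>k \<omega>. real (grid_index \<tau> k \<omega>) / 2 ^ k"
  shows "expectation (\<lambda>\<omega>. (X j \<omega> - X k \<omega>)\<^sup>2) = expectation (\<lambda>\<omega>. \<bar>\<sigma> j \<omega> - \<sigma> k \<omega>\<bar>) \<and> integrable M (\<lambda>\<omega>. (X j \<omega> - X k \<omega>)\<^sup>2)
     \<and> X k \<in> borel_measurable M"
    "expectation (\<lambda>\<omega>. (X k \<omega>)\<^sup>2) = expectation (\<sigma> k) \<and> integrable M (\<lambda>\<omega>. (X k \<omega>)\<^sup>2) \<and> expectation (X k) = 0"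
proof -
  have A: "expectation (\<lambda>\<omega>. (X j \<omega> - X k \<omega>)\<^sup>2) = expectation (\<lambda>\<omega>. \<bar>\<sigma> j \<omega> - \<sigma> k \<omega>\<bar>) \<and> integrable M (\<lambda>\<omega>. (X j \<omega> - X k \<omega>)\<^sup>2)"
    if jk: "j \<le> k" for j k
  proof -
    have p: "(2::real) ^ k = 2 ^ (k - j) * 2 ^ j" using jk by (simp flip: power_add)
    have e: "real (grid_index \<tau> j \<omega> * 2 ^ (k - j)) * (1 / 2 ^ k) = \<sigma> j \<omega>" for \<omega>
      unfolding p by (simp add: \<sigma>_def)
    have e': "real (grid_index \<tau> k \<omega> * 2 ^ (k - k)) * (1 / 2 ^ k) = \<sigma> k \<omega>" for \<omega>
      by (simp add: \<sigma>_def)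
    have "grid_index \<tau> j \<omega> * 2 ^ (k - j) \<le> k * 2 ^ k" for \<omega>
    proof -
      have "grid_index \<tau> j \<omega> * 2 ^ (k - j) \<le> (j * 2 ^ j) * 2 ^ (k - j)" by (intro mult_right_mono grid_index_le) simp
      also have "\<dots> = j * 2 ^ k" using jk by (simp flip: power_add mult.assoc)
      also have "\<dots> \<le> k * 2 ^ k" using jk by simp
      finally show ?thesis .
    qed
    from grid_times_isometry[of "1 / 2 ^ k" "\<lambda>\<omega>. grid_index \<tau> j \<omega> * 2 ^ (k - j)" "k * 2 ^ k" "\<lambda>\<omega>. grid_index \<tau> k \<omega> * 2 ^ (k - k)",
        OF _ less_grid_index_G[OF \<tau> jk] this less_grid_index_G[OF \<tau> order_refl]]
    show ?thesis unfolding e e' using grid_index_le[of \<tau> k] by (simp add: X_def \<sigma>_def)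
  qed
  have Z: "expectation (\<lambda>\<omega>. (X k \<omega>)\<^sup>2) = expectation (\<sigma> k) \<and> integrable M (\<lambda>\<omega>. (X k \<omega>)\<^sup>2) \<and> expectation (X k) = 0 \<and> X k \<in> borel_measurable M" for k
  proof -
    have e': "real (grid_index \<tau> k \<omega> * 2 ^ (k - k)) * (1 / 2 ^ k) = \<sigma> k \<omega>" for \<omega>
      by (simp add: \<sigma>_def)
    have b: "grid_index \<tau> k \<omega> * 2 ^ (k - k) \<le> k * 2 ^ k" for \<omega> using grid_index_le[of \<tau> k] by simp
    have n: "{\<omega>\<in>space M. i < (0::nat)} \<in> sets (Gt (real i * (1 / 2 ^ k)))" for i by simp
    note I = grid_times_isometry[of "1 / 2 ^ k" "\<lambda>\<omega>. grid_index \<tau> k \<omega> * 2 ^ (k - k)" "k * 2 ^ k" "\<lambda>\<omega>. 0",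
        OF _ less_grid_index_G[OF \<tau> order_refl] b n, unfolded e']
    have c: "B (\<sigma> k \<omega>) \<omega> - B 0 \<omega> = X k \<omega>" if "\<omega> \<in> space M" for \<omega>
      using that by (simp add: B_0 X_def \<sigma>_def)
    have c2: "expectation (\<lambda>\<omega>. (B (\<sigma> k \<omega>) \<omega> - B 0 \<omega>)\<^sup>2) = expectation (\<lambda>\<omega>. (X k \<omega>)\<^sup>2)"
      "expectation (\<lambda>\<omega>. B (\<sigma> k \<omega>) \<omega> - B 0 \<omega>) = expectation (X k)"
      "integrable M (\<lambda>\<omega>. (B (\<sigma> k \<omega>) \<omega> - B 0 \<omega>)\<^sup>2) = integrable M (\<lambda>\<omega>. (X k \<omega>)\<^sup>2)"
      "(\<lambda>\<omega>. B (\<sigma> k \<omega>) \<omega> - B 0 \<omega>) \<in> borel_measurable M \<longleftrightarrow> X k \<in> borel_measurable M"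
      by (auto simp: c intro!: Bochner_Integration.integral_cong Bochner_Integration.integrable_cong measurable_cong)
    have d: "\<bar>\<sigma> k \<omega> - real 0 * (1 / 2 ^ k)\<bar> = \<sigma> k \<omega>" for \<omega> by (simp add: \<sigma>_def)
    show ?thesis using I unfolding d by (simp add: c2)
  qed
  show "expectation (\<lambda>\<omega>. (X k \<omega>)\<^sup>2) = expectation (\<sigma> k) \<and> integrable M (\<lambda>\<omega>. (X k \<omega>)\<^sup>2) \<and> expectation (X k) = 0" using Z by blast
  show "expectation (\<lambda>\<omega>. (X j \<omega> - X k \<omega>)\<^sup>2) = expectation (\<lambda>\<omega>. \<bar>\<sigma> j \<omega> - \<sigma> k \<omega>\<bar>) \<and> integrable M (\<lambda>\<omega>. (X j \<omega> - X k \<omega>)\<^sup>2)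
     \<and> X k \<in> borel_measurable M"
    using A[of j k] A[of k j] Z[of k] by (cases "j \<le> k") (auto simp: power2_commute abs_minus_commute)
qed

text \<open>The isometry makes \<open>B\<close> at the grid times a Cauchy sequence in \<open>L\<^sup>2\<close>, whose limit is \<open>B\<close> at the stopping
  time by continuity. The factor \<open>2\<close> comes from \<open>(a + b)\<^sup>2 \<le> 2 a\<^sup>2 + 2 b\<^sup>2\<close> ; any constant
  gives tightness.\<close>

lemma wald:
  assumes \<tau>: "stopping_time G \<tau>" and fin: "(\<integral>\<^sup>+ \<omega>. \<tau> \<omega> \<partial>M) < \<infinity>"
  defines "T \<equiv> \<lambda>\<omega>. enn2real (\<tau> \<omega>)"
  shows "integrable M T" "integrable M (\<lambda>\<omega>. (B (T \<omega>) \<omega>)\<^sup>2)"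
    "expectation T \<le> 2 * expectation (\<lambda>\<omega>. (B (T \<omega>) \<omega>)\<^sup>2)"
    "expectation (\<lambda>\<omega>. B (T \<omega>) \<omega>) = 0"
proof -
  define X where "X = (\<lambda>k \<omega>. B (real (grid_index \<tau> k \<omega>) / 2 ^ k) \<omega>)"
  define \<sigma> where "\<sigma> = (\<lambda>k \<omega>. real (grid_index \<tau> k \<omega>) / 2 ^ k)"
  have L2: "expectation (\<lambda>\<omega>. (X j \<omega> - X k \<omega>)\<^sup>2) = expectation (\<lambda>\<omega>. \<bar>\<sigma> j \<omega> - \<sigma> k \<omega>\<bar>) \<and> integrable M (\<lambda>\<omega>. (X j \<omega> - X k \<omega>)\<^sup>2)
     \<and> X k \<in> borel_measurable M"
    "expectation (\<lambda>\<omega>. (X k \<omega>)\<^sup>2) = expectation (\<sigma> k) \<and> integrable M (\<lambda>\<omega>. (X k \<omega>)\<^sup>2) \<and> expectation (X k) = 0" for j k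
    unfolding X_def \<sigma>_def by (rule grid_times_L2[OF \<tau>])+
  have \<tau>m[measurable]: "\<tau> \<in> borel_measurable M" using \<tau> by (rule stopping_time_measurable)
  have Tm[measurable]: "T \<in> borel_measurable M" unfolding T_def by simp
  have T0: "0 \<le> T \<omega>" for \<omega> by (simp add: T_def)
  have fin_AE: "AE \<omega> in M. \<tau> \<omega> < \<infinity>"
    using nn_integral_PInf_AE[OF \<tau>m] fin by (auto simp: less_top)
  have nT: "(\<integral>\<^sup>+ \<omega>. ennreal (T \<omega>) \<partial>M) = (\<integral>\<^sup>+ \<omega>. \<tau> \<omega> \<partial>M)"
    using fin_AE by (intro nn_integral_cong_AE) (auto simp: T_def)
  show Ti: "integrable M T" using nT fin T0 by (intro integrableI_nonneg) auto
  define Y where "Y = (\<lambda>\<omega>. B (T \<omega>) \<omega>)"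
  have Ym[measurable]: "Y \<in> borel_measurable M" unfolding Y_def by (rule borel_measurable_B_at) (auto simp: T0)
  have Xm[measurable]: "X k \<in> borel_measurable M" for k using L2 by blast
  have \<sigma>m[measurable]: "\<sigma> k \<in> borel_measurable M" for k
  proof -
    have "Measurable.pred M (\<lambda>\<omega>. i < grid_index \<tau> k \<omega>)" for i
      unfolding less_grid_index by measurable
    then have "{\<omega>\<in>space M. i < grid_index \<tau> k \<omega>} \<in> sets M" for i by (simp add: pred_def)
    then have "grid_index \<tau> k \<in> measurable M (count_space UNIV)"
    proof (intro measurable_count_space_eq2_countable[THEN iffD2] conjI allI ballI)
      fix i
      assume a: "\<And>i. {\<omega>\<in>space M. i < grid_index \<tau> k \<omega>} \<in> sets M"
      have "grid_index \<tau> k -` {i} \<inter> space M = (if i = 0 then space M else {\<omega>\<in>space M. i - 1 < grid_index \<tau> k \<omega>}) - {\<omega>\<in>space M. i < grid_index \<tau> k \<omega>}"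
        by auto
      then show "grid_index \<tau> k -` {i} \<inter> space M \<in> sets M" using a by auto
    qed auto
    then show ?thesis unfolding \<sigma>_def by measurable
  qed
  have \<sigma>T1: "AE \<omega> in M. (\<lambda>k. \<sigma> k \<omega>) \<longlonglongrightarrow> T \<omega>"
    using fin_AE by eventually_elim (auto simp: \<sigma>_def T_def intro: grid_time_tendsto)
  have \<sigma>T2: "AE \<omega> in M. \<forall>k. \<sigma> k \<omega> \<le> T \<omega> + 1"
    using fin_AE
  proof eventually_elim
    fix \<omega> assume f: "\<tau> \<omega> < \<infinity>"
    have "(1::real) / 2 ^ k \<le> 1" for k by simp
    then show "\<forall>k. \<sigma> k \<omega> \<le> T \<omega> + 1" using grid_time_bounds(1)[of \<tau> \<omega>] f
      unfolding \<sigma>_def T_def by (meson add_left_mono order_trans)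
  qed
  note \<sigma>T = \<sigma>T1 \<sigma>T2
  have \<sigma>0: "0 \<le> \<sigma> k \<omega>" for k \<omega> by (simp add: \<sigma>_def)
  have \<sigma>i: "integrable M (\<sigma> k)" for k
    by (rule Bochner_Integration.integrable_bound[of _ "\<lambda>\<omega>. T \<omega> + 1"])
      (use Ti \<sigma>T(2) in \<open>auto elim!: eventually_mono simp: \<sigma>0 T0 add_nonneg_nonneg\<close>)
  define d where "d k = expectation (\<lambda>\<omega>. \<bar>T \<omega> - \<sigma> k \<omega>\<bar>)" for k
  have d0: "d \<longlonglongrightarrow> 0"
  proof -
    have "d \<longlonglongrightarrow> expectation (\<lambda>\<omega>. 0)" unfolding d_def
    proof (rule integral_dominated_convergence[where w="\<lambda>\<omega>. 2 * T \<omega> + 1"])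
      show "AE \<omega> in M. (\<lambda>k. \<bar>T \<omega> - \<sigma> k \<omega>\<bar>) \<longlonglongrightarrow> 0"
        using \<sigma>T(1) by eventually_elim (auto intro!: tendsto_eq_intros)
      show "AE \<omega> in M. norm \<bar>T \<omega> - \<sigma> k \<omega>\<bar> \<le> 2 * T \<omega> + 1" for k
        using \<sigma>T(2) by eventually_elim (use \<sigma>0 T0 in \<open>smt (verit) real_norm_def\<close>)
    qed (use Ti in auto)
    then show ?thesis by simp
  qed
  have "AE \<omega> in M. norm (\<sigma> k \<omega>) \<le> T \<omega> + 1" for k
    using \<sigma>T2 by eventually_elim (simp add: \<sigma>0)
  then have \<sigma>lim: "(\<lambda>k. expectation (\<sigma> k)) \<longlonglongrightarrow> expectation T"
    using Ti \<sigma>T1 by (intro integral_dominated_convergence[where w="\<lambda>\<omega>. T \<omega> + 1"]) auto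
  \<comment> \<open>Fatou's lemma as the finer grid is refined.\<close>
  have close: "(\<integral>\<^sup>+ \<omega>. ennreal ((Y \<omega> - X k \<omega>)\<^sup>2) \<partial>M) \<le> ennreal (d k)" for k
  proof -
    have "(\<integral>\<^sup>+ \<omega>. ennreal ((Y \<omega> - X k \<omega>)\<^sup>2) \<partial>M) = (\<integral>\<^sup>+ \<omega>. liminf (\<lambda>j. ennreal ((X j \<omega> - X k \<omega>)\<^sup>2)) \<partial>M)"
    proof (rule nn_integral_cong_AE)
      show "AE \<omega> in M. ennreal ((Y \<omega> - X k \<omega>)\<^sup>2) = liminf (\<lambda>j. ennreal ((X j \<omega> - X k \<omega>)\<^sup>2))"
        using \<sigma>T(1) AE_space
      proof eventually_elim
        fix \<omega> assume l: "(\<lambda>k. \<sigma> k \<omega>) \<longlonglongrightarrow> T \<omega>" and \<omega>: "\<omega> \<in> space M"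
        have "(\<lambda>j. X j \<omega>) \<longlonglongrightarrow> Y \<omega>"
          unfolding X_def Y_def using l B_continuous[OF \<omega>]
          by (intro continuous_on_tendsto_right[of "\<lambda>t. B t \<omega>"]) (auto simp: T0 \<sigma>_def)
        then have "(\<lambda>j. ennreal ((X j \<omega> - X k \<omega>)\<^sup>2)) \<longlonglongrightarrow> ennreal ((Y \<omega> - X k \<omega>)\<^sup>2)"
          by (intro tendsto_ennrealI tendsto_intros)
        then show "ennreal ((Y \<omega> - X k \<omega>)\<^sup>2) = liminf (\<lambda>j. ennreal ((X j \<omega> - X k \<omega>)\<^sup>2))"
          using lim_imp_Liminf[OF trivial_limit_sequentially] by metis
      qed
    qed
    also have "\<dots> \<le> liminf (\<lambda>j. \<integral>\<^sup>+ \<omega>. ennreal ((X j \<omega> - X k \<omega>)\<^sup>2) \<partial>M)"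
      by (rule nn_integral_liminf) simp
    also have "\<dots> = liminf (\<lambda>j. ennreal (expectation (\<lambda>\<omega>. \<bar>\<sigma> j \<omega> - \<sigma> k \<omega>\<bar>)))"
      using L2(1) by (subst nn_integral_eq_integral) auto
    also have "\<dots> = ennreal (d k)"
    proof (intro lim_imp_Liminf tendsto_ennrealI)
      show "(\<lambda>j. expectation (\<lambda>\<omega>. \<bar>\<sigma> j \<omega> - \<sigma> k \<omega>\<bar>)) \<longlonglongrightarrow> d k" unfolding d_def
      proof (rule integral_dominated_convergence[where w="\<lambda>\<omega>. T \<omega> + 1 + \<sigma> k \<omega>"])
        show "AE \<omega> in M. (\<lambda>j. \<bar>\<sigma> j \<omega> - \<sigma> k \<omega>\<bar>) \<longlonglongrightarrow> \<bar>T \<omega> - \<sigma> k \<omega>\<bar>"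
          using \<sigma>T(1) by eventually_elim (auto intro!: tendsto_intros)
        show "AE \<omega> in M. norm \<bar>\<sigma> j \<omega> - \<sigma> k \<omega>\<bar> \<le> T \<omega> + 1 + \<sigma> k \<omega>" for j
          using \<sigma>T(2) by eventually_elim (use \<sigma>0 T0 in \<open>smt (verit) real_norm_def\<close>)
      qed (use Ti \<sigma>i in auto)
    qed simp
    finally show ?thesis .
  qed
  have dnn: "0 \<le> d k" for k unfolding d_def by (intro integral_nonneg_AE) simp
  have Ci: "integrable M (\<lambda>\<omega>. (Y \<omega> - X k \<omega>)\<^sup>2)" for k
  proof (intro integrableI_nonneg)
    show "(\<integral>\<^sup>+ \<omega>. ennreal ((Y \<omega> - X k \<omega>)\<^sup>2) \<partial>M) < \<infinity>" using close[of k] by (rule le_less_trans) simp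
  qed auto
  have Cd: "expectation (\<lambda>\<omega>. (Y \<omega> - X k \<omega>)\<^sup>2) \<le> d k" for k
    using close[of k] dnn[of k] by (subst (asm) nn_integral_eq_integral[OF Ci]) auto
  have Xi: "integrable M (\<lambda>\<omega>. (X k \<omega>)\<^sup>2)" and X0: "expectation (X k) = 0" and X2: "expectation (\<lambda>\<omega>. (X k \<omega>)\<^sup>2) = expectation (\<sigma> k)" for k
    using L2(2)[of k] by auto
  have sq: "(a + b)\<^sup>2 \<le> 2 * a\<^sup>2 + 2 * b\<^sup>2" for a b :: real
    using zero_le_power2[of "a - b"] by (simp add: power2_sum power2_diff)
  have sqX: "(Y \<omega>)\<^sup>2 \<le> 2 * (Y \<omega> - X k \<omega>)\<^sup>2 + 2 * (X k \<omega>)\<^sup>2" for \<omega> k using sq[of "Y \<omega> - X k \<omega>" "X k \<omega>"] by simp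
  have sqY: "(X k \<omega>)\<^sup>2 \<le> 2 * (Y \<omega>)\<^sup>2 + 2 * (Y \<omega> - X k \<omega>)\<^sup>2" for \<omega> k
    using sq[of "Y \<omega>" "X k \<omega> - Y \<omega>"] by (simp add: power2_commute)
  have Yi: "integrable M (\<lambda>\<omega>. (Y \<omega>)\<^sup>2)"
    proof (rule Bochner_Integration.integrable_bound[of _ "\<lambda>\<omega>. 2 * (Y \<omega> - X 0 \<omega>)\<^sup>2 + 2 * (X 0 \<omega>)\<^sup>2"])
      show "AE \<omega> in M. norm ((Y \<omega>)\<^sup>2) \<le> norm (2 * (Y \<omega> - X 0 \<omega>)\<^sup>2 + 2 * (X 0 \<omega>)\<^sup>2)"
        using sqX[of _ 0] by (intro AE_I2) simp
    qed (use Ci Xi in auto)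
  then show "integrable M (\<lambda>\<omega>. (B (T \<omega>) \<omega>)\<^sup>2)" by (simp add: Y_def)
  have "expectation T \<le> 2 * expectation (\<lambda>\<omega>. (Y \<omega>)\<^sup>2) + 2 * 0"
  proof (rule LIMSEQ_le[OF \<sigma>lim])
    show "(\<lambda>k. 2 * expectation (\<lambda>\<omega>. (Y \<omega>)\<^sup>2) + 2 * d k) \<longlonglongrightarrow> 2 * expectation (\<lambda>\<omega>. (Y \<omega>)\<^sup>2) + 2 * 0"
      by (intro tendsto_intros d0)
    have "expectation (\<sigma> k) \<le> 2 * expectation (\<lambda>\<omega>. (Y \<omega>)\<^sup>2) + 2 * d k" for k
    proof -
      have "expectation (\<lambda>\<omega>. (X k \<omega>)\<^sup>2) \<le> expectation (\<lambda>\<omega>. 2 * (Y \<omega>)\<^sup>2 + 2 * (Y \<omega> - X k \<omega>)\<^sup>2)"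
        using Yi Ci Xi sqY by (intro integral_mono) auto
      also have "\<dots> = 2 * expectation (\<lambda>\<omega>. (Y \<omega>)\<^sup>2) + 2 * expectation (\<lambda>\<omega>. (Y \<omega> - X k \<omega>)\<^sup>2)"
        using Yi Ci[of k] by simp
      finally show ?thesis using Cd[of k] X2[of k] by linarith
    qed
    then show "\<exists>N. \<forall>k\<ge>N. expectation (\<sigma> k) \<le> 2 * expectation (\<lambda>\<omega>. (Y \<omega>)\<^sup>2) + 2 * d k" by blast
  qed
  then show "expectation T \<le> 2 * expectation (\<lambda>\<omega>. (B (T \<omega>) \<omega>)\<^sup>2)" by (simp add: Y_def)
  have Y1: "integrable M Y" using Ym Yi by (rule square_integrable_imp_integrable)
  have X1: "integrable M (X k)" for k using Xm Xi by (rule square_integrable_imp_integrable)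
  \<comment> \<open>The grid values are centred and converge in \<open>L\<^sup>2\<close>.\<close>
  have "(expectation Y)\<^sup>2 \<le> d k" for k
  proof -
    have i1: "integrable M (\<lambda>\<omega>. Y \<omega> - X k \<omega>)" using Y1 X1 by simp
    have "expectation Y = expectation (\<lambda>\<omega>. Y \<omega> - X k \<omega>)" using Y1 X1 X0 by simp
    moreover have "0 \<le> variance (\<lambda>\<omega>. Y \<omega> - X k \<omega>)" by (rule variance_positive)
    ultimately show ?thesis using variance_eq[OF i1 Ci[of k]] Cd[of k] by simp
  qed
  then have "(expectation Y)\<^sup>2 \<le> 0" by (intro LIMSEQ_le_const[OF d0]) auto
  then show "expectation (\<lambda>\<omega>. B (T \<omega>) \<omega>) = 0" by (simp add: Y_def)
qed

end

section \<open>Classes of functions that are closed in mean\<close>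

text \<open>The layer-cake decomposition of a number in \<open>[0,1]\<close> into \<open>m\<close> levels.\<close>

lemma layer_approximation:
  fixes z :: real
  assumes "0 \<le> z" "z \<le> 1" "0 < m"
  shows "\<bar>z - (1 / real m) * (\<Sum>i<m. of_bool (real (Suc i) / real m \<le> z))\<bar> \<le> 1 / real m"
proof -
  let ?n = "nat \<lfloor>z * real m\<rfloor>"
  have n: "real ?n \<le> z * real m" "z * real m < real ?n + 1" using assms by (auto simp: of_nat_floor)
  have "z * real m \<le> 1 * real m" using assms by (intro mult_right_mono) auto
  then have nm: "?n \<le> m" using n by linarith
  have iff: "real (Suc i) / real m \<le> z \<longleftrightarrow> i < ?n" for i
  proof -
    have "real (Suc i) / real m \<le> z \<longleftrightarrow> real (Suc i) \<le> z * real m" using assms by (simp add: field_simps)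
    also have "\<dots> \<longleftrightarrow> i < ?n" using n by linarith
    finally show ?thesis .
  qed
  have "(\<Sum>i<m. of_bool (real (Suc i) / real m \<le> z)) = (\<Sum>i<?n. (1::real))"
    unfolding iff using nm by (intro sum.mono_neutral_cong_right) auto
  then have e: "(\<Sum>i<m. of_bool (real (Suc i) / real m \<le> z)) = real ?n" by simp
  have "z - (1 / real m) * real ?n = (z * real m - real ?n) / real m" using assms by (simp add: field_simps)
  then have "\<bar>z - (1 / real m) * real ?n\<bar> = \<bar>(z * real m - real ?n) / real m\<bar>" by (rule arg_cong)
  also have "\<dots> = (z * real m - real ?n) / real m"
    using n(1) by (intro abs_of_nonneg divide_nonneg_nonneg) linarith+
  also have "\<dots> \<le> 1 / real m" using n(2) by (intro divide_right_mono) linarith+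
  finally show ?thesis unfolding e .
qed

text \<open>A monotone class theorem in which monotone limits are replaced by limits in mean. Dynkin's
  lemma gives indicators of the generated sets, and layers give bounded functions.\<close>

lemma (in prob_space) L1_closed_class:
  fixes V :: "('a \<Rightarrow> real) \<Rightarrow> bool"
  assumes stable: "Int_stable \<G>" and \<G>: "\<G> \<subseteq> sets M"
    and integrable: "\<And>f. V f \<Longrightarrow> integrable M f"
    and one: "V (\<lambda>_. 1)"
    and add: "\<And>f g. V f \<Longrightarrow> V g \<Longrightarrow> V (\<lambda>\<omega>. f \<omega> + g \<omega>)"
    and cmult: "\<And>f c. V f \<Longrightarrow> V (\<lambda>\<omega>. c * f \<omega>)"
    and lim: "\<And>f C. f \<in> borel_measurable M \<Longrightarrow> (\<And>\<omega>. \<omega> \<in> space M \<Longrightarrow> \<bar>f \<omega>\<bar> \<le> C) \<Longrightarrow>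
      (\<And>e. 0 < e \<Longrightarrow> \<exists>g. V g \<and> expectation (\<lambda>\<omega>. \<bar>f \<omega> - g \<omega>\<bar>) < e) \<Longrightarrow> V f"
    and basic: "\<And>A. A \<in> \<G> \<Longrightarrow> V (indicator A)"
    and f: "f \<in> borel_measurable (sigma (space M) \<G>)" "\<And>\<omega>. \<omega> \<in> space M \<Longrightarrow> \<bar>f \<omega>\<bar> \<le> C"
  shows "V f"
proof -
  let ?N = "sigma (space M) \<G>"
  have G': "\<G> \<subseteq> Pow (space M)" using \<G> sets.sets_into_space by auto
  have NM: "sets ?N \<subseteq> sets M" using \<G> by (simp add: G' sets.sigma_sets_subset)
  have sum: "V (\<lambda>\<omega>. \<Sum>i<n. h i \<omega>)" if "\<And>i. i < n \<Longrightarrow> V (h i)" for n :: nat and h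
    using that
  proof (induction n)
    case 0
    have "V (\<lambda>\<omega>. 0 * 1)" by (rule cmult[OF one])
    then show ?case by simp
  next
    case (Suc n)
    then show ?case by (simp add: add)
  qed
  have lim_seq: "V f" if fm: "f \<in> borel_measurable M" and b: "\<And>\<omega>. \<omega> \<in> space M \<Longrightarrow> \<bar>f \<omega>\<bar> \<le> C"
    and g: "\<And>n. V (g n)" "(\<lambda>n. expectation (\<lambda>\<omega>. \<bar>f \<omega> - g n \<omega>\<bar>)) \<longlonglongrightarrow> 0" for f g C
  proof (rule lim[OF fm b])
    fix e :: real assume "0 < e"
    then have "\<forall>\<^sub>F n in sequentially. expectation (\<lambda>\<omega>. \<bar>f \<omega> - g n \<omega>\<bar>) < e"
      using g(2) by (simp add: order_tendsto_iff)
    then obtain n where "expectation (\<lambda>\<omega>. \<bar>f \<omega> - g n \<omega>\<bar>) < e" by (auto simp: eventually_sequentially)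
    then show "\<exists>g. V g \<and> expectation (\<lambda>\<omega>. \<bar>f \<omega> - g \<omega>\<bar>) < e" using g(1) by blast
  qed
  have sets: "V (indicator A)" if "A \<in> sigma_sets (space M) \<G>" for A
    using stable G' that
  proof (induction rule: sigma_sets_induct_disjoint)
    case (basic A)
    then show ?case by (rule assms(8))
  next
    case empty
    have "V (\<lambda>\<omega>. 0 * 1)" by (rule cmult[OF one])
    then show ?case by simp
  next
    case (compl A)
    then have v: "V (\<lambda>\<omega>. 1 + (-1) * indicator A \<omega>)" by (intro add one cmult)
    have Am: "A \<in> sets M" using compl(1) NM G' by auto
    show ?case
    proof (rule lim_seq)
      show "V (\<lambda>\<omega>. 1 + (-1) * indicator A \<omega>)" by (rule v)
      have "expectation (\<lambda>\<omega>. \<bar>indicator (space M - A) \<omega> - (1 + - 1 * indicator A \<omega>)\<bar>) = expectation (\<lambda>\<omega>. 0 :: real)"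
        by (intro Bochner_Integration.integral_cong) (auto simp: indicator_def)
      then show "(\<lambda>n. expectation (\<lambda>\<omega>. \<bar>indicator (space M - A) \<omega> - (1 + - 1 * indicator A \<omega>)\<bar>)) \<longlonglongrightarrow> (0::real)"
        by simp
      show "\<bar>indicator (space M - A) \<omega>\<bar> \<le> (1::real)" for \<omega> by (simp add: indicator_def)
      show "indicator (space M - A) \<in> borel_measurable M" using Am by simp
    qed
  next
    case (union A)
    have Am: "range A \<subseteq> sets M" using union(2) NM G' by auto
    then have Am': "A i \<in> sets M" for i by auto
    show ?case
    proof (rule lim_seq[of _ 1 "\<lambda>n \<omega>. \<Sum>i<n. indicator (A i) \<omega>"])
      have p: "(\<Sum>i<n. indicator (A i) \<omega>) = indicator (\<Union>i<n. A i) \<omega>" for n and \<omega> :: 'a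
        using union(1) by (intro indicator_UN_disjoint[symmetric]) (auto simp: disjoint_family_on_def)
      have "(\<lambda>n. expectation (\<lambda>\<omega>. \<bar>indicator (\<Union>(range A)) \<omega> - (\<Sum>i<n. indicator (A i) \<omega>)\<bar>)) \<longlonglongrightarrow> expectation (\<lambda>\<omega>. 0 :: real)"
      proof (rule integral_dominated_convergence[where w="\<lambda>_. 1"])
        show "AE \<omega> in M. (\<lambda>n. \<bar>indicator (\<Union>(range A)) \<omega> - (\<Sum>i<n. indicator (A i) \<omega>)\<bar>) \<longlonglongrightarrow> (0::real)"
        proof (intro AE_I2 tendsto_eventually)
          fix \<omega>
          show "\<forall>\<^sub>F n in sequentially. \<bar>indicator (\<Union>(range A)) \<omega> - (\<Sum>i<n. indicator (A i) \<omega>)\<bar> = (0::real)"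
          proof (cases "\<exists>i. \<omega> \<in> A i")
            case True
            then obtain i where i: "\<omega> \<in> A i" by auto
            show ?thesis using eventually_gt_at_top[of i]
            proof eventually_elim
              case (elim n)
              then have "\<omega> \<in> (\<Union>i<n. A i)" "\<omega> \<in> \<Union>(range A)" using i by auto
              then show ?case unfolding p by simp
            qed
          next
            case False
            then show ?thesis by (simp add: indicator_def)
          qed
        qed
        show "AE \<omega> in M. norm \<bar>(indicator (\<Union>(range A)) \<omega> :: real) - (\<Sum>i<n. indicator (A i) \<omega>)\<bar> \<le> (1::real)" for n
          unfolding p by (intro AE_I2) (auto simp: indicator_def)
      qed (use Am' in \<open>auto intro!: borel_measurable_abs borel_measurable_diff borel_measurable_sum borel_measurable_indicator\<close>)
      then show "(\<lambda>n. expectation (\<lambda>\<omega>. \<bar>indicator (\<Union>(range A)) \<omega> - (\<Sum>i<n. indicator (A i) \<omega>)\<bar>)) \<longlonglongrightarrow> (0::real)" by simp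
      show "V (\<lambda>\<omega>. \<Sum>i<n. indicator (A i) \<omega>)" for n using union(3) by (intro sum)
      show "\<bar>indicator (\<Union>(range A)) \<omega>\<bar> \<le> (1::real)" for \<omega> by (auto simp: indicator_def)
    qed (use Am' in \<open>auto intro!: borel_measurable_indicator\<close>)
  qed
  have unit: "V f" if fm: "f \<in> borel_measurable ?N" and b: "\<And>\<omega>. \<omega> \<in> space M \<Longrightarrow> 0 \<le> f \<omega> \<and> f \<omega> \<le> 1" for f
  proof (rule lim_seq)
    have fM: "f \<in> borel_measurable M" using fm NM by (intro measurable_from_subalg[of M ?N]) (auto simp: subalgebra_def G')
    then show "f \<in> borel_measurable M" .
    show "\<bar>f \<omega>\<bar> \<le> 1" if "\<omega> \<in> space M" for \<omega> using b[OF that] by auto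
    let ?A = "\<lambda>n i. {\<omega>\<in>space M. real (Suc i) / real (Suc n) \<le> f \<omega>}"
    let ?g = "\<lambda>n \<omega>. (1 / real (Suc n)) * (\<Sum>i<Suc n. indicator (?A n i) \<omega>)"
    show "V (?g n)" for n
    proof (intro cmult sum sets)
      fix i
      have "{\<omega>\<in>space ?N. real (Suc i) / real (Suc n) \<le> f \<omega>} \<in> sets ?N" using fm by measurable
      then show "?A n i \<in> sigma_sets (space M) \<G>" by (simp add: G' space_measure_of)
    qed
    have le: "\<bar>f \<omega> - ?g n \<omega>\<bar> \<le> 1 / real (Suc n)" if "\<omega> \<in> space M" for n \<omega>
    proof -
      have "indicator (?A n i) \<omega> = (of_bool (real (Suc i) / real (Suc n) \<le> f \<omega>) :: real)" for i
        using that by (simp add: indicator_def)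
      then show ?thesis using layer_approximation[of "f \<omega>" "Suc n"] b[OF that] by (simp only:)
    qed
    have A: "?A n i \<in> sets M" for n i using fM by measurable
    show "(\<lambda>n. expectation (\<lambda>\<omega>. \<bar>f \<omega> - ?g n \<omega>\<bar>)) \<longlonglongrightarrow> 0"
    proof (rule tendsto_sandwich[OF _ _ tendsto_const LIMSEQ_Suc[OF lim_1_over_n]])
      show "\<forall>\<^sub>F n in sequentially. 0 \<le> expectation (\<lambda>\<omega>. \<bar>f \<omega> - ?g n \<omega>\<bar>)" by (intro always_eventually allI integral_nonneg_AE) auto
      show "\<forall>\<^sub>F n in sequentially. expectation (\<lambda>\<omega>. \<bar>f \<omega> - ?g n \<omega>\<bar>) \<le> 1 / real (Suc n)"
      proof (intro always_eventually allI)
        fix n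
        have m: "(\<lambda>\<omega>. \<bar>f \<omega> - ?g n \<omega>\<bar>) \<in> borel_measurable M"
          using fM A by (intro borel_measurable_abs borel_measurable_diff borel_measurable_times borel_measurable_sum borel_measurable_indicator) auto
        have "expectation (\<lambda>\<omega>. \<bar>f \<omega> - ?g n \<omega>\<bar>) \<le> expectation (\<lambda>\<omega>. 1 / real (Suc n))"
          using m le[of _ n] by (intro integral_mono integrable_const_bound[of _ "1 / real (Suc n)"]) (auto simp del: of_nat_Suc)
        then show "expectation (\<lambda>\<omega>. \<bar>f \<omega> - ?g n \<omega>\<bar>) \<le> 1 / real (Suc n)" using prob_space by simp
      qed
    qed
  qed
  define D where "D = max 1 C"
  have D: "0 < D" "C \<le> D" by (auto simp: D_def)
  have "V (\<lambda>\<omega>. (f \<omega> + D) / (2 * D))"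
  proof (rule unit)
    show "(\<lambda>\<omega>. (f \<omega> + D) / (2 * D)) \<in> borel_measurable ?N" using f(1) by measurable
    show "0 \<le> (f \<omega> + D) / (2 * D) \<and> (f \<omega> + D) / (2 * D) \<le> 1" if "\<omega> \<in> space M" for \<omega>
      using f(2)[OF that] D by (auto simp: field_simps)
  qed
  then have "V (\<lambda>\<omega>. (2 * D) * ((f \<omega> + D) / (2 * D)) + (- D) * 1)" by (intro add cmult one)
  then show ?thesis using D by simp
qed

text \<open>A continuous substitute for the indicator of \<open>{..c}\<close>.\<close>

definition ramp :: "nat \<Rightarrow> real \<Rightarrow> real \<Rightarrow> real" where
  "ramp k c x = max 0 (min 1 (1 - real k * (x - c)))"

lemma ramp_bounds: "0 \<le> ramp k c x" "ramp k c x \<le> 1" "\<bar>ramp k c x\<bar> \<le> 1"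
  by (auto simp: ramp_def)

lemma continuous_on_ramp: "continuous_on A (ramp k c)"
  unfolding ramp_def by (intro continuous_intros)

lemma ramp_tendsto: "(\<lambda>k. ramp k c x) \<longlonglongrightarrow> of_bool (x \<le> c)"
proof (cases "x \<le> c")
  case True
  then have "ramp k c x = 1" for k by (simp add: ramp_def mult_nonneg_nonpos)
  then show ?thesis using True by simp
next
  case False
  obtain K where K: "1 / (x - c) < real K" using reals_Archimedean2 by blast
  have "\<forall>\<^sub>F k in sequentially. ramp k c x = 0"
    using eventually_ge_at_top[of K]
  proof eventually_elim
    case (elim k)
    then have "1 / (x - c) \<le> real k" using K by linarith
    then have "1 \<le> real k * (x - c)" using False by (simp add: field_simps)
    then show ?case by (simp add: ramp_def)
  qed
  then show ?thesis using False by (simp add: tendsto_eventually)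
qed

section \<open>The sigma-algebras of Brownian motion and of the randomisation\<close>

context brownian_basis
begin

text \<open>The randomisation \<open>U\<close> is treated as the value of the process at all negative times, so
  that a set of indices selects the sub-sigma-algebras with and without randomisation alike.\<close>

definition coord :: "real \<Rightarrow> 'a \<Rightarrow> real" where
  "coord t \<omega> = (if t < 0 then U \<omega> else B t \<omega>)"

lemma U_G: "U \<in> borel_measurable (G t)"
proof (rule measurable_G_mono)
  show "U \<in> borel_measurable (G 0)" using uniform by (simp add: independent_uniform_def)
qed simp

lemma U_M: "U \<in> borel_measurable M"
  using U_G[of 0] by (rule measurable_G_M)

lemma coord_G: "0 \<le> s \<Longrightarrow> t \<le> s \<Longrightarrow> coord t \<in> borel_measurable (Gt s)"
proof -
  assume "0 \<le> s" "t \<le> s"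
  then show ?thesis
    using U_G B_adapted[of t s] by (cases "t < 0") (auto simp: coord_def[abs_def])
qed

lemma coord_M: "coord t \<in> borel_measurable M"
  using coord_G[of "max 0 t" t] measurable_G_M by auto

text \<open>These sets form a generator that is stable under intersection, as the thresholds of a common
  coordinate can be replaced by their minimum.\<close>

definition cylinders :: "real set \<Rightarrow> 'a set set" where
  "cylinders I = {{\<omega>\<in>space M. \<forall>t\<in>J. coord t \<omega> \<le> c t} |J c. finite J \<and> J \<subseteq> I}"

lemma cylindersI:
  "finite J \<Longrightarrow> J \<subseteq> I \<Longrightarrow> A = {\<omega>\<in>space M. \<forall>t\<in>J. coord t \<omega> \<le> c t} \<Longrightarrow> A \<in> cylinders I"
  unfolding cylinders_def by (rule CollectI) (intro exI conjI)

definition info :: "real set \<Rightarrow> 'a measure" where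
  "info I = sigma (space M) (cylinders I)"

lemma cylinders_into_space: "cylinders I \<subseteq> Pow (space M)"
  by (auto simp: cylinders_def)

lemma space_info: "space (info I) = space M"
  by (simp add: info_def cylinders_into_space space_measure_of)

lemma sets_info: "sets (info I) = sigma_sets (space M) (cylinders I)"
  by (simp add: info_def cylinders_into_space)

lemma Int_stable_cylinders: "Int_stable (cylinders I)"
proof (rule Int_stableI)
  fix a b assume "a \<in> cylinders I" "b \<in> cylinders I"
  then obtain J c K d where a: "a = {\<omega>\<in>space M. \<forall>t\<in>J. coord t \<omega> \<le> c t}" "finite J" "J \<subseteq> I"
    and b: "b = {\<omega>\<in>space M. \<forall>t\<in>K. coord t \<omega> \<le> d t}" "finite K" "K \<subseteq> I"
    by (auto simp: cylinders_def)
  let ?e = "\<lambda>t. if t \<in> J \<inter> K then min (c t) (d t) else if t \<in> J then c t else d t"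
  have "a \<inter> b = {\<omega>\<in>space M. \<forall>t\<in>J \<union> K. coord t \<omega> \<le> ?e t}"
    unfolding a(1) b(1) by (auto split: if_splits)
  then show "a \<inter> b \<in> cylinders I" using a(2,3) b(2,3) by (intro cylindersI[of "J \<union> K"]) auto
qed

lemma cylinders_sets:
  assumes "\<And>t. t \<in> I \<Longrightarrow> coord t \<in> borel_measurable N" "space N = space M"
  shows "cylinders I \<subseteq> sets N"
proof
  fix A assume "A \<in> cylinders I"
  then obtain J c where A: "A = {\<omega>\<in>space M. \<forall>t\<in>J. coord t \<omega> \<le> c t}" "finite J" "J \<subseteq> I"
    by (auto simp: cylinders_def)
  have "{\<omega>\<in>space N. coord t \<omega> \<le> c t} \<in> sets N" if "t \<in> J" for t
  proof -
    have [measurable]: "coord t \<in> borel_measurable N" using A(3) that assms by auto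
    show ?thesis by measurable
  qed
  then have "{\<omega>\<in>space N. \<forall>t\<in>J. coord t \<omega> \<le> c t} \<in> sets N"
    using sets.sets_Collect_finite_All'[OF _ A(2), of N "\<lambda>t \<omega>. coord t \<omega> \<le> c t"] by (cases "J = {}") auto
  then show "A \<in> sets N" using A assms(2) by simp
qed

lemma sets_info_subset:
  assumes "\<And>t. t \<in> I \<Longrightarrow> coord t \<in> borel_measurable N" "space N = space M"
  shows "sets (info I) \<subseteq> sets N"
  using sets.sigma_sets_subset[OF cylinders_sets[OF assms]] assms(2) by (simp add: sets_info)

lemma subalgebra_info: "subalgebra M (info I)"
  using sets_info_subset[of I M] coord_M by (auto simp: subalgebra_def space_info)

lemma info_M: "f \<in> measurable (info I) N \<Longrightarrow> f \<in> measurable M N"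
  using measurable_from_subalg[OF subalgebra_info] .

lemma sets_info_G: "0 \<le> t \<Longrightarrow> I \<subseteq> {..t} \<Longrightarrow> sets (info I) \<subseteq> sets (Gt t)"
  by (rule sets_info_subset) (auto simp: space_F intro!: coord_G)

lemma info_G: "f \<in> measurable (info I) N \<Longrightarrow> 0 \<le> t \<Longrightarrow> I \<subseteq> {..t} \<Longrightarrow> f \<in> measurable (Gt t) N"
  by (rule measurable_from_subalg[of "Gt t" "info I"]) (auto simp: subalgebra_def space_F space_info dest: sets_info_G)

lemma coord_info: "t \<in> I \<Longrightarrow> coord t \<in> borel_measurable (info I)"
proof (rule borel_measurableI_le)
  fix c assume t: "t \<in> I"
  have "{\<omega> \<in> space M. coord t \<omega> \<le> c} = {\<omega>\<in>space M. \<forall>s\<in>{t}. coord s \<omega> \<le> (\<lambda>_. c) s}" by simp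
  also have "\<dots> \<in> cylinders I" using t by (intro cylindersI[of "{t}"]) auto
  finally show "{\<omega> \<in> space (info I). coord t \<omega> \<le> c} \<in> sets (info I)"
    by (auto simp: sets_info space_info)
qed

lemma sets_info_mono: "I \<subseteq> I' \<Longrightarrow> sets (info I) \<subseteq> sets (info I')"
  by (rule sets_info_subset) (auto simp: space_info intro: coord_info)

lemma info_mono: "f \<in> measurable (info I) N \<Longrightarrow> I \<subseteq> I' \<Longrightarrow> f \<in> measurable (info I') N"
  by (rule measurable_from_subalg[of "info I'" "info I"]) (auto simp: subalgebra_def space_info dest: sets_info_mono)

lemma B_info: "0 \<le> t \<Longrightarrow> t \<in> I \<Longrightarrow> B t \<in> borel_measurable (info I)"
  using coord_info[of t I] by (simp add: coord_def[abs_def])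

text \<open>Indicators of cylinder sets are limits in mean of products of ramps, so continuous cylinder
  functions suffice as a starting point.\<close>

lemma L1_closed_class_info:
  fixes V :: "('a \<Rightarrow> real) \<Rightarrow> bool"
  assumes integrable: "\<And>f. V f \<Longrightarrow> integrable M f"
    and add: "\<And>f g. V f \<Longrightarrow> V g \<Longrightarrow> V (\<lambda>\<omega>. f \<omega> + g \<omega>)"
    and cmult: "\<And>f c. V f \<Longrightarrow> V (\<lambda>\<omega>. c * f \<omega>)"
    and lim: "\<And>f C. f \<in> borel_measurable M \<Longrightarrow> (\<And>\<omega>. \<omega> \<in> space M \<Longrightarrow> \<bar>f \<omega>\<bar> \<le> C) \<Longrightarrow>
      (\<And>e. 0 < e \<Longrightarrow> \<exists>g. V g \<and> expectation (\<lambda>\<omega>. \<bar>f \<omega> - g \<omega>\<bar>) < e) \<Longrightarrow> V f"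
    and prod: "\<And>J c k. finite J \<Longrightarrow> J \<subseteq> I \<Longrightarrow> V (\<lambda>\<omega>. \<Prod>t\<in>J. ramp k (c t) (coord t \<omega>))"
    and f: "f \<in> borel_measurable (info I)" "\<And>\<omega>. \<omega> \<in> space M \<Longrightarrow> \<bar>f \<omega>\<bar> \<le> C"
  shows "V f"
proof (rule L1_closed_class[where V=V, OF Int_stable_cylinders _ integrable _ add cmult lim])
  show "cylinders I \<subseteq> sets M" by (rule cylinders_sets) (auto simp: coord_M)
  show "V (\<lambda>_. 1)" using prod[of "{}"] by simp
  show "f \<in> borel_measurable (sigma (space M) (cylinders I))" using f by (simp add: info_def)
  fix A assume A: "A \<in> cylinders I"
  then obtain J c where J: "A = {\<omega>\<in>space M. \<forall>t\<in>J. coord t \<omega> \<le> c t}" "finite J" "J \<subseteq> I"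
    by (auto simp: cylinders_def)
  have Am: "A \<in> sets M" using A cylinders_sets[of I M] coord_M by auto
  show "V (indicator A)"
  proof (rule lim[of _ 1])
    show "indicator A \<in> borel_measurable M" using Am by simp
    show "\<bar>indicator A \<omega>\<bar> \<le> (1::real)" for \<omega> by (auto simp: indicator_def)
    fix e :: real assume e: "0 < e"
    let ?g = "\<lambda>k \<omega>. \<Prod>t\<in>J. ramp k (c t) (coord t \<omega>)"
    have gb: "0 \<le> ?g k \<omega> \<and> ?g k \<omega> \<le> 1" for k \<omega>
      by (auto intro!: prod_nonneg prod_le_1 simp: ramp_bounds)
    have gm: "?g k \<in> borel_measurable M" for k
      by (intro borel_measurable_prod measurable_compose[OF coord_M] borel_measurable_continuous_onI continuous_on_ramp)
    have "(\<lambda>k. expectation (\<lambda>\<omega>. \<bar>indicator A \<omega> - ?g k \<omega>\<bar>)) \<longlonglongrightarrow> expectation (\<lambda>\<omega>. 0)"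
    proof (rule integral_dominated_convergence[where w="\<lambda>_. 1"])
      show "AE \<omega> in M. (\<lambda>k. \<bar>indicator A \<omega> - ?g k \<omega>\<bar>) \<longlonglongrightarrow> (0::real)"
      proof (intro AE_I2)
        fix \<omega> assume \<omega>: "\<omega> \<in> space M"
        have "(\<lambda>k. ?g k \<omega>) \<longlonglongrightarrow> (\<Prod>t\<in>J. of_bool (coord t \<omega> \<le> c t))" by (intro tendsto_prod ramp_tendsto)
        also have "(\<Prod>t\<in>J. of_bool (coord t \<omega> \<le> c t)) = (indicator A \<omega> :: real)"
        proof (cases "\<omega> \<in> A")
          case True
          then show ?thesis by (simp add: J(1))
        next
          case False
          then obtain t where t: "t \<in> J" "\<not> coord t \<omega> \<le> c t" using J(1) \<omega> by auto
          then have "(\<Prod>t\<in>J. of_bool (coord t \<omega> \<le> c t)) = (0::real)" using J(2) by (intro prod_zero) (auto intro!: bexI[of _ t])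
          then show ?thesis using False by simp
        qed
        finally show "(\<lambda>k. \<bar>indicator A \<omega> - ?g k \<omega>\<bar>) \<longlonglongrightarrow> (0::real)" by (intro tendsto_rabs_zero) (simp add: LIM_zero_iff LIM_zero_cancel tendsto_diff[OF tendsto_const, where a="indicator A \<omega>" and b="indicator A \<omega>", simplified])
      qed
      show "AE \<omega> in M. norm \<bar>indicator A \<omega> - ?g k \<omega>\<bar> \<le> (1::real)" for k
      proof (intro AE_I2)
        fix \<omega> show "norm \<bar>indicator A \<omega> - ?g k \<omega>\<bar> \<le> (1::real)" using gb[of k \<omega>] by (auto simp: indicator_def abs_if)
      qed
    qed (use Am gm in auto)
    then have "\<forall>\<^sub>F k in sequentially. expectation (\<lambda>\<omega>. \<bar>indicator A \<omega> - ?g k \<omega>\<bar>) < e"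
      using e by (simp add: order_tendsto_iff)
    then obtain k where "expectation (\<lambda>\<omega>. \<bar>indicator A \<omega> - ?g k \<omega>\<bar>) < e" by (auto simp: eventually_sequentially)
    then show "\<exists>g. V g \<and> expectation (\<lambda>\<omega>. \<bar>indicator A \<omega> - g \<omega>\<bar>) < e" using prod J by blast
  qed
qed (use f in auto)

section \<open>Continuous martingales closed by cylinder functions\<close>

text \<open>\<open>X\<close> is a bounded continuous version of the martingale of conditional expectations of \<open>Y\<close> with
  respect to the filtration of the basis, while its values are measurable for the possibly smaller
  sigma-algebras \<open>K t\<close>. The martingale property is stated by integration against bounded
  functions of the past, which avoids null sets.\<close>

definition closed_martingale :: "(real \<Rightarrow> 'a measure) \<Rightarrow> (real \<Rightarrow> 'a \<Rightarrow> real) \<Rightarrow> ('a \<Rightarrow> real) \<Rightarrow> bool" where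
  "closed_martingale K X Y \<longleftrightarrow>
    (\<forall>t\<ge>0. X t \<in> borel_measurable (K t)) \<and>
    (\<forall>\<omega>\<in>space M. continuous_on {0..} (\<lambda>t. X t \<omega>)) \<and>
    Y \<in> borel_measurable M \<and>
    (\<exists>C. \<forall>\<omega>\<in>space M. \<bar>Y \<omega>\<bar> \<le> C \<and> (\<forall>t\<ge>0. \<bar>X t \<omega>\<bar> \<le> C)) \<and>
    (\<forall>t\<ge>0. \<forall>Z D. Z \<in> borel_measurable (Gt t) \<longrightarrow> (\<forall>\<omega>\<in>space M. \<bar>Z \<omega>\<bar> \<le> D) \<longrightarrow>
      expectation (\<lambda>\<omega>. Z \<omega> * Y \<omega>) = expectation (\<lambda>\<omega>. Z \<omega> * X t \<omega>))"

abbreviation Binfo :: "real \<Rightarrow> 'a measure" where "Binfo t \<equiv> info {0..t}"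

lemma bounded_integrable:
  "f \<in> borel_measurable M \<Longrightarrow> (\<And>\<omega>. \<omega> \<in> space M \<Longrightarrow> \<bar>f \<omega>\<bar> \<le> C) \<Longrightarrow> integrable M (f :: 'a \<Rightarrow> real)"
  by (rule integrable_const_bound[of _ C]) auto

lemma closed_martingaleD:
  assumes "closed_martingale K X Y"
  shows "0 \<le> t \<Longrightarrow> X t \<in> borel_measurable (K t)"
    and "\<omega> \<in> space M \<Longrightarrow> continuous_on {0..} (\<lambda>t. X t \<omega>)"
    and "Y \<in> borel_measurable M"
    and "0 \<le> t \<Longrightarrow> Z \<in> borel_measurable (Gt t) \<Longrightarrow> (\<And>\<omega>. \<omega> \<in> space M \<Longrightarrow> \<bar>Z \<omega>\<bar> \<le> D) \<Longrightarrow>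
      expectation (\<lambda>\<omega>. Z \<omega> * Y \<omega>) = expectation (\<lambda>\<omega>. Z \<omega> * X t \<omega>)"
  using assms unfolding closed_martingale_def by blast+

lemma closed_martingale_bounded:
  assumes "closed_martingale K X Y"
  shows "\<exists>C. 0 \<le> C \<and> (\<forall>\<omega>\<in>space M. \<bar>Y \<omega>\<bar> \<le> C) \<and> (\<forall>\<omega>\<in>space M. \<forall>t\<ge>0. \<bar>X t \<omega>\<bar> \<le> C)"
proof -
  obtain C where C: "\<And>\<omega>. \<omega> \<in> space M \<Longrightarrow> \<bar>Y \<omega>\<bar> \<le> C \<and> (\<forall>t\<ge>0. \<bar>X t \<omega>\<bar> \<le> C)"
    using assms unfolding closed_martingale_def by blast
  have "\<bar>X t \<omega>\<bar> \<le> max 0 C" if "\<omega> \<in> space M" "0 \<le> t" for \<omega> t using C[OF that(1)] that(2) by force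
  moreover have "\<bar>Y \<omega>\<bar> \<le> max 0 C" if "\<omega> \<in> space M" for \<omega> using C[OF that] by auto
  ultimately show ?thesis by (intro exI[of _ "max 0 C"]) auto
qed

lemma closed_martingaleI:
  assumes "\<And>t. 0 \<le> t \<Longrightarrow> X t \<in> borel_measurable (K t)" "\<And>\<omega>. \<omega> \<in> space M \<Longrightarrow> continuous_on {0..} (\<lambda>t. X t \<omega>)"
    "Y \<in> borel_measurable M" "\<And>\<omega>. \<omega> \<in> space M \<Longrightarrow> \<bar>Y \<omega>\<bar> \<le> C" "\<And>\<omega> t. \<omega> \<in> space M \<Longrightarrow> 0 \<le> t \<Longrightarrow> \<bar>X t \<omega>\<bar> \<le> C"
    "\<And>t Z D. 0 \<le> t \<Longrightarrow> Z \<in> borel_measurable (Gt t) \<Longrightarrow> (\<And>\<omega>. \<omega> \<in> space M \<Longrightarrow> \<bar>Z \<omega>\<bar> \<le> D) \<Longrightarrow>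
      expectation (\<lambda>\<omega>. Z \<omega> * Y \<omega>) = expectation (\<lambda>\<omega>. Z \<omega> * X t \<omega>)"
  shows "closed_martingale K X Y"
proof -
  have "expectation (\<lambda>\<omega>. Z \<omega> * Y \<omega>) = expectation (\<lambda>\<omega>. Z \<omega> * X t \<omega>)"
    if "0 \<le> t" "Z \<in> borel_measurable (Gt t)" "\<forall>\<omega>\<in>space M. \<bar>Z \<omega>\<bar> \<le> D" for t Z D
    using that by (intro assms(6)[of t Z D]) auto
  then show ?thesis unfolding closed_martingale_def using assms(1-5) by blast
qed

lemma closed_martingale_const: "closed_martingale K (\<lambda>_ _. c) (\<lambda>_. c)"
  by (rule closed_martingaleI[of _ _ _ "\<bar>c\<bar>"]) auto

lemma bounded_mult_integrable:
  assumes "f \<in> borel_measurable M" "g \<in> borel_measurable M" "\<And>\<omega>. \<omega> \<in> space M \<Longrightarrow> \<bar>f \<omega>\<bar> \<le> C" "\<And>\<omega>. \<omega> \<in> space M \<Longrightarrow> \<bar>g \<omega>\<bar> \<le> D"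
  shows "integrable M (\<lambda>\<omega>. f \<omega> * g \<omega> :: real)"
proof (rule bounded_integrable)
  show "\<bar>f \<omega> * g \<omega>\<bar> \<le> C * D" if "\<omega> \<in> space M" for \<omega>
    using assms(3,4)[OF that] unfolding abs_mult by (intro mult_mono) auto
qed (use assms in auto)

lemma closed_martingale_lincomb:
  assumes X: "closed_martingale K X Y" and X': "closed_martingale K X' Y'" and K: "\<And>t. 0 \<le> t \<Longrightarrow> subalgebra M (K t)"
  shows "closed_martingale K (\<lambda>t \<omega>. a * X t \<omega> + b * X' t \<omega>) (\<lambda>\<omega>. a * Y \<omega> + b * Y' \<omega>)"
proof -
  obtain C where "0 \<le> C \<and> (\<forall>\<omega>\<in>space M. \<bar>Y \<omega>\<bar> \<le> C) \<and> (\<forall>\<omega>\<in>space M. \<forall>t\<ge>0. \<bar>X t \<omega>\<bar> \<le> C)"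
    using closed_martingale_bounded[OF X] ..
  note C = this[THEN conjunct1] this[THEN conjunct2, THEN conjunct1, rule_format] this[THEN conjunct2, THEN conjunct2, rule_format]
  obtain C' where "0 \<le> C' \<and> (\<forall>\<omega>\<in>space M. \<bar>Y' \<omega>\<bar> \<le> C') \<and> (\<forall>\<omega>\<in>space M. \<forall>t\<ge>0. \<bar>X' t \<omega>\<bar> \<le> C')"
    using closed_martingale_bounded[OF X'] ..
  note C' = this[THEN conjunct1] this[THEN conjunct2, THEN conjunct1, rule_format] this[THEN conjunct2, THEN conjunct2, rule_format]
  note D = closed_martingaleD[OF X] and D' = closed_martingaleD[OF X']
  have comb: "\<bar>a * x + b * y\<bar> \<le> \<bar>a\<bar> * C + \<bar>b\<bar> * C'" if "\<bar>x\<bar> \<le> C" "\<bar>y\<bar> \<le> C'" for x y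
  proof -
    have "\<bar>a * x + b * y\<bar> \<le> \<bar>a\<bar> * \<bar>x\<bar> + \<bar>b\<bar> * \<bar>y\<bar>" by (metis abs_mult abs_triangle_ineq)
    also have "\<dots> \<le> \<bar>a\<bar> * C + \<bar>b\<bar> * C'" using that by (intro add_mono mult_left_mono) auto
    finally show ?thesis .
  qed
  show ?thesis
  proof (rule closed_martingaleI[where C="\<bar>a\<bar> * C + \<bar>b\<bar> * C'"])
    fix t Z E assume t: "0 \<le> (t::real)" and Z: "Z \<in> borel_measurable (Gt t)" and E: "\<And>\<omega>. \<omega> \<in> space M \<Longrightarrow> \<bar>Z \<omega>\<bar> \<le> (E::real)"
    have ZM: "Z \<in> borel_measurable M" using Z by (rule measurable_G_M)
    have XM: "X t \<in> borel_measurable M" "X' t \<in> borel_measurable M"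
      using measurable_from_subalg[OF K[OF t] D(1)[OF t]] measurable_from_subalg[OF K[OF t] D'(1)[OF t]] .
    note i = bounded_mult_integrable[OF ZM D(3) E C(2)] bounded_mult_integrable[OF ZM D'(3) E C'(2)]
      bounded_mult_integrable[OF ZM XM(1) E C(3)[OF _ t]] bounded_mult_integrable[OF ZM XM(2) E C'(3)[OF _ t]]
    have "expectation (\<lambda>\<omega>. Z \<omega> * (a * Y \<omega> + b * Y' \<omega>)) = a * expectation (\<lambda>\<omega>. Z \<omega> * Y \<omega>) + b * expectation (\<lambda>\<omega>. Z \<omega> * Y' \<omega>)"
      using i by (simp add: distrib_left mult.left_commute)
    also have "\<dots> = a * expectation (\<lambda>\<omega>. Z \<omega> * X t \<omega>) + b * expectation (\<lambda>\<omega>. Z \<omega> * X' t \<omega>)"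
      using D(4)[OF t Z E] D'(4)[OF t Z E] by simp
    also have "\<dots> = expectation (\<lambda>\<omega>. Z \<omega> * (a * X t \<omega> + b * X' t \<omega>))"
      using i by (simp add: distrib_left mult.left_commute)
    finally show "expectation (\<lambda>\<omega>. Z \<omega> * (a * Y \<omega> + b * Y' \<omega>)) = expectation (\<lambda>\<omega>. Z \<omega> * (a * X t \<omega> + b * X' t \<omega>))" .
  qed (use D(1-3) D'(1-3) C C' comb in \<open>auto intro!: continuous_intros\<close>)
qed

text \<open>A factor known at time \<open>0\<close> can be absorbed into the test function; this adds the
  randomisation to martingales of the Brownian path.\<close>

lemma closed_martingale_times_initial:
  assumes X: "closed_martingale Binfo X Y" and V: "V \<in> borel_measurable (G 0)" "\<And>\<omega>. \<omega> \<in> space M \<Longrightarrow> \<bar>V \<omega>\<bar> \<le> D"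
  shows "closed_martingale Gt (\<lambda>t \<omega>. V \<omega> * X t \<omega>) (\<lambda>\<omega>. V \<omega> * Y \<omega>)"
proof -
  obtain C where "0 \<le> C \<and> (\<forall>\<omega>\<in>space M. \<bar>Y \<omega>\<bar> \<le> C) \<and> (\<forall>\<omega>\<in>space M. \<forall>t\<ge>0. \<bar>X t \<omega>\<bar> \<le> C)"
    using closed_martingale_bounded[OF X] ..
  note C = this[THEN conjunct1] this[THEN conjunct2, THEN conjunct1, rule_format] this[THEN conjunct2, THEN conjunct2, rule_format]
  note D = closed_martingaleD[OF X]
  have VG: "V \<in> borel_measurable (Gt t)" for t using V(1) by (rule measurable_G_mono) simp
  have VM: "V \<in> borel_measurable M" using V(1) by (rule measurable_G_M)
  show ?thesis
  proof (rule closed_martingaleI[where C="D * C"])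
    fix t Z E assume t: "0 \<le> (t::real)" and Z: "Z \<in> borel_measurable (Gt t)" and E: "\<And>\<omega>. \<omega> \<in> space M \<Longrightarrow> \<bar>Z \<omega>\<bar> \<le> (E::real)"
    have "\<bar>Z \<omega> * V \<omega>\<bar> \<le> E * D" if "\<omega> \<in> space M" for \<omega>
      using E[OF that] V(2)[OF that] unfolding abs_mult by (intro mult_mono) auto
    from D(4)[OF t _ this] show "expectation (\<lambda>\<omega>. Z \<omega> * (V \<omega> * Y \<omega>)) = expectation (\<lambda>\<omega>. Z \<omega> * (V \<omega> * X t \<omega>))"
      using Z VG by (simp add: mult.assoc)
  next
    fix t :: real assume t: "0 \<le> t"
    have "X t \<in> borel_measurable (Gt t)" using D(1)[OF t] t by (rule info_G) auto
    then show "(\<lambda>\<omega>. V \<omega> * X t \<omega>) \<in> borel_measurable (Gt t)" using VG by simp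
  next
    show "\<bar>V \<omega> * Y \<omega>\<bar> \<le> D * C" if "\<omega> \<in> space M" for \<omega>
      using C(2)[OF that] V(2)[OF that] unfolding abs_mult by (intro mult_mono) auto
    show "\<bar>V \<omega> * X t \<omega>\<bar> \<le> D * C" if "\<omega> \<in> space M" "0 \<le> t" for \<omega> t
      using C(3)[OF that] V(2)[OF that(1)] unfolding abs_mult by (intro mult_mono) auto
  qed (use D(2,3) VM in \<open>auto intro!: continuous_intros\<close>)
qed

lemma continuous_on_heat:
  assumes g: "continuous_on UNIV g" "\<And>x. \<bar>g x\<bar> \<le> D"
  shows "continuous_on UNIV (heat g r)"
  unfolding continuous_on_sequentially comp_def
  using heat_tendsto[OF g tendsto_const] by blast

text \<open>One backward step: between \<open>s\<close> and \<open>t\<close> the conditional expectation of \<open>g (B t)\<close> is given by the heat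
  semigroup, and before \<open>s\<close> by the martingale closed by the resulting function of \<open>B s\<close>.\<close>

lemma heat_step:
  assumes X': "closed_martingale Binfo X' (\<lambda>\<omega>. W \<omega> * heat g (t - s) (B s \<omega>))"
    and X's: "\<And>r \<omega>. s \<le> r \<Longrightarrow> \<omega> \<in> space M \<Longrightarrow> X' r \<omega> = W \<omega> * heat g (t - s) (B s \<omega>)"
    and W: "W \<in> borel_measurable (Binfo s)" "\<And>\<omega>. \<omega> \<in> space M \<Longrightarrow> \<bar>W \<omega>\<bar> \<le> C"
    and st: "0 \<le> s" "s < t" and g: "continuous_on UNIV g" "\<And>x. \<bar>g x\<bar> \<le> D"
  shows "\<exists>X. closed_martingale Binfo X (\<lambda>\<omega>. W \<omega> * g (B t \<omega>)) \<and>
    (\<forall>r\<ge>t. \<forall>\<omega>\<in>space M. X r \<omega> = W \<omega> * g (B t \<omega>))"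
proof -
  \<comment> \<open>After \<open>t\<close> the process is frozen; \<open>max\<close> and \<open>min\<close> keep the arguments in range.\<close>
  define X where "X = (\<lambda>r \<omega>. if r \<le> s then X' r \<omega> else W \<omega> * heat g (max 0 (t - r)) (B (min r t) \<omega>))"
  have gm[measurable]: "g \<in> borel_measurable borel" using g(1) by (rule borel_measurable_continuous_onI)
  have hm: "heat g r \<in> borel_measurable borel" for r by (rule borel_measurable_continuous_onI[OF continuous_on_heat[OF g]])
  have Wr: "W \<in> borel_measurable (Binfo r)" if "s \<le> r" for r using W(1) by (rule info_mono) (use that in auto)
  have WM: "W \<in> borel_measurable M" using W(1) by (rule info_M)
  have WG: "W \<in> borel_measurable (Gt r)" if "s \<le> r" for r using Wr[OF that] by (rule info_G) (use that st in auto)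
  obtain C' where "0 \<le> C' \<and> (\<forall>\<omega>\<in>space M. \<bar>W \<omega> * heat g (t - s) (B s \<omega>)\<bar> \<le> C') \<and> (\<forall>\<omega>\<in>space M. \<forall>r\<ge>0. \<bar>X' r \<omega>\<bar> \<le> C')"
    using closed_martingale_bounded[OF X'] ..
  note C' = this[THEN conjunct1] this[THEN conjunct2, THEN conjunct1, rule_format] this[THEN conjunct2, THEN conjunct2, rule_format]
  have late: "X r \<omega> = W \<omega> * g (B t \<omega>)" if "t \<le> r" for r \<omega> using that st by (simp add: X_def heat_0)
  have "closed_martingale Binfo X (\<lambda>\<omega>. W \<omega> * g (B t \<omega>))"
  proof (rule closed_martingaleI[where C="max C' (C * D)"])
    fix r :: real assume r: "0 \<le> r"
    show "X r \<in> borel_measurable (Binfo r)"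
    proof (cases "r \<le> s")
      case True
      then show ?thesis using closed_martingaleD(1)[OF X' r] by (simp add: X_def)
    next
      case False
      have "B (min r t) \<in> borel_measurable (Binfo r)" using r st by (intro B_info) auto
      then show ?thesis using False Wr[of r] measurable_compose[OF _ hm, of "B (min r t)" "Binfo r"]
        by (auto simp: X_def[abs_def])
    qed
  next
    fix \<omega> assume \<omega>: "\<omega> \<in> space M"
    show "continuous_on {0..} (\<lambda>r. X r \<omega>)"
      unfolding X_def
    proof (rule continuous_on_cases_le)
      show "continuous_on {r\<in>{0..}. r \<le> s} (\<lambda>r. X' r \<omega>)"
        using closed_martingaleD(2)[OF X' \<omega>] by (rule continuous_on_subset) auto
      show "continuous_on {r\<in>{0..}. s \<le> r} (\<lambda>r. W \<omega> * heat g (max 0 (t - r)) (B (min r t) \<omega>))"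
        unfolding continuous_on_sequentially comp_def
      proof (intro allI ballI impI)
        fix x :: "nat \<Rightarrow> real" and a assume a: "a \<in> {r\<in>{0..}. s \<le> r}" and x: "(\<forall>n. x n \<in> {r\<in>{0..}. s \<le> r}) \<and> x \<longlonglongrightarrow> a"
        have "(\<lambda>n. B (min (x n) t) \<omega>) \<longlonglongrightarrow> B (min a t) \<omega>"
          using a x st by (intro continuous_on_tendsto_right[OF B_continuous[OF \<omega>]] tendsto_intros) auto
        then show "(\<lambda>n. W \<omega> * heat g (max 0 (t - x n)) (B (min (x n) t) \<omega>)) \<longlonglongrightarrow> W \<omega> * heat g (max 0 (t - a)) (B (min a t) \<omega>)"
          using x by (intro tendsto_intros heat_tendsto[OF g]) auto
      qed
      show "continuous_on {0..} (\<lambda>r::real. r)" by (rule continuous_on_id)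
      fix r assume "r \<in> {0..}" "r = s"
      then show "X' r \<omega> = W \<omega> * heat g (max 0 (t - r)) (B (min r t) \<omega>)" using X's[of r \<omega>] \<omega> st by simp
    qed
  next
    show "(\<lambda>\<omega>. W \<omega> * g (B t \<omega>)) \<in> borel_measurable M"
      using WM B_measurable[of t] st by simp
    fix \<omega> assume \<omega>: "\<omega> \<in> space M"
    have D0: "0 \<le> D" using g(2)[of 0] by linarith
    have b: "\<bar>W \<omega> * y\<bar> \<le> C * D" if "\<bar>y\<bar> \<le> D" for y
      using W(2)[OF \<omega>] that unfolding abs_mult by (intro mult_mono) auto
    show "\<bar>W \<omega> * g (B t \<omega>)\<bar> \<le> max C' (C * D)" using b[OF g(2)] by (simp add: le_max_iff_disj)
    show "\<bar>X r \<omega>\<bar> \<le> max C' (C * D)" if "0 \<le> r" for r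
      using C'(3)[OF \<omega> that] b[OF abs_heat_le[OF g(2) gm]] by (simp add: X_def le_max_iff_disj)
  next
    fix r Z E assume r: "0 \<le> (r::real)" and Z: "Z \<in> borel_measurable (Gt r)" and E: "\<And>\<omega>. \<omega> \<in> space M \<Longrightarrow> \<bar>Z \<omega>\<bar> \<le> (E::real)"
    have ZW: "\<bar>Z \<omega> * W \<omega>\<bar> \<le> E * C" if "\<omega> \<in> space M" for \<omega>
      using E[OF that] W(2)[OF that] unfolding abs_mult by (intro mult_mono) auto
    consider "r \<le> s" | "s < r" "r \<le> t" | "t < r" by linarith
    then show "expectation (\<lambda>\<omega>. Z \<omega> * (W \<omega> * g (B t \<omega>))) = expectation (\<lambda>\<omega>. Z \<omega> * X r \<omega>)"
    proof cases
      case 1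
      have "Z \<in> borel_measurable (Gt s)" using Z ennreal_leI[OF 1] by (rule measurable_G_mono)
      then have "(\<lambda>\<omega>. Z \<omega> * W \<omega>) \<in> borel_measurable (Gt s)" using WG[of s] by simp
      from markov_property[OF _ _ this ZW g, of t] st
      have "expectation (\<lambda>\<omega>. Z \<omega> * W \<omega> * g (B t \<omega>)) = expectation (\<lambda>\<omega>. Z \<omega> * W \<omega> * heat g (t - s) (B s \<omega>))" by simp
      then show ?thesis using closed_martingaleD(4)[OF X' r Z E] 1 by (simp add: X_def mult.assoc)
    next
      case 2
      have "(\<lambda>\<omega>. Z \<omega> * W \<omega>) \<in> borel_measurable (Gt r)" using WG[of r] Z 2 by simp
      from markov_property[OF _ _ this ZW g, of t] 2 r
      show ?thesis by (simp add: X_def mult.assoc)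
    next
      case 3
      then show ?thesis by (simp add: late)
    qed
  qed
  then show ?thesis using late by blast
qed

text \<open>Induction on the last time: its factor is replaced, by the heat semigroup, with a factor at the
  preceding time. The second clause records that the martingale is constant after the last time,
  as \<open>heat_step\<close> requires.\<close>

lemma product_martingale:
  assumes "finite J" "J \<subseteq> {0..}" "\<And>t. t \<in> J \<Longrightarrow> continuous_on UNIV (g t)" "\<And>t x. t \<in> J \<Longrightarrow> \<bar>g t x\<bar> \<le> 1"
  shows "\<exists>X. closed_martingale Binfo X (\<lambda>\<omega>. \<Prod>t\<in>J. g t (B t \<omega>)) \<and>
    (\<forall>r\<ge>0. (\<forall>t\<in>J. t \<le> r) \<longrightarrow> (\<forall>\<omega>\<in>space M. X r \<omega> = (\<Prod>t\<in>J. g t (B t \<omega>))))"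
  using assms
proof (induction J arbitrary: g rule: finite_linorder_max_induct)
  case empty
  show ?case using closed_martingale_const[of Binfo 1] by auto
next
  case (insert b A)
  have b: "0 \<le> b" and A0: "A \<subseteq> {0..}" and bA: "b \<notin> A" using insert by auto
  have gb: "continuous_on UNIV (g b)" "\<And>x. \<bar>g b x\<bar> \<le> 1" using insert.prems by auto
  have gbm: "g b \<in> borel_measurable borel" using gb(1) by (rule borel_measurable_continuous_onI)
  let ?W = "\<lambda>\<omega>. \<Prod>t\<in>A. g t (B t \<omega>)"
  have prod: "(\<Prod>t\<in>insert b A. g t (B t \<omega>)) = ?W \<omega> * g b (B b \<omega>)" for \<omega>
    using insert.hyps(1) bA by (simp add: mult.commute)
  consider "b = 0" | "0 < b" "A = {}" | "A \<noteq> {}" using b by fastforce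
  then show ?case
  proof cases
    case 1
    then have "A = {}" using insert.hyps(2) A0 by fastforce
    have e: "(\<Prod>t\<in>insert b A. g t (B t \<omega>)) = g 0 0" if "\<omega> \<in> space M" for \<omega>
      using that 1 \<open>A = {}\<close> by (simp add: B_0)
    have "closed_martingale Binfo (\<lambda>_ _. g 0 0) (\<lambda>\<omega>. \<Prod>t\<in>insert b A. g t (B t \<omega>))"
    proof (rule closed_martingaleI[where C="\<bar>g 0 0\<bar>"])
      show "(\<lambda>\<omega>. \<Prod>t\<in>insert b A. g t (B t \<omega>)) \<in> borel_measurable M"
        using e by (subst measurable_cong[where g="\<lambda>_. g 0 0"]) auto
      show "expectation (\<lambda>\<omega>. Z \<omega> * (\<Prod>t\<in>insert b A. g t (B t \<omega>))) = expectation (\<lambda>\<omega>. Z \<omega> * g 0 0)" for Z :: "'a \<Rightarrow> real"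
        by (intro Bochner_Integration.integral_cong) (auto simp: e)
    qed (auto simp: e simp del: prod.insert)
    then show ?thesis using e by (intro exI[of _ "\<lambda>_ _. g 0 0"]) (auto simp del: prod.insert)
  next
    case 2
    let ?c = "heat (g b) (b - 0) 0"
    have "closed_martingale Binfo (\<lambda>_ _. ?c) (\<lambda>\<omega>. 1 * heat (g b) (b - 0) (B 0 \<omega>))"
    proof (rule closed_martingaleI[where C="\<bar>?c\<bar>"])
      show "(\<lambda>\<omega>. 1 * heat (g b) (b - 0) (B 0 \<omega>)) \<in> borel_measurable M"
        by (subst measurable_cong[where g="\<lambda>_. ?c"]) (auto simp: B_0)
      show "expectation (\<lambda>\<omega>. Z \<omega> * (1 * heat (g b) (b - 0) (B 0 \<omega>))) = expectation (\<lambda>\<omega>. Z \<omega> * ?c)" for Z :: "'a \<Rightarrow> real"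
        by (intro Bochner_Integration.integral_cong) (auto simp: B_0)
    qed (auto simp: B_0)
    from heat_step[OF this, where C=1 and D=1] 2 gb
    show ?thesis by (auto simp: B_0)
  next
    case 3
    define s where "s = Max A"
    have s: "s \<in> A" "\<And>a. a \<in> A \<Longrightarrow> a \<le> s" using 3 insert.hyps(1) by (auto simp: s_def)
    have sb: "0 \<le> s" "s < b" using s(1) A0 insert.hyps(2) by auto
    \<comment> \<open>The factor at the last time \<open>b\<close> is averaged and merged into the factor at \<open>s\<close>.\<close>
    define g' where "g' = g(s := \<lambda>x. g s x * heat (g b) (b - s) x)"
    have "\<exists>X. closed_martingale Binfo X (\<lambda>\<omega>. \<Prod>t\<in>A. g' t (B t \<omega>)) \<and>
      (\<forall>r\<ge>0. (\<forall>t\<in>A. t \<le> r) \<longrightarrow> (\<forall>\<omega>\<in>space M. X r \<omega> = (\<Prod>t\<in>A. g' t (B t \<omega>))))"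
    proof (rule insert.IH[OF A0])
      show "continuous_on UNIV (g' t)" if "t \<in> A" for t
        using that insert.prems(2) s(1) by (auto simp: g'_def intro!: continuous_intros continuous_on_heat[OF gb])
      show "\<bar>g' t x\<bar> \<le> 1" if "t \<in> A" for t x
        using that insert.prems(3) s(1) abs_heat_le[OF gb(2) gbm] by (auto simp: g'_def abs_mult intro!: mult_le_one)
    qed
    then obtain X' where X': "closed_martingale Binfo X' (\<lambda>\<omega>. \<Prod>t\<in>A. g' t (B t \<omega>))"
      and X'': "\<forall>r\<ge>0. (\<forall>t\<in>A. t \<le> r) \<longrightarrow> (\<forall>\<omega>\<in>space M. X' r \<omega> = (\<Prod>t\<in>A. g' t (B t \<omega>)))" by blast
    have X's: "X' r \<omega> = (\<Prod>t\<in>A. g' t (B t \<omega>))" if "s \<le> r" "\<omega> \<in> space M" for r \<omega>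
    proof -
      have "0 \<le> r" "\<forall>t\<in>A. t \<le> r" using s(2) sb(1) that(1) by force+
      then show ?thesis using X'' that(2) by blast
    qed
    have p': "(\<Prod>t\<in>A. g' t (B t \<omega>)) = ?W \<omega> * heat (g b) (b - s) (B s \<omega>)" for \<omega>
    proof -
      have A: "(\<Prod>t\<in>A. h t) = h s * (\<Prod>t\<in>A - {s}. h t)" for h :: "real \<Rightarrow> real"
        using insert.hyps(1) s(1) by (rule prod.remove)
      have "(\<Prod>t\<in>A - {s}. g' t (B t \<omega>)) = (\<Prod>t\<in>A - {s}. g t (B t \<omega>))" by (intro prod.cong) (auto simp: g'_def)
      then show ?thesis unfolding A[of "\<lambda>t. g' t (B t \<omega>)"] A[of "\<lambda>t. g t (B t \<omega>)"] by (simp add: g'_def)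
    qed
    have "\<exists>X. closed_martingale Binfo X (\<lambda>\<omega>. ?W \<omega> * g b (B b \<omega>)) \<and> (\<forall>r\<ge>b. \<forall>\<omega>\<in>space M. X r \<omega> = ?W \<omega> * g b (B b \<omega>))"
    proof (rule heat_step[where s=s and C=1 and D=1])
      show "closed_martingale Binfo X' (\<lambda>\<omega>. ?W \<omega> * heat (g b) (b - s) (B s \<omega>))" using X' unfolding p' .
      show "X' r \<omega> = ?W \<omega> * heat (g b) (b - s) (B s \<omega>)" if "s \<le> r" "\<omega> \<in> space M" for r \<omega> using X's[OF that] unfolding p' .
      show "?W \<in> borel_measurable (Binfo s)"
      proof (rule borel_measurable_prod)
        fix t assume t: "t \<in> A"
        have "g t \<in> borel_measurable borel" using insert.prems(2) t by (intro borel_measurable_continuous_onI) auto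
        moreover have "B t \<in> borel_measurable (Binfo s)" using t A0 s(2) by (intro B_info) auto
        ultimately show "(\<lambda>\<omega>. g t (B t \<omega>)) \<in> borel_measurable (Binfo s)" by simp
      qed
      show "\<bar>?W \<omega>\<bar> \<le> 1" for \<omega> using insert.prems(3) by (auto simp: abs_prod intro!: prod_le_1)
    qed (use sb gb in auto)
    then show ?thesis unfolding prod by auto
  qed
qed

lemma subalgebra_Gt: "subalgebra M (Gt t)" by (rule subalgebra_basis)

lemma cylinder_martingale:
  assumes "finite J"
  shows "\<exists>X. closed_martingale Gt X (\<lambda>\<omega>. \<Prod>t\<in>J. ramp k (c t) (coord t \<omega>))"
proof -
  let ?J = "{t\<in>J. 0 \<le> t}" and ?J' = "{t\<in>J. t < 0}"
  let ?V = "\<lambda>\<omega>. \<Prod>t\<in>?J'. ramp k (c t) (U \<omega>)"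
  obtain X where X: "closed_martingale Binfo X (\<lambda>\<omega>. \<Prod>t\<in>?J. ramp k (c t) (B t \<omega>))"
    using product_martingale[of ?J "\<lambda>t. ramp k (c t)"] assms by (auto simp: continuous_on_ramp ramp_bounds)
  have "ramp k x \<in> borel_measurable borel" for x by (intro borel_measurable_continuous_onI continuous_on_ramp)
  then have V: "?V \<in> borel_measurable (G 0)" using U_G by (intro borel_measurable_prod measurable_compose[OF U_G])
  have "closed_martingale Gt (\<lambda>t \<omega>. ?V \<omega> * X t \<omega>) (\<lambda>\<omega>. ?V \<omega> * (\<Prod>t\<in>?J. ramp k (c t) (B t \<omega>)))"
    by (rule closed_martingale_times_initial[OF X V, of 1]) (auto simp: abs_prod ramp_bounds intro!: prod_le_1)
  moreover have "?V \<omega> * (\<Prod>t\<in>?J. ramp k (c t) (B t \<omega>)) = (\<Prod>t\<in>J. ramp k (c t) (coord t \<omega>))" for \<omega>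
  proof -
    have "?V \<omega> * (\<Prod>t\<in>?J. ramp k (c t) (B t \<omega>)) = (\<Prod>t\<in>?J'. ramp k (c t) (coord t \<omega>)) * (\<Prod>t\<in>?J. ramp k (c t) (coord t \<omega>))"
      by (intro arg_cong2[where f="(*)"] prod.cong) (auto simp: coord_def)
    also have "\<dots> = (\<Prod>t\<in>?J' \<union> ?J. ramp k (c t) (coord t \<omega>))" using assms by (intro prod.union_disjoint[symmetric]) auto
    also have "?J' \<union> ?J = J" by auto
    finally show ?thesis .
  qed
  ultimately show ?thesis by auto
qed

text \<open>The functions that can be approximated in mean by closing variables of continuous martingales
  form a class closed in mean that contains the continuous cylinder functions.\<close>

lemma closed_martingale_dense:
  assumes f: "f \<in> borel_measurable (info UNIV)" "\<And>\<omega>. \<omega> \<in> space M \<Longrightarrow> \<bar>f \<omega>\<bar> \<le> C" and e: "0 < e"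
  shows "\<exists>X Y. closed_martingale Gt X Y \<and> expectation (\<lambda>\<omega>. \<bar>f \<omega> - Y \<omega>\<bar>) < e"
proof -
  define V where "V f \<longleftrightarrow> integrable M f \<and>
    (\<forall>e>0. \<exists>X Y. closed_martingale Gt X Y \<and> expectation (\<lambda>\<omega>. \<bar>f \<omega> - Y \<omega>\<bar>) < e)" for f
  have Yi: "integrable M Y" if "closed_martingale Gt X Y" for X Y
    using closed_martingale_bounded[OF that] bounded_integrable[OF closed_martingaleD(3)[OF that]] by auto
  have "V f"
  proof (rule L1_closed_class_info[where I=UNIV])
    show "V (\<lambda>\<omega>. f \<omega> + g \<omega>)" if f: "V f" and g: "V g" for f g
      unfolding V_def
    proof (intro conjI allI impI)
      show "integrable M (\<lambda>\<omega>. f \<omega> + g \<omega>)" using f g by (simp add: V_def)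
      fix e :: real assume "0 < e"
      then have e2: "0 < e / 2" by simp
      obtain X Y X' Y' where X: "closed_martingale Gt X Y" "expectation (\<lambda>\<omega>. \<bar>f \<omega> - Y \<omega>\<bar>) < e / 2"
        and X': "closed_martingale Gt X' Y'" "expectation (\<lambda>\<omega>. \<bar>g \<omega> - Y' \<omega>\<bar>) < e / 2"
        using f g e2 unfolding V_def by meson
      have "closed_martingale Gt (\<lambda>t \<omega>. 1 * X t \<omega> + 1 * X' t \<omega>) (\<lambda>\<omega>. 1 * Y \<omega> + 1 * Y' \<omega>)"
        by (rule closed_martingale_lincomb[OF X(1) X'(1) subalgebra_Gt])
      moreover have "expectation (\<lambda>\<omega>. \<bar>f \<omega> + g \<omega> - (1 * Y \<omega> + 1 * Y' \<omega>)\<bar>) \<le> expectation (\<lambda>\<omega>. \<bar>f \<omega> - Y \<omega>\<bar> + \<bar>g \<omega> - Y' \<omega>\<bar>)"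
        using f g Yi[OF X(1)] Yi[OF X'(1)] by (intro integral_mono) (auto simp: V_def)
      moreover have "expectation (\<lambda>\<omega>. \<bar>f \<omega> - Y \<omega>\<bar> + \<bar>g \<omega> - Y' \<omega>\<bar>) = expectation (\<lambda>\<omega>. \<bar>f \<omega> - Y \<omega>\<bar>) + expectation (\<lambda>\<omega>. \<bar>g \<omega> - Y' \<omega>\<bar>)"
        using f g Yi[OF X(1)] Yi[OF X'(1)] by (intro Bochner_Integration.integral_add) (auto simp: V_def)
      ultimately show "\<exists>X Y. closed_martingale Gt X Y \<and> expectation (\<lambda>\<omega>. \<bar>f \<omega> + g \<omega> - Y \<omega>\<bar>) < e"
        using X(2) X'(2) by (intro exI conjI) (assumption, linarith)
    qed
    show "V (\<lambda>\<omega>. c * f \<omega>)" if f: "V f" for f c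
      unfolding V_def
    proof (intro conjI allI impI)
      show "integrable M (\<lambda>\<omega>. c * f \<omega>)" using f by (simp add: V_def)
      fix e :: real assume e: "0 < e"
      then have e2: "0 < e / (\<bar>c\<bar> + 1)" by (simp add: divide_pos_pos add_nonneg_pos)
      obtain X Y where X: "closed_martingale Gt X Y" "expectation (\<lambda>\<omega>. \<bar>f \<omega> - Y \<omega>\<bar>) < e / (\<bar>c\<bar> + 1)"
        using f e2 unfolding V_def by meson
      have "closed_martingale Gt (\<lambda>t \<omega>. c * X t \<omega> + 0 * X t \<omega>) (\<lambda>\<omega>. c * Y \<omega> + 0 * Y \<omega>)"
        by (rule closed_martingale_lincomb[OF X(1) X(1) subalgebra_Gt])
      then have "closed_martingale Gt (\<lambda>t \<omega>. c * X t \<omega>) (\<lambda>\<omega>. c * Y \<omega>)" by simp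
      moreover have "expectation (\<lambda>\<omega>. \<bar>c * f \<omega> - c * Y \<omega>\<bar>) < e"
      proof -
        have "expectation (\<lambda>\<omega>. \<bar>c * f \<omega> - c * Y \<omega>\<bar>) = \<bar>c\<bar> * expectation (\<lambda>\<omega>. \<bar>f \<omega> - Y \<omega>\<bar>)"
          by (simp add: abs_mult flip: right_diff_distrib)
        also have "\<dots> \<le> \<bar>c\<bar> * (e / (\<bar>c\<bar> + 1))" using X(2) by (intro mult_left_mono) auto
        also have "\<dots> < e" using e by (simp add: field_simps)
        finally show ?thesis .
      qed
      ultimately show "\<exists>X Y. closed_martingale Gt X Y \<and> expectation (\<lambda>\<omega>. \<bar>c * f \<omega> - Y \<omega>\<bar>) < e" by blast
    qed
    show "V f" if fm: "f \<in> borel_measurable M" and b: "\<And>\<omega>. \<omega> \<in> space M \<Longrightarrow> \<bar>f \<omega>\<bar> \<le> C"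
      and g: "\<And>e. 0 < e \<Longrightarrow> \<exists>g. V g \<and> expectation (\<lambda>\<omega>. \<bar>f \<omega> - g \<omega>\<bar>) < e" for f C
      unfolding V_def
    proof (intro conjI allI impI)
      show fi: "integrable M f" using fm b by (rule bounded_integrable)
      fix e :: real assume "0 < e"
      then have e2: "0 < e / 2" by simp
      from g[OF e2] obtain h where h: "V h" "expectation (\<lambda>\<omega>. \<bar>f \<omega> - h \<omega>\<bar>) < e / 2" by blast
      obtain X Y where X: "closed_martingale Gt X Y" "expectation (\<lambda>\<omega>. \<bar>h \<omega> - Y \<omega>\<bar>) < e / 2"
        using h(1) e2 unfolding V_def by meson
      have hi: "integrable M h" using h(1) by (simp add: V_def)
      have "expectation (\<lambda>\<omega>. \<bar>f \<omega> - Y \<omega>\<bar>) \<le> expectation (\<lambda>\<omega>. \<bar>f \<omega> - h \<omega>\<bar> + \<bar>h \<omega> - Y \<omega>\<bar>)"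
        using fi hi Yi[OF X(1)] by (intro integral_mono) auto
      also have "\<dots> = expectation (\<lambda>\<omega>. \<bar>f \<omega> - h \<omega>\<bar>) + expectation (\<lambda>\<omega>. \<bar>h \<omega> - Y \<omega>\<bar>)"
        using fi hi Yi[OF X(1)] by (intro Bochner_Integration.integral_add) auto
      finally show "\<exists>X Y. closed_martingale Gt X Y \<and> expectation (\<lambda>\<omega>. \<bar>f \<omega> - Y \<omega>\<bar>) < e"
        using X h(2) by (intro exI conjI) (assumption, linarith)
    qed
    show "V (\<lambda>\<omega>. \<Prod>t\<in>J. ramp k (c t) (coord t \<omega>))" if fJ: "finite J" for J c k
    proof -
      obtain X where X: "closed_martingale Gt X (\<lambda>\<omega>. \<Prod>t\<in>J. ramp k (c t) (coord t \<omega>))"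
        using cylinder_martingale[OF fJ, of k c] by blast
      show ?thesis unfolding V_def
      proof (intro conjI allI impI)
        fix e :: real assume "0 < e"
        with X show "\<exists>X Y. closed_martingale Gt X Y \<and>
          expectation (\<lambda>\<omega>. \<bar>(\<Prod>t\<in>J. ramp k (c t) (coord t \<omega>)) - Y \<omega>\<bar>) < e" by (intro exI conjI) (assumption, simp)
      qed (rule Yi[OF X])
    qed
  qed (use f in \<open>auto simp: V_def\<close>)
  then show ?thesis using e by (simp add: V_def)
qed

text \<open>Doob's maximal inequality. On a finite set of times the event splits according to the
  first time at which the level is exceeded.\<close>

lemma maximal_inequality_finite:
  assumes X: "closed_martingale Gt X Y" and J: "finite J" "J \<subseteq> {0..}" and l: "0 < l"
  shows "l * prob {\<omega>\<in>space M. \<exists>t\<in>J. l < \<bar>X t \<omega>\<bar>} \<le> expectation (\<lambda>\<omega>. \<bar>Y \<omega>\<bar>)"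
proof -
  note D = closed_martingaleD[OF X]
  obtain C where "0 \<le> C \<and> (\<forall>\<omega>\<in>space M. \<bar>Y \<omega>\<bar> \<le> C) \<and> (\<forall>\<omega>\<in>space M. \<forall>t\<ge>0. \<bar>X t \<omega>\<bar> \<le> C)"
    using closed_martingale_bounded[OF X] ..
  note C = this[THEN conjunct1] this[THEN conjunct2, THEN conjunct1, rule_format] this[THEN conjunct2, THEN conjunct2, rule_format]
  have XG: "X s \<in> borel_measurable (Gt t)" if "s \<in> J" "s \<le> t" for s t
  proof (rule measurable_G_mono)
    show "X s \<in> borel_measurable (Gt s)" using that J(2) by (intro D(1)) auto
  qed (use that in \<open>simp add: ennreal_leI\<close>)
  have XM: "X s \<in> borel_measurable M" if "s \<in> J" for s using XG[OF that order_refl] by (rule measurable_G_M)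
  \<comment> \<open>The event that \<open>t\<close> is the first time above the level.\<close>
  define E where "E t = {\<omega>\<in>space M. l < \<bar>X t \<omega>\<bar> \<and> (\<forall>s\<in>{s\<in>J. s < t}. \<bar>X s \<omega>\<bar> \<le> l)}" for t
  have EG: "E t \<in> sets (Gt t)" if t: "t \<in> J" for t
  proof -
    have "{\<omega>\<in>space (Gt t). \<bar>X s \<omega>\<bar> \<le> l} \<in> sets (Gt t)" if "s \<in> {s\<in>J. s < t}" for s
    proof -
      have [measurable]: "X s \<in> borel_measurable (Gt t)" using that by (intro XG) auto
      show ?thesis by measurable
    qed
    then have "{\<omega>\<in>space (Gt t). \<forall>s\<in>{s\<in>J. s < t}. \<bar>X s \<omega>\<bar> \<le> l} \<in> sets (Gt t)"
      using J(1) by (intro sets.sets_Collect_finite_All) auto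
    moreover have "{\<omega>\<in>space (Gt t). l < \<bar>X t \<omega>\<bar>} \<in> sets (Gt t)"
    proof -
      have [measurable]: "X t \<in> borel_measurable (Gt t)" using t by (intro XG) auto
      show ?thesis by measurable
    qed
    ultimately have "{\<omega>\<in>space (Gt t). l < \<bar>X t \<omega>\<bar>} \<inter> {\<omega>\<in>space (Gt t). \<forall>s\<in>{s\<in>J. s < t}. \<bar>X s \<omega>\<bar> \<le> l} \<in> sets (Gt t)" by (rule sets.Int[rotated])
    also have "{\<omega>\<in>space (Gt t). l < \<bar>X t \<omega>\<bar>} \<inter> {\<omega>\<in>space (Gt t). \<forall>s\<in>{s\<in>J. s < t}. \<bar>X s \<omega>\<bar> \<le> l} = E t"
      unfolding E_def space_F by blast
    finally show ?thesis .
  qed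
  then have EM: "E t \<in> sets M" if "t \<in> J" for t using that sets_G_subset by blast
  have disj: "disjoint_family_on E J"
    unfolding disjoint_family_on_def
  proof (intro ballI impI)
    fix s t assume "s \<in> J" "t \<in> J" "s \<noteq> t"
    then show "E s \<inter> E t = {}" by (cases s t rule: linorder_cases) (force simp: E_def)+
  qed
  have union: "{\<omega>\<in>space M. \<exists>t\<in>J. l < \<bar>X t \<omega>\<bar>} = (\<Union>t\<in>J. E t)"
  proof (intro set_eqI iffI)
    fix \<omega> assume "\<omega> \<in> {\<omega>\<in>space M. \<exists>t\<in>J. l < \<bar>X t \<omega>\<bar>}"
    then have \<omega>: "\<omega> \<in> space M" and ne: "{t\<in>J. l < \<bar>X t \<omega>\<bar>} \<noteq> {}" by auto
    let ?t = "Min {t\<in>J. l < \<bar>X t \<omega>\<bar>}"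
    have "?t \<in> {t\<in>J. l < \<bar>X t \<omega>\<bar>}" using J(1) ne by (intro Min_in) auto
    moreover have "\<bar>X s \<omega>\<bar> \<le> l" if "s \<in> J" "s < ?t" for s
      using Min_le[of "{t\<in>J. l < \<bar>X t \<omega>\<bar>}" s] J(1) that by fastforce
    ultimately show "\<omega> \<in> (\<Union>t\<in>J. E t)" using \<omega> by (auto simp: E_def)
  qed (auto simp: E_def)
  have part: "l * prob (E t) \<le> expectation (\<lambda>\<omega>. indicator (E t) \<omega> * \<bar>Y \<omega>\<bar>)" if t: "t \<in> J" for t
  proof -
    have t0: "0 \<le> t" using t J by auto
    \<comment> \<open>The sign replaces \<open>\<bar>X t\<bar>\<close> by a product with \<open>X t\<close>, to which the martingale property applies.\<close>
    let ?Z = "\<lambda>\<omega>. indicator (E t) \<omega> * sgn (X t \<omega>)"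
    have XGt[measurable]: "X t \<in> borel_measurable (Gt t)" using t by (intro XG) auto
    have Z: "?Z \<in> borel_measurable (Gt t)" using EG[OF t] by simp
    have Zb: "\<bar>?Z \<omega>\<bar> \<le> 1" for \<omega> by (auto simp: indicator_def sgn_if)
    have i1: "integrable M (\<lambda>\<omega>. ?Z \<omega> * X t \<omega>)"
      by (rule bounded_mult_integrable[OF measurable_G_M[OF Z] XM[OF t] Zb C(3)[OF _ t0]])
    have i2: "integrable M (\<lambda>\<omega>. ?Z \<omega> * Y \<omega>)"
      by (rule bounded_mult_integrable[OF measurable_G_M[OF Z] D(3) Zb C(2)])
    have i3: "integrable M (\<lambda>\<omega>. indicator (E t) \<omega> * \<bar>Y \<omega>\<bar>)"
      by (rule bounded_mult_integrable[where C=1 and D=C]) (use EM[OF t] D(3) C in \<open>auto simp: indicator_def\<close>)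
    have "l * prob (E t) = expectation (\<lambda>\<omega>. l * indicator (E t) \<omega>)" using EM[OF t] by simp
    also have "\<dots> \<le> expectation (\<lambda>\<omega>. ?Z \<omega> * X t \<omega>)"
    proof (rule integral_mono[OF _ i1])
      show "integrable M (\<lambda>\<omega>. l * indicator (E t) \<omega>)" using EM[OF t] by (simp add: emeasure_eq_measure)
    qed (auto simp: indicator_def E_def sgn_if)
    also have "\<dots> = expectation (\<lambda>\<omega>. ?Z \<omega> * Y \<omega>)" using D(4)[OF t0 Z Zb] by simp
    also have "\<dots> \<le> expectation (\<lambda>\<omega>. indicator (E t) \<omega> * \<bar>Y \<omega>\<bar>)"
      by (rule integral_mono[OF i2 i3]) (auto simp: indicator_def sgn_if)
    finally show ?thesis .
  qed
  have i3: "integrable M (\<lambda>\<omega>. indicator (E t) \<omega> * \<bar>Y \<omega>\<bar>)" if "t \<in> J" for t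
    by (rule bounded_mult_integrable[where C=1 and D=C]) (use EM[OF that] D(3) C in \<open>auto simp: indicator_def\<close>)
  have "l * prob {\<omega>\<in>space M. \<exists>t\<in>J. l < \<bar>X t \<omega>\<bar>} = (\<Sum>t\<in>J. l * prob (E t))"
    unfolding union using J(1) disj EM by (subst finite_measure_finite_Union) (auto simp: sum_distrib_left)
  also have "\<dots> \<le> (\<Sum>t\<in>J. expectation (\<lambda>\<omega>. indicator (E t) \<omega> * \<bar>Y \<omega>\<bar>))" by (intro sum_mono part)
  also have "\<dots> = expectation (\<lambda>\<omega>. \<Sum>t\<in>J. indicator (E t) \<omega> * \<bar>Y \<omega>\<bar>)" using i3 by simp
  also have "\<dots> \<le> expectation (\<lambda>\<omega>. \<bar>Y \<omega>\<bar>)"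
  proof (intro integral_mono)
    show "integrable M (\<lambda>\<omega>. \<Sum>t\<in>J. indicator (E t) \<omega> * \<bar>Y \<omega>\<bar>)" using i3 by simp
    show "integrable M (\<lambda>\<omega>. \<bar>Y \<omega>\<bar>)" using bounded_integrable[OF D(3) C(2)] by simp
    fix \<omega>
    have "(\<Sum>t\<in>J. indicator (E t) \<omega> * \<bar>Y \<omega>\<bar>) = indicator (\<Union>t\<in>J. E t) \<omega> * \<bar>Y \<omega>\<bar>"
      using J(1) disj by (subst indicator_UN_disjoint) (auto simp: sum_distrib_right)
    then show "(\<Sum>t\<in>J. indicator (E t) \<omega> * \<bar>Y \<omega>\<bar>) \<le> \<bar>Y \<omega>\<bar>" by (simp add: indicator_def)
  qed
  finally show ?thesis .
qed

text \<open>By continuity of the paths, the event for all times is the increasing union of the events for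
  dyadic times up to \<open>n\<close>.\<close>

lemma maximal_inequality:
  assumes X: "closed_martingale Gt X Y" and l: "0 < l"
  shows "{\<omega>\<in>space M. \<exists>t\<ge>0. l < \<bar>X t \<omega>\<bar>} \<in> sets M"
    and "l * prob {\<omega>\<in>space M. \<exists>t\<ge>0. l < \<bar>X t \<omega>\<bar>} \<le> expectation (\<lambda>\<omega>. \<bar>Y \<omega>\<bar>)"
proof -
  define A where "A n = {\<omega>\<in>space M. \<exists>t\<in>(\<lambda>i. real i / 2 ^ n) ` {..n * 2 ^ n}. l < \<bar>X t \<omega>\<bar>}" for n
  have XM: "X t \<in> borel_measurable M" if "0 \<le> t" for t
    using closed_martingaleD(1)[OF X that] by (rule measurable_G_M)
  have A: "A n \<in> sets M" for n
  proof -
    have "{\<omega>\<in>space M. l < \<bar>X t \<omega>\<bar>} \<in> sets M" if "0 \<le> t" for t using XM[OF that] by measurable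
    then show ?thesis unfolding A_def by (intro sets.sets_Collect_finite_Ex) auto
  qed
  have inc: "incseq A"
  proof (rule incseq_SucI)
    fix n
    have "(\<lambda>i. real i / 2 ^ n) ` {..n * 2 ^ n} \<subseteq> (\<lambda>i. real i / 2 ^ Suc n) ` {..Suc n * 2 ^ Suc n}"
    proof
      fix x assume "x \<in> (\<lambda>i. real i / 2 ^ n) ` {..n * 2 ^ n}"
      then obtain i where i: "x = real i / 2 ^ n" "i \<le> n * 2 ^ n" by auto
      then have "x = real (2 * i) / 2 ^ Suc n" "2 * i \<le> Suc n * 2 ^ Suc n" by auto
      then show "x \<in> (\<lambda>i. real i / 2 ^ Suc n) ` {..Suc n * 2 ^ Suc n}" by blast
    qed
    then show "A n \<subseteq> A (Suc n)" unfolding A_def by blast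
  qed
  have un: "{\<omega>\<in>space M. \<exists>t\<ge>0. l < \<bar>X t \<omega>\<bar>} = (\<Union>n. A n)"
  proof (intro set_eqI iffI)
    fix \<omega> assume "\<omega> \<in> {\<omega>\<in>space M. \<exists>t\<ge>0. l < \<bar>X t \<omega>\<bar>}"
    then obtain t where \<omega>: "\<omega> \<in> space M" and t: "0 \<le> t" "l < \<bar>X t \<omega>\<bar>" by auto
    have nn: "0 \<le> dyadic_above j t" for j using dyadic_above_bounds(1)[of t j] t by simp
    have "(\<lambda>j. \<bar>X (dyadic_above j t) \<omega>\<bar>) \<longlonglongrightarrow> \<bar>X t \<omega>\<bar>"
      using closed_martingaleD(2)[OF X \<omega>] t nn dyadic_above_tendsto[of t]
      by (intro tendsto_rabs continuous_on_tendsto_right[of "\<lambda>t. X t \<omega>"]) auto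
    then have ev: "\<forall>\<^sub>F j in sequentially. l < \<bar>X (dyadic_above j t) \<omega>\<bar>" using t by (simp add: order_tendsto_iff)
    obtain N :: nat where N: "t + 1 \<le> real N" using real_arch_simple by blast
    have "\<forall>\<^sub>F j in sequentially. N \<le> j \<and> l < \<bar>X (dyadic_above j t) \<omega>\<bar>"
      using eventually_ge_at_top[of N] ev by eventually_elim auto
    then obtain j where j: "N \<le> j" "l < \<bar>X (dyadic_above j t) \<omega>\<bar>" by (auto simp: eventually_sequentially)
    let ?i = "nat (\<lfloor>t * 2 ^ j\<rfloor> + 1)"
    have fl: "0 \<le> \<lfloor>t * 2 ^ j\<rfloor>" using t by simp
    have e: "dyadic_above j t = real ?i / 2 ^ j" using fl by (simp add: dyadic_above_def)
    have "dyadic_above j t \<le> t + 1" using dyadic_above_bounds(2)[of j t] by (rule order_trans) simp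
    then have "real ?i / 2 ^ j \<le> real j" using N j unfolding e by linarith
    then have "real ?i \<le> real (j * 2 ^ j)" by (simp add: field_simps)
    then have "?i \<le> j * 2 ^ j" by (rule of_nat_le_iff[THEN iffD1])
    then have "\<omega> \<in> A j" unfolding A_def using j \<omega> e by blast
    then show "\<omega> \<in> (\<Union>n. A n)" by blast
  next
    fix \<omega> assume "\<omega> \<in> (\<Union>n. A n)"
    then obtain n i where "\<omega> \<in> space M" "l < \<bar>X (real i / 2 ^ n) \<omega>\<bar>" by (auto simp: A_def)
    then show "\<omega> \<in> {\<omega>\<in>space M. \<exists>t\<ge>0. l < \<bar>X t \<omega>\<bar>}" by (auto intro!: exI[of _ "real i / 2 ^ n"])
  qed
  show "{\<omega>\<in>space M. \<exists>t\<ge>0. l < \<bar>X t \<omega>\<bar>} \<in> sets M" unfolding un using A by auto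
  have "(\<lambda>n. l * prob (A n)) \<longlonglongrightarrow> l * prob (\<Union>n. A n)"
    using A inc by (intro tendsto_intros finite_Lim_measure_incseq) auto
  moreover have "l * prob (A n) \<le> expectation (\<lambda>\<omega>. \<bar>Y \<omega>\<bar>)" for n
    unfolding A_def by (rule maximal_inequality_finite[OF X _ _ l]) auto
  ultimately show "l * prob {\<omega>\<in>space M. \<exists>t\<ge>0. l < \<bar>X t \<omega>\<bar>} \<le> expectation (\<lambda>\<omega>. \<bar>Y \<omega>\<bar>)"
    unfolding un by (intro LIMSEQ_le_const2) auto
qed

end

section \<open>Hitting times and limits of stopping times\<close>

text \<open>For continuous \<open>f\<close> the infimum is over a closed set and attained, so that \<open>hitting_time f \<le> t\<close> is decided by \<open>f\<close> on \<open>[0,t]\<close>.\<close>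

definition hitting_time :: "(real \<Rightarrow> real) \<Rightarrow> ennreal" where
  "hitting_time f = Inf (ennreal ` {t. 0 \<le> t \<and> 0 \<le> f t})"

lemma hitting_time_attained:
  assumes f: "continuous_on {0..} f" and fin: "hitting_time f < \<infinity>"
  shows "\<exists>s\<ge>0. hitting_time f = ennreal s \<and> 0 \<le> f s"
proof -
  let ?A = "{t. 0 \<le> t \<and> 0 \<le> f t}"
  have "?A \<noteq> {}"
  proof
    assume "?A = {}"
    then have "hitting_time f = Inf {}" unfolding hitting_time_def by (simp only: image_empty)
    then show False using fin by simp
  qed
  have "?A = {0..} \<inter> f -` {0..}" by auto
  then have cl: "closed ?A" using continuous_closed_preimage[OF f closed_atLeast closed_atLeast] by simp
  have bdd: "bdd_below ?A" by (intro bdd_belowI[of _ 0]) auto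
  have i: "Inf ?A \<in> ?A" by (rule closed_contains_Inf[OF \<open>?A \<noteq> {}\<close> bdd cl])
  have "hitting_time f = ennreal (Inf ?A)"
    unfolding hitting_time_def
  proof (rule antisym)
    show "Inf (ennreal ` ?A) \<le> ennreal (Inf ?A)" using i by (intro Inf_lower) blast
    show "ennreal (Inf ?A) \<le> Inf (ennreal ` ?A)"
    proof (rule Inf_greatest)
      fix x assume "x \<in> ennreal ` ?A"
      then obtain t where t: "x = ennreal t" "t \<in> ?A" by blast
      then show "ennreal (Inf ?A) \<le> x" using cInf_lower[OF t(2) bdd] by (simp add: ennreal_leI)
    qed
  qed
  then show ?thesis using i by auto
qed

lemma hitting_time_le_iff:
  assumes f: "continuous_on {0..} f" and t: "0 \<le> t"
  shows "hitting_time f \<le> ennreal t \<longleftrightarrow> (\<exists>s\<in>{0..t}. 0 \<le> f s)"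
proof
  assume le: "hitting_time f \<le> ennreal t"
  then have "hitting_time f < \<infinity>" by (simp add: le_less_trans)
  then obtain s where "0 \<le> s" "hitting_time f = ennreal s" "0 \<le> f s" using hitting_time_attained[OF f] by blast
  then show "\<exists>s\<in>{0..t}. 0 \<le> f s" using le t by (intro bexI[of _ s]) auto
next
  assume "\<exists>s\<in>{0..t}. 0 \<le> f s"
  then obtain s where s: "0 \<le> s" "s \<le> t" "0 \<le> f s" by auto
  then have "hitting_time f \<le> ennreal s" unfolding hitting_time_def by (intro Inf_lower) auto
  then show "hitting_time f \<le> ennreal t" using ennreal_leI[OF s(2)] by (rule order_trans)
qed

lemma nonpos_until_hitting_time:
  assumes f: "continuous_on {0..} f" "f 0 \<le> 0" and s: "0 \<le> s" "ennreal s \<le> hitting_time f"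
  shows "f s \<le> 0"
proof (cases "s = 0")
  case False
  then have s0: "0 < s" using s by simp
  have "(\<lambda>n. s - s * (1 / real (Suc n))) \<longlonglongrightarrow> s - s * 0"
    by (intro tendsto_intros LIMSEQ_Suc[OF lim_1_over_n])
  then have lim: "(\<lambda>n. s - s / real (Suc n)) \<longlonglongrightarrow> s" by simp
  have pos: "0 \<le> s - s / real (Suc n)" "s - s / real (Suc n) < s" for n using s0 by (auto simp: field_simps)
  have "f (s - s / real (Suc n)) \<le> 0" for n
  proof (rule ccontr)
    assume "\<not> f (s - s / real (Suc n)) \<le> 0"
    then have "hitting_time f \<le> ennreal (s - s / real (Suc n))"
      using pos(1)[of n] by (subst hitting_time_le_iff[OF f(1)]) (auto intro!: bexI[of _ "s - s / real (Suc n)"])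
    also have "\<dots> < ennreal s" using pos[of n] by (simp only: ennreal_less_iff)
    finally show False using s(2) by simp
  qed
  moreover have "(\<lambda>n. f (s - s / real (Suc n))) \<longlonglongrightarrow> f s"
    using pos(1) s by (intro continuous_on_tendsto_right[OF f(1) _ lim]) auto
  ultimately show ?thesis by (intro LIMSEQ_le_const2) auto
qed (use f in simp)

text \<open>A countable criterion: by compactness, values above \<open>- 1 / (m + 1)\<close> for every \<open>m\<close> at dyadic times
  force a nonnegative maximum.\<close>

lemma nonneg_on_interval_iff:
  fixes f :: "real \<Rightarrow> real"
  assumes f: "continuous_on {0..} f" and t: "0 \<le> t"
  shows "(\<exists>s\<in>{0..t}. 0 \<le> f s) \<longleftrightarrow> (\<forall>m::nat. \<exists>p::nat \<times> nat. - 1 / real (Suc m) < f (min (real (fst p) / 2 ^ snd p) t))"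
proof
  assume "\<exists>s\<in>{0..t}. 0 \<le> f s"
  then obtain s where s: "0 \<le> s" "s \<le> t" "0 \<le> f s" by auto
  have nn: "0 \<le> dyadic_above j s" for j using dyadic_above_bounds(1)[of s j] s by simp
  have "(\<lambda>j. f (min (dyadic_above j s) t)) \<longlonglongrightarrow> f (min s t)"
    using s t nn by (intro continuous_on_tendsto_right[OF f] tendsto_intros dyadic_above_tendsto) auto
  then have lim: "(\<lambda>j. f (min (dyadic_above j s) t)) \<longlonglongrightarrow> f s" using s by simp
  show "\<forall>m::nat. \<exists>p::nat \<times> nat. - 1 / real (Suc m) < f (min (real (fst p) / 2 ^ snd p) t)"
  proof
    fix m :: nat
    have "- 1 / real (Suc m) < 0" by simp
    then have "- 1 / real (Suc m) < f s" using s by linarith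
    then have "\<forall>\<^sub>F j in sequentially. - 1 / real (Suc m) < f (min (dyadic_above j s) t)"
      using lim by (simp only: order_tendsto_iff)
    then obtain j where j: "- 1 / real (Suc m) < f (min (dyadic_above j s) t)" by (auto simp: eventually_sequentially)
    have "dyadic_above j s = real (nat (\<lfloor>s * 2 ^ j\<rfloor> + 1)) / 2 ^ j" using s by (simp add: dyadic_above_def)
    with j show "\<exists>p::nat \<times> nat. - 1 / real (Suc m) < f (min (real (fst p) / 2 ^ snd p) t)"
      by (intro exI[of _ "(nat (\<lfloor>s * 2 ^ j\<rfloor> + 1), j)"]) simp
  qed
next
  assume *: "\<forall>m::nat. \<exists>p::nat \<times> nat. - 1 / real (Suc m) < f (min (real (fst p) / 2 ^ snd p) t)"
  have "continuous_on {0..t} f" using f by (rule continuous_on_subset) auto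
  then obtain s where s: "s \<in> {0..t}" "\<And>x. x \<in> {0..t} \<Longrightarrow> f x \<le> f s"
    using continuous_attains_sup[of "{0..t}" f] t by auto
  have "- 1 / real (Suc m) \<le> f s" for m
  proof -
    obtain p where "- 1 / real (Suc m) < f (min (real (fst p) / 2 ^ snd p) t)" using * by blast
    moreover have "min (real (fst p) / 2 ^ snd p) t \<in> {0..t}" using t by auto
    ultimately show ?thesis using s(2) by fastforce
  qed
  moreover have "(\<lambda>m. - 1 / real (Suc m)) \<longlonglongrightarrow> 0"
    using tendsto_minus[OF LIMSEQ_Suc[OF lim_1_over_n[where 'a=real]]] by simp
  ultimately have "0 \<le> f s" by (intro LIMSEQ_le_const2) auto
  then show "\<exists>s\<in>{0..t}. 0 \<le> f s" using s by blast
qed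

lemma hitting_time_le_measurable:
  assumes D: "\<And>s. 0 \<le> s \<Longrightarrow> s \<le> t \<Longrightarrow> D s \<in> borel_measurable N" and cont: "\<And>x. x \<in> space N \<Longrightarrow> continuous_on {0..} (\<lambda>t. D t x)"
    and t: "0 \<le> t"
  shows "{x\<in>space N. hitting_time (\<lambda>t. D t x) \<le> ennreal t} \<in> sets N"
proof -
  have "{x\<in>space N. hitting_time (\<lambda>t. D t x) \<le> ennreal t} =
     {x\<in>space N. \<forall>m::nat. \<exists>p::nat \<times> nat. - 1 / real (Suc m) < D (min (real (fst p) / 2 ^ snd p) t) x}"
  proof (rule Collect_cong, rule conj_cong[OF refl])
    fix x assume "x \<in> space N"
    note c = cont[OF this]
    show "hitting_time (\<lambda>t. D t x) \<le> ennreal t \<longleftrightarrow> (\<forall>m::nat. \<exists>p::nat \<times> nat. - 1 / real (Suc m) < D (min (real (fst p) / 2 ^ snd p) t) x)"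
      unfolding hitting_time_le_iff[OF c t] by (rule nonneg_on_interval_iff[OF c t])
  qed
  also have "\<dots> \<in> sets N"
  proof (intro sets.sets_Collect_countable_All sets.sets_Collect_countable_Ex)
    fix m :: nat and p :: "nat \<times> nat"
    have [measurable]: "D (min (real (fst p) / 2 ^ snd p) t) \<in> borel_measurable N" using t by (intro D) auto
    show "{x \<in> space N. - 1 / real (Suc m) < D (min (real (fst p) / 2 ^ snd p) t) x} \<in> sets N" by measurable
  qed
  finally show ?thesis .
qed

lemma hitting_time_measurable:
  assumes D: "\<And>s. 0 \<le> s \<Longrightarrow> D s \<in> borel_measurable N" and cont: "\<And>x. x \<in> space N \<Longrightarrow> continuous_on {0..} (\<lambda>t. D t x)"
  shows "(\<lambda>x. hitting_time (\<lambda>t. D t x)) \<in> borel_measurable N"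
proof (rule borel_measurableI_le)
  fix y :: ennreal
  show "{x\<in>space N. hitting_time (\<lambda>t. D t x) \<le> y} \<in> sets N"
  proof (cases y)
    case (real t)
    then show ?thesis using hitting_time_le_measurable[OF D cont, where t=t] by simp
  qed simp
qed

context brownian_basis
begin

text \<open>At index \<open>\<infinity>\<close> the condition is void, because every time is at most \<open>\<infinity>\<close>.\<close>

lemma stopping_timeI_finite:
  assumes "\<And>t. 0 \<le> t \<Longrightarrow> {\<omega>\<in>space M. \<tau> \<omega> \<le> ennreal t} \<in> sets (Gt t)"
  shows "stopping_time G \<tau>"
proof (rule stopping_timeI)
  fix t :: ennreal
  show "Measurable.pred (G t) (\<lambda>\<omega>. \<tau> \<omega> \<le> t)"
  proof (cases t)
    case (real r)
    then show ?thesis using assms[of r] by (simp add: pred_def space_F)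
  next
    case top
    then show ?thesis by simp
  qed
qed

lemma stopping_time_hitting_time:
  assumes D: "\<And>t. 0 \<le> t \<Longrightarrow> D t \<in> borel_measurable (Gt t)" and cont: "\<And>\<omega>. \<omega> \<in> space M \<Longrightarrow> continuous_on {0..} (\<lambda>t. D t \<omega>)"
  shows "stopping_time G (\<lambda>\<omega>. hitting_time (\<lambda>t. D t \<omega>))"
proof (rule stopping_timeI_finite)
  fix t :: real assume t: "0 \<le> t"
  have "D s \<in> borel_measurable (Gt t)" if "0 \<le> s" "s \<le> t" for s
    using D[OF that(1)] ennreal_leI[OF that(2)] by (rule measurable_G_mono)
  then have "{\<omega>\<in>space (Gt t). hitting_time (\<lambda>t. D t \<omega>) \<le> ennreal t} \<in> sets (Gt t)"
    using cont t by (intro hitting_time_le_measurable) (auto simp: space_F)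
  then show "{\<omega>\<in>space M. hitting_time (\<lambda>t. D t \<omega>) \<le> ennreal t} \<in> sets (Gt t)" by (simp add: space_F)
qed

text \<open>Below level \<open>t\<close> the sublevel sets are those of \<open>\<tau>\<close> at earlier times; from \<open>t\<close> on they are the
  whole space.\<close>

lemma stopping_time_min_measurable:
  assumes \<tau>: "stopping_time G \<tau>"
  shows "(\<lambda>\<omega>. min (\<tau> \<omega>) t) \<in> borel_measurable (G t)"
proof (rule borel_measurableI_le)
  fix s
  show "{\<omega> \<in> space (G t). min (\<tau> \<omega>) t \<le> s} \<in> sets (G t)"
  proof (cases "t \<le> s")
    case True
    then have "{\<omega> \<in> space (G t). min (\<tau> \<omega>) t \<le> s} = space (G t)" by (auto simp: min_le_iff_disj)
    then show ?thesis by simp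
  next
    case False
    then have e: "{\<omega> \<in> space (G t). min (\<tau> \<omega>) t \<le> s} = {\<omega> \<in> space (G s). \<tau> \<omega> \<le> s}" by (auto simp: min_le_iff_disj space_F)
    have "{\<omega> \<in> space (G s). \<tau> \<omega> \<le> s} \<in> sets (G s)" using stopping_timeD[OF \<tau>, of s] by (simp add: pred_def)
    moreover have "sets (G s) \<subseteq> sets (G t)" using False by (intro sets_F_mono) auto
    ultimately show ?thesis unfolding e by blast
  qed
qed

lemma stopping_time_less_G:
  assumes \<tau>: "stopping_time G \<tau>"
  shows "{\<omega>\<in>space M. \<tau> \<omega> < t} \<in> sets (G t)"
proof -
  have "{\<omega>\<in>space (G t). min (\<tau> \<omega>) t < t} \<in> sets (G t)"
    using stopping_time_min_measurable[OF \<tau>, of t] by measurable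
  then show ?thesis by (simp add: space_F min_less_iff_disj)
qed

text \<open>An eventually constant sequence of stopping times has a limit that is a stopping time for
  the same filtration; a general limit would only be one for the right-continuous filtration.\<close>

definition eventual_value :: "(nat \<Rightarrow> ennreal) \<Rightarrow> ennreal" where
  "eventual_value x = Inf {c. \<forall>\<^sub>F j in sequentially. x j = c}"

lemma eventual_value_eq:
  assumes "\<forall>\<^sub>F j in sequentially. x j = c"
  shows "eventual_value x = c"
proof -
  have "c' = c" if "\<forall>\<^sub>F j in sequentially. x j = c'" for c'
  proof -
    have "\<forall>\<^sub>F j in sequentially. c' = c" using that assms by eventually_elim simp
    then show ?thesis by simp
  qed
  then have "{c. \<forall>\<^sub>F j in sequentially. x j = c} = {c}" using assms by blast
  then show ?thesis by (simp add: eventual_value_def)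
qed

text \<open>The limit is at most \<open>t\<close> if and only if the times are eventually at most \<open>t\<close> and their
  truncations at \<open>t\<close> eventually constant; both are decided at time \<open>t\<close>.\<close>

lemma stopping_time_eventual_value:
  assumes \<tau>: "\<And>j. stopping_time G (\<tau> j)"
  shows "stopping_time G (\<lambda>\<omega>. eventual_value (\<lambda>j. \<tau> j \<omega>))"
proof (rule stopping_timeI_finite)
  fix t :: real assume t: "0 \<le> t"
  have "eventual_value (\<lambda>j. \<tau> j \<omega>) \<le> ennreal t \<longleftrightarrow>
      (\<exists>J. \<forall>j. J \<le> j \<longrightarrow> \<tau> j \<omega> \<le> ennreal t \<and> min (\<tau> j \<omega>) (ennreal t) = min (\<tau> J \<omega>) (ennreal t))" (is "?L \<longleftrightarrow> ?R") for \<omega>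
  proof
    assume L: ?L
    have "{c. \<forall>\<^sub>F j in sequentially. \<tau> j \<omega> = c} \<noteq> {}"
    proof
      assume "{c. \<forall>\<^sub>F j in sequentially. \<tau> j \<omega> = c} = {}"
      then have "eventual_value (\<lambda>j. \<tau> j \<omega>) = \<infinity>" by (simp add: eventual_value_def)
      then show False using L by (simp add: top_unique)
    qed
    then obtain c where c: "\<forall>\<^sub>F j in sequentially. \<tau> j \<omega> = c" by blast
    then have "c \<le> ennreal t" using L eventual_value_eq[OF c] by simp
    moreover obtain J where "\<And>j. J \<le> j \<Longrightarrow> \<tau> j \<omega> = c" using c by (auto simp: eventually_sequentially)
    ultimately show ?R by (intro exI[of _ J]) auto
  next
    assume ?R
    then obtain J where J: "\<And>j. J \<le> j \<Longrightarrow> \<tau> j \<omega> \<le> ennreal t" "\<And>j. J \<le> j \<Longrightarrow> min (\<tau> j \<omega>) (ennreal t) = min (\<tau> J \<omega>) (ennreal t)" by blast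
    have "\<tau> j \<omega> = \<tau> J \<omega>" if "J \<le> j" for j using J(2)[OF that]
      unfolding min_absorb1[OF J(1)[OF that]] min_absorb1[OF J(1)[OF order_refl]] .
    then have "\<forall>\<^sub>F j in sequentially. \<tau> j \<omega> = \<tau> J \<omega>" unfolding eventually_sequentially by blast
    then have "eventual_value (\<lambda>j. \<tau> j \<omega>) = \<tau> J \<omega>" by (rule eventual_value_eq)
    then show ?L using J(1)[OF order_refl] by simp
  qed
  then have "{\<omega>\<in>space M. eventual_value (\<lambda>j. \<tau> j \<omega>) \<le> ennreal t} =
     {\<omega>\<in>space (Gt t). \<exists>J. \<forall>j. J \<le> j \<longrightarrow> \<tau> j \<omega> \<le> ennreal t \<and> min (\<tau> j \<omega>) (ennreal t) = min (\<tau> J \<omega>) (ennreal t)}"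
    by (simp add: space_F)
  also have "\<dots> \<in> sets (Gt t)"
  proof (intro sets.sets_Collect_countable_All sets.sets_Collect_countable_Ex sets.sets_Collect_imp sets.sets_Collect_conj)
    fix j J
    show "{\<omega>\<in>space (Gt t). \<tau> j \<omega> \<le> ennreal t} \<in> sets (Gt t)" using stopping_timeD[OF \<tau>[of j], of "ennreal t"] by (simp add: pred_def)
    note [measurable] = stopping_time_min_measurable[OF \<tau>, of _ "ennreal t"]
    have "{\<omega>\<in>space (Gt t). min (\<tau> j \<omega>) (ennreal t) = min (\<tau> J \<omega>) (ennreal t)} =
       {\<omega>\<in>space (Gt t). min (\<tau> j \<omega>) (ennreal t) \<le> min (\<tau> J \<omega>) (ennreal t)} \<inter> {\<omega>\<in>space (Gt t). min (\<tau> J \<omega>) (ennreal t) \<le> min (\<tau> j \<omega>) (ennreal t)}"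
      unfolding order_eq_iff[where 'a=ennreal] by blast
    also have "\<dots> \<in> sets (Gt t)" by measurable
    finally show "{\<omega>\<in>space (Gt t). min (\<tau> j \<omega>) (ennreal t) = min (\<tau> J \<omega>) (ennreal t)} \<in> sets (Gt t)" .
  qed auto
  finally show "{\<omega>\<in>space M. eventual_value (\<lambda>j. \<tau> j \<omega>) \<le> ennreal t} \<in> sets (Gt t)" .
qed

section \<open>Stopping times of the right-continuous filtration\<close>

lemma sigma_finite_subalgebra_Gt: "sigma_finite_subalgebra M (G t)"
proof (rule finite_measure_subalgebra_is_sigma_finite)
  show "finite_measure_subalgebra M (G t)" by unfold_locales (rule subalgebra_basis)
qed

text \<open>A bounded strictly decreasing function of time, equal to \<open>exp (- t)\<close> at finite times.\<close>

definition discount :: "ennreal \<Rightarrow> real" where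
  "discount x = (if x = \<infinity> then 0 else exp (- enn2real x))"

lemma discount_bounds: "0 \<le> discount x" "discount x \<le> 1"
  by (auto simp: discount_def)

lemma discount_ennreal: "0 \<le> t \<Longrightarrow> discount (ennreal t) = exp (- t)"
  by (simp add: discount_def)

lemma discount_measurable[measurable]: "discount \<in> borel_measurable borel"
  unfolding discount_def[abs_def] by measurable

lemma discount_strict: "x < y \<Longrightarrow> discount y < discount x"
  by (cases x; cases y) (auto simp: discount_def ennreal_less_iff)

lemma discount_antimono: "x \<le> y \<Longrightarrow> discount y \<le> discount x"
  using discount_strict[of x y] by (cases "x = y") (auto simp: less_le)

text \<open>Closing variables that converge fast in mean give, by Doob's inequality and Borel-Cantelli,
  martingales that converge uniformly in time. Their limit is continuous, and at each fixed time
  it is the conditional expectation.\<close>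

lemma fast_martingale_approximation:
  assumes Y: "Y \<in> borel_measurable (info UNIV)" "\<And>\<omega>. \<omega> \<in> space M \<Longrightarrow> \<bar>Y \<omega>\<bar> \<le> 1"
  shows "\<exists>X. (\<forall>k. \<forall>t\<ge>0. X k t \<in> borel_measurable (Gt t)) \<and> (\<forall>k. \<forall>\<omega>\<in>space M. continuous_on {0..} (\<lambda>t. X k t \<omega>)) \<and>
    (AE \<omega> in M. \<forall>\<^sub>F k in sequentially. \<forall>t\<ge>0. \<bar>X (Suc k) t \<omega> - X k t \<omega>\<bar> \<le> (1 / 2) ^ k) \<and>
    (\<forall>t\<ge>0. AE \<omega> in M. (\<lambda>k. X k t \<omega>) \<longlonglongrightarrow> real_cond_exp M (Gt t) Y \<omega>)"
proof -
  have YM[measurable]: "Y \<in> borel_measurable M" using Y(1) by (rule info_M)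
  have Yi: "integrable M Y" using YM Y(2) by (rule bounded_integrable)
  \<comment> \<open>The rate \<open>(1/8)^k\<close> beats the level \<open>(1/2)^k\<close> in the maximal inequality by a summable factor.\<close>
  have "\<exists>X Z. closed_martingale Gt X Z \<and> expectation (\<lambda>\<omega>. \<bar>Y \<omega> - Z \<omega>\<bar>) < (1 / 8) ^ k" for k :: nat
    by (rule closed_martingale_dense[OF Y]) simp_all
  then obtain X Z where X: "\<And>k. closed_martingale Gt (X k) (Z k)" and XZ: "\<And>k. expectation (\<lambda>\<omega>. \<bar>Y \<omega> - Z k \<omega>\<bar>) < (1 / 8) ^ k"
    by metis
  have Zi: "integrable M (Z k)" for k
    using closed_martingale_bounded[OF X, of k] bounded_integrable[OF closed_martingaleD(3)[OF X]] by auto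
  let ?A = "\<lambda>k. {\<omega>\<in>space M. \<exists>t\<ge>0. (1 / 2) ^ k < \<bar>1 * X (Suc k) t \<omega> + (- 1) * X k t \<omega>\<bar>}"
  have d: "closed_martingale Gt (\<lambda>t \<omega>. 1 * X (Suc k) t \<omega> + (- 1) * X k t \<omega>) (\<lambda>\<omega>. 1 * Z (Suc k) \<omega> + (- 1) * Z k \<omega>)" for k
    by (rule closed_martingale_lincomb[OF X X subalgebra_Gt])
  have A: "?A k \<in> sets M" for k by (rule maximal_inequality(1)[OF d]) simp
  have pA: "prob (?A k) \<le> 2 * (1 / 4) ^ k" for k
  proof -
    have "(1 / 2) ^ k * prob (?A k) \<le> expectation (\<lambda>\<omega>. \<bar>1 * Z (Suc k) \<omega> + (- 1) * Z k \<omega>\<bar>)"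
      by (rule maximal_inequality(2)[OF d]) simp
    also have "\<dots> \<le> expectation (\<lambda>\<omega>. \<bar>Y \<omega> - Z (Suc k) \<omega>\<bar> + \<bar>Y \<omega> - Z k \<omega>\<bar>)"
      using Zi Yi by (intro integral_mono) auto
    also have "\<dots> = expectation (\<lambda>\<omega>. \<bar>Y \<omega> - Z (Suc k) \<omega>\<bar>) + expectation (\<lambda>\<omega>. \<bar>Y \<omega> - Z k \<omega>\<bar>)"
      using Zi Yi by (intro Bochner_Integration.integral_add) auto
    also have "\<dots> \<le> (1 / 8) ^ k + (1 / 8) ^ k"
    proof (rule add_mono)
      have "(1 / 8 :: real) ^ Suc k \<le> (1 / 8) ^ k" by (rule power_decreasing) auto
      then show "expectation (\<lambda>\<omega>. \<bar>Y \<omega> - Z (Suc k) \<omega>\<bar>) \<le> (1 / 8) ^ k" using XZ[of "Suc k"] by linarith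
    qed (use XZ[of k] in simp)
    also have "\<dots> = (1 / 2) ^ k * (2 * (1 / 4) ^ k)" by (simp flip: power_mult_distrib)
    finally show ?thesis by simp
  qed
  have "summable (\<lambda>k. prob (?A k))"
  proof (rule summable_comparison_test'[of "\<lambda>k. 2 * (1 / 4) ^ k" 0])
    show "summable (\<lambda>k. 2 * (1 / 4 :: real) ^ k)" by (intro summable_mult summable_geometric) simp
    show "norm (prob (?A k)) \<le> 2 * (1 / 4) ^ k" for k using pA[of k] by simp
  qed
  then have "AE \<omega> in M. \<forall>\<^sub>F k in sequentially. \<omega> \<in> space M - ?A k"
    using A by (intro borel_cantelli_AE1) (auto simp: emeasure_eq_measure)
  then have bc: "AE \<omega> in M. \<forall>\<^sub>F k in sequentially. \<forall>t\<ge>0. \<bar>X (Suc k) t \<omega> - X k t \<omega>\<bar> \<le> (1 / 2) ^ k"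
    by eventually_elim (auto elim!: eventually_mono simp: not_less)
  have ce: "AE \<omega> in M. (\<lambda>k. X k t \<omega>) \<longlonglongrightarrow> real_cond_exp M (Gt t) Y \<omega>" if t: "0 \<le> t" for t
  proof -
    interpret sigma_finite_subalgebra M "Gt t" by (rule sigma_finite_subalgebra_Gt)
    let ?C = "real_cond_exp M (Gt t) Y"
    have Ci: "integrable M ?C" using Yi by (rule real_cond_exp_int(1))
    have XG: "X k t \<in> borel_measurable (Gt t)" for k using closed_martingaleD(1)[OF X t] .
    have XM: "X k t \<in> borel_measurable M" for k using XG by (rule measurable_G_M)
    have Xi: "integrable M (X k t)" for k
      using closed_martingale_bounded[OF X, of k] bounded_integrable[OF XM] t by blast
    have N: "expectation (\<lambda>\<omega>. \<bar>X k t \<omega> - ?C \<omega>\<bar>) \<le> (1 / 8) ^ k" for k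
    proof -
      let ?s = "\<lambda>\<omega>. sgn (X k t \<omega> - ?C \<omega>)"
      have sG: "?s \<in> borel_measurable (Gt t)" using XG by simp
      have sM: "?s \<in> borel_measurable M" using sG by (rule measurable_G_M)
      have sb: "\<bar>?s \<omega>\<bar> \<le> 1" for \<omega> by (simp add: sgn_if)
      have mi: "integrable M (\<lambda>\<omega>. ?s \<omega> * f \<omega>)" if "integrable M f" for f
        using that sM sb by (intro Bochner_Integration.integrable_bound[OF that]) (auto simp: abs_mult intro!: mult_left_le_one_le)
      have "expectation (\<lambda>\<omega>. \<bar>X k t \<omega> - ?C \<omega>\<bar>) = expectation (\<lambda>\<omega>. ?s \<omega> * X k t \<omega> - ?s \<omega> * ?C \<omega>)"
        by (intro Bochner_Integration.integral_cong) (auto simp: sgn_if)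
      also have "\<dots> = expectation (\<lambda>\<omega>. ?s \<omega> * X k t \<omega>) - expectation (\<lambda>\<omega>. ?s \<omega> * ?C \<omega>)"
        using mi[OF Xi] mi[OF Ci] by simp
      also have "expectation (\<lambda>\<omega>. ?s \<omega> * X k t \<omega>) = expectation (\<lambda>\<omega>. ?s \<omega> * Z k \<omega>)"
        using closed_martingaleD(4)[OF X t sG sb] by simp
      also have "expectation (\<lambda>\<omega>. ?s \<omega> * ?C \<omega>) = expectation (\<lambda>\<omega>. ?s \<omega> * Y \<omega>)"
        by (rule real_cond_exp_intg(2)[OF mi[OF Yi] sG YM])
      also have "expectation (\<lambda>\<omega>. ?s \<omega> * Z k \<omega>) - expectation (\<lambda>\<omega>. ?s \<omega> * Y \<omega>) = expectation (\<lambda>\<omega>. ?s \<omega> * Z k \<omega> - ?s \<omega> * Y \<omega>)"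
        using mi[OF Zi] mi[OF Yi] by simp
      also have "\<dots> \<le> expectation (\<lambda>\<omega>. \<bar>Y \<omega> - Z k \<omega>\<bar>)"
        using mi[OF Zi[of k]] mi[OF Yi] Yi Zi by (intro integral_mono) (auto simp: sgn_if)
      also have "\<dots> \<le> (1 / 8) ^ k" using XZ[of k] by simp
      finally show ?thesis .
    qed
    have Ni: "integrable M (\<lambda>\<omega>. \<bar>X k t \<omega> - ?C \<omega>\<bar>)" for k using Xi Ci by simp
    have "(\<integral>\<^sup>+ \<omega>. (\<Sum>k. ennreal \<bar>X k t \<omega> - ?C \<omega>\<bar>) \<partial>M) = (\<Sum>k. \<integral>\<^sup>+ \<omega>. ennreal \<bar>X k t \<omega> - ?C \<omega>\<bar> \<partial>M)"
      using XM Ci by (intro nn_integral_suminf) auto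
    also have "\<dots> = (\<Sum>k. ennreal (expectation (\<lambda>\<omega>. \<bar>X k t \<omega> - ?C \<omega>\<bar>)))"
      using Ni by (subst nn_integral_eq_integral) auto
    also have "\<dots> \<le> (\<Sum>k. ennreal ((1 / 8) ^ k))" using N by (intro suminf_le ennreal_leI) auto
    also have "\<dots> = ennreal (\<Sum>k. (1 / 8) ^ k)" by (intro suminf_ennreal2 summable_geometric) auto
    also have "\<dots> < \<infinity>" by simp
    finally have "AE \<omega> in M. (\<Sum>k. ennreal \<bar>X k t \<omega> - ?C \<omega>\<bar>) \<noteq> \<infinity>"
      using XM Ci by (intro nn_integral_PInf_AE) auto
    then show ?thesis
    proof eventually_elim
      fix \<omega> assume "(\<Sum>k. ennreal \<bar>X k t \<omega> - ?C \<omega>\<bar>) \<noteq> \<infinity>"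
      then have "summable (\<lambda>k. \<bar>X k t \<omega> - ?C \<omega>\<bar>)" by (intro summable_suminf_not_top) auto
      then have "(\<lambda>k. \<bar>X k t \<omega> - ?C \<omega>\<bar>) \<longlonglongrightarrow> 0" by (rule summable_LIMSEQ_zero)
      then show "(\<lambda>k. X k t \<omega>) \<longlonglongrightarrow> ?C \<omega>" by (simp add: tendsto_rabs_zero_iff LIM_zero_iff)
    qed
  qed
  show ?thesis
    using closed_martingaleD(1,2)[OF X] bc ce by (intro exI[of _ X] conjI allI impI ballI) auto
qed

definition clamp_to :: "real \<Rightarrow> real \<Rightarrow> real" where
  "clamp_to c x = max (- c) (min c x)"

lemma abs_clamp_to_le: "0 \<le> c \<Longrightarrow> \<bar>clamp_to c x\<bar> \<le> c"
  by (auto simp: clamp_to_def)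

text \<open>Clamping the increments makes the series converge uniformly for all sequences, and does not
  change it once the increments are small. Hence the continuous limit process can be defined
  everywhere and adaptedly, without discarding a null set that need not lie in the
  filtration.\<close>

lemma telescoping_clamped_series:
  fixes x :: "nat \<Rightarrow> real"
  assumes "\<And>k. j \<le> k \<Longrightarrow> \<bar>x (Suc k) - x k\<bar> \<le> (1 / 2) ^ k" "j \<le> i"
  shows "x \<longlonglongrightarrow> x i + (\<Sum>k. clamp_to ((1 / 2) ^ (i + k)) (x (Suc (i + k)) - x (i + k)))"
proof -
  let ?d = "\<lambda>k. x (Suc (i + k)) - x (i + k)"
  have d: "\<bar>?d k\<bar> \<le> (1 / 2) ^ (i + k)" for k using assms(1)[of "i + k"] assms(2) by simp
  have "clamp_to c y = y" if "\<bar>y\<bar> \<le> c" for c y using that by (auto simp: clamp_to_def)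
  then have c: "clamp_to ((1 / 2) ^ (i + k)) (?d k) = ?d k" for k using d[of k] by blast
  have "summable ?d"
  proof (rule summable_comparison_test'[of "\<lambda>k. (1 / 2) ^ k" 0])
    fix k
    have "(1 / 2 :: real) ^ (i + k) \<le> (1 / 2) ^ k" by (rule power_decreasing) auto
    then have "\<bar>?d k\<bar> \<le> (1 / 2) ^ k" using d[of k] by (rule order_trans[rotated])
    then show "norm (?d k) \<le> (1 / 2) ^ k" by simp
  qed simp
  then have "(\<lambda>n. \<Sum>k<n. ?d k) \<longlonglongrightarrow> (\<Sum>k. ?d k)" by (rule summable_LIMSEQ)
  moreover have "(\<Sum>k<n. ?d k) = x (i + n) - x i" for n by (induction n) auto
  ultimately have "(\<lambda>n. x i + (x (i + n) - x i)) \<longlonglongrightarrow> x i + (\<Sum>k. ?d k)" by (intro tendsto_intros) simp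
  then have "(\<lambda>n. x (n + i)) \<longlonglongrightarrow> x i + (\<Sum>k. ?d k)" by (simp add: add.commute)
  then show ?thesis unfolding c by (rule LIMSEQ_offset)
qed

text \<open>Brownian martingales are continuous, so a stopping time \<open>T\<close> of the right-continuous
  filtration is the first time at which the martingale closed by \<open>exp (- T)\<close> reaches the curve
  \<open>exp (- t)\<close>. Hitting times of closed sets by continuous adapted processes are stopping times of
  the original filtration.\<close>

lemma predictable_version:
  assumes T: "T \<in> borel_measurable (info UNIV)" and TG: "\<And>t. 0 \<le> t \<Longrightarrow> {\<omega>\<in>space M. T \<omega> < ennreal t} \<in> sets (Gt t)"
  shows "\<exists>T'. stopping_time G T' \<and> (AE \<omega> in M. T' \<omega> = T \<omega>)"
proof -
  define Y where "Y = (\<lambda>\<omega>. discount (T \<omega>))"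
  have Yinfo: "Y \<in> borel_measurable (info UNIV)" unfolding Y_def using T by measurable
  have YM[measurable]: "Y \<in> borel_measurable M" using Yinfo by (rule info_M)
  have Yb: "0 \<le> Y \<omega>" "Y \<omega> \<le> 1" for \<omega> by (auto simp: Y_def discount_bounds)
  have Yi: "integrable M Y" using YM Yb by (intro bounded_integrable[of _ 1]) auto
  have "\<bar>Y \<omega>\<bar> \<le> 1" for \<omega> using Yb[of \<omega>] by simp
  from fast_martingale_approximation[OF Yinfo this]
  obtain X where X: "\<forall>k. \<forall>t\<ge>0. X k t \<in> borel_measurable (Gt t)" "\<forall>k. \<forall>\<omega>\<in>space M. continuous_on {0..} (\<lambda>t. X k t \<omega>)"
    "\<forall>t\<ge>0. AE \<omega> in M. (\<lambda>k. X k t \<omega>) \<longlonglongrightarrow> real_cond_exp M (Gt t) Y \<omega>"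
    and Xd: "AE \<omega> in M. \<forall>\<^sub>F k in sequentially. \<forall>t\<ge>0. \<bar>X (Suc k) t \<omega> - X k t \<omega>\<bar> \<le> (1 / 2) ^ k"
    by (elim exE conjE) (rule that)
  note XG = X(1)[rule_format] and Xc = X(2)[rule_format] and XC = X(3)[rule_format]
  define C where "C = (\<lambda>t. real_cond_exp M (Gt t) Y)"
  \<comment> \<open>The limit of the martingales \<open>X k\<close>, as soon as the increments after \<open>i\<close> are below the clamping levels.\<close>
  define Z where "Z = (\<lambda>i t \<omega>. X i t \<omega> + (\<Sum>k. clamp_to ((1 / 2) ^ (i + k)) (X (Suc (i + k)) t \<omega> - X (i + k) t \<omega>)))"
  have Zc: "continuous_on {0..} (\<lambda>t. Z i t \<omega>)" if \<omega>: "\<omega> \<in> space M" for i \<omega>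
  proof -
    let ?f = "\<lambda>k t. clamp_to ((1 / 2) ^ (i + k)) (X (Suc (i + k)) t \<omega> - X (i + k) t \<omega>)"
    have "uniform_limit {0..} (\<lambda>n t. \<Sum>k<n. ?f k t) (\<lambda>t. \<Sum>k. ?f k t) sequentially"
    proof (rule Weierstrass_m_test[of _ _ "\<lambda>k. (1 / 2) ^ k"])
      fix k t
      have "(1 / 2 :: real) ^ (i + k) \<le> (1 / 2) ^ k" by (rule power_decreasing) auto
      moreover have "\<bar>?f k t\<bar> \<le> (1 / 2) ^ (i + k)" by (rule abs_clamp_to_le) simp
      ultimately have "\<bar>?f k t\<bar> \<le> (1 / 2) ^ k" by linarith
      then show "norm (?f k t) \<le> (1 / 2) ^ k" by simp
    qed simp
    then have "continuous_on {0..} (\<lambda>t. \<Sum>k. ?f k t)"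
    proof (rule uniform_limit_theorem[rotated])
      show "\<forall>\<^sub>F n in sequentially. continuous_on {0..} (\<lambda>t. \<Sum>k<n. ?f k t)"
        unfolding clamp_to_def by (intro always_eventually allI continuous_intros Xc \<omega>)
    qed simp
    then show ?thesis unfolding Z_def by (intro continuous_intros Xc \<omega>)
  qed
  have ZG: "Z i t \<in> borel_measurable (Gt t)" if t: "0 \<le> t" for i t
  proof -
    note [measurable] = XG[OF t]
    show ?thesis unfolding Z_def clamp_to_def by measurable
  qed
  \<comment> \<open>For almost every path the processes \<open>Z i\<close> agree for large \<open>i\<close>, hence so do their hitting times.\<close>
  define \<tau> where "\<tau> = (\<lambda>i \<omega>. hitting_time (\<lambda>t. Z i t \<omega> - exp (- t)))"
  have \<tau>: "stopping_time G (\<tau> i)" for i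
    unfolding \<tau>_def using ZG Zc by (intro stopping_time_hitting_time) (auto intro!: continuous_intros)
  define T' where "T' = (\<lambda>\<omega>. eventual_value (\<lambda>j. \<tau> j \<omega>))"
  have T': "stopping_time G T'" unfolding T'_def using \<tau> by (rule stopping_time_eventual_value)
  note T'm[measurable] = stopping_time_measurable[OF T']
  have Tm[measurable]: "T \<in> borel_measurable M" using T by (rule info_M)

  have CG: "C q \<in> borel_measurable (Gt q)" for q unfolding C_def by (rule borel_measurable_cond_exp)
  have CM[measurable]: "C q \<in> borel_measurable M" for q using CG by (rule measurable_G_M)
  have C01: "AE \<omega> in M. 0 \<le> C q \<omega> \<and> C q \<omega> \<le> 1" for q
  proof -
    interpret sigma_finite_subalgebra M "Gt q" by (rule sigma_finite_subalgebra_Gt)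
    have "AE \<omega> in M. 0 \<le> C q \<omega>" unfolding C_def using Yb by (intro real_cond_exp_pos) auto
    moreover have "AE \<omega> in M. C q \<omega> \<le> 1" unfolding C_def using Yb Yi by (intro real_cond_exp_le_c) auto
    ultimately show ?thesis by eventually_elim simp
  qed
  \<comment> \<open>On \<open>T < q\<close>, an event known at time \<open>q\<close>, \<open>exp (- T)\<close> exceeds \<open>exp (- q)\<close>.\<close>
  have Cge: "AE \<omega> in M. T \<omega> < ennreal q \<longrightarrow> exp (- q) \<le> C q \<omega>" if q: "0 \<le> q" for q
  proof -
    interpret sigma_finite_subalgebra M "Gt q" by (rule sigma_finite_subalgebra_Gt)
    let ?D = "{\<omega>\<in>space M. T \<omega> < ennreal q}"
    have D: "?D \<in> sets (Gt q)" by (rule TG[OF q])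
    have DM: "?D \<in> sets M" using D sets_G_subset by blast
    have i1: "integrable M (\<lambda>\<omega>. indicator ?D \<omega> * Y \<omega>)"
      using DM Yb by (intro bounded_mult_integrable[where C=1 and D=1]) (auto simp: indicator_def)
    have "AE \<omega> in M. real_cond_exp M (Gt q) (\<lambda>\<omega>. exp (- q) * indicator ?D \<omega>) \<omega> \<le> real_cond_exp M (Gt q) (\<lambda>\<omega>. indicator ?D \<omega> * Y \<omega>) \<omega>"
    proof (rule real_cond_exp_mono[OF _ _ i1])
      show "AE \<omega> in M. exp (- q) * indicator ?D \<omega> \<le> indicator ?D \<omega> * Y \<omega>"
        using discount_antimono[of "T _" "ennreal q"] q by (intro AE_I2) (auto simp: indicator_def Y_def discount_ennreal)
    qed (use DM in \<open>simp add: emeasure_eq_measure\<close>)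
    moreover have "AE \<omega> in M. real_cond_exp M (Gt q) (\<lambda>\<omega>. exp (- q) * indicator ?D \<omega>) \<omega> = exp (- q) * indicator ?D \<omega>"
      using D DM by (intro real_cond_exp_F_meas) (auto simp: emeasure_eq_measure)
    moreover have "AE \<omega> in M. real_cond_exp M (Gt q) (\<lambda>\<omega>. indicator ?D \<omega> * Y \<omega>) \<omega> = indicator ?D \<omega> * C q \<omega>"
      unfolding C_def using D i1 by (intro real_cond_exp_mult) auto
    ultimately show ?thesis using AE_space by eventually_elim (auto simp: indicator_def)
  qed
  define D where "D = (\<lambda>p::nat \<times> nat. real (fst p) / 2 ^ snd p)"
  have D0: "0 \<le> D p" for p by (simp add: D_def)
  have "AE \<omega> in M. \<forall>p. ((\<lambda>k. X k (D p) \<omega>) \<longlonglongrightarrow> C (D p) \<omega>) \<and> 0 \<le> C (D p) \<omega> \<and> C (D p) \<omega> \<le> 1 \<and>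
     (T \<omega> < ennreal (D p) \<longrightarrow> exp (- D p) \<le> C (D p) \<omega>)"
    unfolding AE_all_countable
  proof
    fix p
    show "AE \<omega> in M. ((\<lambda>k. X k (D p) \<omega>) \<longlonglongrightarrow> C (D p) \<omega>) \<and> 0 \<le> C (D p) \<omega> \<and> C (D p) \<omega> \<le> 1 \<and>
      (T \<omega> < ennreal (D p) \<longrightarrow> exp (- D p) \<le> C (D p) \<omega>)"
      using XC[OF D0[of p], folded fun_cong[OF C_def]] C01[of "D p"] Cge[OF D0[of p]] by eventually_elim simp
  qed
  \<comment> \<open>On almost every path the conditional expectations at dyadic times extend to a continuous function \<open>Xi\<close>, and \<open>T'\<close> is the time at which it reaches the curve.\<close>
  then have good: "AE \<omega> in M. \<omega> \<in> space M \<and> (\<exists>Xi. continuous_on {0..} Xi \<and> (\<forall>p. Xi (D p) = C (D p) \<omega>) \<and>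
      (\<forall>p. 0 \<le> C (D p) \<omega> \<and> C (D p) \<omega> \<le> 1 \<and> (T \<omega> < ennreal (D p) \<longrightarrow> exp (- D p) \<le> C (D p) \<omega>)) \<and>
      T' \<omega> = hitting_time (\<lambda>t. Xi t - exp (- t)))"
    using Xd AE_space
  proof eventually_elim
    fix \<omega> assume ev: "\<forall>\<^sub>F k in sequentially. \<forall>t\<ge>0. \<bar>X (Suc k) t \<omega> - X k t \<omega>\<bar> \<le> (1 / 2) ^ k" and \<omega>: "\<omega> \<in> space M"
      and p: "\<forall>p. ((\<lambda>k. X k (D p) \<omega>) \<longlonglongrightarrow> C (D p) \<omega>) \<and> 0 \<le> C (D p) \<omega> \<and> C (D p) \<omega> \<le> 1 \<and>
        (T \<omega> < ennreal (D p) \<longrightarrow> exp (- D p) \<le> C (D p) \<omega>)"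
    obtain j where j: "\<And>k t. j \<le> k \<Longrightarrow> 0 \<le> t \<Longrightarrow> \<bar>X (Suc k) t \<omega> - X k t \<omega>\<bar> \<le> (1 / 2) ^ k"
      using ev by (auto simp: eventually_sequentially)
    have lim: "(\<lambda>k. X k t \<omega>) \<longlonglongrightarrow> Z i t \<omega>" if "j \<le> i" "0 \<le> t" for i t
      unfolding Z_def using j that by (intro telescoping_clamped_series[of j "\<lambda>k. X k t \<omega>"]) auto
    have Zeq: "Z i t \<omega> = Z j t \<omega>" if "j \<le> i" "0 \<le> t" for i t
      using LIMSEQ_unique[OF lim[OF that] lim[OF order_refl that(2)]] .
    have "\<tau> i \<omega> = hitting_time (\<lambda>t. Z j t \<omega> - exp (- t))" if "j \<le> i" for i
    proof -
      have "{t. 0 \<le> t \<and> 0 \<le> Z i t \<omega> - exp (- t)} = {t. 0 \<le> t \<and> 0 \<le> Z j t \<omega> - exp (- t)}"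
        using Zeq[OF that] by auto
      then show ?thesis by (simp only: \<tau>_def hitting_time_def)
    qed
    then have "T' \<omega> = hitting_time (\<lambda>t. Z j t \<omega> - exp (- t))"
      unfolding T'_def eventually_sequentially[symmetric] by (intro eventual_value_eq) (unfold eventually_sequentially, blast)
    moreover have "Z j (D q) \<omega> = C (D q) \<omega>" for q
      using LIMSEQ_unique[OF lim[OF order_refl D0[of q]]] p by blast
    ultimately show "\<omega> \<in> space M \<and> (\<exists>Xi. continuous_on {0..} Xi \<and> (\<forall>p. Xi (D p) = C (D p) \<omega>) \<and>
      (\<forall>p. 0 \<le> C (D p) \<omega> \<and> C (D p) \<omega> \<le> 1 \<and> (T \<omega> < ennreal (D p) \<longrightarrow> exp (- D p) \<le> C (D p) \<omega>)) \<and>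
      T' \<omega> = hitting_time (\<lambda>t. Xi t - exp (- t)))"
      using \<omega> Zc[OF \<omega>] p by (intro conjI exI[of _ "\<lambda>t. Z j t \<omega>"]) auto
  qed
  have D_above: "dyadic_above m t = D (nat (\<lfloor>t * 2 ^ m\<rfloor> + 1), m)" if "0 \<le> t" for m t
    using that by (simp add: dyadic_above_def D_def)

  \<comment> \<open>The martingale has reached the curve at time \<open>T\<close>, by continuity from dyadic times after \<open>T\<close>.\<close>
  have T'_le: "AE \<omega> in M. T' \<omega> \<le> T \<omega>"
    using good
  proof eventually_elim
    fix \<omega> assume "\<omega> \<in> space M \<and> (\<exists>Xi. continuous_on {0..} Xi \<and> (\<forall>p. Xi (D p) = C (D p) \<omega>) \<and>
      (\<forall>p. 0 \<le> C (D p) \<omega> \<and> C (D p) \<omega> \<le> 1 \<and> (T \<omega> < ennreal (D p) \<longrightarrow> exp (- D p) \<le> C (D p) \<omega>)) \<and>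
      T' \<omega> = hitting_time (\<lambda>t. Xi t - exp (- t)))"
    then obtain Xi where Xi: "continuous_on {0..} Xi" "\<And>p. Xi (D p) = C (D p) \<omega>"
      "\<And>p. T \<omega> < ennreal (D p) \<Longrightarrow> exp (- D p) \<le> C (D p) \<omega>" "T' \<omega> = hitting_time (\<lambda>t. Xi t - exp (- t))" by blast
    show "T' \<omega> \<le> T \<omega>"
    proof (cases "T \<omega>")
      case (real t)
      have nn: "0 \<le> dyadic_above m t" for m using dyadic_above_bounds(1)[of t m] real by simp
      have "exp (- dyadic_above m t) \<le> Xi (dyadic_above m t)" for m
      proof -
        have "T \<omega> < ennreal (dyadic_above m t)" using real dyadic_above_bounds(1)[of t m] by (simp add: ennreal_less_iff)
        then show ?thesis using Xi(2,3) real D_above by metis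
      qed
      moreover have "(\<lambda>m. Xi (dyadic_above m t)) \<longlonglongrightarrow> Xi t"
        using real nn by (intro continuous_on_tendsto_right[OF Xi(1)] dyadic_above_tendsto) auto
      moreover have "(\<lambda>m. exp (- dyadic_above m t)) \<longlonglongrightarrow> exp (- t)" by (intro tendsto_intros dyadic_above_tendsto)
      ultimately have "exp (- t) \<le> Xi t" by (intro LIMSEQ_le) auto
      then have "hitting_time (\<lambda>t. Xi t - exp (- t)) \<le> ennreal t"
        using real Xi(1) by (subst hitting_time_le_iff) (auto intro!: continuous_intros bexI[of _ t])
      then show ?thesis using Xi(4) real by simp
    qed simp
  qed

  \<comment> \<open>Optional stopping at \<open>T'\<close>: its approximation \<open>S m\<close> from above by dyadic times uses the conditional expectations directly. The value of the martingale at \<open>T'\<close> is that of the curve. The truncation at \<open>N\<close> keeps the sums finite.\<close>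
  have stop: "expectation (\<lambda>\<omega>. indicator {\<omega>\<in>space M. T' \<omega> < of_nat N} \<omega> * Y \<omega>) =
     expectation (\<lambda>\<omega>. indicator {\<omega>\<in>space M. T' \<omega> < of_nat N} \<omega> * discount (T' \<omega>))" for N
  proof -
    let ?I = "{\<omega>\<in>space M. T' \<omega> < of_nat N}"
    define A where "A = (\<lambda>m i. {\<omega>\<in>space M. ennreal (real i / 2 ^ m) \<le> T' \<omega> \<and> T' \<omega> < ennreal (real (Suc i) / 2 ^ m)})"
    define S where "S = (\<lambda>m \<omega>. \<Sum>i<N * 2 ^ m. indicator (A m i) \<omega> * C (real (Suc i) / 2 ^ m) \<omega>)"
    have AG: "A m i \<in> sets (Gt (real (Suc i) / 2 ^ m))" for m i
    proof -
      let ?q = "ennreal (real (Suc i) / 2 ^ m)" and ?r = "ennreal (real i / 2 ^ m)"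
      have le: "?r \<le> ?q" by (intro ennreal_leI divide_right_mono) auto
      have "{\<omega>\<in>space M. T' \<omega> < ?q} \<in> sets (G ?q)" "{\<omega>\<in>space M. T' \<omega> < ?r} \<in> sets (G ?q)"
        using stopping_time_less_G[OF T'] sets_F_mono[OF le] by auto
      then have "{\<omega>\<in>space M. T' \<omega> < ?q} - {\<omega>\<in>space M. T' \<omega> < ?r} \<in> sets (G ?q)" by (rule sets.Diff)
      also have "{\<omega>\<in>space M. T' \<omega> < ?q} - {\<omega>\<in>space M. T' \<omega> < ?r} = A m i" by (auto simp: A_def)
      finally show ?thesis .
    qed
    have AM: "A m i \<in> sets M" for m i using AG sets_G_subset by blast
    have key: "indicator (A m i) \<omega> = (of_bool (i = nat \<lfloor>t * 2 ^ m\<rfloor>) :: real)" if \<omega>: "\<omega> \<in> space M" and t: "T' \<omega> = ennreal t" "0 \<le> t" for m i \<omega> t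
    proof -
      have "\<omega> \<in> A m i \<longleftrightarrow> real i / 2 ^ m \<le> t \<and> t < real (Suc i) / 2 ^ m"
        using \<omega> t by (auto simp: A_def ennreal_less_iff simp del: of_nat_Suc)
      also have "\<dots> \<longleftrightarrow> real i \<le> t * 2 ^ m \<and> t * 2 ^ m < real i + 1" by (auto simp: field_simps)
      also have "\<dots> \<longleftrightarrow> \<lfloor>t * 2 ^ m\<rfloor> = int i" by (subst floor_eq_iff) auto
      also have "\<dots> \<longleftrightarrow> i = nat \<lfloor>t * 2 ^ m\<rfloor>" using t(2) by auto
      finally show ?thesis by (simp add: indicator_def)
    qed
    have less_iff: "T' \<omega> < of_nat N \<longleftrightarrow> nat \<lfloor>t * 2 ^ m\<rfloor> < N * 2 ^ m" if t: "T' \<omega> = ennreal t" "0 \<le> t" for m \<omega> t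
    proof -
      have "T' \<omega> < of_nat N \<longleftrightarrow> t < real N" unfolding t(1) ennreal_of_nat_eq_real_of_nat by (rule ennreal_less_iff[OF t(2)])
      also have "\<dots> \<longleftrightarrow> t * 2 ^ m < real_of_int (int (N * 2 ^ m))" by simp
      also have "\<dots> \<longleftrightarrow> \<lfloor>t * 2 ^ m\<rfloor> < int (N * 2 ^ m)" by (rule floor_less_iff[symmetric])
      also have "\<dots> \<longleftrightarrow> nat \<lfloor>t * 2 ^ m\<rfloor> < N * 2 ^ m" using t(2) by (simp add: nat_less_iff)
      finally show ?thesis .
    qed
    have S_eq: "S m \<omega> = indicator ?I \<omega> * C (dyadic_above m t) \<omega>" if \<omega>: "\<omega> \<in> space M" and t: "T' \<omega> = ennreal t" "0 \<le> t" for m \<omega> t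
    proof -
      let ?i = "nat \<lfloor>t * 2 ^ m\<rfloor>"
      have "S m \<omega> = (\<Sum>i<N * 2 ^ m. if i = ?i then C (real (Suc i) / 2 ^ m) \<omega> else 0)"
        unfolding S_def key[OF \<omega> t] by (intro sum.cong) auto
      also have "\<dots> = (if ?i < N * 2 ^ m then C (real (Suc ?i) / 2 ^ m) \<omega> else 0)"
        by (subst sum.delta) auto
      also have "real (Suc ?i) / 2 ^ m = dyadic_above m t" using t(2) by (simp add: dyadic_above_def)
      finally show ?thesis using \<omega> less_iff[OF t, of m] by (simp add: indicator_def)
    qed
    have S_inf: "S m \<omega> = 0" "indicator ?I \<omega> = (0::real)" if "T' \<omega> = \<infinity>" for m \<omega>
      using that by (auto simp: S_def A_def indicator_def)
    have int_eq: "expectation (S m) = expectation (\<lambda>\<omega>. indicator ?I \<omega> * Y \<omega>)" for m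
    proof -
      have i: "integrable M (\<lambda>\<omega>. indicator (A m i) \<omega> * Y \<omega>)" for i
        using AM Yb by (intro bounded_mult_integrable[where C=1 and D=1]) (auto simp: indicator_def)
      have c: "integrable M (\<lambda>\<omega>. indicator (A m i) \<omega> * C (real (Suc i) / 2 ^ m) \<omega>)"
        "expectation (\<lambda>\<omega>. indicator (A m i) \<omega> * C (real (Suc i) / 2 ^ m) \<omega>) = expectation (\<lambda>\<omega>. indicator (A m i) \<omega> * Y \<omega>)" for i
      proof -
        interpret sigma_finite_subalgebra M "Gt (real (Suc i) / 2 ^ m)" by (rule sigma_finite_subalgebra_Gt)
        have "indicator (A m i) \<in> borel_measurable (Gt (real (Suc i) / 2 ^ m))" using AG by simp
        from real_cond_exp_intg[OF i this YM]
        show "integrable M (\<lambda>\<omega>. indicator (A m i) \<omega> * C (real (Suc i) / 2 ^ m) \<omega>)"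
          "expectation (\<lambda>\<omega>. indicator (A m i) \<omega> * C (real (Suc i) / 2 ^ m) \<omega>) = expectation (\<lambda>\<omega>. indicator (A m i) \<omega> * Y \<omega>)"
          by (simp_all add: C_def)
      qed
      have "expectation (S m) = (\<Sum>i<N * 2 ^ m. expectation (\<lambda>\<omega>. indicator (A m i) \<omega> * Y \<omega>))"
        unfolding S_def by (subst Bochner_Integration.integral_sum) (auto simp only: c)
      also have "\<dots> = expectation (\<lambda>\<omega>. \<Sum>i<N * 2 ^ m. indicator (A m i) \<omega> * Y \<omega>)"
        using i by (subst Bochner_Integration.integral_sum) auto
      also have "\<dots> = expectation (\<lambda>\<omega>. indicator ?I \<omega> * Y \<omega>)"
      proof (intro Bochner_Integration.integral_cong refl)
        fix \<omega> assume \<omega>: "\<omega> \<in> space M"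
        show "(\<Sum>i<N * 2 ^ m. indicator (A m i) \<omega> * Y \<omega>) = indicator ?I \<omega> * Y \<omega>"
        proof (cases "T' \<omega>")
          case (real t)
          have "(\<Sum>i<N * 2 ^ m. indicator (A m i) \<omega> * Y \<omega>) = (\<Sum>i<N * 2 ^ m. if i = nat \<lfloor>t * 2 ^ m\<rfloor> then Y \<omega> else 0)"
            unfolding key[OF \<omega> real(2,1)] by (intro sum.cong) auto
          then show ?thesis using \<omega> less_iff[OF real(2,1), of m] by (simp add: indicator_def)
        next
          case top
          then show ?thesis by (simp add: A_def indicator_def)
        qed
      qed
      finally show ?thesis .
    qed
    have "(\<lambda>m. expectation (S m)) \<longlonglongrightarrow> expectation (\<lambda>\<omega>. indicator ?I \<omega> * discount (T' \<omega>))"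
    proof (rule integral_dominated_convergence[where w="\<lambda>_. 1"])
      show "(\<lambda>\<omega>. indicator ?I \<omega> * discount (T' \<omega>)) \<in> borel_measurable M" by measurable
      show "S m \<in> borel_measurable M" for m unfolding S_def using AM by measurable
      show "AE \<omega> in M. norm (S m \<omega>) \<le> 1" for m
        using good
      proof eventually_elim
        fix \<omega> assume "\<omega> \<in> space M \<and> (\<exists>Xi. continuous_on {0..} Xi \<and> (\<forall>p. Xi (D p) = C (D p) \<omega>) \<and>
          (\<forall>p. 0 \<le> C (D p) \<omega> \<and> C (D p) \<omega> \<le> 1 \<and> (T \<omega> < ennreal (D p) \<longrightarrow> exp (- D p) \<le> C (D p) \<omega>)) \<and>
          T' \<omega> = hitting_time (\<lambda>t. Xi t - exp (- t)))"
        then have \<omega>: "\<omega> \<in> space M" and c: "\<And>p. 0 \<le> C (D p) \<omega> \<and> C (D p) \<omega> \<le> 1" by auto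
        show "norm (S m \<omega>) \<le> 1"
        proof (cases "T' \<omega>")
          case (real t)
          then show ?thesis using c[of "(nat (\<lfloor>t * 2 ^ m\<rfloor> + 1), m)"] unfolding S_eq[OF \<omega> real(2,1)] D_above[OF real(1)]
            by (auto simp: indicator_def)
        qed (simp add: S_inf)
      qed
      show "AE \<omega> in M. (\<lambda>m. S m \<omega>) \<longlonglongrightarrow> indicator ?I \<omega> * discount (T' \<omega>)"
        using good T'_le
      proof eventually_elim
        fix \<omega> assume "\<omega> \<in> space M \<and> (\<exists>Xi. continuous_on {0..} Xi \<and> (\<forall>p. Xi (D p) = C (D p) \<omega>) \<and>
          (\<forall>p. 0 \<le> C (D p) \<omega> \<and> C (D p) \<omega> \<le> 1 \<and> (T \<omega> < ennreal (D p) \<longrightarrow> exp (- D p) \<le> C (D p) \<omega>)) \<and>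
          T' \<omega> = hitting_time (\<lambda>t. Xi t - exp (- t)))"
          and "T' \<omega> \<le> T \<omega>"
        then obtain Xi where Xi: "continuous_on {0..} Xi" "\<And>p. Xi (D p) = C (D p) \<omega>" and h: "T' \<omega> = hitting_time (\<lambda>t. Xi t - exp (- t))"
          and \<omega>: "\<omega> \<in> space M" and Cge: "\<And>p. T \<omega> < ennreal (D p) \<Longrightarrow> exp (- D p) \<le> C (D p) \<omega>" by blast
        show "(\<lambda>m. S m \<omega>) \<longlonglongrightarrow> indicator ?I \<omega> * discount (T' \<omega>)"
        proof (cases "T' \<omega>")
          case (real t)
          have nn: "0 \<le> dyadic_above m t" for m using dyadic_above_bounds(1)[of t m] real by simp
          have S': "S m \<omega> = indicator ?I \<omega> * Xi (dyadic_above m t)" for m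
            unfolding S_eq[OF \<omega> real(2,1)] D_above[OF real(1)] Xi(2) ..
          have "(\<lambda>m. Xi (dyadic_above m t)) \<longlonglongrightarrow> Xi t"
            using real nn by (intro continuous_on_tendsto_right[OF Xi(1)] dyadic_above_tendsto) auto
          then have "(\<lambda>m. S m \<omega>) \<longlonglongrightarrow> indicator ?I \<omega> * Xi t" unfolding S' by (intro tendsto_intros)
          moreover have "Xi t = discount (T' \<omega>)"
          proof -
            have cc: "continuous_on {0..} (\<lambda>t. Xi t - exp (- t))" using Xi(1) by (intro continuous_intros)
            have ht: "hitting_time (\<lambda>t. Xi t - exp (- t)) = ennreal t" unfolding h[symmetric] by (rule real(2))
            have fin: "hitting_time (\<lambda>t. Xi t - exp (- t)) < \<infinity>" unfolding ht by simp
            obtain s where s: "0 \<le> s" "hitting_time (\<lambda>t. Xi t - exp (- t)) = ennreal s" "0 \<le> Xi s - exp (- s)"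
              using hitting_time_attained[OF cc fin] by blast
            have "s = t" using s(1,2) real(1) unfolding ht by simp
            have "Xi 0 = C (D (0, 0)) \<omega>" using Xi(2)[of "(0, 0)"] by (simp add: D_def)
            then have "Xi 0 \<le> 1" using \<open>\<omega> \<in> space M \<and> _\<close> by auto
            then have "Xi t - exp (- t) \<le> 0"
              using nonpos_until_hitting_time[OF cc, of t] real(1) unfolding ht by simp
            then show ?thesis using s \<open>s = t\<close> real by (simp add: discount_ennreal)
          qed
          ultimately show ?thesis by simp
        qed (simp add: S_inf)
      qed
    qed simp
    then have "(\<lambda>m. expectation (\<lambda>\<omega>. indicator ?I \<omega> * Y \<omega>)) \<longlonglongrightarrow> expectation (\<lambda>\<omega>. indicator ?I \<omega> * discount (T' \<omega>))"
      unfolding int_eq .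
    then show ?thesis by (simp add: LIMSEQ_const_iff)
  qed
  \<comment> \<open>Since \<open>T' \<le> T\<close>, the difference of the two sides has a sign, and its expectation vanishes by \<open>stop\<close>.\<close>
  have "AE \<omega> in M. \<forall>N. T' \<omega> < of_nat N \<longrightarrow> Y \<omega> = discount (T' \<omega>)"
    unfolding AE_all_countable
  proof
    fix N :: nat
    let ?I = "{\<omega>\<in>space M. T' \<omega> < of_nat N}"
    let ?f = "\<lambda>\<omega>. indicator ?I \<omega> * discount (T' \<omega>) - indicator ?I \<omega> * Y \<omega>"
    have i1: "integrable M (\<lambda>\<omega>. indicator ?I \<omega> * discount (T' \<omega>))"
      using discount_bounds by (intro bounded_mult_integrable[where C=1 and D=1]) (auto simp: indicator_def)
    have i2: "integrable M (\<lambda>\<omega>. indicator ?I \<omega> * Y \<omega>)"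
      using Yb by (intro bounded_mult_integrable[where C=1 and D=1]) (auto simp: indicator_def)
    have nonneg: "AE \<omega> in M. 0 \<le> ?f \<omega>"
      using T'_le by eventually_elim (auto simp: indicator_def Y_def intro: discount_antimono)
    have "expectation ?f = 0" using i1 i2 stop[of N] by simp
    then have "AE \<omega> in M. ?f \<omega> = 0"
      using integral_nonneg_eq_0_iff_AE[OF _ nonneg] i1 i2 by auto
    then show "AE \<omega> in M. T' \<omega> < of_nat N \<longrightarrow> Y \<omega> = discount (T' \<omega>)"
      using AE_space by eventually_elim (auto simp: indicator_def)
  qed
  then have "AE \<omega> in M. T' \<omega> = T \<omega>"
    using T'_le
  proof eventually_elim
    fix \<omega> assume N: "\<forall>N. T' \<omega> < of_nat N \<longrightarrow> Y \<omega> = discount (T' \<omega>)" and le: "T' \<omega> \<le> T \<omega>"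
    show "T' \<omega> = T \<omega>"
    proof (rule ccontr)
      assume "T' \<omega> \<noteq> T \<omega>"
      then have less: "T' \<omega> < T \<omega>" using le by simp
      then have "T' \<omega> < \<infinity>" by (rule less_le_trans) simp
      then obtain N :: nat where "T' \<omega> < of_nat N" using ennreal_Ex_less_of_nat by auto
      then have "Y \<omega> = discount (T' \<omega>)" using N by blast
      then show False using discount_strict[OF less] by (simp add: Y_def)
    qed
  qed
  then show ?thesis using T' by blast
qed

end

section \<open>Compactness of stopping times\<close>

text \<open>A cluster point of the sequence in the product space yields a filter along which all
  coordinates converge at once. Passing to a filter instead of a subsequence allows arbitrarily
  many coordinates.\<close>

lemma simultaneous_limits:
  fixes p :: "nat \<Rightarrow> 'i \<Rightarrow> real"
  assumes p: "\<And>n i. p n i \<in> {0..1}"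
  shows "\<exists>\<U> L. \<U> \<le> sequentially \<and> \<U> \<noteq> bot \<and> (\<forall>i. ((\<lambda>n. p n i) \<longlongrightarrow> L i) \<U>)"
proof -
  let ?K = "PiE UNIV (\<lambda>_. {0..1}) :: ('i \<Rightarrow> real) set"
  have "compactin (product_topology (\<lambda>_. euclidean) UNIV) ?K" by (subst compactin_PiE) auto
  then have "compact ?K" by (simp add: euclidean_product_topology)
  moreover have "filtermap p sequentially \<noteq> bot" by (simp add: filtermap_bot_iff)
  moreover have "eventually (\<lambda>x. x \<in> ?K) (filtermap p sequentially)"
  proof -
    have "p n \<in> ?K" for n using p by (simp add: PiE_UNIV_domain)
    then show ?thesis by (simp only: eventually_filtermap eventually_True)
  qed
  ultimately obtain x where x: "inf (nhds x) (filtermap p sequentially) \<noteq> bot"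
    unfolding compact_filter by blast
  define \<U> where "\<U> = inf sequentially (filtercomap p (nhds x))"
  have "\<U> \<noteq> bot"
  proof
    assume "\<U> = bot"
    then have "eventually (\<lambda>_. False) \<U>" by simp
    then obtain P Q where P: "eventually P sequentially" and Q: "eventually Q (filtercomap p (nhds x))" and PQ: "\<And>n. P n \<Longrightarrow> Q n \<Longrightarrow> False"
      unfolding \<U>_def eventually_inf by blast
    obtain R where R: "eventually R (nhds x)" "\<And>n. R (p n) \<Longrightarrow> Q n" using Q unfolding eventually_filtercomap by blast
    have "eventually (\<lambda>y. \<exists>n. P n \<and> y = p n) (filtermap p sequentially)"
      unfolding eventually_filtermap using P by eventually_elim blast
    then have "eventually (\<lambda>_. False) (inf (nhds x) (filtermap p sequentially))"
      unfolding eventually_inf using R PQ by (intro exI[of _ R] exI[of _ "\<lambda>y. \<exists>n. P n \<and> y = p n"]) blast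
    then show False using x by (simp add: trivial_limit_def)
  qed
  moreover have "\<U> \<le> sequentially" by (simp add: \<U>_def)
  moreover have "((\<lambda>n. p n i) \<longlongrightarrow> x i) \<U>" for i
  proof -
    have "filterlim p (nhds x) \<U>" unfolding \<U>_def by (rule filterlim_mono[OF filterlim_filtercomap]) auto
    show ?thesis
    proof (rule topological_tendstoI)
      fix S :: "real set" assume S: "open S" "x i \<in> S"
      have "open ((\<lambda>y. y i) -` S)" by (rule open_vimage[OF S(1) continuous_on_product_coordinates])
      then have "\<forall>\<^sub>F y in nhds x. y \<in> (\<lambda>y. y i) -` S" using S(2) by (intro eventually_nhds_in_open) auto
      then have "\<forall>\<^sub>F n in \<U>. p n \<in> (\<lambda>y. y i) -` S" using \<open>filterlim p (nhds x) \<U>\<close> by (rule eventually_compose_filterlim)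
      then show "\<forall>\<^sub>F n in \<U>. p n i \<in> S" by simp
    qed
  qed
  ultimately show ?thesis by blast
qed

context brownian_basis
begin

text \<open>Weak convergence of the bounded functions \<open>W n\<close> to \<open>W0\<close>, tested against one function \<open>f\<close>. As a
  property of \<open>f\<close> it is closed in mean.\<close>

definition tested_limit :: "nat filter \<Rightarrow> (nat \<Rightarrow> 'a \<Rightarrow> real) \<Rightarrow> ('a \<Rightarrow> real) \<Rightarrow> ('a \<Rightarrow> real) \<Rightarrow> bool" where
  "tested_limit \<U> W W0 f \<longleftrightarrow> integrable M f \<and>
    ((\<lambda>n. expectation (\<lambda>\<omega>. f \<omega> * W n \<omega>)) \<longlongrightarrow> expectation (\<lambda>\<omega>. f \<omega> * W0 \<omega>)) \<U>"

lemma tested_limit_integrable: "tested_limit \<U> W W0 f \<Longrightarrow> integrable M f"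
  by (simp add: tested_limit_def)

lemma tested_limit_closed:
  assumes W: "\<And>n. W n \<in> borel_measurable M" "\<And>n \<omega>. \<bar>W n \<omega>\<bar> \<le> 1"
    and W0: "W0 \<in> borel_measurable M" "\<And>\<omega>. \<bar>W0 \<omega>\<bar> \<le> 1"
  shows "tested_limit \<U> W W0 f \<Longrightarrow> tested_limit \<U> W W0 g \<Longrightarrow> tested_limit \<U> W W0 (\<lambda>\<omega>. f \<omega> + g \<omega>)"
    and "tested_limit \<U> W W0 f \<Longrightarrow> tested_limit \<U> W W0 (\<lambda>\<omega>. c * f \<omega>)"
    and "f \<in> borel_measurable M \<Longrightarrow> (\<And>\<omega>. \<omega> \<in> space M \<Longrightarrow> \<bar>f \<omega>\<bar> \<le> C) \<Longrightarrow>
      (\<And>e. 0 < e \<Longrightarrow> \<exists>g. tested_limit \<U> W W0 g \<and> expectation (\<lambda>\<omega>. \<bar>f \<omega> - g \<omega>\<bar>) < e) \<Longrightarrow> tested_limit \<U> W W0 f"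
proof -
  have i: "integrable M (\<lambda>\<omega>. f \<omega> * V \<omega>)" if "integrable M f" "V \<in> borel_measurable M" "\<And>\<omega>. \<bar>V \<omega>\<bar> \<le> 1" for f V :: "'a \<Rightarrow> real"
    using that by (intro Bochner_Integration.integrable_bound[OF that(1)]) (auto simp: abs_mult intro!: mult_right_le_one_le)
  show "tested_limit \<U> W W0 (\<lambda>\<omega>. f \<omega> + g \<omega>)" if f: "tested_limit \<U> W W0 f" and g: "tested_limit \<U> W W0 g"
  proof -
    have fi: "integrable M f" "integrable M g" using f g by (auto simp: tested_limit_def)
    have "((\<lambda>n. expectation (\<lambda>\<omega>. f \<omega> * W n \<omega>) + expectation (\<lambda>\<omega>. g \<omega> * W n \<omega>)) \<longlongrightarrow>
       expectation (\<lambda>\<omega>. f \<omega> * W0 \<omega>) + expectation (\<lambda>\<omega>. g \<omega> * W0 \<omega>)) \<U>"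
      using f g by (auto simp: tested_limit_def intro: tendsto_add)
    then show ?thesis using fi i[OF fi(1) W] i[OF fi(2) W] i[OF fi(1) W0] i[OF fi(2) W0]
      by (simp add: tested_limit_def distrib_right)
  qed
  show "tested_limit \<U> W W0 (\<lambda>\<omega>. c * f \<omega>)" if f: "tested_limit \<U> W W0 f"
    using f by (auto simp: tested_limit_def mult.assoc intro: tendsto_mult_left)
  show "tested_limit \<U> W W0 f" if fm: "f \<in> borel_measurable M" and b: "\<And>\<omega>. \<omega> \<in> space M \<Longrightarrow> \<bar>f \<omega>\<bar> \<le> C"
    and lim: "\<And>e. 0 < e \<Longrightarrow> \<exists>g. tested_limit \<U> W W0 g \<and> expectation (\<lambda>\<omega>. \<bar>f \<omega> - g \<omega>\<bar>) < e"
  proof -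
    have fi: "integrable M f" using fm b by (rule bounded_integrable)
    have "((\<lambda>n. expectation (\<lambda>\<omega>. f \<omega> * W n \<omega>)) \<longlongrightarrow> expectation (\<lambda>\<omega>. f \<omega> * W0 \<omega>)) \<U>"
    proof (rule tendstoI)
      fix e :: real assume e: "0 < e"
      then obtain g where g: "tested_limit \<U> W W0 g" "expectation (\<lambda>\<omega>. \<bar>f \<omega> - g \<omega>\<bar>) < e / 3"
        using lim[of "e / 3"] by auto
      have gi: "integrable M g" using g by (simp add: tested_limit_def)
      have close: "\<bar>expectation (\<lambda>\<omega>. f \<omega> * V \<omega>) - expectation (\<lambda>\<omega>. g \<omega> * V \<omega>)\<bar> < e / 3"
        if V: "V \<in> borel_measurable M" "\<And>\<omega>. \<bar>V \<omega>\<bar> \<le> 1" for V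
      proof -
        have "\<bar>expectation (\<lambda>\<omega>. f \<omega> * V \<omega>) - expectation (\<lambda>\<omega>. g \<omega> * V \<omega>)\<bar> = \<bar>expectation (\<lambda>\<omega>. f \<omega> * V \<omega> - g \<omega> * V \<omega>)\<bar>"
          using i[OF fi V] i[OF gi V] by simp
        also have "\<dots> \<le> expectation (\<lambda>\<omega>. \<bar>f \<omega> * V \<omega> - g \<omega> * V \<omega>\<bar>)" by (rule integral_abs_bound)
        also have "\<dots> \<le> expectation (\<lambda>\<omega>. \<bar>f \<omega> - g \<omega>\<bar>)"
        proof (rule integral_mono)
          show "\<bar>f \<omega> * V \<omega> - g \<omega> * V \<omega>\<bar> \<le> \<bar>f \<omega> - g \<omega>\<bar>" for \<omega>
            using V(2)[of \<omega>] by (simp add: abs_mult mult_right_le_one_le flip: left_diff_distrib)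
        qed (use fi gi i[OF fi V] i[OF gi V] in auto)
        finally show ?thesis using g(2) by simp
      qed
      have "\<forall>\<^sub>F n in \<U>. dist (expectation (\<lambda>\<omega>. g \<omega> * W n \<omega>)) (expectation (\<lambda>\<omega>. g \<omega> * W0 \<omega>)) < e / 3"
        using g(1) e unfolding tested_limit_def by (intro tendstoD) auto
      then show "\<forall>\<^sub>F n in \<U>. dist (expectation (\<lambda>\<omega>. f \<omega> * W n \<omega>)) (expectation (\<lambda>\<omega>. f \<omega> * W0 \<omega>)) < e"
      proof eventually_elim
        case (elim n)
        then show ?case using close[OF W(1,2), of n] close[OF W0] unfolding dist_real_def by linarith
      qed
    qed
    then show ?thesis using fi by (simp add: tested_limit_def)
  qed
qed

lemma tested_limit_sets:
  assumes W: "\<And>n. W n \<in> borel_measurable M" "\<And>n \<omega>. \<bar>W n \<omega>\<bar> \<le> 1"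
    and W0: "W0 \<in> borel_measurable M" "\<And>\<omega>. \<bar>W0 \<omega>\<bar> \<le> 1"
    and lim: "\<And>E. E \<in> sets (info I) \<Longrightarrow> ((\<lambda>n. expectation (\<lambda>\<omega>. indicator E \<omega> * W n \<omega>)) \<longlongrightarrow> expectation (\<lambda>\<omega>. indicator E \<omega> * W0 \<omega>)) \<U>"
    and f: "f \<in> borel_measurable (info I)" "\<And>\<omega>. \<omega> \<in> space M \<Longrightarrow> \<bar>f \<omega>\<bar> \<le> C"
  shows "tested_limit \<U> W W0 f"
proof (rule L1_closed_class[where V="tested_limit \<U> W W0" and \<G>="sets (info I)",
      OF _ _ tested_limit_integrable _ tested_limit_closed[where W=W and ?W0.0=W0, OF W W0] _ _ f(2)])
  have sub: "sets (info I) \<subseteq> sets M" using subalgebra_info by (simp add: subalgebra_def)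
  show "sets (info I) \<subseteq> sets M" by (rule sub)
  show "Int_stable (sets (info I))" by (auto simp: Int_stable_def)
  show basic: "tested_limit \<U> W W0 (indicator A)" if "A \<in> sets (info I)" for A
    using lim[OF that] that sub unfolding tested_limit_def by (auto simp: emeasure_eq_measure)
  have "tested_limit \<U> W W0 (indicator (space M))" using basic[of "space M"] sets.top[of "info I"] by (simp add: space_info)
  then show "tested_limit \<U> W W0 (\<lambda>_. 1)"
    unfolding tested_limit_def by (simp cong: Bochner_Integration.integral_cong)
  have "borel_measurable (sigma (space M) (sets (info I))) = (borel_measurable (info I) :: ('a \<Rightarrow> real) set)"
    by (rule measurable_cong_sets) (auto simp: sets.sigma_sets_eq[of "info I", unfolded space_info] sets.space_closed[of "info I", unfolded space_info])
  then show "f \<in> borel_measurable (sigma (space M) (sets (info I)))" using f(1) by simp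
qed

lemma tested_limit_cylinders:
  assumes W: "\<And>n. W n \<in> borel_measurable M" "\<And>n \<omega>. \<bar>W n \<omega>\<bar> \<le> 1"
    and W0: "W0 \<in> borel_measurable M" "\<And>\<omega>. \<bar>W0 \<omega>\<bar> \<le> 1"
    and prod: "\<And>J c k. finite J \<Longrightarrow> J \<subseteq> I \<Longrightarrow> tested_limit \<U> W W0 (\<lambda>\<omega>. \<Prod>t\<in>J. ramp k (c t) (coord t \<omega>))"
    and f: "f \<in> borel_measurable (info I)" "\<And>\<omega>. \<omega> \<in> space M \<Longrightarrow> \<bar>f \<omega>\<bar> \<le> C"
  shows "tested_limit \<U> W W0 f"
  by (rule L1_closed_class_info[where V="tested_limit \<U> W W0" and I=I,
      OF tested_limit_integrable tested_limit_closed[where W=W and ?W0.0=W0, OF W W0] prod f])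

text \<open>Domination by the probability turns finite additivity into countable additivity and gives
  absolute continuity, so that Radon-Nikodym applies.\<close>

lemma dominated_additive_density:
  fixes L :: "'a set \<Rightarrow> real"
  assumes F: "subalgebra M F" and L0: "\<And>E. E \<in> sets F \<Longrightarrow> 0 \<le> L E \<and> L E \<le> prob E"
    and add: "\<And>E E'. E \<in> sets F \<Longrightarrow> E' \<in> sets F \<Longrightarrow> E \<inter> E' = {} \<Longrightarrow> L (E \<union> E') = L E + L E'"
  shows "\<exists>A. A \<in> borel_measurable F \<and> (\<forall>\<omega>. 0 \<le> A \<omega> \<and> A \<omega> \<le> 1) \<and>
    (\<forall>E\<in>sets F. expectation (\<lambda>\<omega>. indicator E \<omega> * A \<omega>) = L E)"
proof -
  have FM: "sets F \<subseteq> sets M" and sF: "space F = space M" using F by (auto simp: subalgebra_def)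
  have empty: "L {} = 0" using L0[of "{}"] by simp
  have fin: "L (\<Union>i<n. A i) = (\<Sum>i<n. L (A i))" if A: "range A \<subseteq> sets F" and dis: "disjoint_family A" for A and n :: nat
  proof (induction n)
    case (Suc n)
    have d: "A n \<inter> A i = {}" if "i < n" for i
      by (rule disjoint_family_onD[OF dis]) (use that in auto)
    have "L (A n \<union> (\<Union>i<n. A i)) = L (A n) + L (\<Union>i<n. A i)"
    proof (rule add)
      show "(\<Union>i<n. A i) \<in> sets F" using A by (intro sets.finite_UN) auto
      show "A n \<inter> (\<Union>i<n. A i) = {}" using d by blast
      show "A n \<in> sets F" using A by auto
    qed
    moreover have "(\<Union>i<Suc n. A i) = A n \<union> (\<Union>i<n. A i)" unfolding lessThan_Suc by blast
    ultimately show ?case using Suc.IH unfolding sum.lessThan_Suc by (simp only: add.commute[of "L (A n)"])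
  next
    case 0
    show ?case using empty by simp
  qed
  have ca: "countably_additive (sets F) (\<lambda>E. ennreal (L E))"
  proof (rule countably_additiveI)
    fix A :: "nat \<Rightarrow> 'a set" assume A: "range A \<subseteq> sets F" "disjoint_family A" and U: "\<Union>(range A) \<in> sets F"
    have AF: "A i \<in> sets F" for i using A by auto
    have "(\<lambda>n. prob (\<Union>i<n. A i)) \<longlonglongrightarrow> prob (\<Union>n. \<Union>i<n. A i)"
    proof (rule finite_Lim_measure_incseq)
      show "range (\<lambda>n. \<Union>i<n. A i) \<subseteq> sets M" using AF FM by auto
      show "incseq (\<lambda>n. \<Union>i<n. A i)" by (intro incseq_SucI) (auto simp: less_Suc_eq)
    qed
    moreover have "(\<Union>n. \<Union>i<n. A i) = \<Union>(range A)" by auto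
    ultimately have p: "(\<lambda>n. prob (\<Union>i<n. A i)) \<longlonglongrightarrow> prob (\<Union>(range A))" by simp
    have le: "L (\<Union>(range A)) - (prob (\<Union>(range A)) - prob (\<Union>i<n. A i)) \<le> (\<Sum>i<n. L (A i))" "(\<Sum>i<n. L (A i)) \<le> L (\<Union>(range A))" for n
    proof -
      let ?X = "\<Union>i<n. A i" and ?Y = "\<Union>(range A) - (\<Union>i<n. A i)"
      have X: "?X \<in> sets F" and Y: "?Y \<in> sets F" using AF U by auto
      have "L (?X \<union> ?Y) = L ?X + L ?Y" using X Y by (intro add) auto
      moreover have "?X \<union> ?Y = \<Union>(range A)" by auto
      moreover have "prob ?Y = prob (\<Union>(range A)) - prob ?X"
        using X U FM by (intro finite_measure_Diff) auto
      ultimately show "L (\<Union>(range A)) - (prob (\<Union>(range A)) - prob (\<Union>i<n. A i)) \<le> (\<Sum>i<n. L (A i))"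
        "(\<Sum>i<n. L (A i)) \<le> L (\<Union>(range A))" using L0[OF Y] fin[OF A, of n] by auto
    qed
    have "(\<lambda>n. \<Sum>i<n. L (A i)) \<longlonglongrightarrow> L (\<Union>(range A))"
    proof (rule tendsto_sandwich)
      have "(\<lambda>n. L (\<Union>(range A)) - (prob (\<Union>(range A)) - prob (\<Union>i<n. A i))) \<longlonglongrightarrow> L (\<Union>(range A)) - (prob (\<Union>(range A)) - prob (\<Union>(range A)))"
        by (intro tendsto_intros p)
      then show "(\<lambda>n. L (\<Union>(range A)) - (prob (\<Union>(range A)) - prob (\<Union>i<n. A i))) \<longlonglongrightarrow> L (\<Union>(range A))" by simp
    qed (use le in auto)
    then have "(\<lambda>i. L (A i)) sums L (\<Union>(range A))" by (simp add: sums_def)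
    then show "(\<Sum>i. ennreal (L (A i))) = ennreal (L (\<Union>(range A)))"
      using L0[OF AF] by (intro suminf_ennreal_eq) auto
  qed
  define N where "N = measure_of (space F) (sets F) (\<lambda>E. ennreal (L E))"
  have sN: "sets N = sets F" unfolding N_def by simp
  have eN: "emeasure N E = ennreal (L E)" if "E \<in> sets F" for E
    unfolding N_def by (rule emeasure_measure_of_sigma) (use ca that empty in \<open>auto simp: positive_def intro: sets.sigma_algebra_axioms\<close>)
  let ?P = "restr_to_subalg M F"
  interpret P: finite_measure ?P by (rule finite_measure_restr_to_subalg[OF F]) (rule finite_measure_axioms)
  have eP: "emeasure ?P E = ennreal (prob E)" if "E \<in> sets F" for E
    using emeasure_restr_to_subalg[OF F that] by (simp add: emeasure_eq_measure)
  have sP: "sets ?P = sets F" by (rule sets_restr_to_subalg[OF F])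
  have ac: "absolutely_continuous ?P N"
    unfolding absolutely_continuous_def
  proof
    fix E assume E: "E \<in> null_sets ?P"
    then have EF: "E \<in> sets F" and "prob E = 0" using eP sP by (auto simp: null_sets_def)
    then have "L E = 0" using L0[OF EF] by simp
    then show "E \<in> null_sets N" using EF eN sN by (auto simp: null_sets_def)
  qed
  obtain f where f: "f \<in> borel_measurable ?P" "density ?P f = N"
    using P.Radon_Nikodym[OF ac] sN sP by auto
  have fF[measurable]: "f \<in> borel_measurable F" using f(1) by (rule measurable_in_subalg'[OF F])
  have fM[measurable]: "f \<in> borel_measurable M" using fF by (rule measurable_from_subalg[OF F])
  have int: "(\<integral>\<^sup>+ \<omega>. f \<omega> * indicator E \<omega> \<partial>M) = ennreal (L E)" if E: "E \<in> sets F" for E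
  proof -
    have "ennreal (L E) = emeasure (density ?P f) E" using eN[OF E] f(2) by simp
    also have "\<dots> = (\<integral>\<^sup>+ \<omega>. f \<omega> * indicator E \<omega> \<partial>?P)" using f(1) E sP by (simp add: emeasure_density)
    also have "\<dots> = (\<integral>\<^sup>+ \<omega>. f \<omega> * indicator E \<omega> \<partial>M)" using E by (intro nn_integral_subalgebra2[OF F] borel_measurable_times_ennreal fF borel_measurable_indicator)
    finally show ?thesis by simp
  qed
  have le1: "AE \<omega> in M. f \<omega> \<le> 1"
  proof -
    let ?D = "{\<omega>\<in>space F. 1 < f \<omega>}"
    have D: "?D \<in> sets F" by measurable
    have DM: "?D \<in> sets M" using D FM by blast
    have "(\<integral>\<^sup>+ \<omega>. indicator ?D \<omega> + (f \<omega> - 1) * indicator ?D \<omega> \<partial>M) = (\<integral>\<^sup>+ \<omega>. f \<omega> * indicator ?D \<omega> \<partial>M)"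
      by (intro nn_integral_cong) (auto simp: indicator_def)
    moreover have "(\<integral>\<^sup>+ \<omega>. indicator ?D \<omega> + (f \<omega> - 1) * indicator ?D \<omega> \<partial>M) = emeasure M ?D + (\<integral>\<^sup>+ \<omega>. (f \<omega> - 1) * indicator ?D \<omega> \<partial>M)"
      using DM by (subst nn_integral_add) auto
    moreover have "(\<integral>\<^sup>+ \<omega>. f \<omega> * indicator ?D \<omega> \<partial>M) \<le> emeasure M ?D"
      unfolding int[OF D] using L0[OF D] by (simp add: emeasure_eq_measure ennreal_leI)
    ultimately have le: "emeasure M ?D + (\<integral>\<^sup>+ \<omega>. (f \<omega> - 1) * indicator ?D \<omega> \<partial>M) \<le> emeasure M ?D" by simp
    have "emeasure M ?D < \<top>" by (simp add: emeasure_eq_measure)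
    moreover have "emeasure M ?D + (\<integral>\<^sup>+ \<omega>. (f \<omega> - 1) * indicator ?D \<omega> \<partial>M) \<le> emeasure M ?D + 0" using le by simp
    ultimately have "(\<integral>\<^sup>+ \<omega>. (f \<omega> - 1) * indicator ?D \<omega> \<partial>M) = 0"
      unfolding ennreal_add_left_cancel_le by auto
    then have "AE \<omega> in M. (f \<omega> - 1) * indicator ?D \<omega> = 0"
      using DM by (subst (asm) nn_integral_0_iff_AE) auto
    then show ?thesis using AE_space
    proof eventually_elim
      fix \<omega> assume z: "(f \<omega> - 1) * indicator ?D \<omega> = 0" and \<omega>: "\<omega> \<in> space M"
      show "f \<omega> \<le> 1"
      proof (rule ccontr)
        assume "\<not> f \<omega> \<le> 1"
        then have "1 < f \<omega>" by simp
        then show False using z \<omega> sF by (auto simp: indicator_def diff_eq_0_iff_ennreal dest: leD)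
      qed
    qed
  qed
  define A where "A = (\<lambda>\<omega>. min 1 (enn2real (f \<omega>)))"
  have AF: "A \<in> borel_measurable F" unfolding A_def by measurable
  have AM: "A \<in> borel_measurable M" using AF by (rule measurable_from_subalg[OF F])
  have A01: "0 \<le> A \<omega>" "A \<omega> \<le> 1" for \<omega> by (auto simp: A_def)
  have "expectation (\<lambda>\<omega>. indicator E \<omega> * A \<omega>) = L E" if E: "E \<in> sets F" for E
  proof -
    have EM: "E \<in> sets M" using E FM by blast
    have "(\<integral>\<^sup>+ \<omega>. ennreal (indicator E \<omega> * A \<omega>) \<partial>M) = (\<integral>\<^sup>+ \<omega>. f \<omega> * indicator E \<omega> \<partial>M)"
      using le1
    proof (intro nn_integral_cong_AE, eventually_elim)
      fix \<omega> assume "f \<omega> \<le> 1"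
      moreover from this have "f \<omega> < \<top>" by (rule le_less_trans) simp
      ultimately have "ennreal (A \<omega>) = f \<omega>"
        by (cases "f \<omega>") (auto simp: A_def min_def)
      then show "ennreal (indicator E \<omega> * A \<omega>) = f \<omega> * indicator E \<omega>" by (simp add: indicator_def)
    qed
    also have "\<dots> = ennreal (L E)" by (rule int[OF E])
    finally have n: "(\<integral>\<^sup>+ \<omega>. ennreal (indicator E \<omega> * A \<omega>) \<partial>M) = ennreal (L E)" .
    have "expectation (\<lambda>\<omega>. indicator E \<omega> * A \<omega>) = enn2real (\<integral>\<^sup>+ \<omega>. ennreal (indicator E \<omega> * A \<omega>) \<partial>M)"
      using EM AM A01 by (intro integral_eq_nn_integral) auto
    then show ?thesis using n L0[OF E] by simp
  qed
  then show ?thesis using AF A01 by blast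
qed

section \<open>Randomisation by an independent uniform variable\<close>

lemma info_nonneg_subset: "sets (info {0..}) \<subseteq> sets (vimage_algebra (space M) (\<lambda>\<omega>. \<lambda>t\<in>{0..}. B t \<omega>) (PiM {0..} (\<lambda>_. borel)))"
proof (rule sets_info_subset)
  fix t :: real assume t: "t \<in> {0..}"
  have "(\<lambda>x. x t) \<circ> (\<lambda>\<omega>. \<lambda>t\<in>{0..}. B t \<omega>) \<in> borel_measurable (vimage_algebra (space M) (\<lambda>\<omega>. \<lambda>t\<in>{0..}. B t \<omega>) (PiM {0..} (\<lambda>_. borel)))"
    by (rule measurable_comp[OF measurable_vimage_algebra1 measurable_component_singleton[OF t]]) (auto simp: space_PiM)
  then show "coord t \<in> borel_measurable (vimage_algebra (space M) (\<lambda>\<omega>. \<lambda>t\<in>{0..}. B t \<omega>) (PiM {0..} (\<lambda>_. borel)))"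
    using t by (simp add: comp_def coord_def[abs_def])
qed (simp add: space_vimage_algebra)

lemma indep_U:
  assumes E: "E \<in> sets (info {0..})" and b: "b \<in> sets borel"
  shows "prob (E \<inter> (U -` b \<inter> space M)) = prob E * prob (U -` b \<inter> space M)"
proof -
  have "indep_set (sets (vimage_algebra (space M) U borel)) (sets (vimage_algebra (space M) (\<lambda>\<omega>. \<lambda>t\<in>{0..}. B t \<omega>) (PiM {0..} (\<lambda>_. borel))))"
    using uniform by (simp add: independent_uniform_def)
  moreover have "U -` b \<inter> space M \<in> sets (vimage_algebra (space M) U borel)" using b by (rule in_vimage_algebra)
  moreover have "E \<in> sets (vimage_algebra (space M) (\<lambda>\<omega>. \<lambda>t\<in>{0..}. B t \<omega>) (PiM {0..} (\<lambda>_. borel)))"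
    using E info_nonneg_subset by blast
  ultimately have "prob ((U -` b \<inter> space M) \<inter> E) = prob (U -` b \<inter> space M) * prob E"
    unfolding indep_sets2_eq by blast
  then show ?thesis by (simp add: Int_commute mult.commute)
qed

lemma id_info: "(\<lambda>\<omega>. \<omega>) \<in> measurable M (info I)"
  using info_M[of "\<lambda>\<omega>. \<omega>" I "info I"] by simp

lemma distr_info_U:
  "distr M (info {0..}) (\<lambda>\<omega>. \<omega>) \<Otimes>\<^sub>M uniform_measure lborel {0..1} = distr M (info {0..} \<Otimes>\<^sub>M borel) (\<lambda>\<omega>. (\<omega>, U \<omega>))"
proof -
  have "distr M borel U = uniform_measure lborel {0..1}" using uniform by (simp add: independent_uniform_def)
  then show ?thesis using distr_pair_of_independent[OF id_info space_info U_M indep_U] by (simp only:)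
qed

text \<open>Comparison with an independent uniform variable realises a given conditional probability
  \<open>Z\<close>.\<close>

lemma prob_U_le:
  assumes E: "E \<in> sets (info {0..})" and Z[measurable]: "Z \<in> borel_measurable (info {0..})" and Z01: "\<And>\<omega>. 0 \<le> Z \<omega> \<and> Z \<omega> \<le> 1"
  shows "prob {\<omega>\<in>E. U \<omega> \<le> Z \<omega>} = expectation (\<lambda>\<omega>. indicator E \<omega> * Z \<omega>)"
proof -
  let ?R = "{x \<in> space (info {0..} \<Otimes>\<^sub>M borel). fst x \<in> E \<and> snd x \<le> Z (fst x)}"
  have EM: "E \<in> sets M" using E subalgebra_info by (auto simp: subalgebra_def)
  have ZM: "Z \<in> borel_measurable M" using Z by (rule info_M)
  have R: "?R \<in> sets (info {0..} \<Otimes>\<^sub>M borel)" using E by measurable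
  have pm: "(\<lambda>\<omega>. (\<omega>, U \<omega>)) \<in> measurable M (info {0..} \<Otimes>\<^sub>M borel)" using id_info U_M by measurable
  have pre: "(\<lambda>\<omega>. (\<omega>, U \<omega>)) -` ?R \<inter> space M = {\<omega>\<in>E. U \<omega> \<le> Z \<omega>}"
    using sets.sets_into_space[OF EM] by (auto simp: space_pair_measure space_info)
  have "emeasure M {\<omega>\<in>E. U \<omega> \<le> Z \<omega>} = emeasure (distr M (info {0..} \<Otimes>\<^sub>M borel) (\<lambda>\<omega>. (\<omega>, U \<omega>))) ?R"
    unfolding emeasure_distr[OF pm R] pre ..
  also have "\<dots> = emeasure (distr M (info {0..}) (\<lambda>\<omega>. \<omega>) \<Otimes>\<^sub>M uniform_measure lborel {0..1}) ?R"
    unfolding distr_info_U ..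
  also have "\<dots> = (\<integral>\<^sup>+ \<omega>. emeasure (uniform_measure lborel {0..1}) (Pair \<omega> -` ?R) \<partial>distr M (info {0..}) (\<lambda>\<omega>. \<omega>))"
  proof -
    interpret u: prob_space "uniform_measure lborel {0..1 :: real}" by (rule prob_space_uniform_measure) auto
    show ?thesis using R by (intro u.emeasure_pair_measure_alt) (simp add: sets_pair_measure_cong[OF sets_distr sets_uniform_measure] cong: sets_pair_measure_cong)
  qed
  also have "\<dots> = (\<integral>\<^sup>+ \<omega>. ennreal (indicator E \<omega> * Z \<omega>) \<partial>distr M (info {0..}) (\<lambda>\<omega>. \<omega>))"
  proof (rule nn_integral_cong)
    fix \<omega> assume "\<omega> \<in> space (distr M (info {0..}) (\<lambda>\<omega>. \<omega>))"
    then have "Pair \<omega> -` ?R = (if \<omega> \<in> E then {..Z \<omega>} else {})" by (auto simp: space_pair_measure)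
    moreover have "emeasure (uniform_measure lborel {0..1}) {..Z \<omega>} = ennreal (Z \<omega>)"
    proof -
      have "{0..1} \<inter> {..Z \<omega>} = {0..Z \<omega>}" using Z01[of \<omega>] by auto
      then show ?thesis using Z01[of \<omega>] by (subst emeasure_uniform_measure) (auto simp: divide_ennreal_def)
    qed
    ultimately show "emeasure (uniform_measure lborel {0..1}) (Pair \<omega> -` ?R) = ennreal (indicator E \<omega> * Z \<omega>)" by simp
  qed
  also have "\<dots> = (\<integral>\<^sup>+ \<omega>. ennreal (indicator E \<omega> * Z \<omega>) \<partial>M)"
    using E id_info by (intro nn_integral_distr) auto
  finally have n: "emeasure M {\<omega>\<in>E. U \<omega> \<le> Z \<omega>} = (\<integral>\<^sup>+ \<omega>. ennreal (indicator E \<omega> * Z \<omega>) \<partial>M)" .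
  have "expectation (\<lambda>\<omega>. indicator E \<omega> * Z \<omega>) = enn2real (\<integral>\<^sup>+ \<omega>. ennreal (indicator E \<omega> * Z \<omega>) \<partial>M)"
    using EM ZM Z01 by (intro integral_eq_nn_integral) auto
  then show ?thesis unfolding n[symmetric] by (simp add: measure_def)
qed

text \<open>The conditional expectation given the whole history up to \<open>q\<close> of a functional of the Brownian
  path depends on the path up to \<open>q\<close> only. The events \<open>\<tau> n \<le> q\<close> belong to that history, hence testing them
  against the path reduces to testing them against the path up to \<open>q\<close>, and this survives the
  limit.\<close>

lemma limit_distribution_adapted:
  fixes \<U> :: "nat filter"
  assumes \<tau>: "\<And>n. stopping_time G (\<tau> n)" and \<U>: "\<U> \<noteq> bot" and q: "0 \<le> q"
    and L: "\<And>E. E \<in> sets M \<Longrightarrow> ((\<lambda>n. prob {\<omega>\<in>E. \<tau> n \<omega> \<le> ennreal q}) \<longlongrightarrow> L E) \<U>"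
  shows "\<exists>A. A \<in> borel_measurable (Binfo q) \<and> (\<forall>\<omega>. 0 \<le> A \<omega> \<and> A \<omega> \<le> 1) \<and>
    (\<forall>E\<in>sets (info {0..}). expectation (\<lambda>\<omega>. indicator E \<omega> * A \<omega>) = L E)"
proof -
  let ?K = "\<lambda>n. {\<omega>\<in>space M. \<tau> n \<omega> \<le> ennreal q}"
  let ?W = "\<lambda>n. indicator (?K n) :: 'a \<Rightarrow> real"
  have KG: "?K n \<in> sets (Gt q)" for n using stopping_timeD[OF \<tau>[of n], of "ennreal q"] by (simp add: pred_def space_F)
  have KM: "?K n \<in> sets M" for n using KG sets_G_subset by blast
  have WM: "?W n \<in> borel_measurable M" "\<bar>?W n \<omega>\<bar> \<le> 1" for n \<omega> using KM by (auto simp: indicator_def)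
  have EK: "prob {\<omega>\<in>E. \<tau> n \<omega> \<le> ennreal q} = expectation (\<lambda>\<omega>. indicator E \<omega> * ?W n \<omega>)" if E: "E \<in> sets M" for E n
  proof -
    have e: "{\<omega>\<in>E. \<tau> n \<omega> \<le> ennreal q} = E \<inter> ?K n" using sets.sets_into_space[OF E] by auto
    have "expectation (\<lambda>\<omega>. indicator E \<omega> * ?W n \<omega>) = expectation (indicator (E \<inter> ?K n))"
      by (intro Bochner_Integration.integral_cong) (auto simp: indicator_def)
    then show ?thesis using E KM unfolding e by simp
  qed
  have sub: "sets (info I) \<subseteq> sets M" for I using subalgebra_info by (simp add: subalgebra_def)
  have L01: "0 \<le> L E \<and> L E \<le> prob E" if E: "E \<in> sets M" for E
  proof
    show "0 \<le> L E" by (rule tendsto_lowerbound[OF L[OF E] _ \<U>]) simp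
    show "L E \<le> prob E"
      by (rule tendsto_upperbound[OF L[OF E] _ \<U>]) (use E in \<open>auto intro!: always_eventually finite_measure_mono\<close>)
  qed
  have Ladd: "L (E \<union> E') = L E + L E'" if E: "E \<in> sets M" "E' \<in> sets M" "E \<inter> E' = {}" for E E'
  proof (rule tendsto_unique[OF \<U>])
    show "((\<lambda>n. prob {\<omega>\<in>E \<union> E'. \<tau> n \<omega> \<le> ennreal q}) \<longlongrightarrow> L (E \<union> E')) \<U>" using E by (intro L) auto
    have "prob {\<omega>\<in>E \<union> E'. \<tau> n \<omega> \<le> ennreal q} = prob {\<omega>\<in>E. \<tau> n \<omega> \<le> ennreal q} + prob {\<omega>\<in>E'. \<tau> n \<omega> \<le> ennreal q}" for n
    proof -
      have m: "{\<omega>\<in>E. \<tau> n \<omega> \<le> ennreal q} \<in> sets M" if "E \<in> sets M" for E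
      proof -
        have "{\<omega>\<in>E. \<tau> n \<omega> \<le> ennreal q} = E \<inter> ?K n" using sets.sets_into_space[OF that] by auto
        then show ?thesis using that KM by auto
      qed
      have "{\<omega>\<in>E \<union> E'. \<tau> n \<omega> \<le> ennreal q} = {\<omega>\<in>E. \<tau> n \<omega> \<le> ennreal q} \<union> {\<omega>\<in>E'. \<tau> n \<omega> \<le> ennreal q}" by auto
      then show ?thesis using m[OF E(1)] m[OF E(2)] E(3) by (subst finite_measure_Union[symmetric]) auto
    qed
    then show "((\<lambda>n. prob {\<omega>\<in>E \<union> E'. \<tau> n \<omega> \<le> ennreal q}) \<longlongrightarrow> L E + L E') \<U>"
      using tendsto_add[OF L[OF E(1)] L[OF E(2)]] by simp
  qed
  have subE: "E \<in> sets M" if "E \<in> sets (Binfo q)" for E using that sub by blast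
  have "\<exists>A. A \<in> borel_measurable (Binfo q) \<and> (\<forall>\<omega>. 0 \<le> A \<omega> \<and> A \<omega> \<le> 1) \<and>
    (\<forall>E\<in>sets (Binfo q). expectation (\<lambda>\<omega>. indicator E \<omega> * A \<omega>) = L E)"
  proof (rule dominated_additive_density[OF subalgebra_info])
    show "0 \<le> L E \<and> L E \<le> prob E" if "E \<in> sets (Binfo q)" for E by (rule L01[OF subE[OF that]])
    show "L (E \<union> E') = L E + L E'" if "E \<in> sets (Binfo q)" "E' \<in> sets (Binfo q)" "E \<inter> E' = {}" for E E'
      by (rule Ladd[OF subE[OF that(1)] subE[OF that(2)] that(3)])
  qed
  then obtain A where A: "A \<in> borel_measurable (Binfo q)" "\<forall>\<omega>. 0 \<le> A \<omega> \<and> A \<omega> \<le> 1"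
    "\<forall>E\<in>sets (Binfo q). expectation (\<lambda>\<omega>. indicator E \<omega> * A \<omega>) = L E"
    by (elim exE conjE) (rule that)
  have AM: "A \<in> borel_measurable M" using A(1) by (rule info_M)
  have AG: "A \<in> borel_measurable (Gt q)" using A(1) q by (rule info_G) auto
  have Ab: "\<bar>A \<omega>\<bar> \<le> 1" for \<omega> using A(2)[THEN spec, of \<omega>] by simp
  \<comment> \<open>Against functionals of the path up to \<open>q\<close> the convergence holds by the choice of \<open>A\<close>.\<close>
  have present: "tested_limit \<U> ?W A f" if f: "f \<in> borel_measurable (Binfo q)" "\<And>\<omega>. \<omega> \<in> space M \<Longrightarrow> \<bar>f \<omega>\<bar> \<le> C" for f C
  proof (rule tested_limit_sets[where W="?W" and ?W0.0=A, OF WM AM Ab _ f])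
    fix E assume E: "E \<in> sets (Binfo q)"
    then have EM: "E \<in> sets M" using sub by blast
    show "((\<lambda>n. expectation (\<lambda>\<omega>. indicator E \<omega> * ?W n \<omega>)) \<longlongrightarrow> expectation (\<lambda>\<omega>. indicator E \<omega> * A \<omega>)) \<U>"
      using L[OF EM] A(3) E unfolding EK[OF EM] by simp
  qed
  \<comment> \<open>Both \<open>?W n\<close> and \<open>A\<close> are known at time \<open>q\<close>, so a functional \<open>?Y\<close> may be replaced by its martingale at \<open>q\<close>.\<close>
  have all: "tested_limit \<U> ?W A f" if f: "f \<in> borel_measurable (info {0..})" "\<And>\<omega>. \<omega> \<in> space M \<Longrightarrow> \<bar>f \<omega>\<bar> \<le> C" for f C
  proof (rule tested_limit_cylinders[where W="?W" and ?W0.0=A, OF WM AM Ab _ f])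
    fix J :: "real set" and c k assume J: "finite J" "J \<subseteq> {0..}"
    let ?Y = "\<lambda>\<omega>. \<Prod>t\<in>J. ramp k (c t) (B t \<omega>)"
    have e: "(\<lambda>\<omega>. \<Prod>t\<in>J. ramp k (c t) (coord t \<omega>)) = ?Y"
      using J(2) by (intro ext prod.cong) (auto simp: coord_def)
    obtain X where X: "closed_martingale Binfo X ?Y"
      using product_martingale[OF J, of "\<lambda>t. ramp k (c t)"] by (auto simp: continuous_on_ramp ramp_bounds)
    note D = closed_martingaleD[OF X]
    obtain C where C: "0 \<le> C \<and> (\<forall>\<omega>\<in>space M. \<bar>?Y \<omega>\<bar> \<le> C) \<and> (\<forall>\<omega>\<in>space M. \<forall>t\<ge>0. \<bar>X t \<omega>\<bar> \<le> C)"
      using closed_martingale_bounded[OF X] ..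
    have Yi: "integrable M ?Y" using D(3) C by (intro bounded_integrable[of _ C]) auto
    have p: "tested_limit \<U> ?W A (X q)" using D(1)[OF q] C q by (intro present[of _ C]) auto
    have WG: "?W n \<in> borel_measurable (Gt q)" for n using KG by simp
    have "expectation (\<lambda>\<omega>. ?W n \<omega> * ?Y \<omega>) = expectation (\<lambda>\<omega>. ?W n \<omega> * X q \<omega>)" for n
      by (rule D(4)[OF q WG WM(2)])
    moreover have "expectation (\<lambda>\<omega>. A \<omega> * ?Y \<omega>) = expectation (\<lambda>\<omega>. A \<omega> * X q \<omega>)"
      by (rule D(4)[OF q AG Ab])
    ultimately have "tested_limit \<U> ?W A ?Y"
      using p Yi unfolding tested_limit_def by (simp only: mult.commute[of _ "?W _ _"] mult.commute[of _ "A _"])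
    then show "tested_limit \<U> ?W A (\<lambda>\<omega>. \<Prod>t\<in>J. ramp k (c t) (coord t \<omega>))" unfolding e .
  qed
  have "expectation (\<lambda>\<omega>. indicator E \<omega> * A \<omega>) = L E" if E: "E \<in> sets (info {0..})" for E
  proof (rule tendsto_unique[OF \<U>])
    have EM: "E \<in> sets M" using E sub by blast
    show "((\<lambda>n. prob {\<omega>\<in>E. \<tau> n \<omega> \<le> ennreal q}) \<longlongrightarrow> L E) \<U>" by (rule L[OF EM])
    have "tested_limit \<U> ?W A (indicator E)" using E by (intro all[of _ 1]) (auto simp: indicator_def)
    then show "((\<lambda>n. prob {\<omega>\<in>E. \<tau> n \<omega> \<le> ennreal q}) \<longlongrightarrow> expectation (\<lambda>\<omega>. indicator E \<omega> * A \<omega>)) \<U>"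
      unfolding EK[OF EM] tested_limit_def by simp
  qed
  then show ?thesis using A(1,2) by blast
qed

text \<open>Weak convergence of the times jointly with the Brownian path, tested against bounded functionals
  of the path alone. At an atom of the limit the
  distribution functions need not converge.\<close>

definition converges_stably :: "nat filter \<Rightarrow> (nat \<Rightarrow> 'a \<Rightarrow> ennreal) \<Rightarrow> ('a \<Rightarrow> ennreal) \<Rightarrow> bool" where
  "converges_stably \<U> \<tau> T \<longleftrightarrow>
    (\<forall>t\<ge>0. prob {\<omega>\<in>space M. T \<omega> = ennreal t} = 0 \<longrightarrow>
      (\<forall>(f :: 'a \<Rightarrow> real) C. f \<in> borel_measurable (info {0..}) \<longrightarrow> (\<forall>\<omega>\<in>space M. \<bar>f \<omega>\<bar> \<le> C) \<longrightarrow>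
      ((\<lambda>n. expectation (\<lambda>\<omega>. f \<omega> * indicator {\<omega>\<in>space M. \<tau> n \<omega> \<le> ennreal t} \<omega>)) \<longlongrightarrow>
        expectation (\<lambda>\<omega>. f \<omega> * indicator {\<omega>\<in>space M. T \<omega> \<le> ennreal t} \<omega>)) \<U>))"

text \<open>The limiting conditional distribution functions are realised by comparing them with the
  independent uniform variable. This yields a stopping time of the right-continuous filtration,
  which has a version for the given filtration.\<close>

lemma stopping_time_compactness:
  assumes \<tau>: "\<And>n. stopping_time G (\<tau> n)"
  shows "\<exists>\<U> T. \<U> \<le> sequentially \<and> \<U> \<noteq> bot \<and> stopping_time G T \<and> converges_stably \<U> \<tau> T"
proof -
  have "\<exists>\<U> L. \<U> \<le> sequentially \<and> \<U> \<noteq> bot \<and>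
    (\<forall>i. ((\<lambda>n. (\<lambda>(E, t). prob {\<omega>\<in>E. \<tau> n \<omega> \<le> ennreal t}) i) \<longlongrightarrow> L i) \<U>)"
    by (rule simultaneous_limits) (auto split: prod.split)
  then obtain \<U> L' where \<U>: "\<U> \<le> sequentially" "\<U> \<noteq> bot"
    and L': "\<And>i. ((\<lambda>n. (\<lambda>(E, t). prob {\<omega>\<in>E. \<tau> n \<omega> \<le> ennreal t}) i) \<longlongrightarrow> L' i) \<U>" by blast
  define L where "L = (\<lambda>t E. L' (E, t))"
  have L: "((\<lambda>n. prob {\<omega>\<in>E. \<tau> n \<omega> \<le> ennreal t}) \<longlongrightarrow> L t E) \<U>" for E t
    using L'[of "(E, t)"] by (simp add: L_def)
  have sub: "sets (info I) \<subseteq> sets M" for I using subalgebra_info by (simp add: subalgebra_def)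
  have Km: "{\<omega>\<in>E. \<tau> n \<omega> \<le> ennreal t} \<in> sets M" if "E \<in> sets M" for E n t
  proof -
    have "{\<omega>\<in>space M. \<tau> n \<omega> \<le> ennreal t} \<in> sets M" using stopping_time_measurable[OF \<tau>[of n]] by measurable
    moreover have "{\<omega>\<in>E. \<tau> n \<omega> \<le> ennreal t} = E \<inter> {\<omega>\<in>space M. \<tau> n \<omega> \<le> ennreal t}" using sets.sets_into_space[OF that] by auto
    ultimately show ?thesis using that by auto
  qed
  have Lmono: "L s E \<le> L t E" if E: "E \<in> sets M" and st: "s \<le> t" for s t E
  proof (rule tendsto_le[OF \<U>(2) L L])
    have "{\<omega>\<in>E. \<tau> n \<omega> \<le> ennreal s} \<subseteq> {\<omega>\<in>E. \<tau> n \<omega> \<le> ennreal t}" for n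
      using ennreal_leI[OF st] by (auto intro: order_trans)
    then show "\<forall>\<^sub>F n in \<U>. prob {\<omega>\<in>E. \<tau> n \<omega> \<le> ennreal s} \<le> prob {\<omega>\<in>E. \<tau> n \<omega> \<le> ennreal t}"
      using Km[OF E] by (intro always_eventually allI finite_measure_mono) auto
  qed
  have L0: "0 \<le> L t E" for t E by (rule tendsto_lowerbound[OF L _ \<U>(2)]) simp
  define D where "D = (\<lambda>p::nat \<times> nat. real (fst p) / 2 ^ snd p)"
  have D0: "0 \<le> D p" for p by (simp add: D_def)
  have "\<forall>p. \<exists>A. A \<in> borel_measurable (Binfo (D p)) \<and> (\<forall>\<omega>. 0 \<le> A \<omega> \<and> A \<omega> \<le> 1) \<and>
    (\<forall>E\<in>sets (info {0..}). expectation (\<lambda>\<omega>. indicator E \<omega> * A \<omega>) = L (D p) E)"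
    using limit_distribution_adapted[OF \<tau> \<U>(2) D0 L] by blast
  then obtain A where A: "\<forall>p. A p \<in> borel_measurable (Binfo (D p)) \<and> (\<forall>\<omega>. 0 \<le> A p \<omega> \<and> A p \<omega> \<le> 1) \<and>
    (\<forall>E\<in>sets (info {0..}). expectation (\<lambda>\<omega>. indicator E \<omega> * A p \<omega>) = L (D p) E)" by metis
  have AB: "A p \<in> borel_measurable (Binfo (D p))" and A01: "0 \<le> A p \<omega> \<and> A p \<omega> \<le> 1" for p \<omega>
    using A[THEN spec, of p] by blast+
  have AL: "expectation (\<lambda>\<omega>. indicator E \<omega> * A p \<omega>) = L (D p) E" if "E \<in> sets (info {0..})" for E p using A that by blast
  have AF: "A p \<in> borel_measurable (info {0..})" for p using AB[of p] by (rule info_mono) auto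
  have AM: "A p \<in> borel_measurable M" for p using AF by (rule info_M)
  have AG: "A p \<in> borel_measurable (Gt t)" if "D p \<le> t" for p t
    using AB[of p] by (rule info_G) (use that D0[of p] in auto)
  define R where "R = (\<lambda>p. {\<omega>\<in>space M. U \<omega> \<le> A p \<omega>})"
  have RG: "R p \<in> sets (Gt t)" if "D p \<le> t" for p t
  proof -
    have "{\<omega>\<in>space (Gt t). U \<omega> \<le> A p \<omega>} \<in> sets (Gt t)" using U_G AG[OF that] by measurable
    then show ?thesis by (simp add: R_def space_F)
  qed
  have RM: "R p \<in> sets M" for p using RG[OF order_refl] sets_G_subset by blast
  have RI: "R p \<in> sets (info UNIV)" for p
  proof -
    have "U \<in> borel_measurable (info UNIV)" using coord_info[of "-1" UNIV] by (simp add: coord_def[abs_def])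
    moreover have "A p \<in> borel_measurable (info UNIV)" using AF[of p] by (rule info_mono) auto
    ultimately have "{\<omega>\<in>space (info UNIV). U \<omega> \<le> A p \<omega>} \<in> sets (info UNIV)" by measurable
    then show ?thesis by (simp add: R_def space_info)
  qed
  have pR: "prob (E \<inter> R p) = L (D p) E" if E: "E \<in> sets (info {0..})" for E p
  proof -
    have "E \<subseteq> space M" using E sub sets.sets_into_space by blast
    then have "E \<inter> R p = {\<omega>\<in>E. U \<omega> \<le> A p \<omega>}" by (auto simp: R_def)
    then show ?thesis using prob_U_le[OF E AF A01] AL[OF E] by simp
  qed
  have Amono: "AE \<omega> in M. A p \<omega> \<le> A p' \<omega>" if le: "D p \<le> D p'" for p p'
  proof -
    let ?\<Delta> = "{\<omega>\<in>space M. A p' \<omega> < A p \<omega>}"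
    have "{\<omega>\<in>space (info {0..}). A p' \<omega> < A p \<omega>} \<in> sets (info {0..})" using AF[of p] AF[of p'] by measurable
    then have \<Delta>: "?\<Delta> \<in> sets (info {0..})" by (simp add: space_info)
    then have \<Delta>M: "?\<Delta> \<in> sets M" using sub by blast
    have i: "integrable M (\<lambda>\<omega>. indicator ?\<Delta> \<omega> * A p \<omega>)" for p
      using \<Delta>M AM A01 by (intro bounded_mult_integrable[where C=1 and D=1]) (auto simp: indicator_def)
    have "expectation (\<lambda>\<omega>. indicator ?\<Delta> \<omega> * A p \<omega> - indicator ?\<Delta> \<omega> * A p' \<omega>) \<le> 0"
      using AL[OF \<Delta>] Lmono[OF \<Delta>M le] i by simp
    moreover have nn: "0 \<le> indicator ?\<Delta> \<omega> * A p \<omega> - indicator ?\<Delta> \<omega> * A p' \<omega>" for \<omega> by (auto simp: indicator_def)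
    ultimately have "expectation (\<lambda>\<omega>. indicator ?\<Delta> \<omega> * A p \<omega> - indicator ?\<Delta> \<omega> * A p' \<omega>) = 0"
      by (intro antisym integral_nonneg_AE) auto
    then have "AE \<omega> in M. indicator ?\<Delta> \<omega> * A p \<omega> - indicator ?\<Delta> \<omega> * A p' \<omega> = 0"
      using integral_nonneg_eq_0_iff_AE[of M "\<lambda>\<omega>. indicator ?\<Delta> \<omega> * A p \<omega> - indicator ?\<Delta> \<omega> * A p' \<omega>"] i nn by auto
    then show ?thesis using AE_space
    proof eventually_elim
      fix \<omega> assume "indicator ?\<Delta> \<omega> * A p \<omega> - indicator ?\<Delta> \<omega> * A p' \<omega> = 0" "\<omega> \<in> space M"
      then show "A p \<omega> \<le> A p' \<omega>" by (cases "A p' \<omega> < A p \<omega>") (auto simp: indicator_def)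
    qed
  qed
  \<comment> \<open>The uniform variable is compared with the conditional distribution function at all dyadic times; the first success has that conditional distribution, as the function increases almost surely.\<close>
  define T where "T = (\<lambda>\<omega>. Inf ((\<lambda>p. ennreal (D p)) ` {p. U \<omega> \<le> A p \<omega>}))"
  have T_less: "{\<omega>\<in>space M. T \<omega> < y} = (\<Union>p\<in>{p. ennreal (D p) < y}. R p)" for y
    unfolding T_def R_def by (auto simp: Inf_less_iff)
  have T_info: "T \<in> borel_measurable (info UNIV)"
  proof (rule borel_measurableI_less)
    fix y
    have "(\<Union>p\<in>{p. ennreal (D p) < y}. R p) \<in> sets (info UNIV)" using RI by (intro sets.countable_UN'') auto
    then show "{\<omega>\<in>space (info UNIV). T \<omega> < y} \<in> sets (info UNIV)" unfolding space_info T_less .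
  qed
  have TG: "{\<omega>\<in>space M. T \<omega> < ennreal t} \<in> sets (Gt t)" if "0 \<le> t" for t
  proof -
    have "R p \<in> sets (Gt t)" if "ennreal (D p) < ennreal t" for p
      using that D0[of p] by (intro RG) (simp add: ennreal_less_iff)
    then show ?thesis unfolding T_less by (intro sets.countable_UN'') auto
  qed
  obtain T' where T': "stopping_time G T'" "AE \<omega> in M. T' \<omega> = T \<omega>"
    using predictable_version[OF T_info TG] by blast
  have TM[measurable]: "T \<in> borel_measurable M" using T_info by (rule info_M)
  have T'M[measurable]: "T' \<in> borel_measurable M" using T'(1) by (rule stopping_time_measurable)
  \<comment> \<open>Among finitely many dyadic times before \<open>t\<close> the last one dominates; then the finite sets exhaust all of them.\<close>
  have upper: "prob (E \<inter> {\<omega>\<in>space M. T \<omega> < ennreal t}) \<le> L t E" if E: "E \<in> sets (info {0..})" for E t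
  proof -
    have EM: "E \<in> sets M" using E sub by blast
    define J where "J = (\<lambda>n. {p. prod_encode p < n \<and> ennreal (D p) < ennreal t})"
    have Jfin: "finite (J n)" for n
    proof (rule finite_subset)
      show "J n \<subseteq> prod_decode ` {..<n}" unfolding J_def by (auto simp: image_iff) (metis lessThan_iff prod_encode_inverse)
    qed simp
    have le: "prob (\<Union>p\<in>J n. E \<inter> R p) \<le> L t E" for n
    proof (cases "J n = {}")
      case True
      then show ?thesis using L0 by simp
    next
      case False
      have "Max (D ` J n) \<in> D ` J n" using Jfin False by (intro Max_in) auto
      then obtain p where p: "p \<in> J n" "D p = Max (D ` J n)" by auto
      have pm: "D p' \<le> D p" if "p' \<in> J n" for p' unfolding p(2) using Jfin that by (intro Max_ge) auto
      have "AE \<omega> in M. \<forall>p'\<in>J n. A p' \<omega> \<le> A p \<omega>"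
        using Jfin Amono[OF pm] by (subst AE_ball_countable) (auto intro: countable_finite)
      then have "AE \<omega> in M. \<omega> \<in> (\<Union>p\<in>J n. E \<inter> R p) \<longrightarrow> \<omega> \<in> E \<inter> R p"
        by eventually_elim (auto simp: R_def intro: order_trans)
      then have "prob (\<Union>p\<in>J n. E \<inter> R p) \<le> prob (E \<inter> R p)" using EM RM by (intro finite_measure_mono_AE) auto
      also have "\<dots> = L (D p) E" by (rule pR[OF E])
      also have "\<dots> \<le> L t E" using p(1) D0[of p] by (intro Lmono EM) (simp add: J_def ennreal_less_iff)
      finally show ?thesis .
    qed
    have "(\<lambda>n. prob (\<Union>p\<in>J n. E \<inter> R p)) \<longlonglongrightarrow> prob (\<Union>n. \<Union>p\<in>J n. E \<inter> R p)"
    proof (rule finite_Lim_measure_incseq)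
      have "(\<Union>p\<in>J n. E \<inter> R p) \<in> sets M" for n using EM RM Jfin[of n] by (intro sets.finite_UN) auto
      then show "range (\<lambda>n. \<Union>p\<in>J n. E \<inter> R p) \<subseteq> sets M" by blast
      show "incseq (\<lambda>n. \<Union>p\<in>J n. E \<inter> R p)" by (intro incseq_SucI UN_mono) (auto simp: J_def)
    qed
    moreover have "(\<Union>n. \<Union>p\<in>J n. E \<inter> R p) = E \<inter> {\<omega>\<in>space M. T \<omega> < ennreal t}"
      unfolding T_less by (auto simp: J_def intro: lessI)
    ultimately show ?thesis using le by (intro LIMSEQ_le_const2[of "\<lambda>n. prob (\<Union>p\<in>J n. E \<inter> R p)"]) auto
  qed
  \<comment> \<open>The limits are compared with \<open>T < t\<close> from below and with \<open>T \<le> s\<close>, \<open>s > t\<close>, from above; the two agree when \<open>t\<close> is not an atom.\<close>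
  have eq: "L t E = prob (E \<inter> {\<omega>\<in>space M. T' \<omega> \<le> ennreal t})"
    if t: "0 \<le> t" and null: "prob {\<omega>\<in>space M. T' \<omega> = ennreal t} = 0" and E: "E \<in> sets (info {0..})" for t E
  proof (rule antisym)
    have EM: "E \<in> sets M" using E sub by blast
    have "emeasure M {\<omega>\<in>space M. T' \<omega> = ennreal t} = 0" using null by (simp add: emeasure_eq_measure)
    then have "AE \<omega> in M. T' \<omega> \<noteq> ennreal t" by (subst AE_iff_measurable[OF _ refl]) auto
    then have "AE \<omega> in M. \<omega> \<in> E \<inter> {\<omega>\<in>space M. T' \<omega> \<le> ennreal t} \<longrightarrow> \<omega> \<in> E \<inter> {\<omega>\<in>space M. T \<omega> < ennreal t}"
      using T'(2) by eventually_elim auto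
    then have "prob (E \<inter> {\<omega>\<in>space M. T' \<omega> \<le> ennreal t}) \<le> prob (E \<inter> {\<omega>\<in>space M. T \<omega> < ennreal t})"
      using EM by (intro finite_measure_mono_AE) auto
    also have "\<dots> \<le> L t E" by (rule upper[OF E])
    finally show "prob (E \<inter> {\<omega>\<in>space M. T' \<omega> \<le> ennreal t}) \<le> L t E" .
    have step: "L t E \<le> prob (E \<inter> {\<omega>\<in>space M. T \<omega> \<le> ennreal s})" if s: "t < s" for s
    proof -
      have "\<forall>\<^sub>F m in sequentially. dyadic_above m t < s" using dyadic_above_tendsto[of t] s by (simp add: order_tendsto_iff)
      then obtain m where m: "dyadic_above m t < s" by (auto simp: eventually_sequentially)
      let ?p = "(nat (\<lfloor>t * 2 ^ m\<rfloor> + 1), m)"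
      have Dp: "D ?p = dyadic_above m t" using t by (simp add: D_def dyadic_above_def)
      have "L t E \<le> L (D ?p) E" unfolding Dp using dyadic_above_bounds(1)[of t m] by (intro Lmono EM) simp
      also have "\<dots> = prob (E \<inter> R ?p)" by (rule pR[OF E, symmetric])
      also have "\<dots> \<le> prob (E \<inter> {\<omega>\<in>space M. T \<omega> \<le> ennreal s})"
      proof (rule finite_measure_mono)
        have "T \<omega> \<le> ennreal s" if "\<omega> \<in> R ?p" for \<omega>
        proof -
          have "T \<omega> \<le> ennreal (D ?p)" unfolding T_def using that by (intro Inf_lower) (auto simp: R_def)
          also have "\<dots> \<le> ennreal s" unfolding Dp using m by (intro ennreal_leI) simp
          finally show ?thesis .
        qed
        then show "E \<inter> R ?p \<subseteq> E \<inter> {\<omega>\<in>space M. T \<omega> \<le> ennreal s}" by (auto simp: R_def)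
      qed (use EM in auto)
      finally show ?thesis .
    qed
    let ?S = "\<lambda>m::nat. E \<inter> {\<omega>\<in>space M. T \<omega> \<le> ennreal (t + 1 / real (Suc m))}"
    have "(\<lambda>m. prob (?S m)) \<longlonglongrightarrow> prob (\<Inter>m. ?S m)"
    proof (rule finite_Lim_measure_decseq)
      show "range ?S \<subseteq> sets M" using EM by auto
      have "t + 1 / real (Suc n) \<le> t + 1 / real (Suc m)" if "m \<le> n" for m n :: nat
        using that by (intro add_left_mono divide_left_mono) auto
      then have "ennreal (t + 1 / real (Suc n)) \<le> ennreal (t + 1 / real (Suc m))" if "m \<le> n" for m n :: nat
        using that by (intro ennreal_leI) auto
      then have "?S n \<subseteq> ?S m" if "m \<le> n" for m n using order_trans that by blast
      then show "decseq ?S" unfolding decseq_def by blast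
    qed
    moreover have "(\<Inter>m. ?S m) = E \<inter> {\<omega>\<in>space M. T \<omega> \<le> ennreal t}"
    proof (intro set_eqI iffI)
      fix \<omega> assume \<omega>: "\<omega> \<in> (\<Inter>m. ?S m)"
      have "(\<lambda>m. t + 1 / real (Suc m)) \<longlonglongrightarrow> t + 0" by (intro tendsto_intros LIMSEQ_Suc[OF lim_1_over_n])
      then have "(\<lambda>m. ennreal (t + 1 / real (Suc m))) \<longlonglongrightarrow> ennreal t" by (intro tendsto_ennrealI) simp
      then have "T \<omega> \<le> ennreal t" by (rule LIMSEQ_le_const) (use \<omega> in auto)
      then show "\<omega> \<in> E \<inter> {\<omega>\<in>space M. T \<omega> \<le> ennreal t}" using \<omega> by auto
    next
      fix \<omega> assume \<omega>: "\<omega> \<in> E \<inter> {\<omega>\<in>space M. T \<omega> \<le> ennreal t}"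
      have "ennreal t \<le> ennreal (t + 1 / real (Suc m))" for m by (intro ennreal_leI) simp
      then show "\<omega> \<in> (\<Inter>m. ?S m)" using \<omega> by (auto intro: order_trans simp del: of_nat_Suc)
    qed
    ultimately have "L t E \<le> prob (E \<inter> {\<omega>\<in>space M. T \<omega> \<le> ennreal t})"
      using step by (intro LIMSEQ_le_const[of "\<lambda>m. prob (?S m)"]) auto
    also have "\<dots> \<le> prob (E \<inter> {\<omega>\<in>space M. T' \<omega> \<le> ennreal t})"
      using EM T'(2) by (intro finite_measure_mono_AE) (auto elim!: eventually_mono)
    finally show "L t E \<le> prob (E \<inter> {\<omega>\<in>space M. T' \<omega> \<le> ennreal t})" .
  qed
  have "((\<lambda>n. expectation (\<lambda>\<omega>. f \<omega> * indicator {\<omega>\<in>space M. \<tau> n \<omega> \<le> ennreal t} \<omega>)) \<longlongrightarrow>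
        expectation (\<lambda>\<omega>. f \<omega> * indicator {\<omega>\<in>space M. T' \<omega> \<le> ennreal t} \<omega>)) \<U>"
    if t: "0 \<le> t" and null: "prob {\<omega>\<in>space M. T' \<omega> = ennreal t} = 0" and f: "f \<in> borel_measurable (info {0..})"
      and C: "\<forall>\<omega>\<in>space M. \<bar>f \<omega>\<bar> \<le> C" for t C and f :: "'a \<Rightarrow> real"
  proof -
    let ?W = "\<lambda>n. (indicator {\<omega>\<in>space M. \<tau> n \<omega> \<le> ennreal t} :: 'a \<Rightarrow> real)"
    let ?V = "(indicator {\<omega>\<in>space M. T' \<omega> \<le> ennreal t} :: 'a \<Rightarrow> real)"
    have W: "?W n \<in> borel_measurable M" "\<bar>?W n \<omega>\<bar> \<le> 1" for n \<omega>
      using Km[of "space M" n t] by (auto simp: indicator_def)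
    have V: "?V \<in> borel_measurable M" "\<bar>?V \<omega>\<bar> \<le> 1" for \<omega> by (auto simp: indicator_def)
    have e: "expectation (\<lambda>\<omega>. indicator E \<omega> * indicator {\<omega>\<in>space M. S \<omega> \<le> ennreal t} \<omega> :: real) = prob {\<omega>\<in>E. S \<omega> \<le> ennreal t}"
      if E: "E \<in> sets M" and S: "S \<in> borel_measurable M" for E and S :: "'a \<Rightarrow> ennreal"
    proof -
      have "expectation (\<lambda>\<omega>. indicator E \<omega> * indicator {\<omega>\<in>space M. S \<omega> \<le> ennreal t} \<omega> :: real) = expectation (indicator (E \<inter> {\<omega>\<in>space M. S \<omega> \<le> ennreal t}))"
        by (intro Bochner_Integration.integral_cong) (auto simp: indicator_def)
      also have "\<dots> = prob (E \<inter> {\<omega>\<in>space M. S \<omega> \<le> ennreal t})" using E S by simp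
      also have "E \<inter> {\<omega>\<in>space M. S \<omega> \<le> ennreal t} = {\<omega>\<in>E. S \<omega> \<le> ennreal t}" using sets.sets_into_space[OF E] by auto
      finally show ?thesis .
    qed
    have "tested_limit \<U> ?W ?V f"
    proof (rule tested_limit_sets[where W="?W" and ?W0.0="?V", OF W V _ f])
      fix E assume E: "E \<in> sets (info {0..})"
      then have EM: "E \<in> sets M" using sub by blast
      have "{\<omega>\<in>E. T' \<omega> \<le> ennreal t} = E \<inter> {\<omega>\<in>space M. T' \<omega> \<le> ennreal t}" using sets.sets_into_space[OF EM] by auto
      then show "((\<lambda>n. expectation (\<lambda>\<omega>. indicator E \<omega> * ?W n \<omega>)) \<longlongrightarrow> expectation (\<lambda>\<omega>. indicator E \<omega> * ?V \<omega>)) \<U>"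
        using L[of E t] eq[OF t null E] unfolding e[OF EM stopping_time_measurable[OF \<tau>]] e[OF EM T'M] by simp
    qed (use C in auto)
    then show ?thesis by (simp add: tested_limit_def)
  qed
  then show ?thesis using \<U> T'(1) unfolding converges_stably_def by blast
qed

end

section \<open>Lower semicontinuity for integrands that are continuous in time\<close>

context brownian_basis
begin

text \<open>Each atom excludes at most countably many shifts of the grids of mesh \<open>1 / (m + 1)\<close>.\<close>

lemma grid_avoiding_atoms:
  assumes T[measurable]: "T \<in> borel_measurable M"
  shows "\<exists>r. 0 < r \<and> r < (1::real) \<and> (\<forall>m i::nat. prob {\<omega>\<in>space M. T \<omega> = ennreal ((real i + r) / real (Suc m))} = 0)"
proof -
  interpret D: prob_space "distr M borel T" by (rule prob_space_distr[OF T])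
  define A where "A = {x. measure (distr M borel T) {x} \<noteq> 0}"
  have A: "countable A" unfolding A_def by (rule D.countable_support)
  define Bad where "Bad = (\<Union>m::nat. \<Union>i::nat. (\<lambda>x. enn2real x * real (Suc m) - real i) ` A)"
  have "countable Bad" unfolding Bad_def using A by (intro countable_UN countable_image) auto
  moreover have "uncountable {0<..<1::real}" by (simp add: uncountable_open_interval)
  ultimately have "\<not> {0<..<1} \<subseteq> Bad" using countable_subset by blast
  then obtain r where r: "r \<in> {0<..<1}" "r \<notin> Bad" by blast
  have "prob {\<omega>\<in>space M. T \<omega> = ennreal ((real i + r) / real (Suc m))} = 0" for m i :: nat
  proof (rule ccontr)
    let ?x = "ennreal ((real i + r) / real (Suc m))"
    assume "prob {\<omega>\<in>space M. T \<omega> = ?x} \<noteq> 0"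
    moreover have "measure (distr M borel T) {?x} = prob {\<omega>\<in>space M. T \<omega> = ?x}"
      by (subst measure_distr) (auto intro!: arg_cong[where f=prob])
    ultimately have "?x \<in> A" by (simp add: A_def)
    moreover have "enn2real ?x * real (Suc m) - real i = r" using r(1) by (simp add: field_simps)
    ultimately have "r \<in> Bad" unfolding Bad_def by (metis (mono_tags, lifting) UN_iff UNIV_I image_eqI)
    then show False using r(2) by simp
  qed
  then show ?thesis using r(1) by (intro exI[of _ r]) auto
qed

text \<open>The integrand is bounded from below by step functions in time, whose values are the infima
  over the cells of a grid. The grid points avoid the atoms of the limit, so that the step
  functions pass to the limit.\<close>

lemma lower_semicontinuity_continuous:
  fixes f :: "real \<Rightarrow> 'a \<Rightarrow> real"
  assumes conv: "converges_stably \<U> \<tau> T" and \<tau>: "\<And>n. \<tau> n \<in> borel_measurable M" and T[measurable]: "T \<in> borel_measurable M"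
    and Tfin: "AE \<omega> in M. T \<omega> < \<infinity>"
    and f: "\<And>t. 0 \<le> t \<Longrightarrow> f t \<in> borel_measurable (info {0..})"
    and fc: "\<And>\<omega>. \<omega> \<in> space M \<Longrightarrow> continuous_on {0..} (\<lambda>t. f t \<omega>)"
    and fb: "\<And>\<omega> t. \<omega> \<in> space M \<Longrightarrow> 0 \<le> t \<Longrightarrow> 0 \<le> f t \<omega> \<and> f t \<omega> \<le> C"
    and a: "a < expectation (\<lambda>\<omega>. f (enn2real (T \<omega>)) \<omega>)"
  shows "\<forall>\<^sub>F n in \<U>. a < expectation (\<lambda>\<omega>. f (enn2real (\<tau> n \<omega>)) \<omega>)"
proof -
  obtain r where r: "0 < r" "r < 1" and null: "\<And>m i::nat. prob {\<omega>\<in>space M. T \<omega> = ennreal ((real i + r) / real (Suc m))} = 0"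
    using grid_avoiding_atoms[OF T] by blast
  define pt where "pt = (\<lambda>m i::nat. (real i + r) / real (Suc m))"
  \<comment> \<open>Cell \<open>i\<close> is \<open>(lo m i, pt m i]\<close>, where the cell of index \<open>0\<close> also contains time \<open>0\<close>.\<close>
  define lo where "lo = (\<lambda>m i. if i = 0 then 0 else pt m (i - 1))"
  define D where "D = (\<lambda>p::nat \<times> nat. real (fst p) / 2 ^ snd p)"
  \<comment> \<open>The infimum over a dense countable subset of the cell, which is measurable.\<close>
  define c where "c = (\<lambda>m i \<omega>. INF p. f (min (lo m i + D p) (pt m i)) \<omega>)"
  \<comment> \<open>The step function vanishes after the last cell, in particular at \<open>\<infinity>\<close>. The indicator of a cell is a difference of events \<open>x \<le> t\<close>, as tested in the convergence.\<close>
  define S where "S = (\<lambda>m x \<omega>. \<Sum>i<Suc m * Suc m. c m i \<omega> * (of_bool (x \<le> ennreal (pt m i)) - of_bool (i \<noteq> 0 \<and> x \<le> ennreal (pt m (i - 1)))))"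
  have D0: "0 \<le> D p" for p by (simp add: D_def)
  have pt0: "0 < pt m i" for m i unfolding pt_def using r by (intro divide_pos_pos) auto
  have lo0: "0 \<le> lo m i" for m i using pt0[of m "i - 1"] by (simp add: lo_def)
  have lo_pt: "lo m i \<le> pt m i" for m i
    using pt0[of m i] by (auto simp: lo_def pt_def intro!: divide_right_mono)
  have width: "pt m i - lo m i \<le> 1 / real (Suc m)" for m i
  proof (cases i)
    case 0
    then show ?thesis unfolding lo_def pt_def using r by (simp add: divide_right_mono)
  next
    case (Suc j)
    have "pt m (Suc j) - pt m j = ((real (Suc j) + r) - (real j + r)) / real (Suc m)" unfolding pt_def by (rule diff_divide_distrib[symmetric])
    then show ?thesis unfolding Suc lo_def by simp
  qed
  have arg0: "0 \<le> min (lo m i + D p) (pt m i)" for m i p using lo0[of m i] D0[of p] pt0[of m i] by simp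
  have bdd: "bdd_below (range (\<lambda>p. f (min (lo m i + D p) (pt m i)) \<omega>))" if "\<omega> \<in> space M" for m i \<omega>
    using fb[OF that arg0] by (intro bdd_belowI2[of _ 0]) blast
  have cM: "c m i \<in> borel_measurable (info {0..})" for m i
    unfolding c_def using bdd by (intro borel_measurable_cINF f arg0) (auto simp: space_info)
  have c0: "0 \<le> c m i \<omega>" if "\<omega> \<in> space M" for m i \<omega>
    unfolding c_def using fb[OF that arg0] by (intro cINF_greatest) auto
  have c_le: "c m i \<omega> \<le> f t \<omega>" if \<omega>: "\<omega> \<in> space M" and t: "lo m i \<le> t" "t \<le> pt m i" for m i \<omega> t
  proof -
    have nn: "0 \<le> dyadic_above j (t - lo m i)" for j using dyadic_above_bounds(1)[of "t - lo m i" j] t by simp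
    have "(\<lambda>j. f (min (lo m i + dyadic_above j (t - lo m i)) (pt m i)) \<omega>) \<longlonglongrightarrow> f (min (lo m i + (t - lo m i)) (pt m i)) \<omega>"
      using lo0[of m i] nn pt0[of m i] t by (intro continuous_on_tendsto_right[OF fc[OF \<omega>]] tendsto_intros dyadic_above_tendsto) (auto intro: add_nonneg_nonneg)
    moreover have "c m i \<omega> \<le> f (min (lo m i + dyadic_above j (t - lo m i)) (pt m i)) \<omega>" for j
    proof -
      have "dyadic_above j (t - lo m i) = D (nat (\<lfloor>(t - lo m i) * 2 ^ j\<rfloor> + 1), j)" using t by (simp add: dyadic_above_def D_def)
      then show ?thesis unfolding c_def using cINF_lower[OF bdd[OF \<omega>]] by simp
    qed
    ultimately have "c m i \<omega> \<le> f (min (lo m i + (t - lo m i)) (pt m i)) \<omega>" by (intro LIMSEQ_le_const) auto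
    then show ?thesis using t by simp
  qed
  have c_C: "c m i \<omega> \<le> C" if "\<omega> \<in> space M" for m i \<omega>
  proof -
    have "c m i \<omega> \<le> f (pt m i) \<omega>" by (rule c_le[OF that lo_pt order_refl])
    also have "\<dots> \<le> C" using fb[OF that, of "pt m i"] pt0[of m i] by simp
    finally show ?thesis .
  qed
  have cMM: "c m i \<in> borel_measurable M" for m i using cM by (rule info_M)
  have S_eq: "S m (ennreal t) \<omega> = (let i = nat \<lceil>t * real (Suc m) - r\<rceil> in if i < Suc m * Suc m then c m i \<omega> else 0)"
    and cell: "lo m (nat \<lceil>t * real (Suc m) - r\<rceil>) \<le> t \<and> t \<le> pt m (nat \<lceil>t * real (Suc m) - r\<rceil>)" if t: "0 \<le> t" for m t \<omega>
  proof -
    let ?i = "nat \<lceil>t * real (Suc m) - r\<rceil>"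
    have iff: "t \<le> pt m i \<longleftrightarrow> ?i \<le> i" for i
    proof -
      have "t \<le> pt m i \<longleftrightarrow> t * real (Suc m) - r \<le> real i" by (auto simp: pt_def field_simps)
      also have "\<dots> \<longleftrightarrow> \<lceil>t * real (Suc m) - r\<rceil> \<le> int i" by (simp only: ceiling_le_iff of_int_of_nat_eq)
      also have "\<dots> \<longleftrightarrow> ?i \<le> i" by (simp only: nat_le_iff)
      finally show ?thesis .
    qed
    have e: "ennreal t \<le> ennreal (pt m i) \<longleftrightarrow> ?i \<le> i" for i using pt0[of m i] iff[of i] by simp
    have jump: "of_bool (I \<le> i) - of_bool (i \<noteq> 0 \<and> I \<le> i - 1) = (of_bool (i = I) :: real)" for i I :: nat
      by (cases i I rule: linorder_cases) auto
    have "S m (ennreal t) \<omega> = (\<Sum>i<Suc m * Suc m. if i = ?i then c m i \<omega> else 0)"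
      unfolding S_def e jump by (intro sum.cong refl) simp
    also have "\<dots> = (if ?i < Suc m * Suc m then c m ?i \<omega> else 0)" by (subst sum.delta) auto
    finally show "S m (ennreal t) \<omega> = (let i = ?i in if i < Suc m * Suc m then c m i \<omega> else 0)" by simp
    show "lo m ?i \<le> t \<and> t \<le> pt m ?i"
    proof
      show "t \<le> pt m ?i" using iff[of ?i] by simp
      show "lo m ?i \<le> t"
      proof (cases "?i = 0")
        case True
        then show ?thesis using t by (simp add: lo_def)
      next
        case False
        then have "\<not> ?i \<le> ?i - 1" by linarith
        then have "\<not> t \<le> pt m (?i - 1)" unfolding iff .
        moreover have "lo m ?i = pt m (?i - 1)" using False by (simp only: lo_def if_False)
        ultimately show ?thesis by linarith
      qed
    qed
  qed
  have S_top: "S m \<infinity> \<omega> = 0" for m \<omega>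
    unfolding S_def by (intro sum.neutral ballI) (simp add: top_unique)
  have S_le: "S m x \<omega> \<le> f (enn2real x) \<omega>" if \<omega>: "\<omega> \<in> space M" for m x \<omega>
  proof (cases x)
    case (real t)
    let ?i = "nat \<lceil>t * real (Suc m) - r\<rceil>"
    have "S m x \<omega> \<le> f t \<omega>"
      using c_le[OF \<omega>, of m ?i t] cell[OF real(1), of m] fb[OF \<omega> real(1)] S_eq[OF real(1), of m \<omega>] real(2) by (auto simp: Let_def)
    then show ?thesis using real by simp
  next
    case top
    then show ?thesis using fb[OF \<omega>, of 0] S_top[of m \<omega>] by simp
  qed
  have S_0: "0 \<le> S m x \<omega>" if \<omega>: "\<omega> \<in> space M" for m x \<omega>
  proof (cases x)
    case (real t)
    then show ?thesis using c0[OF \<omega>] S_eq[OF real(1), of m \<omega>] by (simp add: Let_def)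
  next
    case top
    then show ?thesis using S_top[of m \<omega>] by simp
  qed
  have C0: "0 \<le> C"
  proof -
    obtain \<omega> where "\<omega> \<in> space M" using not_empty by blast
    then show ?thesis using fb[of \<omega> 0] by auto
  qed
  have S_C: "S m x \<omega> \<le> C" if \<omega>: "\<omega> \<in> space M" for m x \<omega>
    using S_le[OF \<omega>, of m x] fb[OF \<omega>, of "enn2real x"] by simp
  have indM: "(\<lambda>\<omega>. of_bool (\<sigma> \<omega> \<le> ennreal t) :: real) \<in> borel_measurable M" if "\<sigma> \<in> borel_measurable M" for \<sigma> :: "'a \<Rightarrow> ennreal" and t
    unfolding of_bool_def using that by measurable
  have S_M: "(\<lambda>\<omega>. S m (\<sigma> \<omega>) \<omega>) \<in> borel_measurable M" if \<sigma>: "\<sigma> \<in> borel_measurable M" for m \<sigma>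
  proof -
    have m: "(\<lambda>\<omega>. of_bool (i \<noteq> 0 \<and> \<sigma> \<omega> \<le> ennreal t) :: real) \<in> borel_measurable M" for i :: nat and t
    proof (cases "i = 0")
      case False
      then show ?thesis using indM[OF \<sigma>, of t] by simp
    qed simp
    show ?thesis unfolding S_def
      by (intro borel_measurable_sum borel_measurable_times borel_measurable_diff cMM indM[OF \<sigma>] m)
  qed
  have S_lim: "((\<lambda>n. expectation (\<lambda>\<omega>. S m (\<tau> n \<omega>) \<omega>)) \<longlongrightarrow> expectation (\<lambda>\<omega>. S m (T \<omega>) \<omega>)) \<U>" for m
  proof -
    have one: "((\<lambda>n. expectation (\<lambda>\<omega>. c m i \<omega> * of_bool (\<tau> n \<omega> \<le> ennreal (pt m j)))) \<longlongrightarrow> expectation (\<lambda>\<omega>. c m i \<omega> * of_bool (T \<omega> \<le> ennreal (pt m j)))) \<U>" for i j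
    proof -
      have e: "expectation (\<lambda>\<omega>. c m i \<omega> * of_bool (\<sigma> \<omega> \<le> x)) = expectation (\<lambda>\<omega>. c m i \<omega> * indicator {\<omega>\<in>space M. \<sigma> \<omega> \<le> x} \<omega>)" for \<sigma> :: "'a \<Rightarrow> ennreal" and x
        by (intro Bochner_Integration.integral_cong) (auto simp: indicator_def)
      have "\<forall>\<omega>\<in>space M. \<bar>c m i \<omega>\<bar> \<le> C"
      proof
        fix \<omega> assume "\<omega> \<in> space M"
        then show "\<bar>c m i \<omega>\<bar> \<le> C" using c0[of \<omega> m i] c_C[of \<omega> m i] by simp
      qed
      then show ?thesis unfolding e using conv cM[of m i] null[of j m] less_imp_le[OF pt0[of m j]]
        unfolding converges_stably_def pt_def by blast
    qed
    have split: "expectation (\<lambda>\<omega>. S m (\<sigma> \<omega>) \<omega>) = (\<Sum>i<Suc m * Suc m. expectation (\<lambda>\<omega>. c m i \<omega> * of_bool (\<sigma> \<omega> \<le> ennreal (pt m i)))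
        - (if i = 0 then 0 else expectation (\<lambda>\<omega>. c m i \<omega> * of_bool (\<sigma> \<omega> \<le> ennreal (pt m (i - 1))))))"
      if \<sigma>: "\<sigma> \<in> borel_measurable M" for \<sigma>
    proof -
      have i: "integrable M (\<lambda>\<omega>. c m i \<omega> * of_bool (\<sigma> \<omega> \<le> ennreal t))" for i t
      proof (rule bounded_mult_integrable[OF cMM indM[OF \<sigma>]])
        show "\<bar>c m i \<omega>\<bar> \<le> C" if "\<omega> \<in> space M" for \<omega> using c0[OF that, of m i] c_C[OF that, of m i] by simp
        show "\<bar>of_bool (\<sigma> \<omega> \<le> ennreal t)\<bar> \<le> (1::real)" for \<omega> by simp
      qed
      have S': "S m x \<omega> = (\<Sum>i<Suc m * Suc m. c m i \<omega> * of_bool (x \<le> ennreal (pt m i)) - (if i = 0 then 0 else c m i \<omega> * of_bool (x \<le> ennreal (pt m (i - 1)))))" for x \<omega>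
        unfolding S_def by (intro sum.cong refl) (auto simp: right_diff_distrib)
      have "expectation (\<lambda>\<omega>. S m (\<sigma> \<omega>) \<omega>) = (\<Sum>i<Suc m * Suc m. expectation (\<lambda>\<omega>. c m i \<omega> * of_bool (\<sigma> \<omega> \<le> ennreal (pt m i)) - (if i = 0 then 0 else c m i \<omega> * of_bool (\<sigma> \<omega> \<le> ennreal (pt m (i - 1))))))"
        unfolding S'
      proof (rule Bochner_Integration.integral_sum)
        show "integrable M (\<lambda>\<omega>. c m j \<omega> * of_bool (\<sigma> \<omega> \<le> ennreal (pt m j)) - (if j = 0 then 0 else c m j \<omega> * of_bool (\<sigma> \<omega> \<le> ennreal (pt m (j - 1)))))" for j
          using i[of j] by (cases "j = 0") auto
      qed
      also have "\<dots> = (\<Sum>i<Suc m * Suc m. expectation (\<lambda>\<omega>. c m i \<omega> * of_bool (\<sigma> \<omega> \<le> ennreal (pt m i)))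
        - (if i = 0 then 0 else expectation (\<lambda>\<omega>. c m i \<omega> * of_bool (\<sigma> \<omega> \<le> ennreal (pt m (i - 1))))))"
      proof (rule sum.cong[OF refl])
        fix j
        show "expectation (\<lambda>\<omega>. c m j \<omega> * of_bool (\<sigma> \<omega> \<le> ennreal (pt m j)) - (if j = 0 then 0 else c m j \<omega> * of_bool (\<sigma> \<omega> \<le> ennreal (pt m (j - 1))))) =
          expectation (\<lambda>\<omega>. c m j \<omega> * of_bool (\<sigma> \<omega> \<le> ennreal (pt m j))) - (if j = 0 then 0 else expectation (\<lambda>\<omega>. c m j \<omega> * of_bool (\<sigma> \<omega> \<le> ennreal (pt m (j - 1)))))"
          by (cases "j = 0") (simp_all only: simp_thms if_True if_False diff_zero Bochner_Integration.integral_diff[OF i i])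
      qed
      finally show ?thesis .
    qed
    show ?thesis unfolding split[OF \<tau>] split[OF T]
    proof (intro tendsto_sum tendsto_diff one)
      fix j
      show "((\<lambda>n. if j = 0 then 0 else expectation (\<lambda>\<omega>. c m j \<omega> * of_bool (\<tau> n \<omega> \<le> ennreal (pt m (j - 1)))))
        \<longlongrightarrow> (if j = 0 then 0 else expectation (\<lambda>\<omega>. c m j \<omega> * of_bool (T \<omega> \<le> ennreal (pt m (j - 1)))))) \<U>"
        using one[of j "j - 1"] by (cases "j = 0") (simp_all only: simp_thms if_True if_False tendsto_const)
    qed
  qed
  have fT: "(\<lambda>\<omega>. f (enn2real (\<sigma> \<omega>)) \<omega>) \<in> borel_measurable M" if \<sigma>: "\<sigma> \<in> borel_measurable M" for \<sigma>
  proof (rule borel_measurable_at_random_time[of f, OF _ fc])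
    show "f t \<in> borel_measurable M" if "0 \<le> t" for t by (rule info_M[OF f[OF that]])
    show "(\<lambda>\<omega>. enn2real (\<sigma> \<omega>)) \<in> borel_measurable M" using \<sigma> by simp
  qed simp_all
  have "(\<lambda>m. expectation (\<lambda>\<omega>. S m (T \<omega>) \<omega>)) \<longlonglongrightarrow> expectation (\<lambda>\<omega>. f (enn2real (T \<omega>)) \<omega>)"
  proof (rule integral_dominated_convergence[where w="\<lambda>_. C"])
    show "AE \<omega> in M. norm (S m (T \<omega>) \<omega>) \<le> C" for m
    proof (intro AE_I2)
      fix \<omega> assume "\<omega> \<in> space M"
      then show "norm (S m (T \<omega>) \<omega>) \<le> C" using S_0[of \<omega> m "T \<omega>"] S_C[of \<omega> m "T \<omega>"] by simp
    qed
    show "AE \<omega> in M. (\<lambda>m. S m (T \<omega>) \<omega>) \<longlonglongrightarrow> f (enn2real (T \<omega>)) \<omega>"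
      using Tfin AE_space
    proof eventually_elim
      fix \<omega> assume "T \<omega> < \<infinity>" and \<omega>: "\<omega> \<in> space M"
      then obtain t where t: "0 \<le> t" "T \<omega> = ennreal t" by (cases "T \<omega>") auto
      have "(\<lambda>m. S m (T \<omega>) \<omega>) \<longlonglongrightarrow> f t \<omega>"
      proof (rule tendsto_sandwich[OF _ _ _ tendsto_const])
        show "\<forall>\<^sub>F m in sequentially. S m (T \<omega>) \<omega> \<le> f t \<omega>" using S_le[OF \<omega>, of _ "T \<omega>"] t by (intro always_eventually allI) simp
        let ?g = "\<lambda>m. INF s\<in>{s. 0 \<le> s \<and> \<bar>s - t\<bar> \<le> 1 / real (Suc m)}. f s \<omega>"
        have ne: "t \<in> {s. 0 \<le> s \<and> \<bar>s - t\<bar> \<le> 1 / real (Suc m)}" for m using t by simp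
        have bb: "bdd_below ((\<lambda>s. f s \<omega>) ` {s. 0 \<le> s \<and> \<bar>s - t\<bar> \<le> 1 / real (Suc m)})" for m
          using fb[OF \<omega>] by (intro bdd_belowI2[of _ 0]) blast
        show "?g \<longlonglongrightarrow> f t \<omega>"
        proof (rule tendstoI)
          fix e :: real assume e: "0 < e"
          have "\<exists>d>0. \<forall>s\<in>{0..}. dist s t < d \<longrightarrow> dist (f s \<omega>) (f t \<omega>) < e / 2"
            using fc[OF \<omega>] t e unfolding continuous_on_iff by (metis atLeast_iff half_gt_zero)
          then obtain d where d: "0 < d" "\<And>s. 0 \<le> s \<Longrightarrow> \<bar>s - t\<bar> < d \<Longrightarrow> \<bar>f s \<omega> - f t \<omega>\<bar> < e / 2"
            unfolding dist_real_def by (metis atLeast_iff)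
          have "\<forall>\<^sub>F m in sequentially. 1 / real (Suc m) < d"
            using LIMSEQ_Suc[OF lim_1_over_n[where 'a=real]] d(1) by (simp only: order_tendsto_iff)
          then show "\<forall>\<^sub>F m in sequentially. dist (?g m) (f t \<omega>) < e"
          proof eventually_elim
            case (elim m)
            have "f t \<omega> - e / 2 \<le> ?g m"
            proof (rule cINF_greatest)
              fix s assume "s \<in> {s. 0 \<le> s \<and> \<bar>s - t\<bar> \<le> 1 / real (Suc m)}"
              then have "\<bar>f s \<omega> - f t \<omega>\<bar> < e / 2" using elim by (intro d(2)) auto
              then show "f t \<omega> - e / 2 \<le> f s \<omega>" by linarith
            qed (use ne in blast)
            moreover have "?g m \<le> f t \<omega>" using cINF_lower[OF bb ne] .
            ultimately show ?case using e by (simp add: dist_real_def)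
          qed
        qed
        obtain K :: nat where K: "t \<le> real K" using real_arch_simple by blast
        show "\<forall>\<^sub>F m in sequentially. ?g m \<le> S m (T \<omega>) \<omega>"
          using eventually_ge_at_top[of K]
        proof eventually_elim
          case (elim m)
          let ?i = "nat \<lceil>t * real (Suc m) - r\<rceil>"
          have "t * real (Suc m) \<le> real m * real (Suc m)" using elim K by (intro mult_right_mono) auto
          then have "t * real (Suc m) - r \<le> real (m * Suc m)" using r(1) unfolding of_nat_mult by linarith
          then have "\<lceil>t * real (Suc m) - r\<rceil> \<le> int (m * Suc m)" by (simp only: ceiling_le_iff of_int_of_nat_eq)
          then have "?i \<le> m * Suc m" by linarith
          then have i: "?i < Suc m * Suc m" by (rule le_less_trans) simp
          note len = width[of m ?i]
          have "?g m \<le> c m ?i \<omega>"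
            unfolding c_def
          proof (rule cINF_greatest)
            fix p
            obtain w where w: "w = min (lo m ?i + D p) (pt m ?i)" by blast
            have "lo m ?i \<le> w" "w \<le> pt m ?i" unfolding w using D0[of p] lo_pt[of m ?i] by simp_all
            then have "0 \<le> w" "\<bar>w - t\<bar> \<le> 1 / real (Suc m)"
              using cell[OF t(1), of m] len lo0[of m ?i] by linarith+
            then have "min (lo m ?i + D p) (pt m ?i) \<in> {s. 0 \<le> s \<and> \<bar>s - t\<bar> \<le> 1 / real (Suc m)}"
              unfolding w by blast
            then show "?g m \<le> f (min (lo m ?i + D p) (pt m ?i)) \<omega>" using cINF_lower[OF bb] by blast
          qed simp
          then show ?case using i S_eq[OF t(1), of m \<omega>] t(2) by (simp add: Let_def)
        qed
      qed
      then show "(\<lambda>m. S m (T \<omega>) \<omega>) \<longlonglongrightarrow> f (enn2real (T \<omega>)) \<omega>" using t by simp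
    qed
  qed (use fT[OF T] S_M[OF T] in auto)
  then have "\<forall>\<^sub>F m in sequentially. a < expectation (\<lambda>\<omega>. S m (T \<omega>) \<omega>)" using a by (simp add: order_tendsto_iff)
  then obtain m where m: "a < expectation (\<lambda>\<omega>. S m (T \<omega>) \<omega>)" by (auto simp: eventually_sequentially)
  have "\<forall>\<^sub>F n in \<U>. a < expectation (\<lambda>\<omega>. S m (\<tau> n \<omega>) \<omega>)" using S_lim[of m] m by (simp add: order_tendsto_iff)
  then show ?thesis
  proof eventually_elim
    case (elim n)
    have "expectation (\<lambda>\<omega>. S m (\<tau> n \<omega>) \<omega>) \<le> expectation (\<lambda>\<omega>. f (enn2real (\<tau> n \<omega>)) \<omega>)"
    proof (rule integral_mono)
      show "integrable M (\<lambda>\<omega>. S m (\<tau> n \<omega>) \<omega>)"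
      proof (rule bounded_integrable[OF S_M[OF \<tau>], of _ _ C])
        fix \<omega> assume "\<omega> \<in> space M"
        then show "\<bar>S m (\<tau> n \<omega>) \<omega>\<bar> \<le> C" using S_0[of \<omega> m "\<tau> n \<omega>"] S_C[of \<omega> m "\<tau> n \<omega>"] by simp
      qed
      show "integrable M (\<lambda>\<omega>. f (enn2real (\<tau> n \<omega>)) \<omega>)"
      proof (rule bounded_integrable[OF fT[OF \<tau>], of _ C])
        fix \<omega> assume "\<omega> \<in> space M"
        then show "\<bar>f (enn2real (\<tau> n \<omega>)) \<omega>\<bar> \<le> C" using fb[of \<omega> "enn2real (\<tau> n \<omega>)"] by simp
      qed
    qed (rule S_le)
    then show ?case using elim by simp
  qed
qed

end

section \<open>Lower semicontinuous functions of stopped paths\<close>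

text \<open>The inf-convolution of \<open>f\<close> with multiples of the distance, truncated to be bounded.\<close>

lemma (in Metric_space) lipschitz_approximation_from_below:
  assumes lsc: "lower_semicontinuous_map mtopology f" and f0: "\<And>x. x \<in> M \<Longrightarrow> 0 \<le> f x"
  defines "g \<equiv> \<lambda>k x. min (real k) (INF y\<in>M. f y + real k * d x y)"
  shows "x \<in> M \<Longrightarrow> x' \<in> M \<Longrightarrow> \<bar>g k x - g k x'\<bar> \<le> real k * d x x'"
    and "x \<in> M \<Longrightarrow> 0 \<le> g k x" and "g k x \<le> real k" and "x \<in> M \<Longrightarrow> g k x \<le> g (Suc k) x"
    and "x \<in> M \<Longrightarrow> (\<lambda>k. g k x) \<longlonglongrightarrow> f x"
proof -
  let ?h = "\<lambda>k x. INF y\<in>M. f y + real k * d x y"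
  have nn: "0 \<le> f y + real k * d x y" if "y \<in> M" for k x y using f0[OF that] nonneg[of x y] by simp
  have bdd: "bdd_below ((\<lambda>y. f y + real k * d x y) ` M)" for k x using nn by (intro bdd_belowI2[of _ 0])
  have h_le: "?h k x \<le> f y + real k * d x y" if "y \<in> M" for k x y by (rule cINF_lower[OF bdd that])
  have one: "?h k x \<le> ?h k x' + real k * d x x'" if x: "x \<in> M" "x' \<in> M" for k x x'
  proof -
    have "?h k x - real k * d x x' \<le> ?h k x'"
    proof (rule cINF_greatest)
      fix y assume y: "y \<in> M"
      have "real k * d x y \<le> real k * (d x x' + d x' y)" using triangle[OF x y] by (intro mult_left_mono) auto
      then show "?h k x - real k * d x x' \<le> f y + real k * d x' y" using h_le[OF y, of k x] by (simp add: distrib_left)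
    qed (use x in auto)
    then show ?thesis by simp
  qed
  show "\<bar>g k x - g k x'\<bar> \<le> real k * d x x'" if x: "x \<in> M" "x' \<in> M"
    using one[OF x, of k] one[OF x(2,1), of k] by (auto simp: g_def commute min_def abs_le_iff)
  show "0 \<le> g k x" if x: "x \<in> M"
    using nn x unfolding g_def by (auto intro!: cINF_greatest)
  show "g k x \<le> real k" by (simp add: g_def)
  show "g k x \<le> g (Suc k) x" if x: "x \<in> M"
  proof -
    have "?h k x \<le> ?h (Suc k) x"
    proof (rule cINF_greatest)
      fix y assume y: "y \<in> M"
      have "real k * d x y \<le> real (Suc k) * d x y" by (intro mult_right_mono nonneg) simp
      then show "?h k x \<le> f y + real (Suc k) * d x y" using h_le[OF y, of k x] by simp
    qed (use x in auto)
    then show ?thesis unfolding g_def by (intro min.mono) auto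
  qed
  show "(\<lambda>k. g k x) \<longlonglongrightarrow> f x" if x: "x \<in> M"
  proof (rule order_tendstoI)
    fix a assume "f x < a"
    then have "g k x < a" for k using h_le[OF x, of k x] x by (simp add: g_def)
    then show "\<forall>\<^sub>F k in sequentially. g k x < a" by simp
  next
    fix a assume a: "a < f x"
    obtain b where b: "a < b" "b < f x" using dense[OF a] by blast
    have "openin mtopology {y \<in> M. b < f y}" using lsc unfolding lower_semicontinuous_map_def by simp
    then obtain r where r: "0 < r" "mball x r \<subseteq> {y \<in> M. b < f y}" using x b unfolding openin_mtopology by blast
    obtain K :: nat where K: "b / r \<le> real K" "b \<le> real K" using real_arch_simple[of "max (b / r) b"] by auto
    show "\<forall>\<^sub>F k in sequentially. a < g k x"
      using eventually_ge_at_top[of K]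
    proof eventually_elim
      case (elim k)
      have "b \<le> ?h k x"
      proof (rule cINF_greatest)
        fix y assume y: "y \<in> M"
        show "b \<le> f y + real k * d x y"
        proof (cases "d x y < r")
          case True
          then have "y \<in> mball x r" using x y by simp
          then have "b < f y" using r(2) by blast
          moreover have "0 \<le> real k * d x y" by (intro mult_nonneg_nonneg nonneg) simp
          ultimately show ?thesis by linarith
        next
          case False
          have "b \<le> real K * r" using K(1) r(1) by (simp add: field_simps)
          also have "\<dots> \<le> real k * d x y" using elim False r(1) by (intro mult_mono) auto
          finally show ?thesis using f0[OF y] by simp
        qed
      qed (use x in auto)
      then show ?case using b(1) K(2) elim by (simp add: g_def)
    qed
  qed
qed

context brownian_basis
begin

definition path_upto :: "real \<Rightarrow> 'a \<Rightarrow> (real \<Rightarrow> real) \<times> real" where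
  "path_upto t \<omega> = (restrict (\<lambda>s. B s \<omega>) {0..t}, t)"

lemma continuous_on_restrict_self: "continuous_on A f \<Longrightarrow> continuous_on A (restrict f A)"
  by (rule continuous_on_cong[THEN iffD1, rotated -1]) auto

lemma path_upto_stopped_paths: "0 \<le> t \<Longrightarrow> \<omega> \<in> space M \<Longrightarrow> path_upto t \<omega> \<in> stopped_paths"
proof -
  assume t: "0 \<le> t" and \<omega>: "\<omega> \<in> space M"
  have "continuous_on {0..t} (\<lambda>s. B s \<omega>)" using B_continuous[OF \<omega>] by (rule continuous_on_subset) auto
  then have "continuous_on {0..t} (restrict (\<lambda>s. B s \<omega>) {0..t})"
    by (rule continuous_on_restrict_self)
  then show ?thesis using t B_0[OF \<omega>] by (simp add: path_upto_def stopped_paths_def)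
qed

lemma stopped_path_eq: "stopped_path B \<tau> \<omega> = path_upto (enn2real (\<tau> \<omega>)) \<omega>"
  by (simp add: stopped_path_def path_upto_def)

text \<open>Two stopped versions of one path differ only between the two stopping times, where both are
  close to the value at time \<open>t\<close>.\<close>

lemma path_dist_path_upto_le:
  assumes s: "0 \<le> s" and t: "0 \<le> t" and \<omega>: "\<omega> \<in> space M"
    and "\<bar>s - t\<bar> \<le> e" and near: "\<And>u. 0 \<le> u \<Longrightarrow> \<bar>u - t\<bar> \<le> \<bar>s - t\<bar> \<Longrightarrow> \<bar>B u \<omega> - B t \<omega>\<bar> \<le> e / 2"
  shows "path_dist (path_upto s \<omega>) (path_upto t \<omega>) \<le> e"
  unfolding path_dist_le_iff[OF path_upto_stopped_paths[OF s \<omega>] path_upto_stopped_paths[OF t \<omega>]]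
proof (intro conjI allI impI)
  show "\<bar>snd (path_upto s \<omega>) - snd (path_upto t \<omega>)\<bar> \<le> e" using assms(4) by (simp add: path_upto_def)
  fix u :: real assume u: "0 \<le> u"
  have e: "0 \<le> e" using assms(4) by linarith
  have "\<bar>B (min u s) \<omega> - B (min u t) \<omega>\<bar> \<le> e"
  proof (cases "min u s = min u t")
    case True
    then show ?thesis using e by simp
  next
    case False
    then have "\<bar>min u s - t\<bar> \<le> \<bar>s - t\<bar>" "\<bar>min u t - t\<bar> \<le> \<bar>s - t\<bar>" by (auto simp: min_def split: if_splits)
    then have "\<bar>B (min u s) \<omega> - B t \<omega>\<bar> \<le> e / 2" "\<bar>B (min u t) \<omega> - B t \<omega>\<bar> \<le> e / 2"
      using u s t by (auto intro: near simp del: le_divide_eq_numeral1 divide_le_eq_numeral1)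
    then show ?thesis by linarith
  qed
  then show "\<bar>fst (path_upto s \<omega>) (min u (snd (path_upto s \<omega>))) - fst (path_upto t \<omega>) (min u (snd (path_upto t \<omega>)))\<bar> \<le> e"
    using u s t by (simp add: path_upto_def)
qed

lemma continuous_along_path:
  assumes lip: "\<And>x y. x \<in> stopped_paths \<Longrightarrow> y \<in> stopped_paths \<Longrightarrow> \<bar>g x - g y\<bar> \<le> K * path_dist x y"
    and \<omega>: "\<omega> \<in> space M"
  shows "continuous_on {0..} (\<lambda>t. g (path_upto t \<omega>) :: real)"
  unfolding continuous_on_iff
proof (intro ballI allI impI)
  fix t e :: real assume t: "t \<in> {0..}" and e: "0 < e"
  define e' where "e' = e / (2 * (\<bar>K\<bar> + 1))"
  have e': "0 < e'" using e by (simp add: e'_def add_nonneg_pos)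
  obtain d where d: "0 < d" "\<And>u. u \<in> {0..} \<Longrightarrow> dist u t < d \<Longrightarrow> dist (B u \<omega>) (B t \<omega>) < e' / 2"
    using B_continuous[OF \<omega>] t e' unfolding continuous_on_iff by (metis half_gt_zero)
  show "\<exists>d>0. \<forall>s\<in>{0..}. dist s t < d \<longrightarrow> dist (g (path_upto s \<omega>)) (g (path_upto t \<omega>)) < e"
  proof (intro exI[of _ "min d e'"] conjI ballI impI)
    show "0 < min d e'" using d e' by simp
    fix s assume s: "s \<in> {0..}" "dist s t < min d e'"
    have "path_dist (path_upto s \<omega>) (path_upto t \<omega>) \<le> e'"
    proof (rule path_dist_path_upto_le[OF _ _ \<omega>])
      fix u assume u: "0 \<le> u" "\<bar>u - t\<bar> \<le> \<bar>s - t\<bar>"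
      have "dist (B u \<omega>) (B t \<omega>) < e' / 2" using u s by (intro d(2)) (auto simp: dist_real_def)
      then show "\<bar>B u \<omega> - B t \<omega>\<bar> \<le> e' / 2" by (simp add: dist_real_def)
    qed (use s t in \<open>auto simp: dist_real_def\<close>)
    then have "K * path_dist (path_upto s \<omega>) (path_upto t \<omega>) \<le> \<bar>K\<bar> * e'"
      by (intro mult_mono[OF abs_ge_self]) (auto simp: path_dist_nonneg)
    moreover have "\<bar>g (path_upto s \<omega>) - g (path_upto t \<omega>)\<bar> \<le> K * path_dist (path_upto s \<omega>) (path_upto t \<omega>)"
      using s t \<omega> by (intro lip path_upto_stopped_paths) auto
    moreover have "\<bar>K\<bar> * e' < e"
    proof -
      have "\<bar>K\<bar> * e' \<le> (\<bar>K\<bar> + 1) * e'" using e' by (intro mult_right_mono) auto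
      also have "\<dots> = e / 2" by (simp add: e'_def field_simps)
      finally show ?thesis using e by simp
    qed
    ultimately show "dist (g (path_upto s \<omega>)) (g (path_upto t \<omega>)) < e" unfolding dist_real_def by linarith
  qed
qed

lemma measurable_int_list:
  assumes F: "\<And>k. k < m \<Longrightarrow> F k \<in> measurable N (count_space (UNIV :: int set))"
  shows "(\<lambda>\<omega>. map (\<lambda>k. F k \<omega>) [0..<m]) \<in> measurable N (count_space UNIV)"
proof (rule measurable_count_space_eq2_countable[THEN iffD2], intro conjI allI ballI)
  fix l :: "int list"
  have "map (\<lambda>k. F k \<omega>) [0..<m] = l \<longleftrightarrow> length l = m \<and> (\<forall>k\<in>{..<m}. F k \<omega> = l ! k)" for \<omega>
  proof
    assume "map (\<lambda>k. F k \<omega>) [0..<m] = l"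
    then have "l = map (\<lambda>k. F k \<omega>) [0..<m]" by (rule sym)
    then show "length l = m \<and> (\<forall>k\<in>{..<m}. F k \<omega> = l ! k)" by simp
  next
    assume l: "length l = m \<and> (\<forall>k\<in>{..<m}. F k \<omega> = l ! k)"
    show "map (\<lambda>k. F k \<omega>) [0..<m] = l" by (rule nth_equalityI) (use l in auto)
  qed
  then have "(\<lambda>\<omega>. map (\<lambda>k. F k \<omega>) [0..<m]) -` {l} \<inter> space N = {\<omega>\<in>space N. length l = m \<and> (\<forall>k\<in>{..<m}. F k \<omega> = l ! k)}"
    by blast
  also have "\<dots> = (if length l = m then {\<omega>\<in>space N. \<forall>k\<in>{..<m}. F k \<omega> = l ! k} else {})" by simp
  finally have "(\<lambda>\<omega>. map (\<lambda>k. F k \<omega>) [0..<m]) -` {l} \<inter> space N = (if length l = m then {\<omega>\<in>space N. \<forall>k\<in>{..<m}. F k \<omega> = l ! k} else {})" .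
  moreover have "{\<omega>\<in>space N. \<forall>k\<in>{..<m}. F k \<omega> = l ! k} \<in> sets N"
  proof (rule sets.sets_Collect_finite_All)
    fix k assume "k \<in> {..<m}"
    then have [measurable]: "F k \<in> measurable N (count_space UNIV)" using F by simp
    show "{\<omega>\<in>space N. F k \<omega> = l ! k} \<in> sets N" by measurable
  qed simp
  ultimately show "(\<lambda>\<omega>. map (\<lambda>k. F k \<omega>) [0..<m]) -` {l} \<inter> space N \<in> sets N" by simp
qed auto

text \<open>Bernstein polynomials with rounded coefficients approximate the path uniformly and take
  countably many values, so functionals of the path are measurable without reference to a
  sigma-algebra on the path space.\<close>

lemma measurable_along_path:
  assumes lip: "\<And>x y. x \<in> stopped_paths \<Longrightarrow> y \<in> stopped_paths \<Longrightarrow> \<bar>g x - g y\<bar> \<le> K * path_dist x y"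
    and t: "0 \<le> t"
  shows "(\<lambda>\<omega>. g (path_upto t \<omega>) :: real) \<in> borel_measurable (info {0..})"
proof (cases "t = 0")
  case True
  have "g (path_upto t \<omega>) = g (restrict (\<lambda>_. 0) {0..0}, 0)" if "\<omega> \<in> space (info {0..})" for \<omega>
  proof -
    have "restrict (\<lambda>s. B s \<omega>) {0..0} = restrict (\<lambda>_. 0) {0..0}" using that B_0[of \<omega>] by (auto simp: space_info restrict_def)
    then show ?thesis by (simp add: path_upto_def True)
  qed
  then show ?thesis by (subst measurable_cong[where g="\<lambda>_. g (restrict (\<lambda>_. 0) {0..0}, 0)"]) auto
next
  case False
  with t have t: "0 < t" by simp
  define Z where "Z = (\<lambda>n k \<omega>. \<lfloor>real (Suc n) * B (real k / real (Suc n) * t) \<omega>\<rfloor>)"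
  \<comment> \<open>The polynomial as a function of its list of integer coefficients; the type of lists is countable, so that composing with \<open>g\<close> preserves measurability.\<close>
  define P where "P = (\<lambda>n (l :: int list). (restrict (\<lambda>u. \<Sum>k\<le>Suc n. (real_of_int (l ! k) / real (Suc n)) * Bernstein (Suc n) k (u / t)) {0..t}, t))"
  define L where "L = (\<lambda>n \<omega>. map (\<lambda>k. Z n k \<omega>) [0..<Suc (Suc n)])"
  have PL: "fst (P n (L n \<omega>)) u = (\<Sum>k\<le>Suc n. (real_of_int (Z n k \<omega>) / real (Suc n)) * Bernstein (Suc n) k (u / t))" if "u \<in> {0..t}" for n u \<omega>
    using that unfolding P_def L_def by (auto intro!: sum.cong simp del: upt_Suc)
  have close: "\<bar>real_of_int (Z n k \<omega>) / real (Suc n) - B (real k / real (Suc n) * t) \<omega>\<bar> \<le> 1 / real (Suc n)" for n k \<omega>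
  proof -
    let ?b = "B (real k / real (Suc n) * t) \<omega>"
    have "\<bar>real_of_int (Z n k \<omega>) - real (Suc n) * ?b\<bar> \<le> 1" unfolding Z_def by linarith
    moreover have "real_of_int (Z n k \<omega>) / real (Suc n) - ?b = (real_of_int (Z n k \<omega>) - real (Suc n) * ?b) / real (Suc n)"
      by (simp add: diff_divide_distrib del: of_nat_Suc)
    ultimately show ?thesis by (simp add: abs_divide divide_right_mono del: of_nat_Suc)
  qed
  show ?thesis
  proof (rule borel_measurable_LIMSEQ_real)
    fix n
    have "L n \<in> measurable (info {0..}) (count_space UNIV)"
      unfolding L_def
    proof (rule measurable_int_list)
      fix k
      have "B (real k / real (Suc n) * t) \<in> borel_measurable (info {0..})" using t by (intro B_info) auto
      then show "(\<lambda>\<omega>. Z n k \<omega>) \<in> measurable (info {0..}) (count_space UNIV)" unfolding Z_def by measurable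
    qed
    from measurable_compose[OF this, of "\<lambda>l. g (P n l)" borel]
    show "(\<lambda>\<omega>. g (P n (L n \<omega>))) \<in> borel_measurable (info {0..})" by simp
  next
    fix \<omega> assume "\<omega> \<in> space (info {0..})"
    then have \<omega>: "\<omega> \<in> space M" by (simp add: space_info)
    have mem: "P n (L n \<omega>) \<in> stopped_paths" for n
    proof -
      have "continuous_on {0..t} (\<lambda>u. \<Sum>k\<le>Suc n. (real_of_int (L n \<omega> ! k) / real (Suc n)) * Bernstein (Suc n) k (u / t))"
        unfolding Bernstein_def using t by (intro continuous_intros) auto
      then have c: "continuous_on {0..t} (fst (P n (L n \<omega>)))" unfolding P_def fst_conv by (rule continuous_on_restrict_self)
      have "Bernstein (Suc n) k 0 = of_bool (k = 0)" for k by (auto simp: Bernstein_def power_0_left)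
      then have "fst (P n (L n \<omega>)) 0 = (\<Sum>k\<le>Suc n. (real_of_int (Z n k \<omega>) / real (Suc n)) * of_bool (k = 0))"
        using t by (subst PL) auto
      also have "\<dots> = (\<Sum>k\<le>Suc n. if k = 0 then real_of_int (Z n 0 \<omega>) / real (Suc n) else 0)" by (intro sum.cong) auto
      also have "\<dots> = real_of_int (Z n 0 \<omega>) / real (Suc n)" by (subst sum.delta) auto
      also have "\<dots> = 0" using B_0[OF \<omega>] by (simp add: Z_def)
      finally have z: "fst (P n (L n \<omega>)) 0 = 0" .
      have ext: "fst (P n (L n \<omega>)) \<in> extensional {0..t}" and sn: "snd (P n (L n \<omega>)) = t" by (auto simp: P_def)
      have "(fst (P n (L n \<omega>)), snd (P n (L n \<omega>))) \<in> stopped_paths"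
        unfolding stopped_paths_def using t c z ext sn by simp
      then show ?thesis by simp
    qed
    have pu: "path_upto t \<omega> \<in> stopped_paths" using t \<omega> by (intro path_upto_stopped_paths) auto
    have dist0: "(\<lambda>n. path_dist (P n (L n \<omega>)) (path_upto t \<omega>)) \<longlonglongrightarrow> 0"
    proof (rule tendstoI)
      fix e :: real assume e: "0 < e"
      have "continuous_on {0..1} (\<lambda>x. B (x * t) \<omega>)"
        using t by (intro continuous_on_compose2[OF B_continuous[OF \<omega>]] continuous_intros) auto
      from Bernstein_Weierstrass[OF this, of "e / 4"] e
      obtain N where N: "\<And>n x. N \<le> n \<Longrightarrow> x \<in> {0..1} \<Longrightarrow> \<bar>B (x * t) \<omega> - (\<Sum>k\<le>n. B (real k / real n * t) \<omega> * Bernstein n k x)\<bar> < e / 4" by auto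
      have "\<forall>\<^sub>F n in sequentially. 1 / real (Suc n) < e / 4"
        using LIMSEQ_Suc[OF lim_1_over_n[where 'a=real]] e by (simp only: order_tendsto_iff)
      then show "\<forall>\<^sub>F n in sequentially. dist (path_dist (P n (L n \<omega>)) (path_upto t \<omega>)) 0 < e"
        using eventually_ge_at_top[of N]
      proof eventually_elim
        case (elim n)
        have "path_dist (P n (L n \<omega>)) (path_upto t \<omega>) \<le> e / 2"
          unfolding path_dist_le_iff[OF mem pu]
        proof (intro conjI allI impI)
          show "\<bar>snd (P n (L n \<omega>)) - snd (path_upto t \<omega>)\<bar> \<le> e / 2" using e by (simp add: P_def path_upto_def)
          fix u :: real assume u: "0 \<le> u"
          define v where "v = min u t"
          have v: "v \<in> {0..t}" using u t by (auto simp: v_def)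
          then have x: "v / t \<in> {0..1}" using t by auto
          have "\<bar>fst (P n (L n \<omega>)) v - (\<Sum>k\<le>Suc n. B (real k / real (Suc n) * t) \<omega> * Bernstein (Suc n) k (v / t))\<bar>
              = \<bar>\<Sum>k\<le>Suc n. (real_of_int (Z n k \<omega>) / real (Suc n) - B (real k / real (Suc n) * t) \<omega>) * Bernstein (Suc n) k (v / t)\<bar>"
            unfolding PL[OF v] by (simp only: left_diff_distrib sum_subtractf)
          also have "\<dots> \<le> (\<Sum>k\<le>Suc n. \<bar>(real_of_int (Z n k \<omega>) / real (Suc n) - B (real k / real (Suc n) * t) \<omega>) * Bernstein (Suc n) k (v / t)\<bar>)"
            by (rule sum_abs)
          also have "\<dots> \<le> (\<Sum>k\<le>Suc n. 1 / real (Suc n) * Bernstein (Suc n) k (v / t))"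
          proof (rule sum_mono)
            fix k
            have b: "0 \<le> Bernstein (Suc n) k (v / t)" using x by (intro Bernstein_nonneg) auto
            show "\<bar>(real_of_int (Z n k \<omega>) / real (Suc n) - B (real k / real (Suc n) * t) \<omega>) * Bernstein (Suc n) k (v / t)\<bar> \<le> 1 / real (Suc n) * Bernstein (Suc n) k (v / t)"
              unfolding abs_mult abs_of_nonneg[OF b] by (intro mult_right_mono close b)
          qed
          also have "\<dots> = 1 / real (Suc n)" by (simp only: sum_distrib_left[symmetric] sum_Bernstein mult_1_right)
          finally have 1: "\<bar>fst (P n (L n \<omega>)) v - (\<Sum>k\<le>Suc n. B (real k / real (Suc n) * t) \<omega> * Bernstein (Suc n) k (v / t))\<bar> \<le> 1 / real (Suc n)" .
          have 2: "\<bar>B (v / t * t) \<omega> - (\<Sum>k\<le>Suc n. B (real k / real (Suc n) * t) \<omega> * Bernstein (Suc n) k (v / t))\<bar> < e / 4"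
            using elim(2) by (intro N x) simp
          have "\<bar>fst (P n (L n \<omega>)) v - B v \<omega>\<bar> \<le> e / 2"
          proof -
            have "v / t * t = v" using t by simp
            then show ?thesis using 1 2 elim(1) by (simp only:)
          qed
          then show "\<bar>fst (P n (L n \<omega>)) (min u (snd (P n (L n \<omega>)))) - fst (path_upto t \<omega>) (min u (snd (path_upto t \<omega>)))\<bar> \<le> e / 2"
            using v unfolding v_def by (simp add: P_def path_upto_def)
        qed
        then show ?case using e path_dist_nonneg[of "P n (L n \<omega>)" "path_upto t \<omega>"] by simp
      qed
    qed
    show "(\<lambda>n. g (P n (L n \<omega>))) \<longlonglongrightarrow> g (path_upto t \<omega>)"
    proof (rule LIM_zero_cancel, rule Lim_null_comparison)
      show "\<forall>\<^sub>F n in sequentially. norm (g (P n (L n \<omega>)) - g (path_upto t \<omega>)) \<le> K * path_dist (P n (L n \<omega>)) (path_upto t \<omega>)"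
        unfolding real_norm_def by (intro always_eventually allI lip mem pu)
      show "(\<lambda>n. K * path_dist (P n (L n \<omega>)) (path_upto t \<omega>)) \<longlonglongrightarrow> 0" using tendsto_mult_left[OF dist0, of K] by simp
    qed
  qed
qed

text \<open>A limit of Lipschitz functionals, each of which is measurable at fixed times and continuous in
  time, hence measurable at a random time.\<close>

lemma cost_measurable:
  assumes lsc: "lower_semicontinuous_map stopped_paths.mtopology \<gamma>" and \<gamma>0: "\<And>x. x \<in> stopped_paths \<Longrightarrow> 0 \<le> \<gamma> x"
    and \<tau>: "\<tau> \<in> borel_measurable M"
  shows "(\<lambda>\<omega>. \<gamma> (stopped_path B \<tau> \<omega>)) \<in> borel_measurable M"
proof -
  note A = stopped_paths.lipschitz_approximation_from_below[OF lsc \<gamma>0]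
  let ?g = "\<lambda>k x. min (real k) (INF y\<in>stopped_paths. \<gamma> y + real k * path_dist x y)"
  show ?thesis
  proof (rule borel_measurable_LIMSEQ_real)
    show "(\<lambda>k. ?g k (stopped_path B \<tau> \<omega>)) \<longlonglongrightarrow> \<gamma> (stopped_path B \<tau> \<omega>)" if "\<omega> \<in> space M" for \<omega>
      unfolding stopped_path_eq by (rule A(5)) (auto intro!: path_upto_stopped_paths that)
    show "(\<lambda>\<omega>. ?g k (stopped_path B \<tau> \<omega>)) \<in> borel_measurable M" for k
      unfolding stopped_path_eq
    proof (rule borel_measurable_at_random_time[of "\<lambda>t \<omega>. ?g k (path_upto t \<omega>)"])
      show "(\<lambda>\<omega>. ?g k (path_upto t \<omega>)) \<in> borel_measurable M" if "0 \<le> t" for t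
        by (rule info_M[OF measurable_along_path[OF A(1) that]])
      show "continuous_on {0..} (\<lambda>t. ?g k (path_upto t \<omega>))" if "\<omega> \<in> space M" for \<omega>
        by (rule continuous_along_path[OF A(1) that])
    qed (use \<tau> in auto)
  qed
qed

text \<open>The expectation of the cost is the supremum of the expectations of its Lipschitz approximations,
  and a supremum of lower semicontinuous quantities is lower semicontinuous.\<close>

lemma lower_semicontinuity_cost:
  assumes conv: "converges_stably \<U> \<tau> T" and \<tau>: "\<And>n. \<tau> n \<in> borel_measurable M" and T: "T \<in> borel_measurable M"
    and Tfin: "AE \<omega> in M. T \<omega> < \<infinity>"
    and lsc: "lower_semicontinuous_map stopped_paths.mtopology \<gamma>" and \<gamma>0: "\<And>x. x \<in> stopped_paths \<Longrightarrow> 0 \<le> \<gamma> x"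
    and a: "a < (\<integral>\<^sup>+ \<omega>. ennreal (\<gamma> (stopped_path B T \<omega>)) \<partial>M)"
  shows "\<forall>\<^sub>F n in \<U>. a < (\<integral>\<^sup>+ \<omega>. ennreal (\<gamma> (stopped_path B (\<tau> n) \<omega>)) \<partial>M)"
proof -
  note A = stopped_paths.lipschitz_approximation_from_below[OF lsc \<gamma>0]
  define g where "g = (\<lambda>k x. min (real k) (INF y\<in>stopped_paths. \<gamma> y + real k * path_dist x y))"
  have A: "x \<in> stopped_paths \<Longrightarrow> x' \<in> stopped_paths \<Longrightarrow> \<bar>g k x - g k x'\<bar> \<le> real k * path_dist x x'"
    "x \<in> stopped_paths \<Longrightarrow> 0 \<le> g k x" "g k x \<le> real k" "x \<in> stopped_paths \<Longrightarrow> g k x \<le> g (Suc k) x"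
    "x \<in> stopped_paths \<Longrightarrow> (\<lambda>k. g k x) \<longlonglongrightarrow> \<gamma> x" for k x x'
    unfolding g_def by (rule A; assumption)+
  have mem: "stopped_path B \<sigma> \<omega> \<in> stopped_paths" if "\<omega> \<in> space M" for \<sigma> \<omega>
    unfolding stopped_path_eq by (intro path_upto_stopped_paths that) simp
  have cont: "continuous_on {0..} (\<lambda>t. g k (path_upto t \<omega>))" if "\<omega> \<in> space M" for k \<omega>
    by (rule continuous_along_path[OF A(1) that])
  have info: "(\<lambda>\<omega>. g k (path_upto t \<omega>)) \<in> borel_measurable (info {0..})" if "0 \<le> t" for k t
    by (rule measurable_along_path[OF A(1) that])
  have gM: "(\<lambda>\<omega>. g k (stopped_path B \<sigma> \<omega>)) \<in> borel_measurable M" if \<sigma>: "\<sigma> \<in> borel_measurable M" for k \<sigma>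
    unfolding stopped_path_eq
    by (rule borel_measurable_at_random_time[of "\<lambda>t \<omega>. g k (path_upto t \<omega>)"]) (use info_M[OF info] cont \<sigma> in auto)
  have gi: "integrable M (\<lambda>\<omega>. g k (stopped_path B \<sigma> \<omega>))" if \<sigma>: "\<sigma> \<in> borel_measurable M" for k \<sigma>
  proof (rule bounded_integrable[OF gM[OF \<sigma>], of k "real k"])
    fix \<omega> assume "\<omega> \<in> space M"
    from A(2)[OF mem[OF this, of \<sigma>], of k] show "\<bar>g k (stopped_path B \<sigma> \<omega>)\<bar> \<le> real k"
      using A(3)[of k "stopped_path B \<sigma> \<omega>"] by simp
  qed
  have g0: "AE \<omega> in M. 0 \<le> g k (stopped_path B \<sigma> \<omega>)" for k \<sigma> using A(2) mem by (intro AE_I2) auto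
  have sup: "(\<integral>\<^sup>+ \<omega>. ennreal (\<gamma> (stopped_path B \<sigma> \<omega>)) \<partial>M) = (SUP k. \<integral>\<^sup>+ \<omega>. ennreal (g k (stopped_path B \<sigma> \<omega>)) \<partial>M)"
    if \<sigma>: "\<sigma> \<in> borel_measurable M" for \<sigma>
  proof -
    have inc: "incseq (\<lambda>k. ennreal (g k x))" if "x \<in> stopped_paths" for x
      using A(4)[OF that] by (intro incseq_SucI ennreal_leI)
    have "(\<integral>\<^sup>+ \<omega>. ennreal (\<gamma> (stopped_path B \<sigma> \<omega>)) \<partial>M) = (\<integral>\<^sup>+ \<omega>. (SUP k. ennreal (g k (stopped_path B \<sigma> \<omega>))) \<partial>M)"
    proof (rule nn_integral_cong)
      fix \<omega> assume "\<omega> \<in> space M"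
      note m = mem[OF this, of \<sigma>]
      have "(\<lambda>k. ennreal (g k (stopped_path B \<sigma> \<omega>))) \<longlonglongrightarrow> ennreal (\<gamma> (stopped_path B \<sigma> \<omega>))" by (intro tendsto_ennrealI A(5)[OF m])
      then show "ennreal (\<gamma> (stopped_path B \<sigma> \<omega>)) = (SUP k. ennreal (g k (stopped_path B \<sigma> \<omega>)))"
        using LIMSEQ_SUP[OF inc[OF m]] LIMSEQ_unique by blast
    qed
    also have "\<dots> = (SUP k. \<integral>\<^sup>+ \<omega>. ennreal (g k (stopped_path B \<sigma> \<omega>)) \<partial>M)"
    proof (rule nn_integral_monotone_convergence_SUP_AE)
      show "AE \<omega> in M. ennreal (g k (stopped_path B \<sigma> \<omega>)) \<le> ennreal (g (Suc k) (stopped_path B \<sigma> \<omega>))" for k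
        using A(4) mem by (intro AE_I2 ennreal_leI) auto
    qed (use gM[OF \<sigma>] in auto)
    finally show ?thesis .
  qed
  have int: "(\<integral>\<^sup>+ \<omega>. ennreal (g k (stopped_path B \<sigma> \<omega>)) \<partial>M) = ennreal (expectation (\<lambda>\<omega>. g k (stopped_path B \<sigma> \<omega>)))"
    if \<sigma>: "\<sigma> \<in> borel_measurable M" for k \<sigma>
    by (rule nn_integral_eq_integral[OF gi[OF \<sigma>] g0])
  obtain k where k: "a < ennreal (expectation (\<lambda>\<omega>. g k (stopped_path B T \<omega>)))"
    using a unfolding sup[OF T] less_SUP_iff int[OF T] by blast
  then have "a < \<infinity>" by (rule less_le_trans) simp
  then obtain b where b: "a = ennreal b" "0 \<le> b" by (cases a) auto
  have "b < expectation (\<lambda>\<omega>. g k (path_upto (enn2real (T \<omega>)) \<omega>))"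
    using k b unfolding stopped_path_eq by (simp add: ennreal_less_iff)
  have "\<forall>\<^sub>F n in \<U>. b < expectation (\<lambda>\<omega>. g k (path_upto (enn2real (\<tau> n \<omega>)) \<omega>))"
  proof (rule lower_semicontinuity_continuous[where f="\<lambda>t \<omega>. g k (path_upto t \<omega>)" and C="real k", OF conv \<tau> T Tfin info cont])
    show "0 \<le> g k (path_upto t \<omega>) \<and> g k (path_upto t \<omega>) \<le> real k" if "\<omega> \<in> space M" "0 \<le> t" for \<omega> t
      using A(2)[OF path_upto_stopped_paths[OF that(2,1)]] A(3) by blast
    show "b < expectation (\<lambda>\<omega>. g k (path_upto (enn2real (T \<omega>)) \<omega>))" by fact
  qed
  then show ?thesis
  proof eventually_elim
    case (elim n)
    then have "a < ennreal (expectation (\<lambda>\<omega>. g k (stopped_path B (\<tau> n) \<omega>)))"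
      using b unfolding stopped_path_eq by (simp add: ennreal_less_iff)
    also have "\<dots> \<le> (\<integral>\<^sup>+ \<omega>. ennreal (\<gamma> (stopped_path B (\<tau> n) \<omega>)) \<partial>M)"
      unfolding sup[OF \<tau>] int[OF \<tau>, symmetric] by (rule SUP_upper) simp
    finally show ?case .
  qed
qed

end

section \<open>Existence of an embedding\<close>

text \<open>The library's generalised inverse \<open>I\<close> of the distribution function, extended by \<open>0\<close> outside the unit
  interval to a total measurable function.\<close>

lemma quantile_function:
  assumes "real_distribution \<nu>"
  shows "\<exists>q\<in>(borel_measurable borel :: (real \<Rightarrow> real) set). \<forall>h\<in>borel_measurable borel.
    (\<integral>\<^sup>+ u. h (q u) * indicator {0<..<1} u \<partial>lborel) = (\<integral>\<^sup>+ x. h x \<partial>\<nu> :: ennreal)"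
proof -
  interpret cdf_distribution \<nu> using assms by (simp add: cdf_distribution_def)
  define q where "q = (\<lambda>u. if u \<in> {0<..<1} then I u else 0)"
  have q: "q \<in> borel_measurable borel"
    using measurable_CI unfolding q_def by (subst (asm) measurable_restrict_space_iff[where c=0]) auto
  have Im: "I \<in> measurable (restrict_space lborel {0<..<1}) borel"
    using measurable_CI by (simp cong: measurable_cong_sets sets_restrict_space_cong)
  have key: "(\<integral>\<^sup>+ u. h (q u) * indicator {0<..<1} u \<partial>lborel) = (\<integral>\<^sup>+ x. h x \<partial>\<nu>)" if h: "h \<in> borel_measurable borel" for h :: "real \<Rightarrow> ennreal"
  proof -
    have "(\<integral>\<^sup>+ x. h x \<partial>\<nu>) = (\<integral>\<^sup>+ x. h x \<partial>distr (restrict_space lborel {0<..<1}) borel I)" by (simp only: distr_I_eq_M)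
    also have "\<dots> = (\<integral>\<^sup>+ u. h (I u) \<partial>restrict_space lborel {0<..<1})" by (rule nn_integral_distr[OF Im]) (use h in simp)
    also have "\<dots> = (\<integral>\<^sup>+ u. h (I u) * indicator {0<..<1} u \<partial>lborel)" by (subst nn_integral_restrict_space) auto
    also have "\<dots> = (\<integral>\<^sup>+ u. h (q u) * indicator {0<..<1} u \<partial>lborel)"
      by (intro nn_integral_cong) (auto simp: q_def indicator_def)
    finally show ?thesis by simp
  qed
  show ?thesis by (intro bexI[OF _ q] ballI key)
qed

text \<open>The law with density \<open>s x / c\<close> with respect to \<open>\<mu>\<close>. For \<open>s = 1\<close> it is the positive part of \<open>\<mu>\<close> weighted
  by size, and for \<open>s = - 1\<close> the negative part; the truncation of \<^const>\<open>ennreal\<close> at \<open>0\<close> removes the other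
  part.\<close>

lemma size_biased_quantile:
  fixes s c :: real
  assumes \<mu>: "real_distribution \<mu>" and c: "0 < c" and mass: "(\<integral>\<^sup>+ x. ennreal (s * x) \<partial>\<mu>) = ennreal c"
  shows "\<exists>q\<in>(borel_measurable borel :: (real \<Rightarrow> real) set). \<forall>h\<in>borel_measurable borel.
    (\<integral>\<^sup>+ u. h (q u) * indicator {0<..<1} u \<partial>lborel) = (\<integral>\<^sup>+ x. ennreal (s * x / c) * h x \<partial>\<mu> :: ennreal)"
proof -
  interpret real_distribution \<mu> by fact
  let ?\<nu> = "density \<mu> (\<lambda>x. ennreal (s * x / c))"
  have "emeasure ?\<nu> (space ?\<nu>) = (\<integral>\<^sup>+ x. ennreal (s * x / c) \<partial>\<mu>)"
    by (subst emeasure_density) (auto intro!: nn_integral_cong simp: indicator_def)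
  also have "\<dots> = (\<integral>\<^sup>+ x. ennreal (1 / c) * ennreal (s * x) \<partial>\<mu>)"
    using c by (intro nn_integral_cong) (subst ennreal_mult'[symmetric], auto)
  also have "\<dots> = ennreal (1 / c) * ennreal c" by (subst nn_integral_cmult) (auto simp: mass)
  also have "\<dots> = 1" using c by (simp add: ennreal_mult'[symmetric])
  finally have "prob_space ?\<nu>" by (rule prob_spaceI)
  then have "real_distribution ?\<nu>" by (simp add: real_distribution_def real_distribution_axioms_def)
  from quantile_function[OF this] obtain q :: "real \<Rightarrow> real" where q: "q \<in> borel_measurable borel"
    "\<And>h :: real \<Rightarrow> ennreal. h \<in> borel_measurable borel \<Longrightarrow> (\<integral>\<^sup>+ u. h (q u) * indicator {0<..<1} u \<partial>lborel) = (\<integral>\<^sup>+ x. h x \<partial>?\<nu>)"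
    by blast
  have "(\<integral>\<^sup>+ u. h (q u) * indicator {0<..<1} u \<partial>lborel) = (\<integral>\<^sup>+ x. ennreal (s * x / c) * h x \<partial>\<mu>)"
    if h: "h \<in> borel_measurable borel" for h :: "real \<Rightarrow> ennreal"
    unfolding q(2)[OF h] using h by (intro nn_integral_density) auto
  then show ?thesis by (intro bexI[OF _ q(1)] ballI)
qed

lemma size_biased_quantile_sign:
  fixes s c :: real and q :: "real \<Rightarrow> real"
  assumes q: "q \<in> borel_measurable borel" and c: "0 < c"
    and law: "\<forall>h\<in>borel_measurable borel.
      (\<integral>\<^sup>+ u. h (q u) * indicator {0<..<1} u \<partial>lborel) = (\<integral>\<^sup>+ x. ennreal (s * x / c) * h x \<partial>\<mu> :: ennreal)"
  shows "AE u in lborel. u \<in> {0<..<1} \<longrightarrow> 0 < s * q u"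
proof -
  note [measurable] = q
  have "(\<integral>\<^sup>+ u. indicator {x. s * x \<le> 0} (q u) * indicator {0<..<1} u \<partial>lborel) =
      (\<integral>\<^sup>+ x. ennreal (s * x / c) * indicator {x. s * x \<le> 0} x \<partial>\<mu>)" by (rule law[rule_format]) measurable
  also have "\<dots> = (\<integral>\<^sup>+ x. 0 \<partial>\<mu>)"
    using c by (intro nn_integral_cong) (auto simp: indicator_def ennreal_neg divide_nonpos_pos)
  finally have "(\<integral>\<^sup>+ u. indicator {x. s * x \<le> 0} (q u) * indicator {0<..<1} u \<partial>lborel) = 0" by simp
  moreover have "(\<lambda>u. indicator {x. s * x \<le> 0} (q u) * indicator {0<..<1} u :: ennreal) \<in> borel_measurable lborel" by measurable
  ultimately have "AE u in lborel. indicator {x. s * x \<le> 0} (q u) * indicator {0<..<1} u = (0::ennreal)"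
    by (simp add: nn_integral_0_iff_AE)
  then show ?thesis by eventually_elim (auto simp: indicator_def not_le)
qed

text \<open>Dividing by the size undoes the size bias and recovers the positive or negative part of \<open>\<mu>\<close>.\<close>

lemma size_biased_quantile_reweighted:
  fixes s c :: real and q :: "real \<Rightarrow> real"
  assumes q: "q \<in> borel_measurable borel" and c: "0 < c" and \<mu>: "real_distribution \<mu>" and A: "A \<in> sets borel"
    and law: "\<forall>h\<in>borel_measurable borel.
      (\<integral>\<^sup>+ u. h (q u) * indicator {0<..<1} u \<partial>lborel) = (\<integral>\<^sup>+ x. ennreal (s * x / c) * h x \<partial>\<mu> :: ennreal)"
  shows "(\<integral>\<^sup>+ u. ennreal (c / (s * q u)) * indicator A (q u) * indicator {0<..<1} u \<partial>lborel) = emeasure \<mu> (A \<inter> {x. 0 < s * x})"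
proof -
  interpret real_distribution \<mu> by fact
  note [measurable] = q A
  have "(\<integral>\<^sup>+ u. ennreal (c / (s * q u)) * indicator A (q u) * indicator {0<..<1} u \<partial>lborel) =
      (\<integral>\<^sup>+ x. ennreal (s * x / c) * (ennreal (c / (s * x)) * indicator A x) \<partial>\<mu>)" by (rule law[rule_format]) measurable
  also have "\<dots> = (\<integral>\<^sup>+ x. indicator (A \<inter> {x. 0 < s * x}) x \<partial>\<mu>)"
  proof (rule nn_integral_cong)
    fix x
    consider "0 < s * x" | "s * x \<le> 0" by linarith
    then show "ennreal (s * x / c) * (ennreal (c / (s * x)) * indicator A x) = indicator (A \<inter> {x. 0 < s * x}) x"
    proof cases
      case 1
      then have "ennreal (s * x / c) * ennreal (c / (s * x)) = 1" using c by (subst ennreal_mult'[symmetric]) auto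
      then show ?thesis using 1 by (auto simp: indicator_def)
    next
      case 2
      then have "s * x / c \<le> 0" using c by (intro divide_nonpos_pos)
      then show ?thesis using 2 by (auto simp: indicator_def ennreal_neg)
    qed
  qed
  also have "\<dots> = emeasure \<mu> (A \<inter> {x. 0 < s * x})" by (rule nn_integral_indicator) measurable
  finally show ?thesis .
qed

text \<open>The centred law on the two points \<open>a < 0 < b\<close>; any other pair of parameters stands for the unit mass at
  \<open>0\<close>.\<close>

definition two_point_law :: "real \<Rightarrow> real \<Rightarrow> real set \<Rightarrow> ennreal" where
  "two_point_law a b A = (if a < 0 \<and> 0 < b
     then ennreal (b / (b - a)) * indicator A a + ennreal (- a / (b - a)) * indicator A b else indicator A 0)"

text \<open>Both parts of a centred law have the same mean \<open>c\<close>. Weighted by size they are two probability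
  laws with quantile functions \<open>n\<close> and \<open>p\<close>, coupled here by evaluation at the same point. The centred
  law on \<open>{n u, p u}\<close> has weights proportional to \<open>1 / - n u\<close> and \<open>1 / p u\<close>, so giving \<open>u\<close> the density
  \<open>c / - n u + c / p u\<close> restores the parts of \<open>\<mu>\<close> without size bias. The quantity
  \<open>2 (- a) b\<close> in the last clause bounds the expected exit time of Brownian motion from \<open>(a, b)\<close>.\<close>

lemma two_point_decomposition:
  assumes \<mu>: "real_distribution \<mu>" and i1: "integrable \<mu> (\<lambda>x. x)" and mean: "(\<integral>x. x \<partial>\<mu>) = 0"
    and i2: "integrable \<mu> (\<lambda>x. x\<^sup>2)"
  obtains a b :: "real \<Rightarrow> real" where "a \<in> borel_measurable borel" "b \<in> borel_measurable borel"
    "\<And>u. (a u < 0 \<and> 0 < b u) \<or> (a u = 0 \<and> b u = 0)"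
    "\<And>A. A \<in> sets borel \<Longrightarrow> (\<integral>\<^sup>+ u. two_point_law (a u) (b u) A * indicator {0<..<1} u \<partial>lborel) = emeasure \<mu> A"
    "(\<integral>\<^sup>+ u. ennreal (2 * (- a u) * b u) * indicator {0<..<1} u \<partial>lborel) < \<infinity>"
proof -
  interpret real_distribution \<mu> by fact
  define c where "c = (\<integral>x. max 0 x \<partial>\<mu>)"
  have ip: "integrable \<mu> (\<lambda>x. max 0 x)" "integrable \<mu> (\<lambda>x. max 0 (- x))" using i1 by auto
  have pos: "(\<integral>\<^sup>+ x. ennreal (1 * x) \<partial>\<mu>) = ennreal c"
    unfolding c_def by (subst nn_integral_eq_integral[OF ip(1), symmetric]) (auto intro!: nn_integral_cong simp: max_def ennreal_neg)
  have "(\<integral>x. max 0 (- x) \<partial>\<mu>) = (\<integral>x. max 0 x - x \<partial>\<mu>)" by (intro Bochner_Integration.integral_cong) auto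
  also have "\<dots> = c" unfolding c_def using i1 ip mean by simp
  finally have c': "(\<integral>x. max 0 (- x) \<partial>\<mu>) = c" .
  have neg: "(\<integral>\<^sup>+ x. ennreal (- 1 * x) \<partial>\<mu>) = ennreal c"
    unfolding c'[symmetric] by (subst nn_integral_eq_integral[OF ip(2), symmetric]) (auto intro!: nn_integral_cong simp: max_def ennreal_neg)
  have "0 \<le> c" unfolding c_def by (intro Bochner_Integration.integral_nonneg) simp
  then consider "c = 0" | "0 < c" by linarith
  then show ?thesis
  proof cases
    case 1
    have "AE x in \<mu>. ennreal (1 * x) = 0" "AE x in \<mu>. ennreal (- 1 * x) = 0"
      using pos neg 1 by (auto simp: nn_integral_0_iff_AE)
    then have z: "AE x in \<mu>. x = 0" by eventually_elim (simp add: ennreal_eq_0_iff)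
    show ?thesis
    proof (rule that[of "\<lambda>_. 0" "\<lambda>_. 0"])
      fix A :: "real set" assume A: "A \<in> sets borel"
      have "emeasure \<mu> A = (\<integral>\<^sup>+ x. indicator A x \<partial>\<mu>)" using A by simp
      also have "\<dots> = (\<integral>\<^sup>+ x. indicator A 0 \<partial>\<mu>)" using z by (intro nn_integral_cong_AE) (auto elim!: eventually_mono)
      also have "\<dots> = indicator A 0" using emeasure_space_1 by (simp add: indicator_def)
      finally show "(\<integral>\<^sup>+ u. two_point_law 0 0 A * indicator {0<..<1::real} u \<partial>lborel) = emeasure \<mu> A"
        by (simp add: two_point_law_def nn_integral_cmult)
    qed auto
  next
    case 2
    obtain p :: "real \<Rightarrow> real" where p: "p \<in> borel_measurable borel"
      "\<forall>h\<in>borel_measurable borel. (\<integral>\<^sup>+ u. h (p u) * indicator {0<..<1} u \<partial>lborel) = (\<integral>\<^sup>+ x. ennreal (1 * x / c) * h x \<partial>\<mu> :: ennreal)"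
      using size_biased_quantile[OF \<mu> 2 pos] by blast
    obtain n :: "real \<Rightarrow> real" where n: "n \<in> borel_measurable borel"
      "\<forall>h\<in>borel_measurable borel. (\<integral>\<^sup>+ u. h (n u) * indicator {0<..<1} u \<partial>lborel) = (\<integral>\<^sup>+ x. ennreal (- 1 * x / c) * h x \<partial>\<mu>)"
      using size_biased_quantile[OF \<mu> 2 neg] by blast
    note [measurable] = p(1) n(1)
    note RP = size_biased_quantile_reweighted[OF p(1) 2 \<mu> _ p(2)]
    note RN = size_biased_quantile_reweighted[OF n(1) 2 \<mu> _ n(2)]
    have sgn: "AE u in lborel. u \<in> {0<..<1} \<longrightarrow> n u < 0 \<and> 0 < p u"
      using size_biased_quantile_sign[OF p(1) 2 p(2)] size_biased_quantile_sign[OF n(1) 2 n(2)] by eventually_elim auto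
    \<comment> \<open>The mass of \<open>\<mu>\<close> at \<open>0\<close> is placed on the interval \<open>(1,2)\<close>, where both levels are \<open>0\<close>.\<close>
    define w where "w = (\<lambda>u. (ennreal (c / (- 1 * n u)) + ennreal (c / (1 * p u))) * indicator {0<..<1} u + emeasure \<mu> {0} * indicator {1<..<2} u)"
    have wm[measurable]: "w \<in> borel_measurable borel" unfolding w_def by measurable
    let ?\<kappa> = "density lborel w"
    define \<alpha> where "\<alpha> = (\<lambda>u. if u \<in> {0<..<1} \<and> n u < 0 \<and> 0 < p u then n u else 0)"
    define \<beta> where "\<beta> = (\<lambda>u. if u \<in> {0<..<1} \<and> n u < 0 \<and> 0 < p u then p u else 0)"
    have m[measurable]: "\<alpha> \<in> borel_measurable borel" "\<beta> \<in> borel_measurable borel" unfolding \<alpha>_def \<beta>_def by measurable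
    have law: "(\<integral>\<^sup>+ u. w u * two_point_law (\<alpha> u) (\<beta> u) A \<partial>lborel) = emeasure \<mu> A" if A[measurable]: "A \<in> sets borel" for A
    proof -
      have "(\<integral>\<^sup>+ u. w u * two_point_law (\<alpha> u) (\<beta> u) A \<partial>lborel) =
        (\<integral>\<^sup>+ u. ennreal (c / (- 1 * n u)) * indicator A (n u) * indicator {0<..<1} u
          + ennreal (c / (1 * p u)) * indicator A (p u) * indicator {0<..<1} u
          + emeasure \<mu> {0} * indicator A 0 * indicator {1<..<2} u \<partial>lborel)"
      proof (rule nn_integral_cong_AE)
        show "AE u in lborel. w u * two_point_law (\<alpha> u) (\<beta> u) A = ennreal (c / (- 1 * n u)) * indicator A (n u) * indicator {0<..<1} u
          + ennreal (c / (1 * p u)) * indicator A (p u) * indicator {0<..<1} u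
          + emeasure \<mu> {0} * indicator A 0 * indicator {1<..<2} u"
          using sgn
        proof eventually_elim
          case (elim u)
          show ?case
          proof (cases "u \<in> {0<..<1}")
            case True
            then have s: "n u < 0" "0 < p u" using elim by auto
            have wu: "w u = ennreal (c / - n u + c / p u)" using True s 2 by (simp add: w_def ennreal_plus del: ennreal_plus add: ennreal_plus[symmetric] divide_nonneg_neg divide_nonpos_pos)
            have "c / - n u + c / p u = c * (p u - n u) / (- n u * p u)" using s by (simp add: field_simps)
            then have wu': "w u = ennreal (c * (p u - n u) / (- n u * p u))" using wu by simp
            have x: "0 \<le> c * (p u - n u) / (- n u * p u)" using s 2 by (intro divide_nonneg_pos mult_nonneg_nonneg mult_pos_pos) auto
            have "c * (p u - n u) / (- n u * p u) * (p u / (p u - n u)) = c / (- 1 * n u)"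
              "c * (p u - n u) / (- n u * p u) * (- n u / (p u - n u)) = c / (1 * p u)" using s by (auto simp: divide_simps)
            then have e: "w u * ennreal (p u / (p u - n u)) = ennreal (c / (- 1 * n u))" "w u * ennreal (- n u / (p u - n u)) = ennreal (c / (1 * p u))"
              unfolding wu' using x by (metis ennreal_mult')+
            have "w u * two_point_law (\<alpha> u) (\<beta> u) A = w u * ennreal (p u / (p u - n u)) * indicator A (n u) + w u * ennreal (- n u / (p u - n u)) * indicator A (p u)"
              using True s by (simp only: \<alpha>_def \<beta>_def two_point_law_def simp_thms if_True distrib_left mult.assoc)
            then show ?thesis unfolding e using True by (simp add: indicator_def)
          next
            case False
            then show ?thesis by (auto simp: w_def \<alpha>_def \<beta>_def two_point_law_def indicator_def)
          qed
        qed
      qed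
      also have "\<dots> = emeasure \<mu> (A \<inter> {x. 0 < - 1 * x}) + emeasure \<mu> (A \<inter> {x. 0 < 1 * x}) + emeasure \<mu> {0} * indicator A 0"
        unfolding RN[OF A, symmetric] RP[OF A, symmetric] by (simp add: nn_integral_add nn_integral_cmult)
      also have "emeasure \<mu> {0} * indicator A 0 = emeasure \<mu> (A \<inter> {0})" by (auto simp: indicator_def)
      also have "emeasure \<mu> (A \<inter> {x. 0 < - 1 * x}) + emeasure \<mu> (A \<inter> {x. 0 < 1 * x}) + emeasure \<mu> (A \<inter> {0}) =
          emeasure \<mu> ((A \<inter> {x. 0 < - 1 * x}) \<union> (A \<inter> {x. 0 < 1 * x}) \<union> (A \<inter> {0}))"
        by (subst plus_emeasure, measurable, force, subst plus_emeasure, measurable, force, simp)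
      also have "(A \<inter> {x. 0 < - 1 * x}) \<union> (A \<inter> {x. 0 < 1 * x}) \<union> (A \<inter> {0}) = A" by auto
      finally show ?thesis .
    qed
    have tm[measurable]: "(\<lambda>u. two_point_law (\<alpha> u) (\<beta> u) A) \<in> borel_measurable borel" if [measurable]: "A \<in> sets borel" for A
      unfolding two_point_law_def by measurable
    have "emeasure ?\<kappa> (space ?\<kappa>) = (\<integral>\<^sup>+ u. w u * two_point_law (\<alpha> u) (\<beta> u) UNIV \<partial>lborel)"
    proof -
      have "two_point_law (\<alpha> u) (\<beta> u) UNIV = 1" for u
      proof (cases "\<alpha> u < 0 \<and> 0 < \<beta> u")
        case True
        then have "\<beta> u / (\<beta> u - \<alpha> u) + - \<alpha> u / (\<beta> u - \<alpha> u) = 1" by (simp add: diff_divide_distrib[symmetric])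
        then have "ennreal (\<beta> u / (\<beta> u - \<alpha> u)) + ennreal (- \<alpha> u / (\<beta> u - \<alpha> u)) = 1"
          using True by (subst ennreal_plus[symmetric]) (auto simp: divide_nonpos_pos)
        then show ?thesis using True unfolding two_point_law_def by simp
      qed (auto simp: two_point_law_def)
      then show ?thesis by (subst emeasure_density) auto
    qed
    also have "\<dots> = 1" using law[of UNIV] emeasure_space_1 by simp
    finally have "prob_space ?\<kappa>" by (rule prob_spaceI)
    then have "real_distribution ?\<kappa>" by (simp add: real_distribution_def real_distribution_axioms_def)
    from quantile_function[OF this] obtain q :: "real \<Rightarrow> real" where q[measurable]: "q \<in> borel_measurable borel"
      and q': "\<And>h :: real \<Rightarrow> ennreal. h \<in> borel_measurable borel \<Longrightarrow> (\<integral>\<^sup>+ u. h (q u) * indicator {0<..<1} u \<partial>lborel) = (\<integral>\<^sup>+ x. h x \<partial>?\<kappa>)"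
      by blast
    have mix: "(\<integral>\<^sup>+ u. h (q u) * indicator {0<..<1} u \<partial>lborel) = (\<integral>\<^sup>+ u. w u * h u \<partial>lborel)" if "h \<in> borel_measurable borel" for h :: "real \<Rightarrow> ennreal"
      unfolding q'[OF that] using that by (intro nn_integral_density) auto
    show ?thesis
    proof (rule that[of "\<lambda>u. \<alpha> (q u)" "\<lambda>u. \<beta> (q u)"])
      show "(\<integral>\<^sup>+ u. two_point_law (\<alpha> (q u)) (\<beta> (q u)) A * indicator {0<..<1} u \<partial>lborel) = emeasure \<mu> A" if A: "A \<in> sets borel" for A
        using mix[OF tm[OF A]] law[OF A] by simp
      have "(\<integral>\<^sup>+ u. ennreal (2 * (- \<alpha> (q u)) * \<beta> (q u)) * indicator {0<..<1} u \<partial>lborel) = (\<integral>\<^sup>+ u. w u * ennreal (2 * (- \<alpha> u) * \<beta> u) \<partial>lborel)"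
        by (rule mix) measurable
      also have "\<dots> = (\<integral>\<^sup>+ u. ennreal (2 * c * (1 * p u)) * indicator {0<..<1} u + ennreal (2 * c * (- 1 * n u)) * indicator {0<..<1} u \<partial>lborel)"
      proof (rule nn_integral_cong_AE)
        show "AE u in lborel. w u * ennreal (2 * (- \<alpha> u) * \<beta> u) = ennreal (2 * c * (1 * p u)) * indicator {0<..<1} u + ennreal (2 * c * (- 1 * n u)) * indicator {0<..<1} u"
          using sgn
        proof eventually_elim
          case (elim u)
          show ?case
          proof (cases "u \<in> {0<..<1}")
            case True
            then have s: "n u < 0" "0 < p u" using elim by auto
            have "w u = ennreal (c / - n u + c / p u)" using True s 2 by (simp add: w_def ennreal_plus del: ennreal_plus add: ennreal_plus[symmetric] divide_nonneg_neg divide_nonpos_pos)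
            moreover have "(c / - n u + c / p u) * (2 * (- n u) * p u) = 2 * c * (1 * p u) + 2 * c * (- 1 * n u)" using s by (simp add: field_simps)
            moreover have "0 \<le> c / - n u + c / p u" using s 2 by (intro add_nonneg_nonneg divide_nonneg_pos) auto
            ultimately have "w u * ennreal (2 * (- n u) * p u) = ennreal (2 * c * (1 * p u) + 2 * c * (- 1 * n u))" by (metis ennreal_mult')
            also have "\<dots> = ennreal (2 * c * (1 * p u)) + ennreal (2 * c * (- 1 * n u))" using s 2 by (intro ennreal_plus) (auto simp: mult_nonneg_nonpos)
            finally show ?thesis using True s by (simp add: \<alpha>_def \<beta>_def)
          qed (auto simp: \<alpha>_def \<beta>_def)
        qed
      qed
      also have "\<dots> = (\<integral>\<^sup>+ u. ennreal (2 * c * (1 * p u)) * indicator {0<..<1} u \<partial>lborel) + (\<integral>\<^sup>+ u. ennreal (2 * c * (- 1 * n u)) * indicator {0<..<1} u \<partial>lborel)"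
        by (rule nn_integral_add) measurable
      also have "\<dots> = (\<integral>\<^sup>+ x. ennreal (1 * x / c) * ennreal (2 * c * (1 * x)) \<partial>\<mu>) + (\<integral>\<^sup>+ x. ennreal (- 1 * x / c) * ennreal (2 * c * (- 1 * x)) \<partial>\<mu>)"
        by (subst p(2)[rule_format], measurable, subst n(2)[rule_format], measurable)
      also have "\<dots> \<le> (\<integral>\<^sup>+ x. ennreal (2 * x\<^sup>2) \<partial>\<mu>) + (\<integral>\<^sup>+ x. ennreal (2 * x\<^sup>2) \<partial>\<mu>)"
      proof (intro add_mono nn_integral_mono)
        have sq: "ennreal (y / c) * ennreal (2 * c * y) \<le> ennreal (2 * y\<^sup>2)" for y
        proof (cases "0 \<le> y")
          case True
          then show ?thesis using 2 by (subst ennreal_mult'[symmetric]) (auto simp: power2_eq_square)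
        next
          case False
          then have "y / c \<le> 0" using 2 by (simp add: divide_nonpos_pos)
          then show ?thesis by (simp add: ennreal_neg)
        qed
        show "ennreal (1 * x / c) * ennreal (2 * c * (1 * x)) \<le> ennreal (2 * x\<^sup>2)" for x using sq[of "1 * x"] by simp
        show "ennreal (- 1 * x / c) * ennreal (2 * c * (- 1 * x)) \<le> ennreal (2 * x\<^sup>2)" for x using sq[of "- 1 * x"] by simp
      qed
      also have "\<dots> < \<infinity>"
      proof -
        have "integrable \<mu> (\<lambda>x. 2 * x\<^sup>2)" using i2 by simp
        then have "(\<integral>\<^sup>+ x. ennreal (2 * x\<^sup>2) \<partial>\<mu>) = ennreal (\<integral>x. 2 * x\<^sup>2 \<partial>\<mu>)" by (rule nn_integral_eq_integral) simp
        then show ?thesis by simp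
      qed
      finally show "(\<integral>\<^sup>+ u. ennreal (2 * (- \<alpha> (q u)) * \<beta> (q u)) * indicator {0<..<1} u \<partial>lborel) < \<infinity>" .
      show "(\<alpha> (q u) < 0 \<and> 0 < \<beta> (q u)) \<or> (\<alpha> (q u) = 0 \<and> \<beta> (q u) = 0)" for u by (simp add: \<alpha>_def \<beta>_def)
    qed measurable
  qed
qed

context brownian_basis
begin

definition exit_time :: "real \<Rightarrow> real \<Rightarrow> 'a \<Rightarrow> ennreal" where
  "exit_time a b \<omega> = hitting_time (\<lambda>t. max (B t \<omega> - b) (a - B t \<omega>))"

lemma exit_continuous: "\<omega> \<in> space M \<Longrightarrow> continuous_on {0..} (\<lambda>t. max (B t \<omega> - b) (a - B t \<omega>))"
  by (intro continuous_intros B_continuous)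

lemma stopping_time_exit_time: "stopping_time G (exit_time a b)"
  unfolding exit_time_def[abs_def]
proof (rule stopping_time_hitting_time[OF _ exit_continuous])
  fix t :: real assume "0 \<le> t"
  then have [measurable]: "B t \<in> borel_measurable (Gt t)" by (intro B_adapted) auto
  show "(\<lambda>\<omega>. max (B t \<omega> - b) (a - B t \<omega>)) \<in> borel_measurable (Gt t)" by measurable
qed

lemma within_until_exit:
  assumes \<omega>: "\<omega> \<in> space M" and ab: "a \<le> 0" "0 \<le> b" and s: "0 \<le> s" "ennreal s \<le> exit_time a b \<omega>"
  shows "a \<le> B s \<omega>" "B s \<omega> \<le> b"
proof -
  have "max (B s \<omega> - b) (a - B s \<omega>) \<le> 0"
  proof (rule nonpos_until_hitting_time[OF exit_continuous[OF \<omega>]])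
    show "max (B 0 \<omega> - b) (a - B 0 \<omega>) \<le> 0" using ab by (simp add: B_0[OF \<omega>])
    show "ennreal s \<le> hitting_time (\<lambda>t. max (B t \<omega> - b) (a - B t \<omega>))" using s(2) unfolding exit_time_def .
  qed (rule s(1))
  then show "a \<le> B s \<omega>" "B s \<omega> \<le> b" by auto
qed

text \<open>Wald's bound is applied to the truncated exit time, before which the path is bounded.\<close>

lemma exit_time_integrable:
  assumes ab: "a < 0" "0 < b"
  shows "(\<integral>\<^sup>+ \<omega>. exit_time a b \<omega> \<partial>M) < \<infinity>"
proof -
  let ?\<tau> = "exit_time a b"
  define m where "m = max (- a) b"
  have \<tau>m[measurable]: "?\<tau> \<in> borel_measurable M" by (rule stopping_time_measurable[OF stopping_time_exit_time])
  have bound: "(\<integral>\<^sup>+ \<omega>. min (?\<tau> \<omega>) (of_nat n) \<partial>M) \<le> ennreal (2 * m\<^sup>2)" for n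
  proof -
    let ?\<sigma> = "\<lambda>\<omega>. min (?\<tau> \<omega>) (of_nat n)"
    have \<sigma>: "stopping_time G ?\<sigma>" by (intro stopping_time_min stopping_time_exit_time stopping_time_const)
    have "(\<integral>\<^sup>+ \<omega>. ?\<sigma> \<omega> \<partial>M) \<le> (\<integral>\<^sup>+ \<omega>. of_nat n \<partial>M)" by (intro nn_integral_mono) simp
    also have "\<dots> < \<infinity>" by (simp add: emeasure_space_1 ennreal_of_nat_eq_real_of_nat)
    finally have fin: "(\<integral>\<^sup>+ \<omega>. ?\<sigma> \<omega> \<partial>M) < \<infinity>" .
    note W = wald[OF \<sigma> fin]
    have fin': "?\<sigma> \<omega> < \<infinity>" for \<omega> by (rule le_less_trans[of _ "of_nat n"]) (auto simp: ennreal_of_nat_eq_real_of_nat)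
    have "expectation (\<lambda>\<omega>. enn2real (?\<sigma> \<omega>)) \<le> 2 * expectation (\<lambda>\<omega>. (B (enn2real (?\<sigma> \<omega>)) \<omega>)\<^sup>2)" by (rule W(3))
    also have "expectation (\<lambda>\<omega>. (B (enn2real (?\<sigma> \<omega>)) \<omega>)\<^sup>2) \<le> expectation (\<lambda>\<omega>. m\<^sup>2)"
    proof (rule integral_mono[OF W(2)])
      fix \<omega> assume \<omega>: "\<omega> \<in> space M"
      have "ennreal (enn2real (?\<sigma> \<omega>)) \<le> ?\<tau> \<omega>" using fin'[of \<omega>] by (simp add: ennreal_enn2real)
      then have "a \<le> B (enn2real (?\<sigma> \<omega>)) \<omega>" "B (enn2real (?\<sigma> \<omega>)) \<omega> \<le> b"
        using within_until_exit[OF \<omega> less_imp_le[OF ab(1)] less_imp_le[OF ab(2)] enn2real_nonneg] by auto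
      then have "\<bar>B (enn2real (?\<sigma> \<omega>)) \<omega>\<bar> \<le> \<bar>m\<bar>" by (auto simp: m_def)
      then show "(B (enn2real (?\<sigma> \<omega>)) \<omega>)\<^sup>2 \<le> m\<^sup>2" by (simp add: abs_le_square_iff)
    qed simp
    finally have le: "expectation (\<lambda>\<omega>. enn2real (?\<sigma> \<omega>)) \<le> 2 * m\<^sup>2" using prob_space by simp
    have "(\<integral>\<^sup>+ \<omega>. ?\<sigma> \<omega> \<partial>M) = (\<integral>\<^sup>+ \<omega>. ennreal (enn2real (?\<sigma> \<omega>)) \<partial>M)"
      using fin' by (intro nn_integral_cong) (simp add: ennreal_enn2real)
    also have "\<dots> = ennreal (expectation (\<lambda>\<omega>. enn2real (?\<sigma> \<omega>)))" by (rule nn_integral_eq_integral[OF W(1)]) simp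
    also have "\<dots> \<le> ennreal (2 * m\<^sup>2)" by (rule ennreal_leI[OF le])
    finally show ?thesis .
  qed
  have sup: "(SUP n. min x (of_nat n)) = x" for x :: ennreal
  proof -
    have "(\<lambda>n. min x (of_nat n)) \<longlonglongrightarrow> x"
    proof (cases x)
      case (real r)
      obtain N :: nat where N: "r \<le> real N" using real_arch_simple by blast
      have "\<forall>\<^sub>F n in sequentially. min x (of_nat n) = x"
        using eventually_ge_at_top[of N]
      proof eventually_elim
        case (elim n)
        then have "x \<le> of_nat n" unfolding real(2) ennreal_of_nat_eq_real_of_nat using N by (intro ennreal_leI) simp
        then show ?case by simp
      qed
      then show ?thesis by (rule tendsto_eventually)
    next
      case top
      then show ?thesis using of_nat_tendsto_top_ennreal by simp
    qed
    moreover have "incseq (\<lambda>n. min x (of_nat n))" by (intro incseq_SucI min.mono) (auto simp: of_nat_Suc intro: order_trans)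
    ultimately show ?thesis using LIMSEQ_SUP LIMSEQ_unique by blast
  qed
  have "(\<integral>\<^sup>+ \<omega>. ?\<tau> \<omega> \<partial>M) = (\<integral>\<^sup>+ \<omega>. (SUP n. min (?\<tau> \<omega>) (of_nat n)) \<partial>M)" by (simp only: sup)
  also have "\<dots> = (SUP n. \<integral>\<^sup>+ \<omega>. min (?\<tau> \<omega>) (of_nat n) \<partial>M)"
  proof (rule nn_integral_monotone_convergence_SUP)
    have "min x (of_nat n) \<le> min x (of_nat (Suc n))" for n and x :: ennreal by (intro min.mono order_refl of_nat_mono) simp
    then show "incseq (\<lambda>n \<omega>. min (?\<tau> \<omega>) (of_nat n))" unfolding incseq_Suc_iff le_fun_def by blast
  qed simp
  also have "\<dots> \<le> ennreal (2 * m\<^sup>2)" using bound by (intro SUP_least)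
  also have "\<dots> < \<infinity>" by simp
  finally show ?thesis .
qed

text \<open>The law at the exit time is determined by its two atoms and its mean.\<close>

lemma exit_law:
  assumes ab: "a < 0" "0 < b"
  shows "\<And>A. A \<in> sets borel \<Longrightarrow> emeasure M {\<omega>\<in>space M. B (enn2real (exit_time a b \<omega>)) \<omega> \<in> A} =
      ennreal (b / (b - a)) * indicator A a + ennreal (- a / (b - a)) * indicator A b"
    and "(\<integral>\<^sup>+ \<omega>. exit_time a b \<omega> \<partial>M) \<le> ennreal (2 * (- a) * b)"
proof -
  let ?\<tau> = "exit_time a b"
  let ?X = "\<lambda>\<omega>. B (enn2real (?\<tau> \<omega>)) \<omega>"
  note fin = exit_time_integrable[OF ab]
  note W = wald[OF stopping_time_exit_time fin]
  have \<tau>m[measurable]: "?\<tau> \<in> borel_measurable M" by (rule stopping_time_measurable[OF stopping_time_exit_time])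
  have fin_AE: "AE \<omega> in M. ?\<tau> \<omega> < \<infinity>" using nn_integral_PInf_AE[OF \<tau>m] fin by (auto simp: less_top)
  have Xm[measurable]: "?X \<in> borel_measurable M" by (rule borel_measurable_B_at) auto
  \<comment> \<open>The path stays in the interval up to the exit time and is outside its interior then.\<close>
  have two: "AE \<omega> in M. ?X \<omega> = a \<or> ?X \<omega> = b"
    using fin_AE AE_space
  proof eventually_elim
    fix \<omega> assume f: "?\<tau> \<omega> < \<infinity>" and \<omega>: "\<omega> \<in> space M"
    then obtain s where s: "0 \<le> s" "?\<tau> \<omega> = ennreal s" "0 \<le> max (B s \<omega> - b) (a - B s \<omega>)"
      using hitting_time_attained[OF exit_continuous[OF \<omega>, of b a]] unfolding exit_time_def by blast
    have "a \<le> B s \<omega>" "B s \<omega> \<le> b" using within_until_exit[OF \<omega>, of a b s] s ab by auto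
    then show "?X \<omega> = a \<or> ?X \<omega> = b" using s by (auto simp: max_def split: if_splits)
  qed
  define p where "p = prob {\<omega>\<in>space M. ?X \<omega> = b}"
  define q where "q = prob {\<omega>\<in>space M. ?X \<omega> = a}"
  have fa: "{\<omega>\<in>space M. ?X \<omega> = b} \<in> sets M" "{\<omega>\<in>space M. ?X \<omega> = a} \<in> sets M" by measurable
  have ind: "integrable M (indicator {\<omega>\<in>space M. ?X \<omega> = b} :: 'a \<Rightarrow> real)" "integrable M (indicator {\<omega>\<in>space M. ?X \<omega> = a} :: 'a \<Rightarrow> real)"
    using fa by (auto simp: emeasure_eq_measure)
  have rep: "expectation (\<lambda>\<omega>. \<phi> (?X \<omega>)) = \<phi> a * q + \<phi> b * p" if \<phi>: "(\<lambda>\<omega>. \<phi> (?X \<omega>)) \<in> borel_measurable M" for \<phi> :: "real \<Rightarrow> real"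
  proof -
    have "expectation (\<lambda>\<omega>. \<phi> (?X \<omega>)) = expectation (\<lambda>\<omega>. \<phi> a * indicator {\<omega>\<in>space M. ?X \<omega> = a} \<omega> + \<phi> b * indicator {\<omega>\<in>space M. ?X \<omega> = b} \<omega>)"
    proof (rule integral_cong_AE)
      show "AE \<omega> in M. \<phi> (?X \<omega>) = \<phi> a * indicator {\<omega>\<in>space M. ?X \<omega> = a} \<omega> + \<phi> b * indicator {\<omega>\<in>space M. ?X \<omega> = b} \<omega>"
        using two AE_space by eventually_elim (use ab in \<open>auto simp: indicator_def\<close>)
    qed (use \<phi> fa in auto)
    also have "\<dots> = \<phi> a * q + \<phi> b * p" using ind fa by (simp add: p_def q_def)
    finally show ?thesis .
  qed
  have "q + p = 1" using rep[of "\<lambda>_. 1"] prob_space by simp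
  moreover have "a * q + b * p = 0" using rep[of "\<lambda>x. x"] W(4) Xm by simp
  ultimately have "p * (b - a) = - a" "q * (b - a) = b" by algebra+
  then have pq: "p = - a / (b - a)" "q = b / (b - a)" using ab by (auto simp: field_simps)
  have p0: "0 \<le> p" "0 \<le> q" by (auto simp: p_def q_def)
  show "emeasure M {\<omega>\<in>space M. ?X \<omega> \<in> A} = ennreal (b / (b - a)) * indicator A a + ennreal (- a / (b - a)) * indicator A b" if A: "A \<in> sets borel" for A
  proof -
    have mA: "(\<lambda>\<omega>. indicator A (?X \<omega>) :: real) \<in> borel_measurable M"
      by (rule measurable_compose[OF Xm]) (use A in simp)
    have sA: "{\<omega>\<in>space M. ?X \<omega> \<in> A} \<in> sets M" using A by measurable
    have "prob {\<omega>\<in>space M. ?X \<omega> \<in> A} = expectation (indicator {\<omega>\<in>space M. ?X \<omega> \<in> A})" using sA by simp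
    also have "\<dots> = expectation (\<lambda>\<omega>. indicator A (?X \<omega>))" by (intro Bochner_Integration.integral_cong) (auto simp: indicator_def)
    also have "\<dots> = indicator A a * q + indicator A b * p" by (rule rep[OF mA])
    finally have "emeasure M {\<omega>\<in>space M. ?X \<omega> \<in> A} = ennreal (indicator A a * q + indicator A b * p)" by (simp add: emeasure_eq_measure)
    also have "\<dots> = ennreal q * indicator A a + ennreal p * indicator A b"
      using p0 by (subst ennreal_plus) (auto simp: indicator_def)
    finally show ?thesis by (simp only: pq)
  qed
  have "(\<integral>\<^sup>+ \<omega>. ?\<tau> \<omega> \<partial>M) = (\<integral>\<^sup>+ \<omega>. ennreal (enn2real (?\<tau> \<omega>)) \<partial>M)"
    using fin_AE by (intro nn_integral_cong_AE) (auto elim!: eventually_mono simp: ennreal_enn2real)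
  also have "\<dots> = ennreal (expectation (\<lambda>\<omega>. enn2real (?\<tau> \<omega>)))" by (rule nn_integral_eq_integral[OF W(1)]) simp
  also have "\<dots> \<le> ennreal (2 * (- a) * b)"
  proof (rule ennreal_leI)
    have "expectation (\<lambda>\<omega>. enn2real (?\<tau> \<omega>)) \<le> 2 * expectation (\<lambda>\<omega>. (?X \<omega>)\<^sup>2)" by (rule W(3))
    also have "expectation (\<lambda>\<omega>. (?X \<omega>)\<^sup>2) = a\<^sup>2 * q + b\<^sup>2 * p" by (rule rep) simp
    also have "\<dots> = - a * b"
    proof -
      have "(a\<^sup>2 * q + b\<^sup>2 * p) * (b - a) = a\<^sup>2 * b - b\<^sup>2 * a"
        using \<open>p * (b - a) = - a\<close> \<open>q * (b - a) = b\<close> by (simp add: distrib_right mult.assoc)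
      also have "\<dots> = (- a * b) * (b - a)" by (simp add: power2_eq_square algebra_simps)
      finally have "(a\<^sup>2 * q + b\<^sup>2 * p) * (b - a) = (- a * b) * (b - a)" .
      moreover have "b - a \<noteq> 0" using ab by simp
      ultimately show ?thesis using mult_right_cancel[of "b - a"] by blast
    qed
    finally show "expectation (\<lambda>\<omega>. enn2real (?\<tau> \<omega>)) \<le> 2 * (- a) * b" by simp
  qed
  finally show "(\<integral>\<^sup>+ \<omega>. ?\<tau> \<omega> \<partial>M) \<le> ennreal (2 * (- a) * b)" .
qed

lemma exit_time_zero: "\<omega> \<in> space M \<Longrightarrow> exit_time 0 0 \<omega> = 0"
proof -
  assume \<omega>: "\<omega> \<in> space M"
  have "exit_time 0 0 \<omega> \<le> ennreal 0"
    unfolding exit_time_def hitting_time_le_iff[OF exit_continuous[OF \<omega>] order_refl] using B_0[OF \<omega>] by simp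
  then show ?thesis by simp
qed

text \<open>Conditioning on the randomisation: a measurable functional of a random parameter and the
  Brownian path is integrated over the path first.\<close>

lemma nn_integral_randomised:
  assumes F: "F \<in> borel_measurable (info {0..} \<Otimes>\<^sub>M borel)"
  shows "(\<integral>\<^sup>+ \<omega>. F (\<omega>, U \<omega>) \<partial>M) = (\<integral>\<^sup>+ u. (\<integral>\<^sup>+ \<omega>. F (\<omega>, u) \<partial>M) * indicator {0<..<1} u \<partial>lborel)"
proof -
  let ?P = "distr M (info {0..}) (\<lambda>\<omega>. \<omega>)" and ?u = "uniform_measure lborel {0..1 :: real}"
  interpret P: prob_space ?P by (rule prob_space_distr[OF id_info])
  interpret u: prob_space ?u by (rule prob_space_uniform_measure) auto
  interpret Pu: pair_sigma_finite ?P ?u ..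
  have F': "F \<in> borel_measurable (?P \<Otimes>\<^sub>M ?u)"
    using F by (subst measurable_cong_sets[OF sets_pair_measure_cong[OF sets_distr sets_uniform_measure] refl]) (simp cong: measurable_cong_sets sets_pair_measure_cong)
  have pm: "(\<lambda>\<omega>. (\<omega>, U \<omega>)) \<in> measurable M (info {0..} \<Otimes>\<^sub>M borel)" using id_info U_M by measurable
  have sec: "(\<lambda>\<omega>. F (\<omega>, u)) \<in> borel_measurable (info {0..})" for u
    by (rule measurable_compose[OF _ F]) simp
  have inner: "(\<integral>\<^sup>+ \<omega>. F (\<omega>, u) \<partial>?P) = (\<integral>\<^sup>+ \<omega>. F (\<omega>, u) \<partial>M)" for u
    by (rule nn_integral_distr[OF id_info]) (use sec in simp)
  have im: "(\<lambda>u. \<integral>\<^sup>+ \<omega>. F (\<omega>, u) \<partial>M) \<in> borel_measurable borel"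
  proof -
    have "(\<lambda>u. \<integral>\<^sup>+ \<omega>. F (\<omega>, u) \<partial>?P) \<in> borel_measurable ?u"
      using F' by (intro P.borel_measurable_nn_integral) simp
    then show ?thesis unfolding inner by simp
  qed
  have "(\<integral>\<^sup>+ \<omega>. F (\<omega>, U \<omega>) \<partial>M) = (\<integral>\<^sup>+ x. F x \<partial>distr M (info {0..} \<Otimes>\<^sub>M borel) (\<lambda>\<omega>. (\<omega>, U \<omega>)))"
    using F by (intro nn_integral_distr[OF pm, symmetric]) simp
  also have "\<dots> = (\<integral>\<^sup>+ x. F x \<partial>(?P \<Otimes>\<^sub>M ?u))" unfolding distr_info_U ..
  also have "\<dots> = (\<integral>\<^sup>+ u. \<integral>\<^sup>+ \<omega>. F (\<omega>, u) \<partial>?P \<partial>?u)" by (rule Pu.nn_integral_snd[OF F', symmetric])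
  also have "\<dots> = (\<integral>\<^sup>+ u. \<integral>\<^sup>+ \<omega>. F (\<omega>, u) \<partial>M \<partial>?u)" unfolding inner ..
  also have "\<dots> = (\<integral>\<^sup>+ u. (\<integral>\<^sup>+ \<omega>. F (\<omega>, u) \<partial>M) * indicator {0..1} u \<partial>lborel) / emeasure lborel {0..1::real}"
    using im by (intro nn_integral_uniform_measure) auto
  also have "\<dots> = (\<integral>\<^sup>+ u. (\<integral>\<^sup>+ \<omega>. F (\<omega>, u) \<partial>M) * indicator {0..1} u \<partial>lborel)" by (simp add: divide_ennreal_def)
  also have "\<dots> = (\<integral>\<^sup>+ u. (\<integral>\<^sup>+ \<omega>. F (\<omega>, u) \<partial>M) * indicator {0<..<1} u \<partial>lborel)"
  proof (rule nn_integral_cong_AE)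
    have "AE u in lborel. u \<noteq> 0 \<and> u \<noteq> (1::real)" using AE_lborel_singleton[of "0::real"] AE_lborel_singleton[of "1::real"] by eventually_elim simp
    then show "AE u in lborel. (\<integral>\<^sup>+ \<omega>. F (\<omega>, u) \<partial>M) * indicator {0..1} u = (\<integral>\<^sup>+ \<omega>. F (\<omega>, u) \<partial>M) * indicator {0<..<1} u"
      by eventually_elim (auto simp: indicator_def)
  qed
  finally show ?thesis .
qed

lemma exit_functionals_measurable:
  fixes a b :: "real \<Rightarrow> real"
  assumes a[measurable]: "a \<in> borel_measurable borel" and b[measurable]: "b \<in> borel_measurable borel"
  shows "(\<lambda>(\<omega>, v). exit_time (a v) (b v) \<omega>) \<in> borel_measurable (info {0..} \<Otimes>\<^sub>M borel)"
    and "(\<lambda>(\<omega>, v). B (enn2real (exit_time (a v) (b v) \<omega>)) \<omega>) \<in> borel_measurable (info {0..} \<Otimes>\<^sub>M borel)"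
proof -
  let ?N = "info {0..} \<Otimes>\<^sub>M (borel :: real measure)"
  have sp: "fst x \<in> space M" if "x \<in> space ?N" for x using that by (auto simp: space_pair_measure space_info)
  have Bm: "(\<lambda>x. B t (fst x)) \<in> borel_measurable ?N" if "0 \<le> t" for t
    by (rule measurable_compose[OF measurable_fst]) (use that in \<open>auto intro: B_info\<close>)
  have e: "(\<lambda>x. hitting_time (\<lambda>t. max (B t (fst x) - b (snd x)) (a (snd x) - B t (fst x)))) \<in> borel_measurable ?N"
  proof (rule hitting_time_measurable)
    fix t :: real assume "0 \<le> t"
    note [measurable] = Bm[OF this]
    show "(\<lambda>x. max (B t (fst x) - b (snd x)) (a (snd x) - B t (fst x))) \<in> borel_measurable ?N" by measurable
  qed (rule exit_continuous[OF sp])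
  then show "(\<lambda>(\<omega>, v). exit_time (a v) (b v) \<omega>) \<in> borel_measurable ?N" by (simp add: exit_time_def case_prod_beta)
  have "(\<lambda>x. B (enn2real (exit_time (a (snd x)) (b (snd x)) (fst x))) (fst x)) \<in> borel_measurable ?N"
  proof (rule borel_measurable_at_random_time[of "\<lambda>t x. B t (fst x)", OF Bm])
    show "(\<lambda>x. enn2real (exit_time (a (snd x)) (b (snd x)) (fst x))) \<in> borel_measurable ?N" using e by (simp add: exit_time_def)
  qed (auto intro: B_continuous sp)
  then show "(\<lambda>(\<omega>, v). B (enn2real (exit_time (a v) (b v) \<omega>)) \<omega>) \<in> borel_measurable ?N" by (simp add: case_prod_beta)
qed

lemma stopping_time_randomised_exit:
  fixes a b :: "real \<Rightarrow> real"
  assumes a[measurable]: "a \<in> borel_measurable borel" and b[measurable]: "b \<in> borel_measurable borel"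
  shows "stopping_time G (\<lambda>\<omega>. exit_time (a (U \<omega>)) (b (U \<omega>)) \<omega>)"
  unfolding exit_time_def[abs_def]
proof (rule stopping_time_hitting_time[OF _ exit_continuous])
  fix t :: real assume "0 \<le> t"
  then have [measurable]: "B t \<in> borel_measurable (Gt t)" by (intro B_adapted) auto
  note [measurable] = U_G[of "ennreal t"]
  show "(\<lambda>\<omega>. max (B t \<omega> - b (U \<omega>)) (a (U \<omega>) - B t \<omega>)) \<in> borel_measurable (Gt t)" by measurable
qed

text \<open>The two exit levels are drawn with the uniform variable from the decomposition of \<open>\<mu>\<close>. The level
  pair \<open>(0, 0)\<close> makes the exit time \<open>0\<close>, which produces the atom of \<open>\<mu>\<close> at \<open>0\<close>.\<close>

theorem embedding_exists:
  assumes \<mu>: "real_distribution \<mu>" and i1: "integrable \<mu> (\<lambda>x. x)" and mean: "(\<integral>x. x \<partial>\<mu>) = 0"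
    and i2: "integrable \<mu> (\<lambda>x. x\<^sup>2)"
  shows "\<exists>\<tau>. \<tau> \<in> skorokhod_embeddings M G B \<mu>"
proof -
  interpret \<mu>: real_distribution \<mu> by fact
  obtain a b :: "real \<Rightarrow> real" where am[measurable]: "a \<in> borel_measurable borel" and bm[measurable]: "b \<in> borel_measurable borel"
    and ab: "\<And>u. (a u < 0 \<and> 0 < b u) \<or> (a u = 0 \<and> b u = 0)"
    and law: "\<And>A. A \<in> sets borel \<Longrightarrow> (\<integral>\<^sup>+ u. two_point_law (a u) (b u) A * indicator {0<..<1} u \<partial>lborel) = emeasure \<mu> A"
    and fin: "(\<integral>\<^sup>+ u. ennreal (2 * (- a u) * b u) * indicator {0<..<1} u \<partial>lborel) < \<infinity>"
    using two_point_decomposition[OF \<mu> i1 mean i2] by blast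
  define \<tau> where "\<tau> = (\<lambda>\<omega>. exit_time (a (U \<omega>)) (b (U \<omega>)) \<omega>)"
  note st = stopping_time_randomised_exit[OF am bm, folded \<tau>_def]
  note em = exit_functionals_measurable[OF am bm]
  note \<tau>m[measurable] = stopping_time_measurable[OF st]
  have Xm: "(\<lambda>\<omega>. B (enn2real (\<tau> \<omega>)) \<omega>) \<in> borel_measurable M" by (rule borel_measurable_B_at) auto
  have "(\<integral>\<^sup>+ \<omega>. \<tau> \<omega> \<partial>M) = (\<integral>\<^sup>+ u. (\<integral>\<^sup>+ \<omega>. exit_time (a u) (b u) \<omega> \<partial>M) * indicator {0<..<1} u \<partial>lborel)"
    using nn_integral_randomised[OF em(1)] by (simp add: \<tau>_def)
  also have "\<dots> \<le> (\<integral>\<^sup>+ u. ennreal (2 * (- a u) * b u) * indicator {0<..<1} u \<partial>lborel)"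
  proof (intro nn_integral_mono mult_right_mono)
    fix u show "(\<integral>\<^sup>+ \<omega>. exit_time (a u) (b u) \<omega> \<partial>M) \<le> ennreal (2 * (- a u) * b u)"
    proof (cases "a u < 0 \<and> 0 < b u")
      case True then show ?thesis using exit_law(2) by blast
    next
      case False
      then have "a u = 0" "b u = 0" using ab[of u] by auto
      then show ?thesis by (simp add: exit_time_zero cong: nn_integral_cong)
    qed
  qed simp
  finally have Efin: "(\<integral>\<^sup>+ \<omega>. \<tau> \<omega> \<partial>M) < \<infinity>" using fin by (rule le_less_trans)
  have "distr M borel (\<lambda>\<omega>. B (enn2real (\<tau> \<omega>)) \<omega>) = \<mu>"
  proof (rule measure_eqI)
    fix A assume "A \<in> sets (distr M borel (\<lambda>\<omega>. B (enn2real (\<tau> \<omega>)) \<omega>))"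
    then have A[measurable]: "A \<in> sets borel" by simp
    let ?X = "\<lambda>u \<omega>. B (enn2real (exit_time (a u) (b u) \<omega>)) \<omega>"
    have Xu: "?X u \<in> borel_measurable M" for u
      by (rule borel_measurable_B_at[OF measurable_compose[OF stopping_time_measurable[OF stopping_time_exit_time]]]) auto
    have Fm: "(\<lambda>z. indicator A (case z of (\<omega>, u) \<Rightarrow> ?X u \<omega>) :: ennreal) \<in> borel_measurable (info {0..} \<Otimes>\<^sub>M borel)"
      by (rule measurable_compose[OF em(2)]) simp
    have "emeasure (distr M borel (\<lambda>\<omega>. B (enn2real (\<tau> \<omega>)) \<omega>)) A = (\<integral>\<^sup>+ \<omega>. indicator A (B (enn2real (\<tau> \<omega>)) \<omega>) \<partial>M)"
      using Xm by (simp add: nn_integral_indicator[symmetric] nn_integral_distr del: nn_integral_indicator)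
    also have "\<dots> = (\<integral>\<^sup>+ u. (\<integral>\<^sup>+ \<omega>. indicator A (?X u \<omega>) \<partial>M) * indicator {0<..<1} u \<partial>lborel)"
      using nn_integral_randomised[OF Fm] by (simp add: \<tau>_def)
    also have "\<dots> = (\<integral>\<^sup>+ u. two_point_law (a u) (b u) A * indicator {0<..<1} u \<partial>lborel)"
    proof (rule nn_integral_cong)
      fix u
      have "(\<integral>\<^sup>+ \<omega>. indicator A (?X u \<omega>) \<partial>M) = emeasure M {\<omega>\<in>space M. ?X u \<omega> \<in> A}"
      proof -
        have "{\<omega>\<in>space M. ?X u \<omega> \<in> A} \<in> sets M" using Xu[of u] A by measurable
        then have "emeasure M {\<omega>\<in>space M. ?X u \<omega> \<in> A} = (\<integral>\<^sup>+ \<omega>. indicator {\<omega>\<in>space M. ?X u \<omega> \<in> A} \<omega> \<partial>M)" by simp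
        also have "\<dots> = (\<integral>\<^sup>+ \<omega>. indicator A (?X u \<omega>) \<partial>M)" by (intro nn_integral_cong) (auto simp: indicator_def)
        finally show ?thesis ..
      qed
      also have "\<dots> = two_point_law (a u) (b u) A"
      proof (cases "a u < 0 \<and> 0 < b u")
        case True then show ?thesis using exit_law(1)[OF _ _ A] by (simp add: two_point_law_def)
      next
        case False
        then have z: "a u = 0" "b u = 0" using ab[of u] by auto
        have "{\<omega>\<in>space M. ?X u \<omega> \<in> A} = (if 0 \<in> A then space M else {})"
          by (auto simp: z exit_time_zero B_0)
        then show ?thesis by (simp add: two_point_law_def z emeasure_space_1)
      qed
      finally show "(\<integral>\<^sup>+ \<omega>. indicator A (?X u \<omega>) \<partial>M) * indicator {0<..<1} u = two_point_law (a u) (b u) A * indicator {0<..<1} u" by simp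
    qed
    also have "\<dots> = emeasure \<mu> A" by (rule law[OF A])
    finally show "emeasure (distr M borel (\<lambda>\<omega>. B (enn2real (\<tau> \<omega>)) \<omega>)) A = emeasure \<mu> A" .
  qed simp
  then show ?thesis using st Efin unfolding skorokhod_embeddings_def by blast
qed

end

section \<open>Existence of an optimal embedding\<close>

text \<open>Adding \<open>K\<close> makes the function nonnegative, so that its integral needs no splitting into parts.\<close>

lemma extended_expectation_bounded_below:
  assumes f: "f \<in> borel_measurable M" and K: "0 \<le> K" "\<And>\<omega>. \<omega> \<in> space M \<Longrightarrow> - K \<le> f \<omega>"
    and prob: "emeasure M (space M) = 1"
  shows "extended_expectation M f = enn2ereal (\<integral>\<^sup>+ \<omega>. ennreal (f \<omega> + K) \<partial>M) - ereal K"
proof -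
  note [measurable] = f
  let ?A = "\<integral>\<^sup>+ \<omega>. ennreal (f \<omega> + K) \<partial>M" and ?P = "\<integral>\<^sup>+ \<omega>. ennreal (f \<omega>) \<partial>M" and ?N = "\<integral>\<^sup>+ \<omega>. ennreal (- f \<omega>) \<partial>M"
  have "?N \<le> (\<integral>\<^sup>+ \<omega>. ennreal K \<partial>M)" using K by (intro nn_integral_mono ennreal_leI) force
  then have "?N < \<top>" using prob by (simp add: le_less_trans)
  then obtain r where r: "?N = ennreal r" "0 \<le> r" by (cases ?N) auto
  have "?A + ?N = (\<integral>\<^sup>+ \<omega>. ennreal (f \<omega> + K) + ennreal (- f \<omega>) \<partial>M)" by (rule nn_integral_add[symmetric]) measurable
  also have "\<dots> = (\<integral>\<^sup>+ \<omega>. ennreal (f \<omega>) + ennreal K \<partial>M)"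
  proof (rule nn_integral_cong)
    fix \<omega> assume "\<omega> \<in> space M"
    then have "- K \<le> f \<omega>" by (rule K)
    then show "ennreal (f \<omega> + K) + ennreal (- f \<omega>) = ennreal (f \<omega>) + ennreal K"
      using K(1) by (cases "0 \<le> f \<omega>") (simp_all add: ennreal_plus[symmetric] ennreal_neg del: ennreal_plus)
  qed
  also have "\<dots> = ?P + ennreal K" using prob by (subst nn_integral_add) auto
  finally have e: "?A + ennreal r = ?P + ennreal K" by (simp only: r)
  show ?thesis
  proof (cases ?P)
    case P: (real x)
    then have "?A + ennreal r = ennreal (x + K)" using e K(1) by simp
    moreover obtain y where y: "?A = ennreal y" "0 \<le> y" using calculation by (cases ?A) auto
    ultimately have "ennreal (y + r) = ennreal (x + K)" using r by simp
    then have "y + r = x + K" using y r P K(1) by (subst (asm) ennreal_inj) auto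
    then show ?thesis unfolding extended_expectation_def P r y using P y r by simp
  next
    case top
    then have "?A = \<top>" using e by (cases ?A) (auto simp: ennreal_plus[symmetric] simp del: ennreal_plus)
    then show ?thesis unfolding extended_expectation_def top r by simp
  qed
qed

context brownian_basis
begin

lemma shifted_cost:
  assumes lsc: "lower_semicontinuous_map stopped_paths.mtopology (\<lambda>x. \<gamma> x + K)"
    and K: "0 \<le> K" "\<And>x. x \<in> stopped_paths \<Longrightarrow> - K \<le> \<gamma> x" and \<tau>: "\<tau> \<in> borel_measurable M"
  shows "embedding_cost M B \<gamma> \<tau> = enn2ereal (\<integral>\<^sup>+ \<omega>. ennreal (\<gamma> (stopped_path B \<tau> \<omega>) + K) \<partial>M) - ereal K"
  unfolding embedding_cost_def
proof (rule extended_expectation_bounded_below)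
  have "(\<lambda>\<omega>. \<gamma> (stopped_path B \<tau> \<omega>) + K) \<in> borel_measurable M"
    by (rule cost_measurable[OF lsc _ \<tau>]) (use K(2) in force)
  then have "(\<lambda>\<omega>. (\<gamma> (stopped_path B \<tau> \<omega>) + K) - K) \<in> borel_measurable M" by (rule borel_measurable_diff) simp
  then show "(\<lambda>\<omega>. \<gamma> (stopped_path B \<tau> \<omega>)) \<in> borel_measurable M" by simp
  show "- K \<le> \<gamma> (stopped_path B \<tau> \<omega>)" if "\<omega> \<in> space M" for \<omega>
    by (rule K(2)) (use that in \<open>simp add: stopped_path_eq path_upto_stopped_paths\<close>)
qed (use K(1) emeasure_space_1 in auto)

lemma embedding_expectation_bound:
  assumes \<tau>: "\<tau> \<in> skorokhod_embeddings M G B \<mu>"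
  shows "integrable M (\<lambda>\<omega>. enn2real (\<tau> \<omega>))" "expectation (\<lambda>\<omega>. enn2real (\<tau> \<omega>)) \<le> 2 * (\<integral>x. x\<^sup>2 \<partial>\<mu>)"
    and "AE \<omega> in M. \<tau> \<omega> = ennreal (enn2real (\<tau> \<omega>))"
proof -
  have st: "stopping_time G \<tau>" and law: "distr M borel (\<lambda>\<omega>. B (enn2real (\<tau> \<omega>)) \<omega>) = \<mu>" and fin: "(\<integral>\<^sup>+ \<omega>. \<tau> \<omega> \<partial>M) < \<infinity>"
    using \<tau> by (auto simp: skorokhod_embeddings_def)
  note [measurable] = stopping_time_measurable[OF st]
  have Xm: "(\<lambda>\<omega>. B (enn2real (\<tau> \<omega>)) \<omega>) \<in> borel_measurable M" by (rule borel_measurable_B_at) auto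
  show "integrable M (\<lambda>\<omega>. enn2real (\<tau> \<omega>))" by (rule wald(1)[OF st fin])
  have "(\<integral>x. x\<^sup>2 \<partial>\<mu>) = expectation (\<lambda>\<omega>. (B (enn2real (\<tau> \<omega>)) \<omega>)\<^sup>2)"
    unfolding law[symmetric] by (rule integral_distr[OF Xm]) simp
  then show "expectation (\<lambda>\<omega>. enn2real (\<tau> \<omega>)) \<le> 2 * (\<integral>x. x\<^sup>2 \<partial>\<mu>)" using wald(3)[OF st fin] by simp
  have "AE \<omega> in M. \<tau> \<omega> \<noteq> \<infinity>" by (rule nn_integral_PInf_AE) (use fin in auto)
  then show "AE \<omega> in M. \<tau> \<omega> = ennreal (enn2real (\<tau> \<omega>))" by eventually_elim (simp add: ennreal_enn2real less_top)
qed

text \<open>Markov's inequality and the uniform bound on expectations keep the mass from escaping to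
  infinity; the moment bound and the law then pass to the limit through bounded integrands that are
  continuous in time.\<close>

lemma limit_of_embeddings:
  assumes \<mu>: "real_distribution \<mu>" and \<tau>: "\<And>n. \<tau> n \<in> skorokhod_embeddings M G B \<mu>"
    and T: "stopping_time G T" and conv: "converges_stably \<U> \<tau> T" and \<U>: "\<U> \<noteq> bot"
  shows "T \<in> skorokhod_embeddings M G B \<mu>" and "AE \<omega> in M. T \<omega> < \<infinity>"
proof -
  interpret \<mu>: real_distribution \<mu> by fact
  define W where "W = 2 * (\<integral>x. x\<^sup>2 \<partial>\<mu>)"
  have W0: "0 \<le> W" unfolding W_def by simp
  note Tm[measurable] = stopping_time_measurable[OF T]
  have st: "stopping_time G (\<tau> n)" and law: "distr M borel (\<lambda>\<omega>. B (enn2real (\<tau> n \<omega>)) \<omega>) = \<mu>" for n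
    using \<tau>[of n] by (auto simp: skorokhod_embeddings_def)
  note \<tau>m[measurable] = stopping_time_measurable[OF st]
  note bound = embedding_expectation_bound[OF \<tau>, folded W_def]
  \<comment> \<open>Markov's inequality for the sequence passes to the limit at times that are not atoms.\<close>
  have tail: "1 - W / t \<le> prob {\<omega>\<in>space M. T \<omega> < \<infinity>}" if t: "0 < t" and at: "prob {\<omega>\<in>space M. T \<omega> = ennreal t} = 0" for t
  proof -
    let ?E = "\<lambda>\<sigma>. {\<omega>\<in>space M. \<sigma> \<omega> \<le> ennreal t}"
    have lim: "((\<lambda>n. prob (?E (\<tau> n))) \<longlongrightarrow> prob (?E T)) \<U>"
      using conv[unfolded converges_stably_def, rule_format, of t "\<lambda>_. 1" 1] t at by simp
    have "1 - W / t \<le> prob (?E (\<tau> n))" for n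
    proof -
      have "prob {\<omega>\<in>space M. t \<le> enn2real (\<tau> n \<omega>)} \<le> expectation (\<lambda>\<omega>. enn2real (\<tau> n \<omega>)) / t"
        by (rule integral_Markov_inequality_measure[where A="{}"]) (use bound(1) t in auto)
      also have "\<dots> \<le> W / t" using bound(2)[of n] t by (intro divide_right_mono) auto
      finally have le: "prob {\<omega>\<in>space M. t \<le> enn2real (\<tau> n \<omega>)} \<le> W / t" .
      have "1 = prob (space M)" by (simp add: prob_space)
      also have "\<dots> \<le> prob (?E (\<tau> n) \<union> {\<omega>\<in>space M. t \<le> enn2real (\<tau> n \<omega>)})"
      proof (rule finite_measure_mono_AE)
        show "AE \<omega> in M. \<omega> \<in> space M \<longrightarrow> \<omega> \<in> ?E (\<tau> n) \<union> {\<omega>\<in>space M. t \<le> enn2real (\<tau> n \<omega>)}"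
          using bound(3)[of n]
        proof eventually_elim
          case (elim \<omega>)
          show ?case
          proof (cases "t \<le> enn2real (\<tau> n \<omega>)")
            case False
            then have "\<tau> n \<omega> \<le> ennreal t" by (subst elim) (intro ennreal_leI, simp)
            then show ?thesis by simp
          qed simp
        qed
      qed measurable
      also have "\<dots> \<le> prob (?E (\<tau> n)) + prob {\<omega>\<in>space M. t \<le> enn2real (\<tau> n \<omega>)}" by (rule measure_Un_le) measurable
      finally show ?thesis using le by linarith
    qed
    then have "1 - W / t \<le> prob (?E T)" by (intro tendsto_lowerbound[OF lim] \<U> always_eventually allI)
    also have "\<dots> \<le> prob {\<omega>\<in>space M. T \<omega> < \<infinity>}"
      by (intro finite_measure_mono) (auto intro: le_less_trans)
    finally show ?thesis .
  qed
  have "1 - \<epsilon> \<le> prob {\<omega>\<in>space M. T \<omega> < \<infinity>}" if \<epsilon>: "0 < \<epsilon>" for \<epsilon>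
  proof -
    obtain r where r: "0 < r" "\<And>m i. prob {\<omega>\<in>space M. T \<omega> = ennreal ((real i + r) / real (Suc m))} = 0"
      using grid_avoiding_atoms[OF Tm] by blast
    obtain i :: nat where i: "W / \<epsilon> \<le> real i" using real_arch_simple by blast
    define t where "t = real i + r"
    have t: "0 < t" "W / \<epsilon> \<le> t" "prob {\<omega>\<in>space M. T \<omega> = ennreal t} = 0" using r i r(2)[of i 0] by (auto simp: t_def)
    have "1 - W / t \<le> prob {\<omega>\<in>space M. T \<omega> < \<infinity>}" by (rule tail[OF t(1,3)])
    moreover have "W / t \<le> \<epsilon>" using t(1,2) \<epsilon> by (simp add: field_simps)
    ultimately show ?thesis by linarith
  qed
  then have "1 \<le> prob {\<omega>\<in>space M. T \<omega> < \<infinity>} + \<epsilon>" if "0 < \<epsilon>" for \<epsilon> using that by (simp add: diff_le_eq)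
  then have "1 \<le> prob {\<omega>\<in>space M. T \<omega> < \<infinity>}" by (rule field_le_epsilon)
  then have "prob {\<omega>\<in>space M. T \<omega> < \<infinity>} = 1" using prob_le_1[of "{\<omega>\<in>space M. T \<omega> < \<infinity>}"] by linarith
  then show Tfin: "AE \<omega> in M. T \<omega> < \<infinity>" by (subst (asm) prob_Collect_eq_1) auto
  note LSC = lower_semicontinuity_continuous[OF conv \<tau>m Tm Tfin]
  have trunc: "(\<integral>\<^sup>+ \<omega>. ennreal (min (enn2real (T \<omega>)) (real k)) \<partial>M) \<le> ennreal W" for k
  proof -
    have ik: "integrable M (\<lambda>\<omega>. min (enn2real (\<sigma> \<omega>)) (real k))" if [measurable]: "\<sigma> \<in> borel_measurable M" for \<sigma> :: "'a \<Rightarrow> ennreal"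
      by (rule integrable_const_bound[where B="real k"]) (simp_all add: abs_of_nonneg)
    have "expectation (\<lambda>\<omega>. min (enn2real (T \<omega>)) (real k)) \<le> W"
    proof (rule ccontr)
      assume "\<not> ?thesis"
      then have "\<forall>\<^sub>F n in \<U>. W < expectation (\<lambda>\<omega>. min (enn2real (\<tau> n \<omega>)) (real k))"
        by (intro LSC[where C="real k" and f="\<lambda>t \<omega>. min t (real k)"]) (auto intro!: continuous_intros)
      then obtain n where "W < expectation (\<lambda>\<omega>. min (enn2real (\<tau> n \<omega>)) (real k))"
        using eventually_happens'[OF \<U>] by blast
      also have "\<dots> \<le> expectation (\<lambda>\<omega>. enn2real (\<tau> n \<omega>))" by (intro integral_mono ik bound(1)) auto
      finally show False using bound(2)[of n] by linarith
    qed
    then show ?thesis by (subst nn_integral_eq_integral[OF ik]) (auto intro: ennreal_leI)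
  qed
  have "(\<integral>\<^sup>+ \<omega>. T \<omega> \<partial>M) = (\<integral>\<^sup>+ \<omega>. (SUP k. ennreal (min (enn2real (T \<omega>)) (real k))) \<partial>M)"
  proof (rule nn_integral_cong_AE)
    show "AE \<omega> in M. T \<omega> = (SUP k. ennreal (min (enn2real (T \<omega>)) (real k)))"
      using Tfin
    proof eventually_elim
      case (elim \<omega>)
      obtain N where N: "enn2real (T \<omega>) \<le> real N" using real_arch_simple by blast
      show ?case
      proof (rule antisym)
        have "T \<omega> = ennreal (min (enn2real (T \<omega>)) (real N))" using N elim by (simp add: ennreal_enn2real)
        also have "\<dots> \<le> (SUP k. ennreal (min (enn2real (T \<omega>)) (real k)))" by (rule SUP_upper) simp
        finally show "T \<omega> \<le> (SUP k. ennreal (min (enn2real (T \<omega>)) (real k)))" .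
        show "(SUP k. ennreal (min (enn2real (T \<omega>)) (real k))) \<le> T \<omega>"
        proof (rule SUP_least)
          fix k :: nat
          have "ennreal (min (enn2real (T \<omega>)) (real k)) \<le> ennreal (enn2real (T \<omega>))" by (intro ennreal_leI) simp
          also have "\<dots> = T \<omega>" using elim by (simp add: ennreal_enn2real)
          finally show "ennreal (min (enn2real (T \<omega>)) (real k)) \<le> T \<omega>" .
        qed
      qed
    qed
  qed
  also have "\<dots> = (SUP k. \<integral>\<^sup>+ \<omega>. ennreal (min (enn2real (T \<omega>)) (real k)) \<partial>M)"
    by (rule nn_integral_monotone_convergence_SUP) (auto simp: incseq_def le_fun_def intro!: ennreal_leI)
  also have "\<dots> \<le> ennreal W" by (intro SUP_least trunc)
  finally have ET: "(\<integral>\<^sup>+ \<omega>. T \<omega> \<partial>M) < \<infinity>" by (simp add: le_less_trans)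
  have Xm: "(\<lambda>\<omega>. B (enn2real (T \<omega>)) \<omega>) \<in> borel_measurable M" by (rule borel_measurable_B_at) auto
  have Xn: "(\<lambda>\<omega>. B (enn2real (\<tau> n \<omega>)) \<omega>) \<in> borel_measurable M" for n by (rule borel_measurable_B_at) auto
  \<comment> \<open>The shift by \<open>1\<close> makes the integrand nonnegative; the same bound for \<open>- \<phi>\<close> turns the inequality into an equality.\<close>
  have half: "expectation (\<lambda>\<omega>. \<phi> (B (enn2real (T \<omega>)) \<omega>)) \<le> (\<integral>x. \<phi> x \<partial>\<mu>)"
    if c: "continuous_on UNIV \<phi>" and b: "\<And>x. \<bar>\<phi> x\<bar> \<le> 1" for \<phi> :: "real \<Rightarrow> real"
  proof (rule ccontr)
    assume n: "\<not> ?thesis"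
    have [measurable]: "\<phi> \<in> borel_measurable borel" using c by (rule borel_measurable_continuous_onI)
    have b': "- 1 \<le> \<phi> x" "\<phi> x \<le> 1" for x using b[of x] by auto
    have ii: "integrable N (\<lambda>x. \<phi> (X x))" if "prob_space N" "X \<in> borel_measurable N" for N :: "'c measure" and X
    proof -
      interpret N: prob_space N by fact
      show ?thesis using that(2) by (intro N.integrable_const_bound[where B=1]) (auto simp: b)
    qed
    have sh: "expectation (\<lambda>\<omega>. 1 + \<phi> (X \<omega>)) = 1 + expectation (\<lambda>\<omega>. \<phi> (X \<omega>))" if "X \<in> borel_measurable M" for X
      using ii[OF prob_space_axioms that] prob_space by simp
    have cc: "continuous_on {0..} (\<lambda>t. 1 + \<phi> (B t \<omega>))" if "\<omega> \<in> space M" for \<omega>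
      by (intro continuous_intros continuous_on_compose2[OF c B_continuous[OF that]]) auto
    have bm: "(\<lambda>\<omega>. 1 + \<phi> (B t \<omega>)) \<in> borel_measurable (info {0..})" if "0 \<le> t" for t
    proof -
      have [measurable]: "B t \<in> borel_measurable (info {0..})" using that by (intro B_info) auto
      show ?thesis by measurable
    qed
    have "\<forall>\<^sub>F n in \<U>. 1 + (\<integral>x. \<phi> x \<partial>\<mu>) < expectation (\<lambda>\<omega>. 1 + \<phi> (B (enn2real (\<tau> n \<omega>)) \<omega>))"
    proof (rule LSC[where C=2 and f="\<lambda>t \<omega>. 1 + \<phi> (B t \<omega>)", OF bm cc])
      show "0 \<le> 1 + \<phi> (B t \<omega>) \<and> 1 + \<phi> (B t \<omega>) \<le> 2" for \<omega> t using b'[of "B t \<omega>"] by auto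
      show "1 + (\<integral>x. \<phi> x \<partial>\<mu>) < expectation (\<lambda>\<omega>. 1 + \<phi> (B (enn2real (T \<omega>)) \<omega>))" unfolding sh[OF Xm] using n by simp
    qed
    then obtain n where "1 + (\<integral>x. \<phi> x \<partial>\<mu>) < expectation (\<lambda>\<omega>. 1 + \<phi> (B (enn2real (\<tau> n \<omega>)) \<omega>))"
      using eventually_happens'[OF \<U>] by blast
    moreover have "expectation (\<lambda>\<omega>. \<phi> (B (enn2real (\<tau> n \<omega>)) \<omega>)) = (\<integral>x. \<phi> x \<partial>\<mu>)"
      unfolding law[of n, symmetric] by (rule integral_distr[OF Xn, symmetric]) simp
    ultimately show False unfolding sh[OF Xn] by simp
  qed
  have test: "expectation (\<lambda>\<omega>. \<phi> (B (enn2real (T \<omega>)) \<omega>)) = (\<integral>x. \<phi> x \<partial>\<mu>)"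
    if c: "continuous_on UNIV \<phi>" and b: "\<And>x. \<bar>\<phi> x\<bar> \<le> 1" for \<phi> :: "real \<Rightarrow> real"
  proof (rule antisym)
    have "expectation (\<lambda>\<omega>. - \<phi> (B (enn2real (T \<omega>)) \<omega>)) \<le> (\<integral>x. - \<phi> x \<partial>\<mu>)"
      by (rule half) (use b in \<open>auto intro!: continuous_intros c\<close>)
    then show "(\<integral>x. \<phi> x \<partial>\<mu>) \<le> expectation (\<lambda>\<omega>. \<phi> (B (enn2real (T \<omega>)) \<omega>))" by simp
  qed (rule half[OF c b])
  let ?\<nu> = "distr M borel (\<lambda>\<omega>. B (enn2real (T \<omega>)) \<omega>)"
  have "?\<nu> = \<mu>"
  proof (rule Levy_uniqueness)
    interpret \<nu>: prob_space ?\<nu> by (rule prob_space_distr[OF Xm])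
    show "real_distribution ?\<nu>" by (simp add: real_distribution_def real_distribution_axioms_def \<nu>.prob_space_axioms)
    show "real_distribution \<mu>" by fact
    show "char ?\<nu> = char \<mu>"
    proof
      fix s
      have i: "integrable ?\<nu> (\<lambda>x. iexp (s * x))" "integrable \<mu> (\<lambda>x. iexp (s * x))"
        by (rule \<nu>.integrable_iexp; simp) (rule \<mu>.integrable_iexp; simp)
      have nu: "(\<integral>x. \<phi> x \<partial>?\<nu>) = expectation (\<lambda>\<omega>. \<phi> (B (enn2real (T \<omega>)) \<omega>))" if "continuous_on UNIV \<phi>" for \<phi> :: "real \<Rightarrow> real"
        by (rule integral_distr[OF Xm]) (rule borel_measurable_continuous_onI[OF that])
      have co: "continuous_on UNIV (\<lambda>x. cos (s * x))" "continuous_on UNIV (\<lambda>x. sin (s * x))" by (intro continuous_intros)+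
      have "Re (char ?\<nu> s) = (\<integral>x. cos (s * x) \<partial>?\<nu>)" "Re (char \<mu> s) = (\<integral>x. cos (s * x) \<partial>\<mu>)"
        "Im (char ?\<nu> s) = (\<integral>x. sin (s * x) \<partial>?\<nu>)" "Im (char \<mu> s) = (\<integral>x. sin (s * x) \<partial>\<mu>)"
        unfolding char_def using integral_Re[OF i(1)] integral_Re[OF i(2)] integral_Im[OF i(1)] integral_Im[OF i(2)]
        by (simp_all add: Re_exp Im_exp)
      moreover have "(\<integral>x. cos (s * x) \<partial>?\<nu>) = (\<integral>x. cos (s * x) \<partial>\<mu>)" "(\<integral>x. sin (s * x) \<partial>?\<nu>) = (\<integral>x. sin (s * x) \<partial>\<mu>)"
        unfolding nu[OF co(1)] nu[OF co(2)] by (rule test[OF co(1)], simp, rule test[OF co(2)], simp)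
      ultimately show "char ?\<nu> s = char \<mu> s" by (simp add: complex_eq_iff)
    qed
  qed
  then show "T \<in> skorokhod_embeddings M G B \<mu>" using T ET by (simp add: skorokhod_embeddings_def)
qed

end

theorem theorem1p1:
  fixes \<mu> :: "real measure"
    and M :: "'a measure" and G :: "ennreal \<Rightarrow> 'a measure"
    and B :: "real \<Rightarrow> 'a \<Rightarrow> real" and U :: "'a \<Rightarrow> real"
    and \<gamma> :: "(real \<Rightarrow> real) \<times> real \<Rightarrow> real"
  assumes "real_distribution \<mu>"
    and "integrable \<mu> (\<lambda>x. x)" and "(\<integral>x. x \<partial>\<mu>) = 0"
    and "integrable \<mu> (\<lambda>x. x\<^sup>2)"
    and "stochastic_basis M G"
    and "brownian_motion M G B"
    and "independent_uniform M G B U"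
    and "lower_semicontinuous_map stopped_paths.mtopology \<gamma>"
    and "bdd_below (\<gamma> ` stopped_paths)"
  shows "\<exists>\<tau>\<in>skorokhod_embeddings M G B \<mu>.
    embedding_cost M B \<gamma> \<tau> = optimal_embedding_value M G B \<mu> \<gamma>"
proof -
  interpret brownian_basis M G B U
    using assms(5-7) by (intro brownian_basis.intro brownian_basis_axioms.intro)
  let ?S = "skorokhod_embeddings M G B \<mu>"
  obtain K0 where K0: "\<And>x. x \<in> stopped_paths \<Longrightarrow> K0 \<le> \<gamma> x" using assms(9) by (auto simp: bdd_below_def)
  define K where "K = \<bar>K0\<bar>"
  have K: "0 \<le> K" "\<And>x. x \<in> stopped_paths \<Longrightarrow> - K \<le> \<gamma> x" using K0 unfolding K_def by (force, smt (verit))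
  have K': "\<And>x. x \<in> stopped_paths \<Longrightarrow> 0 \<le> \<gamma> x + K" using K(2) by force
  have "{x \<in> topspace stopped_paths.mtopology. c < \<gamma> x + K} = {x \<in> topspace stopped_paths.mtopology. c - K < \<gamma> x}" for c by auto
  then have lsc: "lower_semicontinuous_map stopped_paths.mtopology (\<lambda>x. \<gamma> x + K)"
    using assms(8) unfolding lower_semicontinuous_map_def by simp
  define J where "J = (\<lambda>\<tau>. \<integral>\<^sup>+ \<omega>. ennreal (\<gamma> (stopped_path B \<tau> \<omega>) + K) \<partial>M)"
  have meas: "\<tau> \<in> borel_measurable M" if "\<tau> \<in> ?S" for \<tau>
    by (rule stopping_time_measurable) (use that in \<open>simp add: skorokhod_embeddings_def\<close>)
  have cost: "embedding_cost M B \<gamma> \<tau> = enn2ereal (J \<tau>) - ereal K" if "\<tau> \<in> ?S" for \<tau>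
    unfolding J_def by (rule shifted_cost[OF lsc K meas[OF that]])
  have "?S \<noteq> {}" using embedding_exists[OF assms(1-4)] by blast
  then obtain u where u: "\<And>n. u n \<in> embedding_cost M B \<gamma> ` ?S" "u \<longlonglongrightarrow> optimal_embedding_value M G B \<mu> \<gamma>"
    unfolding optimal_embedding_value_def using Inf_as_limit[of "embedding_cost M B \<gamma> ` ?S"] by blast
  have "\<forall>n. \<exists>\<tau>\<in>?S. u n = embedding_cost M B \<gamma> \<tau>" using u(1) by blast
  then obtain \<tau> where \<tau>: "\<And>n. \<tau> n \<in> ?S" "\<And>n. u n = embedding_cost M B \<gamma> (\<tau> n)" by metis
  have st: "stopping_time G (\<tau> n)" for n using \<tau>(1)[of n] by (simp add: skorokhod_embeddings_def)
  obtain \<U> T where \<U>: "\<U> \<le> sequentially" "\<U> \<noteq> bot" and T: "stopping_time G T" and conv: "converges_stably \<U> \<tau> T"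
    using stopping_time_compactness[of \<tau>, OF st] by blast
  note L = limit_of_embeddings[OF assms(1) \<tau>(1) T conv \<U>(2)]
  have "embedding_cost M B \<gamma> T \<le> optimal_embedding_value M G B \<mu> \<gamma>"
  proof (rule ccontr)
    assume "\<not> ?thesis"
    then obtain z where z: "optimal_embedding_value M G B \<mu> \<gamma> < ereal z" "ereal z < embedding_cost M B \<gamma> T"
      using ereal_dense2[of "optimal_embedding_value M G B \<mu> \<gamma>"] by (auto simp: not_le)
    have "\<forall>\<^sub>F n in \<U>. u n < ereal z" by (rule filter_leD[OF \<U>(1) order_tendstoD(2)[OF u(2) z(1)]])
    then have below: "\<forall>\<^sub>F n in \<U>. J (\<tau> n) < ennreal (z + K)"
    proof eventually_elim
      case (elim n)
      then have "enn2ereal (J (\<tau> n)) - ereal K < ereal z" by (simp add: \<tau>(2) cost[OF \<tau>(1)])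
      then show ?case by (cases "J (\<tau> n)") (auto intro!: ennreal_lessI)
    qed
    have "ennreal (z + K) < J T"
    proof (cases "J T")
      case (real j)
      obtain n where "J (\<tau> n) < ennreal (z + K)" using eventually_happens'[OF \<U>(2) below] by blast
      then have "0 < z + K" by (metis ennreal_neg not_le not_less_zero)
      then show ?thesis using z(2) real by (auto simp: cost[OF L(1)] intro!: ennreal_lessI)
    qed (simp add: top_unique)
    then have "\<forall>\<^sub>F n in \<U>. ennreal (z + K) < J (\<tau> n)"
      unfolding J_def by (intro lower_semicontinuity_cost[OF conv meas[OF \<tau>(1)] meas[OF L(1)] L(2) lsc K'])
    with below have "\<forall>\<^sub>F n in \<U>. False" by eventually_elim simp
    then show False using \<U>(2) by (simp add: trivial_limit_def)
  qed
  moreover have "optimal_embedding_value M G B \<mu> \<gamma> \<le> embedding_cost M B \<gamma> T"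
    unfolding optimal_embedding_value_def by (rule INF_lower[OF L(1)])
  ultimately show ?thesis using L(1) by (intro bexI[of _ T] antisym)
qed

end
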